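(* Let $\Gamma$ be a discrete quantum group and let $P_1,P_2\in c_{00}(\Gamma)$ be two generating projections. Then the corresponding quantum Cayley graphs are bi-Lipschitz equivalent: if $(V_t)_{t\ge0}$ and $(W_t)_{t\ge0}$ are the quantum metrics on $\ell^\infty(\Gamma)$ associated with the quantum adjacency matrices $A_1x=P_1\ast x$ and $A_2x=P_2\ast x$, then there exists $M>0$ such that $V_t\subset W_{Mt}$ and $W_t\subset V_{Mt}$ for all $t\ge0$.
   Context: $\Gamma$ is the discrete dual of a compact quantum group $\mathbb G$. For $\alpha\in\mathrm{Irr}(\mathbb G)$ fix a unitary representative $u^\alpha=(u^\alpha_{ij})$ of dimension $n_\alpha$; $\rho_\alpha\in M_{n_\alpha}$ is the unique positive definite matrix with $\mathrm{Tr}(\rho_\alpha)=\mathrm{Tr}(\rho_\alpha^{-1})=:\dim_q(\alpha)$ and $(\mathrm{id}\otimes S_{\mathbb G}^2)(u^\alpha)=\rho_\alpha u^\alpha\rho_\alpha^{-1}$. Put $B=\ell^\infty(\Gamma)=\ell^\infty\text{-}\bigoplus_{\alpha}M_{n_\alpha}$, $c_{00}(\Gamma)=c_{00}\text{-}\bigoplus_\alpha M_{n_\alpha}$, $W=\sum_\alpha\sum_{i,j}e^\alpha_{ij}\otimes u^\alpha_{ij}$. The comultiplication $\Delta$ on $\ell^\infty(\Gamma)$ is the normal $*$-homomorphism with $(\Delta\otimes\mathrm{id})(W)=W_{23}W_{13}$. The right Haar weight is $\widehat{h_R}(x)=\sum_\alpha\mathrm{Tr}(\rho_\alpha)\mathrm{Tr}(\rho_\alpha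 x_\alpha)$. $R$ is the unitary antipode of $(\ell^\infty(\Gamma),\Delta)$ and $\varepsilon$ the counit (the component at the trivial representation). For $P\in c_{00}(\Gamma)$, $x\in\ell^\infty(\Gamma)$, $P\ast x$ is the element with $\widehat{h_R}(y(P\ast x))=(\widehat{h_R}\otimes\widehat{h_R})(\Delta(y)(P\otimes x))$ for all $y\in c_{00}(\Gamma)$; $P^{\ast n}$ is the $n$-fold convolution power. A projection $P\in c_{00}(\Gamma)$ is generating if $R(P)=P$, $\varepsilon(P)=0$ and $\bigvee_n[P^{\ast n}]=1$ in $\ell^\infty(\Gamma)$, where $[T]$ is the range projection of $T$. Its quantum Cayley graph is given by the quantum adjacency matrix $Ax=P\ast x$. Bimodule of $A$: represent $B$ on $H=\bigoplus_\alpha\mathbb C^{n_\alpha}$. Define $Q=\sum_\alpha\frac1{\dim_q(\alpha)}\sum_{i,j}A(\rho_\alpha^{-1/4}e^\alpha_{ij}\rho_\alpha^{-1/4})\otimes(\rho_\alpha^{-1/4}e^\alpha_{ji}\rho_\alpha^{-1/4})^{\mathrm{op}}$, a projection in $B\overline\otimes B^{\mathrm{op}}$ with components $Q_{\beta\alpha}\in M_{n_\beta}\otimes M_{n_\alpha}^{\mathrm{op}}$ (opposite multiplication in the second leg). Let $V_{\alpha\beta}\subset B(\mathbb C^{n_\alpha},\mathbb C^{n_\beta})$ be the range of the idempotent map determined by $Q_{\beta\alpha}$ via $b\otimes c^{\mathrm{op}}\mapsto\big(x\mapsto(\rho_\beta^{1/4}b\rho_\beta^{-1/4})\,x\,(\rho_\alpha^{-1/4}c\rho_\alpha^{1/4})\big)$.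 Then $V\subset B(H)$ is the set of bounded operators $T$ whose block from $\mathbb C^{n_\alpha}$ to $\mathbb C^{n_\beta}$ lies in $V_{\alpha\beta}$ for all $\alpha,\beta$; it is a weak$^*$ closed $B'$-bimodule. The associated quantum metric is $V_t=\overline{\mathrm{span}}\{\sum_{k=0}^{[t]}V^k\}$ (weak$^*$ closure), where $V^0=B'$, $V^k$ consists of linear combinations of $k$-fold products of elements of $V$, and $[t]$ is the integer part of $t$. *)

theory Defs
  imports
    "Jordan_Normal_Form.Schur_Decomposition"
    "HOL-Analysis.Infinite_Sum"
    "HOL-Analysis.Abstract_Topology"
begin

section \<open>Matrices\<close>

definition mtrace :: "complex mat \<Rightarrow> complex" where
  "mtrace A = (\<Sum>i<dim_row A. A $$ (i, i))"

definition munit :: "nat \<Rightarrow> nat \<Rightarrow> nat \<Rightarrow> complex mat" where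
  "munit m i j = mat m m (\<lambda>p. if p = (i, j) then 1 else 0)"

definition vnorm :: "complex vec \<Rightarrow> real" where
  "vnorm v = sqrt (\<Sum>i<dim_vec v. (cmod (v $ i))\<^sup>2)"

definition pos_def :: "nat \<Rightarrow> complex mat \<Rightarrow> bool" where
  "pos_def m A \<longleftrightarrow> A \<in> carrier_mat m m \<and> mat_adjoint A = A \<and>
     (\<forall>v\<in>carrier_vec m. v \<noteq> 0\<^sub>v m \<longrightarrow> Re ((A *\<^sub>v v) \<bullet>c v) > 0)"

text \<open>Real powers of a positive definite matrix, by functional calculus.\<close>

definition mpow :: "complex mat \<Rightarrow> real \<Rightarrow> complex mat" where
  "mpow A s = (THE B. \<exists>U d. U \<in> carrier_mat (dim_row A) (dim_row A) \<and>
     mat_adjoint U * U = 1\<^sub>m (dim_row A) \<and> (\<forall>i<dim_row A. 0 < d i) \<and>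
     A = U * mat_diag (dim_row A) (\<lambda>i. complex_of_real (d i)) * mat_adjoint U \<and>
     B = U * mat_diag (dim_row A) (\<lambda>i. complex_of_real (d i powr s)) * mat_adjoint U)"

text \<open>Kronecker product: \<open>M\<^sub>m \<otimes> M\<^sub>k\<close> is identified with \<open>M\<^sub>m\<^sub>k\<close>, the matrix unit
  \<open>e\<^sub>i\<^sub>j \<otimes> e\<^sub>p\<^sub>q\<close> sitting in row \<open>i * k + p\<close> and column \<open>j * k + q\<close>.\<close>

definition kron :: "'a::semiring_0 mat \<Rightarrow> 'a mat \<Rightarrow> 'a mat" where
  "kron A B = mat (dim_row A * dim_row B) (dim_col A * dim_col B)
     (\<lambda>(r, s). A $$ (r div dim_row B, s div dim_col B) * B $$ (r mod dim_row B, s mod dim_col B))"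


section \<open>Compact quantum groups\<close>

text \<open>
  A compact quantum group is given by its Hopf *-algebra of representative functions, a Hopf
  *-algebra spanned by the coefficients of its finite-dimensional unitary corepresentations.

  An element of the algebraic tensor product is given by a list of pairs, standing for the sum of
  the corresponding elementary tensors; two lists represent the same tensor iff every bilinear
  form takes the same value on both. The comultiplication picks one such representation.
\<close>

definition bilinear_form :: "(complex \<Rightarrow> 'a::ring_1 \<Rightarrow> 'a) \<Rightarrow> ('a \<Rightarrow> 'a \<Rightarrow> complex) \<Rightarrow> bool" where
  "bilinear_form smul f \<longleftrightarrow>
     (\<forall>y. Vector_Spaces.linear smul (*) (\<lambda>x. f x y)) \<and>
     (\<forall>x. Vector_Spaces.linear smul (*) (\<lambda>y. f x y))"

definition trilinear_form ::
    "(complex \<Rightarrow> 'a::ring_1 \<Rightarrow> 'a) \<Rightarrow> ('a \<Rightarrow> 'a \<Rightarrow> 'a \<Rightarrow> complex) \<Rightarrow> bool" where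
  "trilinear_form smul f \<longleftrightarrow>
     (\<forall>y z. Vector_Spaces.linear smul (*) (\<lambda>x. f x y z)) \<and>
     (\<forall>x z. Vector_Spaces.linear smul (*) (\<lambda>y. f x y z)) \<and>
     (\<forall>x y. Vector_Spaces.linear smul (*) (\<lambda>z. f x y z))"

definition tensor_eq ::
    "(complex \<Rightarrow> 'a::ring_1 \<Rightarrow> 'a) \<Rightarrow> ('a \<times> 'a) list \<Rightarrow> ('a \<times> 'a) list \<Rightarrow> bool" where
  "tensor_eq smul xs ys \<longleftrightarrow> (\<forall>f. bilinear_form smul f \<longrightarrow>
     (\<Sum>(x, y)\<leftarrow>xs. f x y) = (\<Sum>(x, y)\<leftarrow>ys. f x y))"

definition tensor3_eq ::
    "(complex \<Rightarrow> 'a::ring_1 \<Rightarrow> 'a) \<Rightarrow> ('a \<times> 'a \<times> 'a) list \<Rightarrow> ('a \<times> 'a \<times> 'a) list \<Rightarrow> bool" where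
  "tensor3_eq smul xs ys \<longleftrightarrow> (\<forall>f. trilinear_form smul f \<longrightarrow>
     (\<Sum>(x, y, z)\<leftarrow>xs. f x y z) = (\<Sum>(x, y, z)\<leftarrow>ys. f x y z))"

locale hopf_star_algebra = vector_space smul
  for smul :: "complex \<Rightarrow> 'a::ring_1 \<Rightarrow> 'a" +
  fixes star :: "'a \<Rightarrow> 'a"
    and cop :: "'a \<Rightarrow> ('a \<times> 'a) list"
    and eps :: "'a \<Rightarrow> complex"
    and S :: "'a \<Rightarrow> 'a"
  assumes scale_mult_left: "smul c x * y = smul c (x * y)"
    and scale_mult_right: "x * smul c y = smul c (x * y)"
    and star_star: "star (star x) = x"
    and star_add: "star (x + y) = star x + star y"
    and star_scale: "star (smul c x) = smul (cnj c) (star x)"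
    and star_mult: "star (x * y) = star y * star x"
    and cop_add: "tensor_eq smul (cop (x + y)) (cop x @ cop y)"
    and cop_scale: "tensor_eq smul (cop (smul c x)) (map (\<lambda>(a, b). (smul c a, b)) (cop x))"
    and cop_one: "tensor_eq smul (cop 1) [(1, 1)]"
    and cop_mult: "tensor_eq smul (cop (x * y))
          [(a * c, b * d). (a, b) \<leftarrow> cop x, (c, d) \<leftarrow> cop y]"
    and cop_star: "tensor_eq smul (cop (star x)) (map (\<lambda>(a, b). (star a, star b)) (cop x))"
    and coassoc: "tensor3_eq smul
          [(c, d, b). (a, b) \<leftarrow> cop x, (c, d) \<leftarrow> cop a]
          [(a, c, d). (a, b) \<leftarrow> cop x, (c, d) \<leftarrow> cop b]"
    and eps_linear: "Vector_Spaces.linear smul (*) eps"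
    and eps_one: "eps 1 = 1"
    and eps_mult: "eps (x * y) = eps x * eps y"
    and eps_star: "eps (star x) = cnj (eps x)"
    and counit_left: "(\<Sum>(a, b)\<leftarrow>cop x. smul (eps a) b) = x"
    and counit_right: "(\<Sum>(a, b)\<leftarrow>cop x. smul (eps b) a) = x"
    and antipode_linear: "Vector_Spaces.linear smul smul S"
    and antipode_left: "(\<Sum>(a, b)\<leftarrow>cop x. S a * b) = smul (eps x) 1"
    and antipode_right: "(\<Sum>(a, b)\<leftarrow>cop x. a * S b) = smul (eps x) 1"
begin

definition emb :: "complex mat \<Rightarrow> 'a mat" where
  "emb T = map_mat (\<lambda>c. smul c 1) T"

definition mstar :: "'a mat \<Rightarrow> 'a mat" where
  "mstar v = map_mat star (transpose_mat v)"

definition unitary_corep :: "nat \<Rightarrow> 'a mat \<Rightarrow> bool" where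
  "unitary_corep m v \<longleftrightarrow> v \<in> carrier_mat m m \<and>
     (\<forall>i<m. \<forall>j<m. tensor_eq smul (cop (v $$ (i, j)))
        (map (\<lambda>k. (v $$ (i, k), v $$ (k, j))) [0..<m])) \<and>
     mstar v * v = 1\<^sub>m m \<and> v * mstar v = 1\<^sub>m m"

definition irreducible_corep :: "nat \<Rightarrow> 'a mat \<Rightarrow> bool" where
  "irreducible_corep m v \<longleftrightarrow> unitary_corep m v \<and> m > 0 \<and>
     (\<forall>T\<in>carrier_mat m m. emb T * v = v * emb T \<longrightarrow> (\<exists>c. T = c \<cdot>\<^sub>m 1\<^sub>m m))"

definition equivalent_coreps :: "nat \<Rightarrow> 'a mat \<Rightarrow> 'a mat \<Rightarrow> bool" where
  "equivalent_coreps m v w \<longleftrightarrow>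
     (\<exists>T\<in>carrier_mat m m. invertible_mat T \<and> emb T * v = w * emb T)"

end

locale compact_quantum_group = hopf_star_algebra +
  assumes spanned_by_coefficients:
    "span {v $$ (i, j) | v m i j. unitary_corep m v \<and> i < m \<and> j < m} = UNIV"


section \<open>Direct sums of matrix algebras\<close>

type_synonym 'i fam = "'i \<Rightarrow> complex mat"

definition linf :: "('i \<Rightarrow> nat) \<Rightarrow> 'i fam set" where
  "linf n = {x. (\<forall>\<alpha>. x \<alpha> \<in> carrier_mat (n \<alpha>) (n \<alpha>)) \<and>
     (\<exists>C. \<forall>\<alpha>. \<forall>v\<in>carrier_vec (n \<alpha>). vnorm (x \<alpha> *\<^sub>v v) \<le> C * vnorm v)}"

definition c00 :: "('i \<Rightarrow> nat) \<Rightarrow> 'i fam set" where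
  "c00 n = {x. (\<forall>\<alpha>. x \<alpha> \<in> carrier_mat (n \<alpha>) (n \<alpha>)) \<and>
     finite {\<alpha>. x \<alpha> \<noteq> 0\<^sub>m (n \<alpha>) (n \<alpha>)}}"

definition fone :: "('i \<Rightarrow> nat) \<Rightarrow> 'i fam" where
  "fone n = (\<lambda>\<alpha>. 1\<^sub>m (n \<alpha>))"

definition fadd :: "'i fam \<Rightarrow> 'i fam \<Rightarrow> 'i fam" where
  "fadd x y = (\<lambda>\<alpha>. x \<alpha> + y \<alpha>)"

definition fscale :: "complex \<Rightarrow> 'i fam \<Rightarrow> 'i fam" where
  "fscale c x = (\<lambda>\<alpha>. c \<cdot>\<^sub>m x \<alpha>)"

definition fmult :: "'i fam \<Rightarrow> 'i fam \<Rightarrow> 'i fam" where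
  "fmult x y = (\<lambda>\<alpha>. x \<alpha> * y \<alpha>)"

definition fstar :: "'i fam \<Rightarrow> 'i fam" where
  "fstar x = (\<lambda>\<alpha>. mat_adjoint (x \<alpha>))"

definition single :: "('i \<Rightarrow> nat) \<Rightarrow> 'i \<Rightarrow> complex mat \<Rightarrow> 'i fam" where
  "single n \<alpha> a = (\<lambda>\<beta>. if \<beta> = \<alpha> then a else 0\<^sub>m (n \<beta>) (n \<beta>))"

text \<open>The von Neumann tensor square of \<open>linf n\<close> is \<open>linf (tdim n)\<close>, indexed by pairs.\<close>

definition tdim :: "('i \<Rightarrow> nat) \<Rightarrow> 'i \<times> 'i \<Rightarrow> nat" where
  "tdim n = (\<lambda>(\<alpha>, \<beta>). n \<alpha> * n \<beta>)"

definition ftensor :: "'i fam \<Rightarrow> 'i fam \<Rightarrow> ('i \<times> 'i) fam" where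
  "ftensor x y = (\<lambda>(\<alpha>, \<beta>). kron (x \<alpha>) (y \<beta>))"

definition is_proj :: "('i \<Rightarrow> nat) \<Rightarrow> 'i fam \<Rightarrow> bool" where
  "is_proj n p \<longleftrightarrow> p \<in> linf n \<and> fmult p p = p \<and> fstar p = p"

definition proj_le :: "'i fam \<Rightarrow> 'i fam \<Rightarrow> bool" where
  "proj_le p q \<longleftrightarrow> fmult q p = p"

definition is_proj_sup :: "('i \<Rightarrow> nat) \<Rightarrow> 'i fam set \<Rightarrow> 'i fam \<Rightarrow> bool" where
  "is_proj_sup n X s \<longleftrightarrow> is_proj n s \<and> (\<forall>p\<in>X. proj_le p s) \<and>
     (\<forall>q. is_proj n q \<and> (\<forall>p\<in>X. proj_le p q) \<longrightarrow> proj_le s q)"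

definition range_proj :: "('i \<Rightarrow> nat) \<Rightarrow> 'i fam \<Rightarrow> 'i fam" where
  "range_proj n x = (\<lambda>\<alpha>. THE p. p \<in> carrier_mat (n \<alpha>) (n \<alpha>) \<and> p * p = p \<and> mat_adjoint p = p \<and>
     (\<lambda>v. p *\<^sub>v v) ` carrier_vec (n \<alpha>) = (\<lambda>v. x \<alpha> *\<^sub>v v) ` carrier_vec (n \<alpha>))"


section \<open>Operators on the direct sum Hilbert space\<close>

text \<open>
  Vectors of \<open>H = \<Oplus>\<^sub>\<alpha> \<complex>\<^sup>n\<^sup>\<alpha>\<close> are square summable functions on pairs \<open>(\<alpha>, k)\<close> vanishing unless
  \<open>k < n \<alpha>\<close>. Operators are functions that are \<open>0\<close> outside \<open>H\<close>, so that equal operators are equal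
  functions.
\<close>

type_synonym 'i hvec = "'i \<times> nat \<Rightarrow> complex"

definition hspace :: "('i \<Rightarrow> nat) \<Rightarrow> 'i hvec set" where
  "hspace n = {\<xi>. (\<forall>\<alpha> k. n \<alpha> \<le> k \<longrightarrow> \<xi> (\<alpha>, k) = 0) \<and> (\<lambda>p. (cmod (\<xi> p))\<^sup>2) summable_on UNIV}"

definition hinner :: "'i hvec \<Rightarrow> 'i hvec \<Rightarrow> complex" where
  "hinner \<xi> \<eta> = (\<Sum>\<^sub>\<infinity>p. cnj (\<xi> p) * \<eta> p)"

definition hnorm :: "'i hvec \<Rightarrow> real" where
  "hnorm \<xi> = sqrt (\<Sum>\<^sub>\<infinity>p. (cmod (\<xi> p))\<^sup>2)"

definition hbasis :: "'i \<Rightarrow> nat \<Rightarrow> 'i hvec" where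
  "hbasis \<alpha> k = (\<lambda>p. if p = (\<alpha>, k) then 1 else 0)"

type_synonym 'i hop = "'i hvec \<Rightarrow> 'i hvec"

definition bops :: "('i \<Rightarrow> nat) \<Rightarrow> 'i hop set" where
  "bops n = {T. (\<forall>\<xi>\<in>hspace n. T \<xi> \<in> hspace n) \<and> (\<forall>\<xi>. \<xi> \<notin> hspace n \<longrightarrow> T \<xi> = (\<lambda>_. 0)) \<and>
     (\<forall>\<xi>\<in>hspace n. \<forall>\<eta>\<in>hspace n. \<forall>c d. T (\<lambda>p. c * \<xi> p + d * \<eta> p) = (\<lambda>p. c * T \<xi> p + d * T \<eta> p)) \<and>
     (\<exists>C. \<forall>\<xi>\<in>hspace n. hnorm (T \<xi>) \<le> C * hnorm \<xi>)}"

text \<open>The weak* topology of \<open>B(H)\<close> is generated by the normal functionals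
  \<open>T \<mapsto> \<Sum>\<^sub>k \<langle>\<eta>\<^sub>k, T \<xi>\<^sub>k\<rangle>\<close> with \<open>\<Sum>\<^sub>k \<parallel>\<xi>\<^sub>k\<parallel>\<^sup>2\<close> and \<open>\<Sum>\<^sub>k \<parallel>\<eta>\<^sub>k\<parallel>\<^sup>2\<close> finite.\<close>

definition normal_functionals :: "('i \<Rightarrow> nat) \<Rightarrow> ('i hop \<Rightarrow> complex) set" where
  "normal_functionals n = {\<lambda>T. \<Sum>k. hinner (\<eta> k) (T (\<xi> k)) | (\<xi> :: nat \<Rightarrow> 'i hvec) \<eta>.
     (\<forall>k. \<xi> k \<in> hspace n \<and> \<eta> k \<in> hspace n) \<and>
     summable (\<lambda>k. (hnorm (\<xi> k))\<^sup>2) \<and> summable (\<lambda>k. (hnorm (\<eta> k))\<^sup>2)}"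

definition weakstar :: "('i \<Rightarrow> nat) \<Rightarrow> 'i hop topology" where
  "weakstar n = topology_generated_by
     {{T \<in> bops n. \<phi> T \<in> U} | \<phi> U. \<phi> \<in> normal_functionals n \<and> open U}"

definition op_span :: "'i hop set \<Rightarrow> 'i hop set" where
  "op_span X = {\<lambda>\<xi> p. \<Sum>T\<in>F. c T * T \<xi> p | F c. finite F \<and> F \<subseteq> X}"

definition rep :: "('i \<Rightarrow> nat) \<Rightarrow> 'i fam \<Rightarrow> 'i hop" where
  "rep n x = (\<lambda>\<xi> (\<alpha>, k). if \<xi> \<in> hspace n \<and> k < n \<alpha> then \<Sum>j<n \<alpha>. x \<alpha> $$ (k, j) * \<xi> (\<alpha>, j) else 0)"

definition commutant :: "('i \<Rightarrow> nat) \<Rightarrow> 'i hop set" where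
  "commutant n = {T \<in> bops n. \<forall>x\<in>linf n. T \<circ> rep n x = rep n x \<circ> T}"

text \<open>The block of \<open>T\<close> from \<open>\<complex>\<^sup>n\<^sup>\<alpha>\<close> to \<open>\<complex>\<^sup>n\<^sup>\<beta>\<close>.\<close>

definition block :: "('i \<Rightarrow> nat) \<Rightarrow> 'i hop \<Rightarrow> 'i \<Rightarrow> 'i \<Rightarrow> complex mat" where
  "block n T \<alpha> \<beta> = mat (n \<beta>) (n \<alpha>) (\<lambda>(k, j). T (hbasis \<alpha> j) (\<beta>, k))"

definition linf_weakstar :: "('i \<Rightarrow> nat) \<Rightarrow> 'i fam topology" where
  "linf_weakstar n = pullback_topology (linf n) (rep n) (weakstar n)"

definition normal_star_map :: "('i \<Rightarrow> nat) \<Rightarrow> ('j \<Rightarrow> nat) \<Rightarrow> ('i fam \<Rightarrow> 'j fam) \<Rightarrow> bool" where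
  "normal_star_map n m \<Phi> \<longleftrightarrow> (\<forall>x\<in>linf n. \<Phi> x \<in> linf m) \<and>
     (\<forall>x\<in>linf n. \<forall>y\<in>linf n. \<Phi> (fadd x y) = fadd (\<Phi> x) (\<Phi> y)) \<and>
     (\<forall>c. \<forall>x\<in>linf n. \<Phi> (fscale c x) = fscale c (\<Phi> x)) \<and>
     (\<forall>x\<in>linf n. \<Phi> (fstar x) = fstar (\<Phi> x)) \<and>
     continuous_map (linf_weakstar n) (linf_weakstar m) \<Phi>"

definition normal_star_hom :: "('i \<Rightarrow> nat) \<Rightarrow> ('j \<Rightarrow> nat) \<Rightarrow> ('i fam \<Rightarrow> 'j fam) \<Rightarrow> bool" where
  "normal_star_hom n m \<Phi> \<longleftrightarrow> normal_star_map n m \<Phi> \<and>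
     (\<forall>x\<in>linf n. \<forall>y\<in>linf n. \<Phi> (fmult x y) = fmult (\<Phi> x) (\<Phi> y))"

definition normal_star_antihom :: "('i \<Rightarrow> nat) \<Rightarrow> ('j \<Rightarrow> nat) \<Rightarrow> ('i fam \<Rightarrow> 'j fam) \<Rightarrow> bool" where
  "normal_star_antihom n m \<Phi> \<longleftrightarrow> normal_star_map n m \<Phi> \<and>
     (\<forall>x\<in>linf n. \<forall>y\<in>linf n. \<Phi> (fmult x y) = fmult (\<Phi> y) (\<Phi> x))"


section \<open>Discrete quantum groups\<close>

text \<open>
  With \<open>W = \<Sum>\<^sub>\<alpha> \<Sum>\<^sub>i\<^sub>j e\<^sup>\<alpha>\<^sub>i\<^sub>j \<otimes> u\<^sup>\<alpha>\<^sub>i\<^sub>j\<close>, \<open>first_leg smul n u \<Phi> w\<close> says that the block of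
  \<open>(\<Phi> \<otimes> id)(W)\<close> selected by the matrix-valued linear map \<open>\<Phi>\<close> is \<open>w\<close>. A matrix over the algebra is
  an element of the tensor product of a matrix algebra and the algebra.
\<close>

definition first_leg ::
    "(complex \<Rightarrow> 'a::ring_1 \<Rightarrow> 'a) \<Rightarrow> ('i \<Rightarrow> nat) \<Rightarrow> ('i \<Rightarrow> 'a mat) \<Rightarrow> ('i fam \<Rightarrow> complex mat) \<Rightarrow>
     'a mat \<Rightarrow> bool" where
  "first_leg smul n u \<Phi> w \<longleftrightarrow> (\<forall>r<dim_row w. \<forall>s<dim_col w.
     (let c = (\<lambda>(\<alpha>, i, j). \<Phi> (single n \<alpha> (munit (n \<alpha>) i j)) $$ (r, s));
          I = {(\<alpha>, i, j). i < n \<alpha> \<and> j < n \<alpha> \<and> c (\<alpha>, i, j) \<noteq> 0}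
      in finite I \<and> w $$ (r, s) = (\<Sum>(\<alpha>, i, j)\<in>I. smul (c (\<alpha>, i, j)) (u \<alpha> $$ (i, j)))))"

text \<open>
  The discrete dual of a compact quantum group: \<open>u\<close> is a family of representatives of the
  irreducible unitary corepresentations, indexed by all of \<open>'i\<close>, with dimensions \<open>n\<close>; \<open>\<rho>\<close>, \<open>D\<close>
  and \<open>R\<close> are the modular matrices, the comultiplication and the unitary antipode.

  In \<open>D_W\<close> the right-hand side is the block of \<open>W\<^sub>2\<^sub>3 W\<^sub>1\<^sub>3\<close>. As for \<open>R_W\<close>: the polar decomposition
  \<open>S = R\<^sub>G \<tau>\<^bsub>-i/2\<^esub>\<close> of the antipode of the compact quantum group, with \<open>S(u) = u\<^sup>*\<close> and
  \<open>\<tau>\<^bsub>-i/2\<^esub>(u) = \<rho>\<^bsup>1/2\<^esup> u \<rho>\<^bsup>-1/2\<^esup>\<close>, gives \<open>R\<^sub>G(u) = \<rho>\<^bsup>-1/2\<^esup> u\<^sup>* \<rho>\<^bsup>1/2\<^esup>\<close>, and the unitary antipode of the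
  dual is determined by \<open>(R \<otimes> id)(W) = (id \<otimes> R\<^sub>G)(W)\<close>.
\<close>

locale discrete_quantum_group = compact_quantum_group smul star cop eps S
  for smul :: "complex \<Rightarrow> 'a::ring_1 \<Rightarrow> 'a" and star cop eps S +
  fixes n :: "'i \<Rightarrow> nat"
    and u :: "'i \<Rightarrow> 'a mat"
    and \<rho> :: "'i fam"
    and D :: "'i fam \<Rightarrow> ('i \<times> 'i) fam"
    and R :: "'i fam \<Rightarrow> 'i fam"
  assumes u_irreducible: "irreducible_corep (n \<alpha>) (u \<alpha>)"
    and u_inequivalent: "\<alpha> \<noteq> \<beta> \<Longrightarrow> n \<alpha> = n \<beta> \<Longrightarrow> \<not> equivalent_coreps (n \<alpha>) (u \<alpha>) (u \<beta>)"
    and u_complete: "irreducible_corep m v \<Longrightarrow> \<exists>\<alpha>. n \<alpha> = m \<and> equivalent_coreps m v (u \<alpha>)"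
    and rho_pos_def: "pos_def (n \<alpha>) (\<rho> \<alpha>)"
    and rho_trace: "mtrace (\<rho> \<alpha>) = mtrace (mpow (\<rho> \<alpha>) (-1))"
    and rho_antipode: "map_mat (S \<circ> S) (u \<alpha>) = emb (\<rho> \<alpha>) * u \<alpha> * emb (mpow (\<rho> \<alpha>) (-1))"
    and D_hom: "normal_star_hom n (tdim n) D"
    and D_W: "first_leg smul n u (\<lambda>x. D x (\<beta>, \<gamma>))
                (kron (1\<^sub>m (n \<beta>)) (u \<gamma>) * kron (u \<beta>) (1\<^sub>m (n \<gamma>)))"
    and R_antihom: "normal_star_antihom n n R"
    and R_W: "first_leg smul n u (\<lambda>x. R x \<beta>)
                (emb (mpow (\<rho> \<beta>) (-1/2)) * mstar (u \<beta>) * emb (mpow (\<rho> \<beta>) (1/2)))"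

definition counit :: "('i \<Rightarrow> nat) \<Rightarrow> ('i \<Rightarrow> 'a::ring_1 mat) \<Rightarrow> 'i fam \<Rightarrow> complex" where
  "counit n u x = x (THE \<alpha>. n \<alpha> = 1 \<and> u \<alpha> = 1\<^sub>m 1) $$ (0, 0)"

text \<open>The right Haar weight and its tensor square. They are only applied to finitely supported
  families, where the sums are finite.\<close>

definition haar :: "'i fam \<Rightarrow> 'i fam \<Rightarrow> complex" where
  "haar \<rho> x = (\<Sum>\<^sub>\<infinity>\<alpha>. mtrace (\<rho> \<alpha>) * mtrace (\<rho> \<alpha> * x \<alpha>))"

definition haar2 :: "'i fam \<Rightarrow> ('i \<times> 'i) fam \<Rightarrow> complex" where
  "haar2 \<rho> z = (\<Sum>\<^sub>\<infinity>(\<alpha>, \<beta>). mtrace (\<rho> \<alpha>) * mtrace (\<rho> \<beta>) * mtrace (kron (\<rho> \<alpha>) (\<rho> \<beta>) * z (\<alpha>, \<beta>)))"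

definition conv ::
    "('i \<Rightarrow> nat) \<Rightarrow> 'i fam \<Rightarrow> ('i fam \<Rightarrow> ('i \<times> 'i) fam) \<Rightarrow> 'i fam \<Rightarrow> 'i fam \<Rightarrow> 'i fam" where
  "conv n \<rho> D P x = (THE z. z \<in> linf n \<and>
     (\<forall>y\<in>c00 n. haar \<rho> (fmult y z) = haar2 \<rho> (fmult (D y) (ftensor P x))))"

fun conv_power ::
    "('i \<Rightarrow> nat) \<Rightarrow> 'i fam \<Rightarrow> ('i fam \<Rightarrow> ('i \<times> 'i) fam) \<Rightarrow> 'i fam \<Rightarrow> nat \<Rightarrow> 'i fam" where
  "conv_power n \<rho> D P (Suc (Suc k)) = conv n \<rho> D P (conv_power n \<rho> D P (Suc k))"
| "conv_power n \<rho> D P _ = P"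

definition generating_projection ::
    "('i \<Rightarrow> nat) \<Rightarrow> ('i \<Rightarrow> 'a::ring_1 mat) \<Rightarrow> 'i fam \<Rightarrow> ('i fam \<Rightarrow> ('i \<times> 'i) fam) \<Rightarrow>
     ('i fam \<Rightarrow> 'i fam) \<Rightarrow> 'i fam \<Rightarrow> bool" where
  "generating_projection n u \<rho> D R P \<longleftrightarrow> P \<in> c00 n \<and> is_proj n P \<and> R P = P \<and> counit n u P = 0 \<and>
     is_proj_sup n {range_proj n (conv_power n \<rho> D P k) | k. k \<ge> 1} (fone n)"


section \<open>Quantum graphs and quantum metrics\<close>

text \<open>The component in \<open>M\<^bsub>n \<beta>\<^esub> \<otimes> M\<^bsub>n \<alpha>\<^esub>\<^sup>o\<^sup>p\<close> of the element \<open>Q\<close> attached to a linear map \<open>A\<close>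
  on \<open>linf n\<close>.\<close>

definition graph_Q ::
    "('i \<Rightarrow> nat) \<Rightarrow> 'i fam \<Rightarrow> ('i fam \<Rightarrow> 'i fam) \<Rightarrow> 'i \<Rightarrow> 'i \<Rightarrow> complex mat" where
  "graph_Q n \<rho> A \<beta> \<alpha> = (let q = mpow (\<rho> \<alpha>) (-1/4); N = n \<beta> * n \<alpha> in
     mat N N (\<lambda>rs. 1 / mtrace (\<rho> \<alpha>) * (\<Sum>i<n \<alpha>. \<Sum>j<n \<alpha>.
       kron (A (single n \<alpha> (q * munit (n \<alpha>) i j * q)) \<beta>) (q * munit (n \<alpha>) j i * q) $$ rs)))"

text \<open>The linear map on \<open>B(\<complex>\<^sup>n\<^sup>\<alpha>, \<complex>\<^sup>n\<^sup>\<beta>)\<close> attached to \<open>z \<in> M\<^bsub>n \<beta>\<^esub> \<otimes> M\<^bsub>n \<alpha>\<^esub>\<^sup>o\<^sup>p\<close>, obtained by expanding \<open>z\<close>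
  in the matrix units \<open>e\<^sub>k\<^sub>l \<otimes> e\<^sub>i\<^sub>j\<close>.\<close>

definition bimod_act ::
    "('i \<Rightarrow> nat) \<Rightarrow> 'i fam \<Rightarrow> 'i \<Rightarrow> 'i \<Rightarrow> complex mat \<Rightarrow> complex mat \<Rightarrow> complex mat" where
  "bimod_act n \<rho> \<beta> \<alpha> z x = mat (n \<beta>) (n \<alpha>) (\<lambda>pq.
     \<Sum>k<n \<beta>. \<Sum>l<n \<beta>. \<Sum>i<n \<alpha>. \<Sum>j<n \<alpha>. z $$ (k * n \<alpha> + i, l * n \<alpha> + j) *
       ((mpow (\<rho> \<beta>) (1/4) * munit (n \<beta>) k l * mpow (\<rho> \<beta>) (-1/4)) * x *
        (mpow (\<rho> \<alpha>) (-1/4) * munit (n \<alpha>) i j * mpow (\<rho> \<alpha>) (1/4))) $$ pq)"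

definition graph_block ::
    "('i \<Rightarrow> nat) \<Rightarrow> 'i fam \<Rightarrow> ('i fam \<Rightarrow> 'i fam) \<Rightarrow> 'i \<Rightarrow> 'i \<Rightarrow> complex mat set" where
  "graph_block n \<rho> A \<alpha> \<beta> =
     bimod_act n \<rho> \<beta> \<alpha> (graph_Q n \<rho> A \<beta> \<alpha>) ` carrier_mat (n \<beta>) (n \<alpha>)"

definition graph_bimodule ::
    "('i \<Rightarrow> nat) \<Rightarrow> 'i fam \<Rightarrow> ('i fam \<Rightarrow> 'i fam) \<Rightarrow> 'i hop set" where
  "graph_bimodule n \<rho> A = {T \<in> bops n. \<forall>\<alpha> \<beta>. block n T \<alpha> \<beta> \<in> graph_block n \<rho> A \<alpha> \<beta>}"

definition bimod_power :: "('i \<Rightarrow> nat) \<Rightarrow> 'i hop set \<Rightarrow> nat \<Rightarrow> 'i hop set" where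
  "bimod_power n V k = (if k = 0 then commutant n
     else op_span {foldr (\<circ>) Ts id | Ts. length Ts = k \<and> set Ts \<subseteq> V})"

definition quantum_metric ::
    "('i \<Rightarrow> nat) \<Rightarrow> 'i fam \<Rightarrow> ('i fam \<Rightarrow> 'i fam) \<Rightarrow> real \<Rightarrow> 'i hop set" where
  "quantum_metric n \<rho> A t = weakstar n closure_of op_span
     {\<lambda>\<xi> p. \<Sum>k\<le>nat \<lfloor>t\<rfloor>. T k \<xi> p | T.
       \<forall>k\<le>nat \<lfloor>t\<rfloor>. T k \<in> bimod_power n (graph_bimodule n \<rho> A) k}"

end

(* Let ft be the Fourier transform from c00 to the Hopf algebra. It turns convolution by P into right
   multiplication by ft P, so the (alpha, beta) block of the graph bimodule of P consists of the compressions
   of x |-> x (ft P) from alpha-coefficients to beta-coefficients. Expanding a product x v in coefficients of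
   irreducibles, the block space of v w factors, through finitely many intermediate irreducibles, into
   products of block spaces of w and v; hence every block of (ft P)^k is a combination of k-fold products of
   single-block operators in the bimodule of P. If P2 is generating, finitely many range projections of
   convolution powers of P2 dominate the blocks in the finite support of P1, so ft P1 is a finite combination
   of slices of the powers (ft P2)^k, k <= N, and slicing does not enlarge block spaces. Hence all blocks of
   the bimodule of P1 are polynomials of degree <= N in that of P2, and block truncation together with
   separate weak* continuity of multiplication carries this to products of arbitrary operators. *)
theory Submission
  imports Defs "HOL-Analysis.L2_Norm" "HOL-Analysis.Elementary_Metric_Spaces"
begin

section \<open>Positive definite matrices\<close>

text \<open>The comparison constant has to serve all blocks at once. A decomposition of
  \<open>ft P1\<close> is therefore fixed before any block is looked at: P1 has finite support, so a
  single N suffices, independent of the block and of t. Domination by range projections only writes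
  a component of P1 as a sum of products z y, with z taken from a convolution power and y an
  arbitrary matrix, and right multiplication by y is not an operation on the graph. In the algebra
  it becomes a slice of the first leg of the coproduct, which mixes only the left indices of
  coefficients; a block space already contains all weights on left indices. The matrices \<rho>
  enter everywhere, but up to an invertible change of weights only conjugation by their fourth roots
  survives, and it cancels between consecutive blocks. No Haar state is among the data of the
  compact quantum group, so the independence of the coefficients, on which the Fourier transform
  rests, is derived from Schur's lemma and an orthogonal projection. The degree zero part of both
  metrics is the same commutant, so only polynomials without constant term have to be
  compared.\<close>

lemma mat_adjoint_dim [simp]: "dim_row (mat_adjoint A) = dim_col A" "dim_col (mat_adjoint A) = dim_row A"
  by (simp_all add: mat_adjoint_def)

lemma mat_adjoint_index [simp]:
  "i < dim_col A \<Longrightarrow> j < dim_row A \<Longrightarrow> mat_adjoint A $$ (i, j) = conjugate (A $$ (j, i))"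
  by (simp add: mat_adjoint_def mat_of_rows_index)

lemma mat_adjoint_carrier [simp]: "A \<in> carrier_mat a b \<Longrightarrow> mat_adjoint A \<in> carrier_mat b a"
  by (metis carrier_matD(1,2) carrier_matI mat_adjoint_dim)

lemma mult_mat_index:
  "A \<in> carrier_mat a b \<Longrightarrow> B \<in> carrier_mat b c \<Longrightarrow> i < a \<Longrightarrow> j < c \<Longrightarrow>
    (A * B) $$ (i, j) = (\<Sum>k<b. A $$ (i, k) * B $$ (k, j))"
  by (auto simp: scalar_prod_def lessThan_atLeast0 intro!: sum.cong)

lemma mult_mat_vec_index_sum:
  "A \<in> carrier_mat a b \<Longrightarrow> v \<in> carrier_vec b \<Longrightarrow> i < a \<Longrightarrow>
    (A *\<^sub>v v) $ i = (\<Sum>k<b. A $$ (i, k) * v $ k)"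
  by (auto simp: scalar_prod_def lessThan_atLeast0 intro!: sum.cong)

lemma cscalar_prod_sum:
  "v \<in> carrier_vec b \<Longrightarrow> w \<in> carrier_vec b \<Longrightarrow> (w::complex vec) \<bullet>c v = (\<Sum>k<b. w $ k * cnj (v $ k))"
  by (auto simp: scalar_prod_def lessThan_atLeast0 intro!: sum.cong)

section \<open>Orthogonal projections onto spaces of finitely supported vectors\<close>

lemma hermitian_idempotent_trace_le:
  fixes P :: "'j \<Rightarrow> 'j \<Rightarrow> complex"
  assumes fin: "finite J"
    and herm: "\<And>i j. P i j = cnj (P j i)"
    and idem: "\<And>i k. (\<Sum>j\<in>J. P i j * P j k) = P i k"
    and tr: "(\<Sum>i\<in>J. P i i) = of_nat k"
  shows "k \<le> card J"
proof -
  have le1: "Re (P i i) \<le> 1" if "i \<in> J" for i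
  proof -
    \<comment> \<open>By idempotence a diagonal entry is the squared norm of its row, hence real and
      at least its own square; so it is at most 1.\<close>
    have "P i i = (\<Sum>j\<in>J. P i j * cnj (P i j))"
    proof -
      have "(\<Sum>j\<in>J. P i j * P j i) = (\<Sum>j\<in>J. P i j * cnj (P i j))"
        by (rule sum.cong) (simp_all add: herm[symmetric])
      then show ?thesis using idem[of i i] by simp
    qed
    also have "\<dots> = complex_of_real (\<Sum>j\<in>J. (cmod (P i j))\<^sup>2)"
      by (simp add: complex_norm_square del: of_real_power)
    finally have e: "P i i = complex_of_real (\<Sum>j\<in>J. (cmod (P i j))\<^sup>2)" .
    then have re: "Re (P i i) = (\<Sum>j\<in>J. (cmod (P i j))\<^sup>2)" by (metis Re_complex_of_real)
    have im: "Im (P i i) = 0" using e by (metis Im_complex_of_real)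
    have "(cmod (P i i))\<^sup>2 \<le> (\<Sum>j\<in>J. (cmod (P i j))\<^sup>2)"
      using fin that by (intro member_le_sum) auto
    then have "(Re (P i i))\<^sup>2 \<le> Re (P i i)"
      using re im by (simp add: cmod_def)
    then show ?thesis
      by (smt (verit) mult_left_le_imp_le mult_cancel_right1 power2_eq_square mult_right_le_imp_le)
  qed
  have "real k = Re (\<Sum>i\<in>J. P i i)" using tr by simp
  also have "\<dots> = (\<Sum>i\<in>J. Re (P i i))" by simp
  also have "\<dots> \<le> (\<Sum>i\<in>J. 1)" using le1 by (intro sum_mono)
  finally show ?thesis by simp
qed

text \<open>Among the Hermitian idempotents with columns in \<open>N\<close> one of maximal trace is
  taken; the preceding lemma bounds the trace. If it failed to fix some c in \<open>N\<close>, the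
  residual would span a line orthogonal to its range, and adding the projection onto that line would
  raise the trace by one. The index type is arbitrary because the lemma serves coefficient vectors
  indexed by triples as well as column vectors indexed by numbers.\<close>

lemma orth_projection_exists:
  fixes N :: "('j \<Rightarrow> complex) set"
  assumes fin: "finite J"
    and supp: "\<And>c i. c \<in> N \<Longrightarrow> i \<notin> J \<Longrightarrow> c i = 0"
    and zero: "(\<lambda>_. 0) \<in> N"
    and add: "\<And>c d. c \<in> N \<Longrightarrow> d \<in> N \<Longrightarrow> (\<lambda>i. c i + d i) \<in> N"
    and scale: "\<And>a c. c \<in> N \<Longrightarrow> (\<lambda>i. a * c i) \<in> N"
  shows "\<exists>P. (\<forall>i j. P i j = cnj (P j i)) \<and> (\<forall>j. (\<lambda>i. P i j) \<in> N) \<and>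
    (\<forall>c\<in>N. \<forall>i. (\<Sum>j\<in>J. P i j * c j) = c i)"
proof -
  \<comment> \<open>The trace is recorded as a natural number, so that a maximum exists.\<close>
  define good where "good P k \<longleftrightarrow> (\<forall>i j. P i j = cnj (P j i)) \<and> (\<forall>j. (\<lambda>i. P i j) \<in> N) \<and>
    (\<forall>i k. (\<Sum>j\<in>J. P i j * P j k) = P i k) \<and> (\<Sum>i\<in>J. P i i) = of_nat k"
    for P :: "'j \<Rightarrow> 'j \<Rightarrow> complex" and k :: nat
  define Q where "Q = {k. \<exists>P. good P k}"
  have "good (\<lambda>_ _. 0) 0" using zero by (simp add: good_def)
  then have "Q \<noteq> {}" by (auto simp: Q_def)
  have "Q \<subseteq> {..card J}"
    using hermitian_idempotent_trace_le[OF fin] unfolding Q_def good_def by blast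
  then have "finite Q" by (rule finite_subset) simp
  define k where "k = Max Q"
  have "k \<in> Q" unfolding k_def using \<open>finite Q\<close> \<open>Q \<noteq> {}\<close> by simp
  then obtain P where P: "good P k" by (auto simp: Q_def)
  have herm: "\<And>i j. P i j = cnj (P j i)" and cols: "\<And>j. (\<lambda>i. P i j) \<in> N"
    and idem: "\<And>i k. (\<Sum>j\<in>J. P i j * P j k) = P i k" and tr: "(\<Sum>i\<in>J. P i i) = of_nat k"
    using P unfolding good_def by blast+
  have sumN: "(\<lambda>i. \<Sum>j\<in>F. P i j * c j) \<in> N" if "finite F" for F c
    using that
  proof (induction F rule: finite_induct)
    case empty then show ?case using zero by simp
  next
    case (insert j F)
    have "(\<lambda>i. c j * P i j) \<in> N" by (rule scale[OF cols])
    from add[OF this insert.IH] show ?case using insert by (simp add: mult.commute)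
  qed
  have "(\<Sum>j\<in>J. P i j * c j) = c i" if c: "c \<in> N" for c i
  proof (rule ccontr)
    assume ne: "(\<Sum>j\<in>J. P i j * c j) \<noteq> c i"
    \<comment> \<open>The component of c orthogonal to the range of P; \<open>Pd\<close> and
      \<open>dP\<close> below express the orthogonality.\<close>
    define d where "d = (\<lambda>i. c i + (- 1) * (\<Sum>j\<in>J. P i j * c j))"
    have dN: "d \<in> N" unfolding d_def by (rule add[OF c scale[OF sumN[OF fin]]])
    have "d i \<noteq> 0" using ne by (simp add: d_def)
    with supp[OF dN] have iJ: "i \<in> J" by blast
    have Pd: "(\<Sum>j\<in>J. P i j * d j) = 0" for i
    proof -
      have "(\<Sum>j\<in>J. P i j * (\<Sum>k\<in>J. P j k * c k)) = (\<Sum>k\<in>J. (\<Sum>j\<in>J. P i j * P j k) * c k)"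
        unfolding sum_distrib_left sum_distrib_right
        by (subst sum.swap) (simp add: mult_ac)
      then have "(\<Sum>j\<in>J. P i j * (\<Sum>k\<in>J. P j k * c k)) = (\<Sum>j\<in>J. P i j * c j)"
        by (simp add: idem)
      then show ?thesis
        by (simp add: d_def right_diff_distrib sum_subtractf)
    qed
    define s where "s = (\<Sum>j\<in>J. (cmod (d j))\<^sup>2)"
    have "0 < (cmod (d i))\<^sup>2" using \<open>d i \<noteq> 0\<close> by simp
    also have "\<dots> \<le> s" unfolding s_def using fin iJ by (intro member_le_sum) auto
    finally have s: "s > 0" .
    have sc: "(\<Sum>j\<in>J. d j * cnj (d j)) = complex_of_real s"
      by (simp add: s_def complex_norm_square del: of_real_power)
    have sc': "(\<Sum>j\<in>J. cnj (d j) * d j) = complex_of_real s"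
      using sc by (simp add: mult.commute)
    have dP: "(\<Sum>j\<in>J. cnj (d j) * P j k) = 0" for k
    proof -
      have "cnj (\<Sum>j\<in>J. P k j * d j) = (\<Sum>j\<in>J. cnj (d j) * P j k)"
        unfolding cnj_sum by (rule sum.cong) (simp_all add: herm[symmetric] mult.commute)
      then show ?thesis using Pd[of k] by simp
    qed
    \<comment> \<open>P plus the rank one projection onto the line of d.\<close>
    define P' where "P' = (\<lambda>i j. P i j + d i * cnj (d j) / complex_of_real s)"
    have "good P' (Suc k)"
      unfolding good_def
    proof (intro conjI allI)
      show "P' i j = cnj (P' j i)" for i j
        using herm[of i j] by (simp add: P'_def)
      show "(\<lambda>i. P' i j) \<in> N" for j
        unfolding P'_def using add[OF cols[of j] scale[OF dN, of "cnj (d j) / complex_of_real s"]]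
        by (simp add: mult_ac)
      show "(\<Sum>j\<in>J. P' i j * P' j k) = P' i k" for i k
      proof -
        have "(\<Sum>j\<in>J. P' i j * P' j k) = (\<Sum>j\<in>J. P i j * P j k)
           + (\<Sum>j\<in>J. P i j * d j) * (cnj (d k) / s) + d i / s * (\<Sum>j\<in>J. cnj (d j) * P j k)
           + d i / s * (\<Sum>j\<in>J. cnj (d j) * d j) * (cnj (d k) / s)"
          unfolding P'_def sum_distrib_left sum_distrib_right sum.distrib[symmetric]
          by (rule sum.cong) (simp_all add: algebra_simps)
        also have "\<dots> = P' i k"
          using s by (simp add: idem Pd dP sc' P'_def)
        finally show ?thesis .
      qed
      have "(\<Sum>i\<in>J. P' i i) = (\<Sum>i\<in>J. P i i) + (\<Sum>j\<in>J. d j * cnj (d j)) / s"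
        unfolding P'_def sum.distrib sum_divide_distrib by simp
      then show "(\<Sum>i\<in>J. P' i i) = of_nat (Suc k)"
        using s by (simp add: tr sc)
    qed
    then have "Suc k \<in> Q" by (auto simp: Q_def)
    then have "Suc k \<le> k" unfolding k_def using \<open>finite Q\<close> by (rule Max_ge[rotated])
    then show False by simp
  qed
  with herm cols show ?thesis by blast
qed

section \<open>Traces and the spectral theorem for positive definite matrices\<close>

lemma mtrace_sum: "A \<in> carrier_mat m m \<Longrightarrow> mtrace A = (\<Sum>i<m. A $$ (i, i))"
  by (simp add: mtrace_def)

lemma mtrace_mult_comm:
  assumes "A \<in> carrier_mat m k" "B \<in> carrier_mat k m"
  shows "mtrace (A * B) = mtrace (B * A)"
proof -
  have "mtrace (A * B) = (\<Sum>i<m. \<Sum>j<k. A $$ (i, j) * B $$ (j, i))"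
    unfolding mtrace_sum[OF mult_carrier_mat[OF assms]]
    by (rule sum.cong) (simp_all add: mult_mat_index[OF assms] del: index_mult_mat)
  also have "\<dots> = (\<Sum>j<k. \<Sum>i<m. B $$ (j, i) * A $$ (i, j))"
    by (subst sum.swap) (simp add: mult.commute)
  also have "\<dots> = mtrace (B * A)"
    unfolding mtrace_sum[OF mult_carrier_mat[OF assms(2,1)]]
    by (rule sum.cong) (simp_all add: mult_mat_index[OF assms(2,1)] del: index_mult_mat)
  finally show ?thesis .
qed

lemma mtrace_similar:
  assumes "similar_mat_wit A B P Q" "A \<in> carrier_mat m m"
  shows "mtrace A = mtrace B"
proof -
  note w = similar_mat_witD2[OF assms(2,1)]
  have A: "A = (P * B) * Q" and PQ: "P \<in> carrier_mat m m" "B \<in> carrier_mat m m" "Q \<in> carrier_mat m m"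
    and QP: "Q * P = 1\<^sub>m m"
    using w by blast+
  have "mtrace A = mtrace (Q * (P * B))"
    unfolding A by (rule mtrace_mult_comm[OF mult_carrier_mat[OF PQ(1,2)] PQ(3)])
  also have "Q * (P * B) = (Q * P) * B"
    by (rule assoc_mult_mat[OF PQ(3,1,2), symmetric])
  also have "\<dots> = B" unfolding QP using PQ by simp
  finally show ?thesis .
qed

text \<open>The Schur form is triangular with the eigenvalues on its diagonal and has the same
  trace, so a nonzero trace forces a nonzero eigenvalue.\<close>

lemma nonzero_eigenvalue:
  assumes A: "(A :: complex mat) \<in> carrier_mat m m" and tr: "mtrace A \<noteq> 0"
  shows "\<exists>v e. v \<in> carrier_vec m \<and> v \<noteq> 0\<^sub>v m \<and> e \<noteq> 0 \<and> A *\<^sub>v v = e \<cdot>\<^sub>v v"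
proof -
  obtain es where cp: "char_poly A = (\<Prod>e\<leftarrow>es. [:- e, 1:])"
    using char_poly_factorized[OF A] by blast
  obtain B P Q where sd: "schur_decomposition A es = (B, P, Q)" by (cases "schur_decomposition A es")
  from schur_decomposition[OF A cp sd]
  have sim: "similar_mat_wit A B P Q" and dB: "diag_mat B = es" by auto
  have B: "B \<in> carrier_mat m m" using similar_mat_witD2[OF A sim] by blast
  have trB: "mtrace B \<noteq> 0" using mtrace_similar[OF sim A] tr by simp
  have "\<exists>i<m. B $$ (i, i) \<noteq> 0"
    using trB unfolding mtrace_sum[OF B] by (rule contrapos_np) simp
  then obtain i where i: "i < m" "B $$ (i, i) \<noteq> 0" by blast
  define e where "e = B $$ (i, i)"
  have "e \<in> set es" unfolding dB[symmetric] e_def diag_mat_def using i B by auto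
  then have "poly (char_poly A) e = 0" unfolding cp by (auto simp: poly_prod_list prod_list_zero_iff)
  then have "eigenvalue A e" by (simp add: eigenvalue_root_char_poly[OF A])
  then show ?thesis unfolding eigenvalue_def eigenvector_def using A i e_def by auto
qed

lemma mult_indicator:
  "a * (if b then 1 else 0) = (if b then a else (0 :: 'a :: semiring_1))"
  "(if b then 1 else 0) * a = (if b then a else (0 :: 'a :: semiring_1))"
  by simp_all

text \<open>Induction on the number of eigenvectors found so far. With q the projection onto their
  orthogonal complement, \<open>B = A q\<close> has positive trace, hence an eigenvector x for a
  nonzero eigenvalue. The range of B is orthogonal to the known eigenvectors, so x is too, and x is
  then an eigenvector of A itself.\<close>

lemma pos_def_orthonormal_eigenvectors:
  assumes A: "pos_def m A"
  shows "k \<le> m \<Longrightarrow> \<exists>v e. (\<forall>i<k. v i \<in> carrier_vec m \<and> A *\<^sub>v v i = complex_of_real (e i) \<cdot>\<^sub>v v i) \<and>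
    (\<forall>i<k. \<forall>j<k. v i \<bullet>c v j = (if i = j then 1 else 0))"
proof (induction k)
  case 0
  then show ?case by simp
next
  case (Suc k)
  from Suc.IH[OF Suc_leD[OF Suc.prems]] obtain v e where
    ve: "\<forall>i<k. v i \<in> carrier_vec m \<and> A *\<^sub>v v i = complex_of_real (e i) \<cdot>\<^sub>v v i"
    and on: "\<forall>i<k. \<forall>j<k. v i \<bullet>c v j = (if i = j then 1 else 0)"
    by (elim exE conjE)
  have v: "v i \<in> carrier_vec m" and Av: "A *\<^sub>v v i = complex_of_real (e i) \<cdot>\<^sub>v v i" if "i < k" for i
    using ve that by blast+
  have on: "v i \<bullet>c v j = (if i = j then 1 else 0)" if "i < k" "j < k" for i j
    using on that by blast
  have Ac: "A \<in> carrier_mat m m" and Ah: "mat_adjoint A = A" using A by (auto simp: pos_def_def)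
  have Ah': "A $$ (i, j) = cnj (A $$ (j, i))" if "i < m" "j < m" for i j
    using that Ac arg_cong[OF Ah, of "\<lambda>M. M $$ (i, j)"] by simp
  define a where "a = (\<lambda>i j. A $$ (i, j))"
  define p where "p = (\<lambda>a b. \<Sum>i<k. v i $ a * cnj (v i $ b))"
  have on': "(\<Sum>b<m. cnj (v i $ b) * v j $ b) = (if i = j then 1 else 0)" if "i < k" "j < k" for i j
    using on[OF that(2,1)] that by (auto simp: cscalar_prod_sum[OF v v] mult.commute)
  have Ave: "(\<Sum>j<m. a l j * v i $ j) = e i * v i $ l" if "i < k" "l < m" for i l
    using arg_cong[OF Av[OF that(1)], of "\<lambda>w. w $ l"] that v[OF that(1)]
    by (simp add: mult_mat_vec_index_sum[OF Ac v[OF that(1)]] a_def del: index_mult_mat_vec)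
  have vA: "(\<Sum>l<m. cnj (v i $ l) * a l j) = e i * cnj (v i $ j)" if "i < k" "j < m" for i j
  proof -
    have "(\<Sum>l<m. cnj (v i $ l) * a l j) = cnj (\<Sum>l<m. a j l * v i $ l)"
      unfolding cnj_sum by (rule sum.cong) (use that Ah'[symmetric] in \<open>simp_all add: a_def mult.commute\<close>)
    then show ?thesis using Ave[OF that] by simp
  qed
  define q where "q = (\<lambda>i j. (if i = j then 1 else 0) - p i j)"
  have vq: "(\<Sum>l<m. cnj (v i $ l) * q l j) = 0" if "i < k" "j < m" for i j
  proof -
    have "(\<Sum>l<m. cnj (v i $ l) * p l j) = (\<Sum>i'<k. (\<Sum>l<m. cnj (v i $ l) * v i' $ l) * cnj (v i' $ j))"
      unfolding p_def sum_distrib_left sum_distrib_right by (subst sum.swap) (simp add: mult_ac)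
    also have "\<dots> = (\<Sum>i'<k. if i' = i then cnj (v i' $ j) else 0)"
      by (rule sum.cong) (use that on' in auto)
    also have "\<dots> = cnj (v i $ j)" using that by simp
    finally show ?thesis
      using that by (simp add: q_def right_diff_distrib sum_subtractf mult_indicator)
  qed
  define B where "B = A * mat m m (\<lambda>(i, j). q i j)"
  have Bc: "B \<in> carrier_mat m m" using Ac by (simp add: B_def)
  have Bi: "B $$ (i, j) = (\<Sum>l<m. a i l * q l j)" if "i < m" "j < m" for i j
    using that unfolding B_def by (subst mult_mat_index[OF Ac]) (auto simp: a_def)
  have vB: "(\<Sum>l<m. cnj (v i $ l) * B $$ (l, j)) = 0" if "i < k" "j < m" for i j
  proof -
    have "(\<Sum>l<m. cnj (v i $ l) * B $$ (l, j)) = (\<Sum>l<m. \<Sum>l'<m. cnj (v i $ l) * (a l l' * q l' j))"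
      using that by (intro sum.cong) (auto simp: Bi sum_distrib_left)
    also have "\<dots> = (\<Sum>l'<m. (\<Sum>l<m. cnj (v i $ l) * a l l') * q l' j)"
      unfolding sum_distrib_right by (subst sum.swap) (simp add: mult_ac)
    also have "\<dots> = (\<Sum>l'<m. e i * (cnj (v i $ l') * q l' j))"
      using that by (intro sum.cong) (auto simp: vA)
    also have "\<dots> = 0" using vq[OF that] by (simp add: sum_distrib_left[symmetric])
    finally show ?thesis .
  qed
  have ph: "p i j = cnj (p j i)" for i j by (simp add: p_def mult.commute)
  have qh: "q i j = cnj (q j i)" for i j using ph[of i j] by (simp add: q_def)
  have pB: "(\<Sum>l<m. p i l * B $$ (l, j)) = 0" if "j < m" for i j
  proof -
    have "(\<Sum>l<m. p i l * B $$ (l, j)) = (\<Sum>i'<k. v i' $ i * (\<Sum>l<m. cnj (v i' $ l) * B $$ (l, j)))"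
      unfolding p_def sum_distrib_left sum_distrib_right by (subst sum.swap) (simp add: mult_ac)
    then show ?thesis using that vB by simp
  qed
  \<comment> \<open>Since p B = 0, B equals q B, and its trace is the sum of the quadratic form of A
    at the columns \<open>w j\<close> of q. Some column is nonzero because k < m.\<close>
  have "mtrace B = (\<Sum>j<m. \<Sum>i<m. q j i * B $$ (i, j))"
    unfolding mtrace_sum[OF Bc]
    by (rule sum.cong) (simp_all add: q_def left_diff_distrib sum_subtractf pB mult_indicator)
  moreover
  define w where "w = (\<lambda>j. vec m (\<lambda>i. q i j))"
  have "(\<Sum>i<m. q j i * B $$ (i, j)) = (A *\<^sub>v w j) \<bullet>c w j" if "j < m" for j
  proof -
    have "(A *\<^sub>v w j) \<bullet>c w j = (\<Sum>i<m. (A *\<^sub>v w j) $ i * cnj (w j $ i))"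
      using Ac by (intro cscalar_prod_sum) (auto simp: w_def)
    also have "\<dots> = (\<Sum>i<m. B $$ (i, j) * q j i)"
      by (rule sum.cong[OF refl], subst mult_mat_vec_index_sum[OF Ac])
         (use that in \<open>auto simp: w_def Bi a_def qh[symmetric]\<close>)
    finally show ?thesis by (simp add: mult.commute)
  qed
  ultimately have trB: "mtrace B = (\<Sum>j<m. (A *\<^sub>v w j) \<bullet>c w j)" by simp
  have wnz: "\<exists>j<m. w j \<noteq> 0\<^sub>v m"
  proof (rule ccontr)
    assume "\<not> ?thesis"
    then have "q i j = 0" if "i < m" "j < m" for i j
      using that unfolding w_def by (auto dest!: spec[of _ j] dest: arg_cong[of _ _ "\<lambda>v. v $ i"])
    then have "p i j = (if i = j then 1 else 0)" if "i < m" "j < m" for i j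
      using that unfolding q_def by (auto split: if_splits)
    then have "(\<Sum>i<m. p i i) = of_nat m" by simp
    moreover have "(\<Sum>i<m. p i i) = (\<Sum>i<k. \<Sum>b<m. cnj (v i $ b) * v i $ b)"
      unfolding p_def by (subst sum.swap) (simp add: mult.commute)
    then have "(\<Sum>i<m. p i i) = of_nat k" using on' by simp
    ultimately have "of_nat m = (of_nat k :: complex)" by simp
    then have "m = k" by (metis of_nat_eq_iff)
    then show False using Suc.prems by simp
  qed
  have nonneg: "Re ((A *\<^sub>v w j) \<bullet>c w j) \<ge> 0" and pos: "w j \<noteq> 0\<^sub>v m \<Longrightarrow> Re ((A *\<^sub>v w j) \<bullet>c w j) > 0" for j
  proof -
    have wc: "w j \<in> carrier_vec m" by (simp add: w_def)
    show *: "w j \<noteq> 0\<^sub>v m \<Longrightarrow> Re ((A *\<^sub>v w j) \<bullet>c w j) > 0" using A wc by (auto simp: pos_def_def)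
    show "Re ((A *\<^sub>v w j) \<bullet>c w j) \<ge> 0"
      using * Ac by (cases "w j = 0\<^sub>v m") (auto intro: less_imp_le)
  qed
  obtain j0 where "j0 < m" "w j0 \<noteq> 0\<^sub>v m" using wnz by blast
  have "Re (mtrace B) > 0"
    unfolding trB Re_sum by (rule sum_pos2[of _ j0]) (use \<open>j0 < m\<close> pos[OF \<open>w j0 \<noteq> 0\<^sub>v m\<close>] nonneg in auto)
  then have "mtrace B \<noteq> 0" by auto
  from nonzero_eigenvalue[OF Bc this] obtain x c where x: "x \<in> carrier_vec m" "x \<noteq> 0\<^sub>v m" "c \<noteq> 0"
    and Bx: "B *\<^sub>v x = c \<cdot>\<^sub>v x" by blast
  have Bxi: "(\<Sum>j<m. B $$ (i, j) * x $ j) = c * x $ i" if "i < m" for i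
    using arg_cong[OF Bx, of "\<lambda>w. w $ i"] that x
    by (simp add: mult_mat_vec_index_sum[OF Bc x(1)] del: index_mult_mat_vec)
  \<comment> \<open>As c is nonzero, x lies in the range of B, which is orthogonal to all
    \<open>v i\<close>.\<close>
  have vx: "(\<Sum>l<m. cnj (v i $ l) * x $ l) = 0" if "i < k" for i
  proof -
    have "c * (\<Sum>l<m. cnj (v i $ l) * x $ l) = (\<Sum>l<m. cnj (v i $ l) * (\<Sum>j<m. B $$ (l, j) * x $ j))"
      unfolding sum_distrib_left[of c] by (rule sum.cong) (simp_all add: Bxi)
    also have "\<dots> = (\<Sum>j<m. (\<Sum>l<m. cnj (v i $ l) * B $$ (l, j)) * x $ j)"
      unfolding sum_distrib_left sum_distrib_right by (subst sum.swap) (simp add: mult_ac)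
    also have "\<dots> = 0" using that vB by simp
    finally show ?thesis using x by simp
  qed
  have px: "(\<Sum>l<m. p i l * x $ l) = 0" for i
  proof -
    have "(\<Sum>l<m. p i l * x $ l) = (\<Sum>i'<k. v i' $ i * (\<Sum>l<m. cnj (v i' $ l) * x $ l))"
      unfolding p_def sum_distrib_left sum_distrib_right by (subst sum.swap) (simp add: mult_ac)
    then show ?thesis using vx by simp
  qed
  have Ax: "(\<Sum>l<m. a i l * x $ l) = c * x $ i" if "i < m" for i
  proof -
    have "c * x $ i = (\<Sum>j<m. (\<Sum>l<m. a i l * q l j) * x $ j)"
      using that by (simp add: Bxi[symmetric] Bi)
    also have "\<dots> = (\<Sum>l<m. a i l * (\<Sum>j<m. q l j * x $ j))"
      unfolding sum_distrib_left sum_distrib_right by (subst sum.swap) (simp add: mult_ac)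
    also have "\<dots> = (\<Sum>l<m. a i l * x $ l)"
      by (rule sum.cong) (simp_all add: q_def left_diff_distrib sum_subtractf px mult_indicator)
    finally show ?thesis by simp
  qed
  define s where "s = (\<Sum>j<m. (cmod (x $ j))\<^sup>2)"
  have sx: "(\<Sum>j<m. x $ j * cnj (x $ j)) = complex_of_real s"
    by (simp add: s_def complex_norm_square del: of_real_power)
  obtain i0 where i0: "i0 < m" "x $ i0 \<noteq> 0" using x by (metis carrier_vecD eq_vecI index_zero_vec)
  have "0 < (cmod (x $ i0))\<^sup>2" using i0 by simp
  also have "\<dots> \<le> s" unfolding s_def using i0 by (intro member_le_sum) auto
  finally have s: "s > 0" .
  \<comment> \<open>\<open>c * s\<close> is the quadratic form of the Hermitian matrix A at x, so c
    is real.\<close>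
  have "c * s = cnj (c * s)"
  proof -
    have 1: "c * s = (\<Sum>i<m. \<Sum>l<m. a i l * x $ l * cnj (x $ i))"
      unfolding sx[symmetric] sum_distrib_left[of c]
      by (rule sum.cong) (simp_all add: Ax[symmetric] sum_distrib_right mult.assoc[symmetric])
    have "cnj (c * s) = (\<Sum>i<m. \<Sum>l<m. a l i * cnj (x $ l) * x $ i)"
      unfolding 1 cnj_sum by (intro sum.cong) (use Ah'[symmetric] in \<open>auto simp: a_def\<close>)
    also have "\<dots> = c * s" unfolding 1 by (subst sum.swap) (simp add: mult_ac)
    finally show ?thesis by (rule sym)
  qed
  then have "Im c = 0" using s by (simp add: complex_eq_iff)
  then have r: "c = complex_of_real (Re c)" by (simp add: complex_eq_iff)
  define r where "r = Re c"
  note r = r[folded r_def]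
  define y where "y = complex_of_real (1 / sqrt s) \<cdot>\<^sub>v x"
  have yc: "y \<in> carrier_vec m" using x by (simp add: y_def)
  have yi: "y $ i = x $ i / sqrt s" if "i < m" for i using that x by (simp add: y_def)
  have Ay: "A *\<^sub>v y = complex_of_real r \<cdot>\<^sub>v y"
  proof (rule eq_vecI)
    fix i assume "i < dim_vec (complex_of_real r \<cdot>\<^sub>v y)"
    then have i: "i < m" using yc by simp
    have "(A *\<^sub>v y) $ i = (\<Sum>l<m. a i l * x $ l) / sqrt s"
      unfolding mult_mat_vec_index_sum[OF Ac yc i] sum_divide_distrib by (rule sum.cong) (simp_all add: yi a_def)
    then show "(A *\<^sub>v y) $ i = (complex_of_real r \<cdot>\<^sub>v y) $ i" using i yc by (simp add: Ax yi r)
  qed (use Ac yc in simp)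
  have yy: "y \<bullet>c y = 1"
  proof -
    have "y \<bullet>c y = (\<Sum>j<m. x $ j * cnj (x $ j)) / s"
      unfolding cscalar_prod_sum[OF yc yc] sum_divide_distrib
      by (rule sum.cong) (use s in \<open>auto simp: yi simp flip: of_real_mult\<close>)
    then show ?thesis using s by (simp add: sx)
  qed
  have vy: "y \<bullet>c v i = 0" "v i \<bullet>c y = 0" if "i < k" for i
  proof -
    have "y \<bullet>c v i = (\<Sum>l<m. cnj (v i $ l) * x $ l) / sqrt s"
      unfolding cscalar_prod_sum[OF v[OF that] yc] sum_divide_distrib
      by (rule sum.cong) (auto simp: yi)
    then show "y \<bullet>c v i = 0" using vx[OF that] by simp
    moreover have "v i \<bullet>c y = cnj (y \<bullet>c v i)"
      unfolding cscalar_prod_sum[OF v[OF that] yc] cscalar_prod_sum[OF yc v[OF that]]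
      by (simp add: mult.commute)
    ultimately show "v i \<bullet>c y = 0" by simp
  qed
  show ?case
    by (rule exI[of _ "v(k := y)"], rule exI[of _ "e(k := r)"])
       (use v Av on yc Ay yy vy in \<open>auto simp: less_Suc_eq\<close>)
qed

section \<open>Unitary diagonalization and real powers\<close>

definition unitary_diagonalization :: "nat \<Rightarrow> complex mat \<Rightarrow> complex mat \<Rightarrow> (nat \<Rightarrow> real) \<Rightarrow> bool" where
  "unitary_diagonalization m A U d \<longleftrightarrow> U \<in> carrier_mat m m \<and> mat_adjoint U * U = 1\<^sub>m m \<and>
     (\<forall>i<m. 0 < d i) \<and> A = U * mat_diag m (\<lambda>i. complex_of_real (d i)) * mat_adjoint U"

lemma mat_inverse_swap:
  assumes "(A :: complex mat) \<in> carrier_mat m m" "B \<in> carrier_mat m m" "A * B = 1\<^sub>m m"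
  shows "B * A = 1\<^sub>m m"
  using mat_mult_left_right_inverse[OF assms] .

lemma pos_def_unitary_diagonalization:
  assumes A: "pos_def m A"
  shows "\<exists>U d. unitary_diagonalization m A U d"
proof -
  from pos_def_orthonormal_eigenvectors[OF A order_refl] obtain v e where
    ve: "\<forall>i<m. v i \<in> carrier_vec m \<and> A *\<^sub>v v i = complex_of_real (e i) \<cdot>\<^sub>v v i"
    and on: "\<forall>i<m. \<forall>j<m. v i \<bullet>c v j = (if i = j then 1 else 0)"
    by (elim exE conjE)
  have v: "v i \<in> carrier_vec m" and Av: "A *\<^sub>v v i = complex_of_real (e i) \<cdot>\<^sub>v v i" if "i < m" for i
    using ve that by blast+
  have Ac: "A \<in> carrier_mat m m" using A by (simp add: pos_def_def)
  have e: "e i > 0" if "i < m" for i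
  proof -
    have vv: "v i \<bullet>c v i = 1" using on that by simp
    then have "v i \<noteq> 0\<^sub>v m" using that v by auto
    then have "Re ((A *\<^sub>v v i) \<bullet>c v i) > 0" using A v[OF that] by (auto simp: pos_def_def)
    moreover have "(A *\<^sub>v v i) \<bullet>c v i = complex_of_real (e i) * (v i \<bullet>c v i)"
      unfolding Av[OF that] using v[OF that] by (simp add: smult_scalar_prod_distrib[OF v[OF that]] carrier_vec_conjugate)
    ultimately show ?thesis using vv by simp
  qed
  define U where "U = mat m m (\<lambda>(i, j). v j $ i)"
  have U: "U \<in> carrier_mat m m" by (simp add: U_def)
  note U' = mat_adjoint_carrier[OF U]
  have UU: "mat_adjoint U * U = 1\<^sub>m m"
  proof (rule eq_matI)
    fix i j assume "i < dim_row (1\<^sub>m m :: complex mat)" "j < dim_col (1\<^sub>m m :: complex mat)"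
    then have ij: "i < m" "j < m" by auto
    have "(mat_adjoint U * U) $$ (i, j) = v j \<bullet>c v i"
      unfolding mult_mat_index[OF U' U ij] cscalar_prod_sum[OF v[OF ij(1)] v[OF ij(2)]]
      by (rule sum.cong) (use ij in \<open>auto simp: U_def\<close>)
    then show "(mat_adjoint U * U) $$ (i, j) = (1\<^sub>m m) $$ (i, j)" using on ij by auto
  qed (use U in auto)
  have UU': "U * mat_adjoint U = 1\<^sub>m m" by (rule mat_inverse_swap[OF U' U UU])
  have "A * U = U * mat_diag m (\<lambda>i. complex_of_real (e i))"
    unfolding mat_diag_mult_right[OF U]
  proof (rule eq_matI)
    fix i j assume "i < dim_row (Matrix.mat m m (\<lambda>(i, j). U $$ (i, j) * complex_of_real (e j)))"
      "j < dim_col (Matrix.mat m m (\<lambda>(i, j). U $$ (i, j) * complex_of_real (e j)))"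
    then have ij: "i < m" "j < m" by auto
    have "(A * U) $$ (i, j) = (A *\<^sub>v v j) $ i"
      unfolding mult_mat_index[OF Ac U ij] mult_mat_vec_index_sum[OF Ac v[OF ij(2)] ij(1)]
      by (rule sum.cong) (use ij in \<open>auto simp: U_def\<close>)
    then show "(A * U) $$ (i, j) = Matrix.mat m m (\<lambda>(i, j). U $$ (i, j) * complex_of_real (e j)) $$ (i, j)"
      using ij v[OF ij(2)] by (simp add: Av U_def)
  qed (use U Ac in auto)
  then have "A * U * mat_adjoint U = U * mat_diag m (\<lambda>i. complex_of_real (e i)) * mat_adjoint U" by simp
  also have "A * U * mat_adjoint U = A" using Ac U U' UU' by (simp add: assoc_mult_mat[OF Ac U U'])
  finally show ?thesis using U UU e unfolding unitary_diagonalization_def by blast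
qed

text \<open>This makes the definite description in \<open>mpow\<close> meaningful. W, the adjoint of
  V times U, intertwines the two diagonal matrices, so a nonzero entry \<open>W $$ (i, j)\<close>
  forces \<open>d j = e i\<close>; hence W intertwines their powers as well.\<close>

lemma unitary_diagonalization_powr_unique:
  assumes U: "unitary_diagonalization m A U d" and V: "unitary_diagonalization m A V e"
  shows "U * mat_diag m (\<lambda>i. complex_of_real (d i powr s)) * mat_adjoint U =
    V * mat_diag m (\<lambda>i. complex_of_real (e i powr s)) * mat_adjoint V"
proof -
  have Uc: "U \<in> carrier_mat m m" and Vc: "V \<in> carrier_mat m m"
    and UU: "mat_adjoint U * U = 1\<^sub>m m" and VV: "mat_adjoint V * V = 1\<^sub>m m"
    using U V by (auto simp: unitary_diagonalization_def)
  note Uc' = mat_adjoint_carrier[OF Uc] and Vc' = mat_adjoint_carrier[OF Vc]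
  have UU': "U * mat_adjoint U = 1\<^sub>m m" by (rule mat_inverse_swap[OF Uc' Uc UU])
  have VV': "V * mat_adjoint V = 1\<^sub>m m" by (rule mat_inverse_swap[OF Vc' Vc VV])
  define W where "W = mat_adjoint V * U"
  have W: "W \<in> carrier_mat m m" using Uc Vc' by (simp add: W_def)
  define dd where "dd f = mat_diag m (\<lambda>i. complex_of_real (f i))" for f :: "nat \<Rightarrow> real"
  have dd: "dd f \<in> carrier_mat m m" for f by (simp add: dd_def)
  have A1: "A = U * dd d * mat_adjoint U" and A2: "A = V * dd e * mat_adjoint V"
    using U V by (auto simp: unitary_diagonalization_def dd_def)
  have "W * dd d = mat_adjoint V * (U * dd d * mat_adjoint U) * U"
    unfolding W_def using Uc Uc' Vc' dd[of d] UU by (simp add: assoc_mult_mat[of _ m m _ m _ m] mult_carrier_mat[of _ m m _ m] left_mult_one_mat[of _ m m])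
  also have "\<dots> = mat_adjoint V * (V * dd e * mat_adjoint V) * U" using A1 A2 by simp
  also have "\<dots> = (mat_adjoint V * V) * dd e * W"
    unfolding W_def using Uc Vc Vc' dd[of e] by (simp add: assoc_mult_mat[of _ m m _ m _ m] mult_carrier_mat[of _ m m _ m] left_mult_one_mat[of _ m m])
  also have "\<dots> = dd e * W" unfolding VV using dd[of e] by simp
  finally have comm: "W * dd d = dd e * W" .
  have "W * dd (\<lambda>i. d i powr s) = dd (\<lambda>i. e i powr s) * W"
    unfolding dd_def mat_diag_mult_right[OF W] mat_diag_mult_left[OF W]
  proof (rule cong_mat)
    fix i j assume ij: "i < m" "j < m"
    have "W $$ (i, j) * complex_of_real (d j) = complex_of_real (e i) * W $$ (i, j)"
      using arg_cong[OF comm, of "\<lambda>M. M $$ (i, j)"] ij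
      unfolding dd_def mat_diag_mult_right[OF W] mat_diag_mult_left[OF W] by simp
    then have "W $$ (i, j) = 0 \<or> d j = e i" by (simp add: mult.commute)
    then show "(case (i, j) of (i, j) \<Rightarrow> W $$ (i, j) * complex_of_real (d j powr s)) =
       (case (i, j) of (i, j) \<Rightarrow> complex_of_real (e i powr s) * W $$ (i, j))" by auto
  qed auto
  then have "V * (W * dd (\<lambda>i. d i powr s)) * mat_adjoint U = V * (dd (\<lambda>i. e i powr s) * W) * mat_adjoint U" by simp
  also have "V * (W * dd (\<lambda>i. d i powr s)) * mat_adjoint U = (V * mat_adjoint V) * U * dd (\<lambda>i. d i powr s) * mat_adjoint U"
    unfolding W_def using Uc Uc' Vc Vc' dd by (simp add: assoc_mult_mat[of _ m m _ m _ m] mult_carrier_mat[of _ m m _ m] left_mult_one_mat[of _ m m])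
  also have "V * (dd (\<lambda>i. e i powr s) * W) * mat_adjoint U = V * dd (\<lambda>i. e i powr s) * mat_adjoint V * (U * mat_adjoint U)"
    unfolding W_def using Uc Uc' Vc Vc' dd by (simp add: assoc_mult_mat[of _ m m _ m _ m] mult_carrier_mat[of _ m m _ m] left_mult_one_mat[of _ m m])
  finally show ?thesis unfolding UU' VV' using Uc Vc Vc' dd by (simp add: dd_def)
qed

lemma mpow_eq:
  assumes A: "pos_def m A" and U: "unitary_diagonalization m A U d"
  shows "mpow A s = U * mat_diag m (\<lambda>i. complex_of_real (d i powr s)) * mat_adjoint U"
proof -
  have dim: "dim_row A = m" using A by (auto simp: pos_def_def)
  show ?thesis
    unfolding mpow_def dim
  proof (rule the_equality)
    show "\<exists>U' d'. U' \<in> carrier_mat m m \<and> mat_adjoint U' * U' = 1\<^sub>m m \<and> (\<forall>i<m. 0 < d' i) \<and>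
      A = U' * mat_diag m (\<lambda>i. complex_of_real (d' i)) * mat_adjoint U' \<and>
      U * mat_diag m (\<lambda>i. complex_of_real (d i powr s)) * mat_adjoint U =
      U' * mat_diag m (\<lambda>i. complex_of_real (d' i powr s)) * mat_adjoint U'"
      using U unfolding unitary_diagonalization_def by blast
  qed (use unitary_diagonalization_powr_unique[OF _ U] in \<open>auto simp: unitary_diagonalization_def\<close>)
qed

lemma mpow_carrier: "pos_def m A \<Longrightarrow> mpow A s \<in> carrier_mat m m"
  using pos_def_unitary_diagonalization[of m A]
  by (auto simp: mpow_eq unitary_diagonalization_def)

lemma mpow_add:
  assumes A: "pos_def m A"
  shows "mpow A s * mpow A t = mpow A (s + t)"
proof -
  obtain U d where U: "unitary_diagonalization m A U d"
    using pos_def_unitary_diagonalization[OF A] by blast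
  have Uc: "U \<in> carrier_mat m m" and UU: "mat_adjoint U * U = 1\<^sub>m m" and d: "\<forall>i<m. 0 < d i"
    using U by (auto simp: unitary_diagonalization_def)
  note Uc' = mat_adjoint_carrier[OF Uc]
  define dd where "dd f = mat_diag m (\<lambda>i. complex_of_real (f i))" for f :: "nat \<Rightarrow> real"
  have dd: "dd f \<in> carrier_mat m m" for f by (simp add: dd_def)
  have "mpow A s * mpow A t = U * dd (\<lambda>i. d i powr s) * (mat_adjoint U * U) * dd (\<lambda>i. d i powr t) * mat_adjoint U"
    unfolding mpow_eq[OF A U] dd_def[symmetric]
    using Uc Uc' dd by (simp add: assoc_mult_mat[of _ m m _ m _ m] mult_carrier_mat[of _ m m _ m] left_mult_one_mat[of _ m m])
  also have "\<dots> = U * (dd (\<lambda>i. d i powr s) * dd (\<lambda>i. d i powr t)) * mat_adjoint U"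
    unfolding UU using Uc Uc' dd by (simp add: assoc_mult_mat[of _ m m _ m _ m] mult_carrier_mat[of _ m m _ m] left_mult_one_mat[of _ m m])
  also have "dd (\<lambda>i. d i powr s) * dd (\<lambda>i. d i powr t) = dd (\<lambda>i. d i powr (s + t))"
    unfolding dd_def mat_diag_diag by (simp add: powr_add)
  finally show ?thesis unfolding mpow_eq[OF A U] dd_def .
qed

lemma mpow_0: 
  assumes A: "pos_def m A" shows "mpow A 0 = 1\<^sub>m m"
proof -
  obtain U d where U: "unitary_diagonalization m A U d"
    using pos_def_unitary_diagonalization[OF A] by blast
  have Uc: "U \<in> carrier_mat m m" and UU: "mat_adjoint U * U = 1\<^sub>m m" and d: "\<forall>i<m. 0 < d i"
    using U by (auto simp: unitary_diagonalization_def)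
  have "mat_diag m (\<lambda>i. complex_of_real (d i powr 0)) = 1\<^sub>m m"
    using d by (intro eq_matI) (auto simp: mat_diag_def)
  then show ?thesis
    unfolding mpow_eq[OF A U] using Uc mat_inverse_swap[OF mat_adjoint_carrier[OF Uc] Uc UU] by simp
qed

lemma mpow_1: 
  assumes A: "pos_def m A" shows "mpow A 1 = A"
proof -
  obtain U d where U: "unitary_diagonalization m A U d"
    using pos_def_unitary_diagonalization[OF A] by blast
  have "mat_diag m (\<lambda>i. complex_of_real (d i powr 1)) = mat_diag m (\<lambda>i. complex_of_real (d i))"
    using U by (intro eq_matI) (auto simp: mat_diag_def unitary_diagonalization_def)
  then show ?thesis
    unfolding mpow_eq[OF A U] using U by (simp add: unitary_diagonalization_def)
qed

lemma mpow_minus_inverse: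
  assumes "pos_def m A" shows "mpow A s * mpow A (- s) = 1\<^sub>m m" "mpow A (- s) * mpow A s = 1\<^sub>m m"
  using mpow_0[OF assms] by (simp_all add: mpow_add[OF assms])

lemma pos_def_inverse:
  assumes "pos_def m A" shows "A * mpow A (-1) = 1\<^sub>m m" "mpow A (-1) * A = 1\<^sub>m m"
  using mpow_minus_inverse[OF assms, of 1] by (simp_all add: mpow_1[OF assms])

lemma pos_def_mtrace_nonzero:
  assumes A: "pos_def m A" and m: "m > 0"
  shows "mtrace A \<noteq> 0"
proof -
  have Ac: "A \<in> carrier_mat m m" using A by (simp add: pos_def_def)
  have "Re (A $$ (i, i)) > 0" if i: "i < m" for i
  proof -
    have "(A *\<^sub>v unit_vec m i) \<bullet>c unit_vec m i = (\<Sum>k<m. (A *\<^sub>v unit_vec m i) $ k * cnj (unit_vec m i $ k))"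
      using Ac by (intro cscalar_prod_sum) auto
    also have "\<dots> = (\<Sum>k<m. if k = i then A $$ (i, i) else 0)"
      using i Ac by (intro sum.cong) auto
    also have "\<dots> = A $$ (i, i)" using i by simp
    finally show ?thesis using A i by (auto simp: pos_def_def dest!: bspec[of _ _ "unit_vec m i"])
  qed
  then have "Re (mtrace A) > 0" unfolding mtrace_sum[OF Ac] Re_sum using m by (intro sum_pos) auto
  then show ?thesis by auto
qed

section \<open>Linear independence of irreducible coefficients\<close>

lemma vector_space_complex: "vector_space ((*) :: complex \<Rightarrow> complex \<Rightarrow> complex)"
  by unfold_locales (simp_all add: algebra_simps)

text \<open>The range of P is invariant under A and under its adjoint. The first invariance reads P
  A P = A P, and the adjoint of the second reads P A P = P A.\<close>

lemma projection_commutes: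
  fixes P :: "'j \<Rightarrow> 'j \<Rightarrow> complex"
  assumes herm: "\<And>x y. P x y = cnj (P y x)"
    and inv: "\<And>x z. x \<in> J \<Longrightarrow> z \<in> J \<Longrightarrow> (\<Sum>y\<in>J. P x y * (\<Sum>w\<in>J. A y w * P w z)) = (\<Sum>w\<in>J. A x w * P w z)"
    and inv': "\<And>x z. x \<in> J \<Longrightarrow> z \<in> J \<Longrightarrow>
      (\<Sum>y\<in>J. P x y * (\<Sum>w\<in>J. cnj (A w y) * P w z)) = (\<Sum>w\<in>J. cnj (A w x) * P w z)"
    and x: "x \<in> J" and z: "z \<in> J"
  shows "(\<Sum>w\<in>J. A x w * P w z) = (\<Sum>w\<in>J. P x w * A w z)"
proof -
  have "(\<Sum>w\<in>J. A x w * P w z) = (\<Sum>y\<in>J. P x y * (\<Sum>w\<in>J. A y w * P w z))"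
    using inv[OF x z] by simp
  also have "\<dots> = (\<Sum>w\<in>J. (\<Sum>y\<in>J. P x y * A y w) * P w z)"
    unfolding sum_distrib_left sum_distrib_right by (subst sum.swap) (simp add: mult_ac)
  also have "\<dots> = cnj (\<Sum>w\<in>J. P z w * (\<Sum>y\<in>J. cnj (A y w) * P y x))"
    unfolding cnj_sum complex_cnj_mult complex_cnj_cnj herm[symmetric]
    by (simp add: mult_ac)
  also have "\<dots> = cnj (\<Sum>w\<in>J. cnj (A w z) * P w x)" using inv'[OF z x] by simp
  also have "\<dots> = (\<Sum>w\<in>J. P x w * A w z)"
    unfolding cnj_sum complex_cnj_mult complex_cnj_cnj herm[symmetric]
    by (simp add: mult_ac)
  finally show ?thesis .
qed

lemma sum_triples:
  fixes n :: "'i \<Rightarrow> nat"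
  assumes "finite F"
  shows "(\<Sum>x\<in>(SIGMA \<alpha>:F. {..<n \<alpha>} \<times> {..<n \<alpha>}). g x) = (\<Sum>\<alpha>\<in>F. \<Sum>i<n \<alpha>. \<Sum>j<n \<alpha>. g (\<alpha>, i, j))"
  using assms by (simp add: sum.Sigma sum.cartesian_product split_def)

lemma sum_triples_slice:
  fixes n :: "'i \<Rightarrow> nat"
  assumes "finite F" "\<alpha> \<in> F" "j < n \<alpha>"
    and h: "\<And>\<beta> i l. h (\<beta>, i, l) = (if \<beta> = \<alpha> then if l = j then t i else 0 else 0)"
  shows "(\<Sum>x\<in>(SIGMA \<alpha>:F. {..<n \<alpha>} \<times> {..<n \<alpha>}). h x) = (\<Sum>i<n \<alpha>. t i)"
proof -
  have "(\<Sum>i<n \<beta>. \<Sum>l<n \<beta>. h (\<beta>, i, l)) =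
      (if \<beta> = \<alpha> then \<Sum>i<n \<alpha>. \<Sum>l<n \<alpha>. if l = j then t i else 0 else 0)" for \<beta>
    by (auto simp: h)
  then show ?thesis using assms(1-3) by (simp add: sum_triples)
qed

section \<open>Linear functionals; counit and antipode on coefficients\<close>

context hopf_star_algebra
begin

abbreviation functional :: "('a \<Rightarrow> complex) \<Rightarrow> bool" where
  "functional f \<equiv> Vector_Spaces.linear smul (*) f"

text \<open>Not a sublocale: the simp rule \<open>scale_scale\<close> of an interpretation for \<open>(*)\<close> loops with
  \<open>mult.assoc\<close>.\<close>

lemma functional_pair: "vector_space_pair smul ((*) :: complex \<Rightarrow> complex \<Rightarrow> complex)"
  by (simp add: vector_space_pair_def vector_space_complex vector_space_axioms)

lemma functionalI:
  assumes "\<And>x y. f (x + y) = f x + f y" "\<And>c x. f (smul c x) = c * f x"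
  shows "functional f"
  using assms vector_space_axioms vector_space_complex
  by (simp add: Vector_Spaces.linear_def module_hom_def module_hom_axioms_def module_iff_vector_space)

lemma functional_add: "functional f \<Longrightarrow> f (x + y) = f x + f y"
  and functional_scale: "functional f \<Longrightarrow> f (smul c x) = c * f x"
  by (rule vector_space_pair.linear_add[OF functional_pair] vector_space_pair.linear_scale[OF functional_pair], assumption)+

lemma functional_0: "functional f \<Longrightarrow> f 0 = 0"
  by (rule vector_space_pair.linear_0[OF functional_pair])

lemma functional_sum: "functional f \<Longrightarrow> f (\<Sum>x\<in>A. g x) = (\<Sum>x\<in>A. f (g x))"
  by (rule vector_space_pair.linear_sum[OF functional_pair])

lemma functional_sum_list: "functional f \<Longrightarrow> f (\<Sum>x\<leftarrow>xs. g x) = (\<Sum>x\<leftarrow>xs. f (g x))"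
  by (induction xs) (auto simp: functional_add[of f] functional_0[of f])

text \<open>\<open>tensor_eq\<close> compares tensors only through scalar-valued forms, so
  identities in the algebra are obtained by testing on linear functionals. A functional with value 1
  at x - y exists by extension from the independent set {x - y}.\<close>

lemma functionals_separate:
  assumes "\<And>f. functional f \<Longrightarrow> f x = f y"
  shows "x = y"
proof (rule ccontr)
  assume "x \<noteq> y"
  then have "independent {x - y}" by simp
  from vector_space_pair.linear_independent_extend[OF functional_pair this, of "\<lambda>_. 1"]
  obtain f where f: "functional f" "f (x - y) = 1" by auto
  have "f (x - y) = f x - f y" using f(1) by (rule vector_space_pair.linear_diff[OF functional_pair])
  with f assms[OF f(1)] show False by simp
qed

lemma star_0 [simp]: "star 0 = 0"
proof -
  have "star (0 + 0) = star 0 + star 0" by (rule star_add)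
  then show ?thesis by simp
qed

lemma star_1 [simp]: "star 1 = 1"
  by (metis mult_1_left mult_1_right star_mult star_star)

lemma star_sum: "star (\<Sum>x\<in>A. g x) = (\<Sum>x\<in>A. star (g x))"
  by (induction A rule: infinite_finite_induct) (simp_all add: star_add)

lemma bilinearI:
  assumes "\<And>y. functional (\<lambda>x. f x y)" "\<And>x. functional (\<lambda>y. f x y)"
  shows "bilinear_form smul f"
  unfolding bilinear_form_def by (intro conjI allI assms)

lemma bilinear_product:
  assumes f: "functional f" and g: "functional g"
  shows "bilinear_form smul (\<lambda>x y. f x * g y)"
  by (intro bilinearI functionalI)
    (simp_all add: functional_add[OF f] functional_scale[OF f] functional_add[OF g] functional_scale[OF g] algebra_simps)

lemma corep_cop:
  assumes "unitary_corep m v" "i < m" "j < m" "bilinear_form smul f"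
  shows "(\<Sum>(x, y)\<leftarrow>cop (v $$ (i, j)). f x y) = (\<Sum>k<m. f (v $$ (i, k)) (v $$ (k, j)))"
proof -
  have "(\<Sum>(x, y)\<leftarrow>cop (v $$ (i, j)). f x y) = (\<Sum>k\<leftarrow>[0..<m]. f (v $$ (i, k)) (v $$ (k, j)))"
    using assms by (simp add: unitary_corep_def tensor_eq_def o_def)
  then show ?thesis by (simp add: interv_sum_list_conv_sum_set_nat atLeast0LessThan)
qed

lemma corep_carrier: "unitary_corep m v \<Longrightarrow> v \<in> carrier_mat m m"
  by (simp add: unitary_corep_def)

lemma mstar_carrier: "v \<in> carrier_mat a b \<Longrightarrow> mstar v \<in> carrier_mat b a"
  by (simp add: mstar_def)

lemma mstar_index: "v \<in> carrier_mat a b \<Longrightarrow> i < b \<Longrightarrow> j < a \<Longrightarrow> mstar v $$ (i, j) = star (v $$ (j, i))"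
  by (simp add: mstar_def)

lemma corep_star_mult:
  assumes v: "unitary_corep m v" and ij: "i < m" "j < m"
  shows "(\<Sum>k<m. star (v $$ (k, i)) * v $$ (k, j)) = (if i = j then 1 else 0)"
proof -
  note c = corep_carrier[OF v]
  have "(mstar v * v) $$ (i, j) = (\<Sum>k<m. star (v $$ (k, i)) * v $$ (k, j))"
    unfolding mult_mat_index[OF mstar_carrier[OF c] c ij]
    by (rule sum.cong) (use ij c in \<open>auto simp: mstar_index\<close>)
  then show ?thesis using v ij by (simp add: unitary_corep_def)
qed

lemma corep_mult_star:
  assumes v: "unitary_corep m v" and ij: "i < m" "j < m"
  shows "(\<Sum>k<m. v $$ (i, k) * star (v $$ (j, k))) = (if i = j then 1 else 0)"
proof -
  note c = corep_carrier[OF v]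
  have "(v * mstar v) $$ (i, j) = (\<Sum>k<m. v $$ (i, k) * star (v $$ (j, k)))"
    unfolding mult_mat_index[OF c mstar_carrier[OF c] ij]
    by (rule sum.cong) (use ij c in \<open>auto simp: mstar_index\<close>)
  then show ?thesis using v ij by (simp add: unitary_corep_def)
qed

text \<open>The counit axiom gives v = eps(v) v entrywise, and multiplication by the adjoint of v on
  the right cancels v.\<close>

lemma corep_eps:
  assumes v: "unitary_corep m v" and ij: "i < m" "j < m"
  shows "eps (v $$ (i, j)) = (if i = j then 1 else 0)"
proof -
  have vl: "v $$ (i, l) = (\<Sum>k<m. smul (eps (v $$ (i, k))) (v $$ (k, l)))" if l: "l < m" for l
  proof (rule functionals_separate)
    fix g assume g: "functional g"
    have "g (v $$ (i, l)) = g (\<Sum>(a, b)\<leftarrow>cop (v $$ (i, l)). smul (eps a) b)"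
      by (simp add: counit_left)
    also have "\<dots> = (\<Sum>(a, b)\<leftarrow>cop (v $$ (i, l)). eps a * g b)"
      by (simp add: functional_sum_list[OF g] split_def functional_scale[OF g])
    also have "\<dots> = (\<Sum>k<m. eps (v $$ (i, k)) * g (v $$ (k, l)))"
      by (rule corep_cop[OF v ij(1) l]) (rule bilinear_product[OF eps_linear g])
    also have "\<dots> = g (\<Sum>k<m. smul (eps (v $$ (i, k))) (v $$ (k, l)))"
      by (simp add: functional_sum[OF g] functional_scale[OF g])
    finally show "g (v $$ (i, l)) = g (\<Sum>k<m. smul (eps (v $$ (i, k))) (v $$ (k, l)))" .
  qed
  have "(if i = j then 1 else 0) = (\<Sum>l<m. v $$ (i, l) * star (v $$ (j, l)))"
    by (simp add: corep_mult_star[OF v ij])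
  also have "\<dots> = (\<Sum>l<m. \<Sum>k<m. smul (eps (v $$ (i, k))) (v $$ (k, l) * star (v $$ (j, l))))"
    by (rule sum.cong[OF refl], subst vl) (simp_all add: sum_distrib_right scale_mult_left)
  also have "\<dots> = (\<Sum>k<m. smul (eps (v $$ (i, k))) (\<Sum>l<m. v $$ (k, l) * star (v $$ (j, l))))"
    by (subst sum.swap) (simp add: scale_sum_right)
  also have "\<dots> = (\<Sum>k<m. if k = j then smul (eps (v $$ (i, j))) 1 else 0)"
    by (rule sum.cong) (use ij in \<open>auto simp: corep_mult_star[OF v]\<close>)
  also have "\<dots> = smul (eps (v $$ (i, j))) 1" using ij by simp
  finally have "eps (if i = j then 1 else 0) = eps (smul (eps (v $$ (i, j))) 1)" by simp
  then show ?thesis by (simp add: functional_scale[OF eps_linear] functional_0[OF eps_linear] eps_one split: if_splits)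
qed

lemma functional_mult_right:
  assumes f: "functional f"
  shows "functional (\<lambda>x. f (x * y))"
  by (intro functionalI) (simp_all add: functional_add[OF f] functional_scale[OF f] distrib_right scale_mult_left)

lemma functional_mult_left:
  assumes f: "functional f"
  shows "functional (\<lambda>x. f (y * x))"
  by (intro functionalI) (simp_all add: functional_add[OF f] functional_scale[OF f] distrib_left scale_mult_right)

lemma functional_antipode: "functional f \<Longrightarrow> functional (\<lambda>x. f (S x))"
proof -
  interpret SS: vector_space_pair smul smul by unfold_locales
  assume f: "functional f"
  show ?thesis
    using SS.linear_add[OF antipode_linear] SS.linear_scale[OF antipode_linear]
    by (intro functionalI) (simp_all add: functional_add[OF f] functional_scale[OF f])
qed

text \<open>By the antipode axiom S(v) is a left inverse of the unitary v, so it equals the adjoint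
  of v.\<close>

lemma corep_antipode:
  assumes v: "unitary_corep m v" and ij: "i < m" "j < m"
  shows "S (v $$ (i, j)) = star (v $$ (j, i))"
proof -
  have vl: "(\<Sum>k<m. S (v $$ (i, k)) * v $$ (k, l)) = smul (if i = l then 1 else 0) 1" if l: "l < m" for l
  proof (rule functionals_separate)
    fix g assume g: "functional g"
    have "g (\<Sum>k<m. S (v $$ (i, k)) * v $$ (k, l)) = (\<Sum>k<m. g (S (v $$ (i, k)) * v $$ (k, l)))"
      by (simp add: functional_sum[OF g])
    also have "\<dots> = (\<Sum>(a, b)\<leftarrow>cop (v $$ (i, l)). g (S a * b))"
      by (rule corep_cop[OF v ij(1) l, symmetric])
        (intro bilinearI functional_antipode[OF functional_mult_right[OF g]] functional_mult_left[OF g])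
    also have "\<dots> = g (\<Sum>(a, b)\<leftarrow>cop (v $$ (i, l)). S a * b)"
      by (simp add: functional_sum_list[OF g] split_def)
    finally show "g (\<Sum>k<m. S (v $$ (i, k)) * v $$ (k, l)) = g (smul (if i = l then 1 else 0) 1)"
      by (simp add: antipode_left corep_eps[OF v ij(1) l])
  qed
  have "S (v $$ (i, j)) = (\<Sum>k<m. if k = j then S (v $$ (i, k)) else 0)" using ij by simp
  also have "\<dots> = (\<Sum>k<m. S (v $$ (i, k)) * (\<Sum>l<m. v $$ (k, l) * star (v $$ (j, l))))"
    by (rule sum.cong) (use ij in \<open>auto simp: corep_mult_star[OF v]\<close>)
  also have "\<dots> = (\<Sum>l<m. (\<Sum>k<m. S (v $$ (i, k)) * v $$ (k, l)) * star (v $$ (j, l)))"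
    unfolding sum_distrib_left sum_distrib_right by (subst sum.swap) (simp add: mult.assoc)
  also have "\<dots> = (\<Sum>l<m. if i = l then star (v $$ (j, l)) else 0)"
    by (rule sum.cong) (auto simp: vl scale_mult_left)
  also have "\<dots> = star (v $$ (j, i))" using ij by simp
  finally show ?thesis .
qed

lemma functional_star:
  assumes f: "functional f"
  shows "functional (\<lambda>x. cnj (f (star x)))"
  by (intro functionalI) (simp_all add: functional_add[OF f] functional_scale[OF f] star_add star_scale)

section \<open>Intertwiners and Schur's lemma\<close>

lemma emb_carrier: "T \<in> carrier_mat a b \<Longrightarrow> emb T \<in> carrier_mat a b"
  by (simp add: emb_def)

lemma emb_index: "T \<in> carrier_mat a b \<Longrightarrow> i < a \<Longrightarrow> j < b \<Longrightarrow> emb T $$ (i, j) = smul (T $$ (i, j)) 1"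
  by (simp add: emb_def)

lemma emb_mult:
  assumes A: "A \<in> carrier_mat a b" and B: "B \<in> carrier_mat b c"
  shows "emb (A * B) = emb A * emb B"
proof (rule eq_matI)
  fix i j assume "i < dim_row (emb A * emb B)" "j < dim_col (emb A * emb B)"
  then have ij: "i < a" "j < c" using A B by (auto simp: emb_def)
  have "(emb A * emb B) $$ (i, j) = (\<Sum>k<b. smul (A $$ (i, k) * B $$ (k, j)) 1)"
    unfolding mult_mat_index[OF emb_carrier[OF A] emb_carrier[OF B] ij]
    by (rule sum.cong) (use ij in \<open>auto simp: emb_index[OF A] emb_index[OF B] scale_mult_left\<close>)
  also have "\<dots> = smul ((A * B) $$ (i, j)) 1"
    unfolding mult_mat_index[OF A B ij] by (simp add: scale_sum_left)
  finally show "emb (A * B) $$ (i, j) = (emb A * emb B) $$ (i, j)"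
    using ij by (simp add: emb_index[OF mult_carrier_mat[OF A B]])
qed (use A B in \<open>auto simp: emb_def\<close>)

lemma mstar_emb: "T \<in> carrier_mat a b \<Longrightarrow> mstar (emb T) = emb (mat_adjoint T)"
  by (rule eq_matI) (auto simp: mstar_def emb_def star_scale)

lemma mstar_mult:
  assumes A: "A \<in> carrier_mat a b" and B: "B \<in> carrier_mat b c"
  shows "mstar (A * B) = mstar B * mstar A"
proof (rule eq_matI)
  fix i j assume "i < dim_row (mstar B * mstar A)" "j < dim_col (mstar B * mstar A)"
  then have ij: "i < c" "j < a" using A B by (auto simp: mstar_def)
  show "mstar (A * B) $$ (i, j) = (mstar B * mstar A) $$ (i, j)"
    unfolding mult_mat_index[OF mstar_carrier[OF B] mstar_carrier[OF A] ij]
      mstar_index[OF mult_carrier_mat[OF A B] ij] mult_mat_index[OF A B ij(2,1)] star_sum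
    by (rule sum.cong) (use ij in \<open>auto simp: mstar_index[OF A] mstar_index[OF B] star_mult\<close>)
qed (use A B in \<open>auto simp: mstar_def\<close>)

lemma mstar_mstar: "v \<in> carrier_mat a b \<Longrightarrow> mstar (mstar v) = v"
  by (rule eq_matI) (auto simp: mstar_def star_star)

text \<open>Multiplying T v = w T by \<open>mstar w\<close> on the left and by
  \<open>mstar v\<close> on the right, unitarity gives \<open>mstar w\<close> T = T
  \<open>mstar v\<close>; the claim is the adjoint of this.\<close>

lemma adjoint_intertwiner:
  assumes v: "unitary_corep m v" and w: "unitary_corep k w" and T: "T \<in> carrier_mat k m"
    and int: "emb T * v = w * emb T"
  shows "emb (mat_adjoint T) * w = v * emb (mat_adjoint T)"
proof -
  note vc = corep_carrier[OF v] and wc = corep_carrier[OF w] and Tc = emb_carrier[OF T]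
  note vs = mstar_carrier[OF vc] and ws = mstar_carrier[OF wc]
  have "mstar w * emb T = mstar w * (emb T * (v * mstar v))"
    using v Tc by (simp add: unitary_corep_def)
  also have "\<dots> = mstar w * (emb T * v) * mstar v"
    using vc wc Tc vs ws by (simp add: assoc_mult_mat[of _ _ _ _ m _ m] assoc_mult_mat[of _ k k _ m _ m])
  also have "\<dots> = (mstar w * w) * (emb T * mstar v)"
    unfolding int using vc wc Tc vs ws
    by (simp add: assoc_mult_mat[of _ k k _ m _ m] assoc_mult_mat[of _ k k _ k _ m])
  also have "\<dots> = emb T * mstar v"
    using w Tc vs by (simp add: unitary_corep_def)
  finally have "mstar (mstar w * emb T) = mstar (emb T * mstar v)" by simp
  then show ?thesis
    using mstar_mult[OF ws Tc] mstar_mult[OF Tc vs] mstar_mstar[OF vc] mstar_mstar[OF wc] mstar_emb[OF T]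
    by simp
qed

lemma compose_intertwiners:
  assumes "v \<in> carrier_mat m m" "w \<in> carrier_mat k k" "x \<in> carrier_mat l l"
    "A \<in> carrier_mat k m" "B \<in> carrier_mat l k"
    "emb A * v = w * emb A" "emb B * w = x * emb B"
  shows "emb (B * A) * v = x * emb (B * A)"
proof -
  note c = emb_carrier[OF assms(4)] emb_carrier[OF assms(5)]
  have "emb (B * A) * v = emb B * (emb A * v)"
    unfolding emb_mult[OF assms(5,4)] by (rule assoc_mult_mat[OF c(2,1) assms(1)])
  also have "\<dots> = (emb B * w) * emb A"
    unfolding assms(6) by (rule assoc_mult_mat[OF c(2) assms(2) c(1), symmetric])
  also have "\<dots> = x * emb (B * A)"
    unfolding assms(7) emb_mult[OF assms(5,4)] by (rule assoc_mult_mat[OF assms(3) c(2,1)])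
  finally show ?thesis .
qed

lemma schur_scalar:
  "irreducible_corep m v \<Longrightarrow> T \<in> carrier_mat m m \<Longrightarrow> emb T * v = v * emb T \<Longrightarrow> \<exists>c. T = c \<cdot>\<^sub>m 1\<^sub>m m"
  unfolding irreducible_corep_def by blast

text \<open>T adjoint times T and T times T adjoint are self-intertwiners, hence scalar, with the
  same scalar c. If T is nonzero then so is c, equality of the traces gives m = k, and T is an
  invertible intertwiner, which is excluded.\<close>

lemma schur_inequivalent:
  assumes v: "irreducible_corep m v" and w: "irreducible_corep k w" and T: "T \<in> carrier_mat k m"
    and int: "emb T * v = w * emb T"
    and ne: "\<not> (m = k \<and> equivalent_coreps m v w)"
  shows "T = 0\<^sub>m k m"
proof (rule ccontr)
  assume nz: "T \<noteq> 0\<^sub>m k m"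
  have v': "unitary_corep m v" and w': "unitary_corep k w" using v w by (auto simp: irreducible_corep_def)
  note vc = corep_carrier[OF v'] and wc = corep_carrier[OF w'] and T' = mat_adjoint_carrier[OF T]
  note int' = adjoint_intertwiner[OF v' w' T int]
  have "emb (mat_adjoint T * T) * v = v * emb (mat_adjoint T * T)"
    by (rule compose_intertwiners[OF vc wc vc T T' int int'])
  then obtain c where c: "mat_adjoint T * T = c \<cdot>\<^sub>m 1\<^sub>m m"
    using schur_scalar[OF v mult_carrier_mat[OF T' T]] by blast
  have "emb (T * mat_adjoint T) * w = w * emb (T * mat_adjoint T)"
    by (rule compose_intertwiners[OF wc vc wc T' T int' int])
  then obtain c' where c': "T * mat_adjoint T = c' \<cdot>\<^sub>m 1\<^sub>m k"
    using schur_scalar[OF w mult_carrier_mat[OF T T']] by blast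
  obtain i j where ij: "i < k" "j < m" "T $$ (i, j) \<noteq> 0"
    using nz T by (metis carrier_matD eq_matI index_zero_mat)
  have "(mat_adjoint T * T) $$ (j, j) = complex_of_real (\<Sum>l<k. (cmod (T $$ (l, j)))\<^sup>2)"
    unfolding mult_mat_index[OF T' T ij(2,2)] of_real_sum complex_norm_square
    by (rule sum.cong) (use T ij in auto)
  then have cr: "c = complex_of_real (\<Sum>l<k. (cmod (T $$ (l, j)))\<^sup>2)" using ij by (simp add: c)
  have "0 < (cmod (T $$ (i, j)))\<^sup>2" using ij by simp
  also have "\<dots> \<le> (\<Sum>l<k. (cmod (T $$ (l, j)))\<^sup>2)" using ij by (intro member_le_sum) auto
  finally have c0: "c \<noteq> 0" unfolding cr by (simp del: of_real_sum)
  have "c \<cdot>\<^sub>m T = T * (mat_adjoint T * T)" unfolding c using T by (simp add: mult_smult_distrib[OF T one_carrier_mat])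
  also have "\<dots> = (T * mat_adjoint T) * T" by (rule assoc_mult_mat[OF T T' T, symmetric])
  also have "\<dots> = c' \<cdot>\<^sub>m T" unfolding c' using T by (simp add: mult_smult_assoc_mat[OF one_carrier_mat T])
  finally have "(c \<cdot>\<^sub>m T) $$ (i, j) = (c' \<cdot>\<^sub>m T) $$ (i, j)" by simp
  then have cc: "c = c'" using ij T by simp
  have "mtrace (mat_adjoint T * T) = mtrace (T * mat_adjoint T)" by (rule mtrace_mult_comm[OF T' T])
  then have "c * of_nat m = c * of_nat k" unfolding c c' cc by (simp add: mtrace_def mult.commute)
  then have mk: "m = k" using c0 by simp
  have "T * ((1 / c) \<cdot>\<^sub>m mat_adjoint T) = 1\<^sub>m k"
    unfolding mult_smult_distrib[OF T T'] c' cc[symmetric] using c0 by (intro eq_matI) auto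
  moreover have "((1 / c) \<cdot>\<^sub>m mat_adjoint T) * T = 1\<^sub>m m"
    unfolding mult_smult_assoc_mat[OF T' T] c using c0 by (intro eq_matI) auto
  ultimately have "inverts_mat T ((1 / c) \<cdot>\<^sub>m mat_adjoint T)" "inverts_mat ((1 / c) \<cdot>\<^sub>m mat_adjoint T) T"
    using T by (simp_all add: inverts_mat_def)
  then have "invertible_mat T" unfolding invertible_mat_def square_mat.simps using T mk by blast
  then have "equivalent_coreps m v w" unfolding equivalent_coreps_def using T int mk by blast
  then show False using ne mk by simp
qed

text \<open>\<open>cop\<close> returns some representing list and is linear only up to
  \<open>tensor_eq\<close>; after evaluation in a bilinear form it becomes linear in the usual
  sense.\<close>

lemma functional_conv:
  assumes f: "bilinear_form smul f"
  shows "functional (\<lambda>a. \<Sum>(x, y)\<leftarrow>cop a. f x y)"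
proof (rule functionalI)
  fix a b
  show "(\<Sum>(x, y)\<leftarrow>cop (a + b). f x y) = (\<Sum>(x, y)\<leftarrow>cop a. f x y) + (\<Sum>(x, y)\<leftarrow>cop b. f x y)"
    using cop_add[of a b] f unfolding tensor_eq_def by simp
next
  fix c a
  have fl: "functional (\<lambda>x. f x y)" for y using f unfolding bilinear_form_def by blast
  have "(\<Sum>(x, y)\<leftarrow>cop (smul c a). f x y) = (\<Sum>(x, y)\<leftarrow>map (\<lambda>(a, b). (smul c a, b)) (cop a). f x y)"
    using cop_scale[of c a] f unfolding tensor_eq_def by blast
  also have "\<dots> = (\<Sum>(x, y)\<leftarrow>cop a. c * f x y)"
    by (simp add: o_def split_def functional_scale[OF fl])
  also have "\<dots> = c * (\<Sum>(x, y)\<leftarrow>cop a. f x y)"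
    by (simp add: split_def sum_list_const_mult)
  finally show "(\<Sum>(x, y)\<leftarrow>cop (smul c a). f x y) = c * (\<Sum>(x, y)\<leftarrow>cop a. f x y)" .
qed

lemma smul_one_eq_0: "smul c 1 = 0 \<Longrightarrow> c = 0"
  using functional_scale[OF eps_linear, of c 1] by (simp add: functional_0[OF eps_linear] eps_one)

lemma irreducible_corepD:
  "irreducible_corep m v \<Longrightarrow> unitary_corep m v" "irreducible_corep m v \<Longrightarrow> m > 0"
  unfolding irreducible_corep_def by blast+

text \<open>The relations between the coefficients form a subspace that is invariant under convolution with
  every functional \<open>f\<close>, hence also with \<open>cnj \<circ> f \<circ> star \<circ> S\<close>, so the orthogonal projection onto it
  commutes with all convolutions; by Schur's lemma its blocks are scalar.\<close>

lemma irreducible_coefficients_independent: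
  fixes n :: "'i \<Rightarrow> nat" and u :: "'i \<Rightarrow> 'a mat"
  assumes F: "finite F"
    and irr: "\<And>\<alpha>. \<alpha> \<in> F \<Longrightarrow> irreducible_corep (n \<alpha>) (u \<alpha>)"
    and ineq: "\<And>\<alpha> \<beta>. \<alpha> \<in> F \<Longrightarrow> \<beta> \<in> F \<Longrightarrow> \<alpha> \<noteq> \<beta> \<Longrightarrow>
      \<not> (n \<alpha> = n \<beta> \<and> equivalent_coreps (n \<alpha>) (u \<alpha>) (u \<beta>))"
    and zero: "(\<Sum>\<alpha>\<in>F. \<Sum>i<n \<alpha>. \<Sum>j<n \<alpha>. smul (c \<alpha> i j) (u \<alpha> $$ (i, j))) = 0"
    and mem: "\<alpha> \<in> F" "i < n \<alpha>" "j < n \<alpha>"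
  shows "c \<alpha> i j = 0"
proof -
  define J where "J = (SIGMA \<alpha>:F. {..<n \<alpha>} \<times> {..<n \<alpha>})"
  have J: "finite J" using F by (simp add: J_def)
  have memJ: "(\<alpha>, i, j) \<in> J \<longleftrightarrow> \<alpha> \<in> F \<and> i < n \<alpha> \<and> j < n \<alpha>" for \<alpha> i j by (auto simp: J_def)
  have sumJ: "(\<Sum>x\<in>J. g x) = (\<Sum>\<alpha>\<in>F. \<Sum>i<n \<alpha>. \<Sum>j<n \<alpha>. g (\<alpha>, i, j))" for g :: "_ \<Rightarrow> 'b::comm_monoid_add"
    unfolding J_def by (rule sum_triples[OF F])
  \<comment> \<open>The space of linear relations between the coefficients; the goal is that it is
    zero.\<close>
  define N where "N = {c. (\<forall>x. x \<notin> J \<longrightarrow> c x = 0) \<and> (\<Sum>x\<in>J. smul (c x) (u (fst x) $$ snd x)) = 0}"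
  have N_supp: "c x = 0" if "c \<in> N" "x \<notin> J" for c x
    using that unfolding N_def by blast
  have N_zero: "(\<lambda>_. 0) \<in> N" by (simp add: N_def)
  have N_add: "(\<lambda>x. c x + d x) \<in> N" if "c \<in> N" "d \<in> N" for c d
    using that by (simp add: N_def scale_left_distrib sum.distrib)
  have N_scale: "(\<lambda>x. a * c x) \<in> N" if "c \<in> N" for a c
  proof -
    have "(\<Sum>x\<in>J. smul (a * c x) (u (fst x) $$ snd x)) = smul a (\<Sum>x\<in>J. smul (c x) (u (fst x) $$ snd x))"
      by (simp add: scale_sum_right)
    then show ?thesis using that by (simp add: N_def)
  qed
  have "\<exists>P. (\<forall>i j. P i j = cnj (P j i)) \<and> (\<forall>j. (\<lambda>i. P i j) \<in> N) \<and>
      (\<forall>c\<in>N. \<forall>i. (\<Sum>j\<in>J. P i j * c j) = c i)"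
    by (rule orth_projection_exists[OF J]) (use N_supp N_zero N_add N_scale in blast)+
  then obtain P where herm: "\<And>x y. P x y = cnj (P y x)" and cols: "\<And>y. (\<lambda>x. P x y) \<in> N"
    and fixN: "\<And>c x. c \<in> N \<Longrightarrow> (\<Sum>y\<in>J. P x y * c y) = c x"
    by blast
  have un: "unitary_corep (n \<alpha>) (u \<alpha>)" if "\<alpha> \<in> F" for \<alpha>
    by (rule irreducible_corepD[OF irr[OF that]])
  \<comment> \<open>The matrix, on coefficient vectors, of slicing the first leg of the coproduct
    with f: it sends \<open>u \<alpha> $$ (i, j)\<close> to the sum over k of
    \<open>f (u \<alpha> $$ (i, k))\<close> times \<open>u \<alpha> $$ (k, j)\<close>, so it acts on
    row indices only.\<close>
  define A where "A f = (\<lambda>(\<alpha>, k, j) (\<beta>, i, l :: nat). if \<beta> = \<alpha> then if l = j then f (u \<alpha> $$ (i, k)) else 0 else 0)"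
    for f :: "'a \<Rightarrow> complex"
  have A_col: "(\<Sum>w\<in>J. A f (\<alpha>, k, j) w * g w) = (\<Sum>i<n \<alpha>. f (u \<alpha> $$ (i, k)) * g (\<alpha>, i, j))"
    if "\<alpha> \<in> F" "j < n \<alpha>" for f g \<alpha> k j
    unfolding J_def by (rule sum_triples_slice[where n = n, OF F that]) (auto simp: A_def)
  have A_row: "(\<Sum>w\<in>J. g w * A f w (\<beta>, l, m)) = (\<Sum>k<n \<beta>. g (\<beta>, k, m) * f (u \<beta> $$ (l, k)))"
    if "\<beta> \<in> F" "m < n \<beta>" for f g \<beta> l m
    unfolding J_def by (rule sum_triples_slice[where n = n, OF F that]) (auto simp: A_def)
  have inv: "(\<lambda>x. if x \<in> J then \<Sum>w\<in>J. A f x w * d w else 0) \<in> N" if d: "d \<in> N" and f: "functional f" for d f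
  proof -
    have "(\<Sum>x\<in>J. smul (\<Sum>w\<in>J. A f x w * d w) (u (fst x) $$ snd x)) = 0"
    proof (rule functionals_separate)
      fix g assume g: "functional g"
      note h = functional_conv[OF bilinear_product[OF f g]]
      have "g (\<Sum>x\<in>J. smul (\<Sum>w\<in>J. A f x w * d w) (u (fst x) $$ snd x)) =
          (\<Sum>x\<in>J. (\<Sum>w\<in>J. A f x w * d w) * g (u (fst x) $$ snd x))"
        by (simp add: functional_sum[OF g] functional_scale[OF g])
      also have "\<dots> = (\<Sum>\<alpha>\<in>F. \<Sum>k<n \<alpha>. \<Sum>j<n \<alpha>. \<Sum>i<n \<alpha>. d (\<alpha>, i, j) * (f (u \<alpha> $$ (i, k)) * g (u \<alpha> $$ (k, j))))"
        by (subst sumJ, intro sum.cong refl) (simp add: A_col sum_distrib_right, simp add: mult_ac)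
      also have "\<dots> = (\<Sum>\<alpha>\<in>F. \<Sum>i<n \<alpha>. \<Sum>j<n \<alpha>. d (\<alpha>, i, j) * (\<Sum>k<n \<alpha>. f (u \<alpha> $$ (i, k)) * g (u \<alpha> $$ (k, j))))"
      proof (rule sum.cong[OF refl])
        fix \<alpha>
        have "(\<Sum>k<n \<alpha>. \<Sum>j<n \<alpha>. \<Sum>i<n \<alpha>. d (\<alpha>, i, j) * (f (u \<alpha> $$ (i, k)) * g (u \<alpha> $$ (k, j)))) =
          (\<Sum>k<n \<alpha>. \<Sum>i<n \<alpha>. \<Sum>j<n \<alpha>. d (\<alpha>, i, j) * (f (u \<alpha> $$ (i, k)) * g (u \<alpha> $$ (k, j))))"
          by (rule sum.cong[OF refl]) (rule sum.swap)
        also have "\<dots> = (\<Sum>i<n \<alpha>. \<Sum>k<n \<alpha>. \<Sum>j<n \<alpha>. d (\<alpha>, i, j) * (f (u \<alpha> $$ (i, k)) * g (u \<alpha> $$ (k, j))))"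
          by (rule sum.swap)
        also have "\<dots> = (\<Sum>i<n \<alpha>. \<Sum>j<n \<alpha>. \<Sum>k<n \<alpha>. d (\<alpha>, i, j) * (f (u \<alpha> $$ (i, k)) * g (u \<alpha> $$ (k, j))))"
          by (rule sum.cong[OF refl]) (rule sum.swap)
        finally show "(\<Sum>k<n \<alpha>. \<Sum>j<n \<alpha>. \<Sum>i<n \<alpha>. d (\<alpha>, i, j) * (f (u \<alpha> $$ (i, k)) * g (u \<alpha> $$ (k, j)))) =
          (\<Sum>i<n \<alpha>. \<Sum>j<n \<alpha>. d (\<alpha>, i, j) * (\<Sum>k<n \<alpha>. f (u \<alpha> $$ (i, k)) * g (u \<alpha> $$ (k, j))))"
          by (simp add: sum_distrib_left)
      qed
      also have "\<dots> = (\<Sum>x\<in>J. d x * (\<Sum>(a, b)\<leftarrow>cop (u (fst x) $$ snd x). f a * g b))"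
        unfolding sumJ
        by (intro sum.cong refl) (simp add: corep_cop[OF un _ _ bilinear_product[OF f g]])
      also have "\<dots> = (\<Sum>(a, b)\<leftarrow>cop (\<Sum>x\<in>J. smul (d x) (u (fst x) $$ snd x)). f a * g b)"
        by (simp add: functional_sum[OF h] functional_scale[OF h])
      also have "\<dots> = g 0"
        using d functional_0[OF h] functional_0[OF g] by (simp add: N_def)
      finally show "g (\<Sum>x\<in>J. smul (\<Sum>w\<in>J. A f x w * d w) (u (fst x) $$ snd x)) = g 0" .
    qed
    then show ?thesis by (simp add: N_def)
  qed
  have invP: "(\<Sum>y\<in>J. P x y * (\<Sum>w\<in>J. A f y w * P w z)) = (\<Sum>w\<in>J. A f x w * P w z)"
    if f: "functional f" and x: "x \<in> J" for f x z
  proof -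
    have "(\<Sum>y\<in>J. P x y * (\<Sum>w\<in>J. A f y w * P w z)) =
        (\<Sum>y\<in>J. P x y * (if y \<in> J then \<Sum>w\<in>J. A f y w * P w z else 0))"
      by (rule sum.cong) auto
    also have "\<dots> = (\<Sum>w\<in>J. A f x w * P w z)"
      unfolding fixN[OF inv[OF cols f]] using x by simp
    finally show ?thesis .
  qed
  have invP': "(\<Sum>y\<in>J. P x y * (\<Sum>w\<in>J. cnj (A f w y) * P w z)) = (\<Sum>w\<in>J. cnj (A f w x) * P w z)"
    if f: "functional f" and x: "x \<in> J" for f x z
  proof -
    \<comment> \<open>Applying \<open>star\<close> after \<open>S\<close> exchanges the two indices
      of a coefficient, so \<open>A f'\<close> is the adjoint matrix of \<open>A f\<close>.
      Invariance under it is the second hypothesis of \<open>projection_commutes\<close>.\<close>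
    define f' where "f' = (\<lambda>x. cnj (f (star (S x))))"
    have f': "functional f'" unfolding f'_def by (rule functional_antipode[OF functional_star[OF f]])
    have *: "A f' y w = cnj (A f w y)" if "y \<in> J" "w \<in> J" for y w
      using that by (cases y; cases w)
        (auto simp: A_def f'_def memJ corep_antipode[OF un] star_star)
    show ?thesis using invP[OF f' x, of z] x by (simp add: * cong: sum.cong)
  qed
  have comm: "(\<Sum>i<n \<alpha>. f (u \<alpha> $$ (i, k)) * P (\<alpha>, i, j) (\<beta>, l, m)) =
      (\<Sum>k'<n \<beta>. P (\<alpha>, k, j) (\<beta>, k', m) * f (u \<beta> $$ (l, k')))"
    if f: "functional f" and "\<alpha> \<in> F" "k < n \<alpha>" "j < n \<alpha>" "\<beta> \<in> F" "l < n \<beta>" "m < n \<beta>" for f \<alpha> k j \<beta> l m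
  proof -
    have "(\<Sum>w\<in>J. A f (\<alpha>, k, j) w * P w (\<beta>, l, m)) = (\<Sum>w\<in>J. P (\<alpha>, k, j) w * A f w (\<beta>, l, m))"
      by (rule projection_commutes[OF herm invP[OF f] invP'[OF f]]) (use that in \<open>auto simp: memJ\<close>)
    then show ?thesis using that by (simp add: A_col A_row)
  qed
  \<comment> \<open>Freezing the column indices j and m in the entries of P leaves a matrix in the
    row indices; commutation of P with every \<open>A f\<close> says that this matrix intertwines
    \<open>u \<alpha>\<close> and \<open>u \<beta>\<close>.\<close>
  define T where "T \<alpha> \<beta> j m = mat (n \<beta>) (n \<alpha>) (\<lambda>(l, i). P (\<alpha>, i, j) (\<beta>, l, m))" for \<alpha> \<beta> j m
  have Tc: "T \<alpha> \<beta> j m \<in> carrier_mat (n \<beta>) (n \<alpha>)" for \<alpha> \<beta> j m by (simp add: T_def)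
  have embT: "emb (T \<alpha> \<beta> j m) $$ (l, i) = smul (P (\<alpha>, i, j) (\<beta>, l, m)) 1" if "l < n \<beta>" "i < n \<alpha>" for \<alpha> \<beta> j m l i
    using that unfolding emb_index[OF Tc that] by (simp add: T_def)
  have int: "emb (T \<alpha> \<beta> j m) * u \<alpha> = u \<beta> * emb (T \<alpha> \<beta> j m)"
    if ab: "\<alpha> \<in> F" "j < n \<alpha>" "\<beta> \<in> F" "m < n \<beta>" for \<alpha> \<beta> j m
  proof -
    note e = emb_carrier[OF Tc[of \<alpha> \<beta> j m]]
    note ua = corep_carrier[OF un[OF ab(1)]] and ub = corep_carrier[OF un[OF ab(3)]]
    show ?thesis
    proof (rule eq_matI)
      fix l k assume "l < dim_row (u \<beta> * emb (T \<alpha> \<beta> j m))" "k < dim_col (u \<beta> * emb (T \<alpha> \<beta> j m))"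
      then have lk: "l < n \<beta>" "k < n \<alpha>" using e ub by auto
      have "(\<Sum>i<n \<alpha>. emb (T \<alpha> \<beta> j m) $$ (l, i) * u \<alpha> $$ (i, k)) =
          (\<Sum>i<n \<alpha>. smul (P (\<alpha>, i, j) (\<beta>, l, m)) (u \<alpha> $$ (i, k)))"
        by (rule sum.cong) (use lk in \<open>auto simp: embT scale_mult_left\<close>)
      also have "\<dots> = (\<Sum>k'<n \<beta>. smul (P (\<alpha>, k, j) (\<beta>, k', m)) (u \<beta> $$ (l, k')))"
      proof (rule functionals_separate)
        fix g assume g: "functional g"
        show "g (\<Sum>i<n \<alpha>. smul (P (\<alpha>, i, j) (\<beta>, l, m)) (u \<alpha> $$ (i, k))) =
            g (\<Sum>k'<n \<beta>. smul (P (\<alpha>, k, j) (\<beta>, k', m)) (u \<beta> $$ (l, k')))"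
          using comm[OF g ab(1) lk(2) ab(2,3) lk(1) ab(4)]
          by (simp add: functional_sum[OF g] functional_scale[OF g] mult.commute)
      qed
      also have "\<dots> = (\<Sum>k'<n \<beta>. u \<beta> $$ (l, k') * emb (T \<alpha> \<beta> j m) $$ (k', k))"
        by (rule sum.cong) (use lk in \<open>auto simp: embT scale_mult_right\<close>)
      finally show "(emb (T \<alpha> \<beta> j m) * u \<alpha>) $$ (l, k) = (u \<beta> * emb (T \<alpha> \<beta> j m)) $$ (l, k)"
        unfolding mult_mat_index[OF e ua lk] mult_mat_index[OF ub e lk] .
    qed (use e ua ub in auto)
  qed
  have P0: "P (\<alpha>, i, j) (\<beta>, l, m) = 0" if ne: "\<alpha> \<noteq> \<beta>"
    and ab: "\<alpha> \<in> F" "i < n \<alpha>" "j < n \<alpha>" "\<beta> \<in> F" "l < n \<beta>" "m < n \<beta>" for \<alpha> i j \<beta> l m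
  proof -
    have "T \<alpha> \<beta> j m = 0\<^sub>m (n \<beta>) (n \<alpha>)"
      by (rule schur_inequivalent[OF irr[OF ab(1)] irr[OF ab(4)] Tc int[OF ab(1,3,4,6)] ineq[OF ab(1,4) ne]])
    then have "T \<alpha> \<beta> j m $$ (l, i) = 0" using ab by simp
    then show ?thesis using ab by (simp add: T_def)
  qed
  \<comment> \<open>The scalar to which Schur's lemma reduces \<open>T \<beta> \<beta> j m\<close>;
    any diagonal entry gives it, and dimensions are positive.\<close>
  define lam where "lam \<beta> j m = T \<beta> \<beta> j m $$ (0, 0)" for \<beta> j m
  have Plam: "P (\<beta>, i, j) (\<beta>, l, m) = (if i = l then lam \<beta> j m else 0)"
    if b: "\<beta> \<in> F" "i < n \<beta>" "j < n \<beta>" "l < n \<beta>" "m < n \<beta>" for \<beta> i j l m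
  proof -
    obtain c where c: "T \<beta> \<beta> j m = c \<cdot>\<^sub>m 1\<^sub>m (n \<beta>)"
      using schur_scalar[OF irr[OF b(1)] Tc int[OF b(1,3,1,5)]] by blast
    have "lam \<beta> j m = c" unfolding lam_def c using irreducible_corepD(2)[OF irr[OF b(1)]] by simp
    moreover have "P (\<beta>, i, j) (\<beta>, l, m) = T \<beta> \<beta> j m $$ (l, i)" using b by (simp add: T_def)
    ultimately show ?thesis unfolding c using b by auto
  qed
  have lam_rel: "(\<Sum>j<n \<beta>. smul (lam \<beta> j m) (u \<beta> $$ (l, j))) = 0" if b: "\<beta> \<in> F" "l < n \<beta>" "m < n \<beta>" for \<beta> l m
  proof -
    have "0 = (\<Sum>x\<in>J. smul (P x (\<beta>, l, m)) (u (fst x) $$ snd x))"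
      using cols[of "(\<beta>, l, m)"] by (simp add: N_def)
    also have "\<dots> = (\<Sum>\<alpha>\<in>F. if \<alpha> = \<beta> then \<Sum>i<n \<beta>. if i = l then \<Sum>j<n \<beta>. smul (lam \<beta> j m) (u \<beta> $$ (l, j)) else 0 else 0)"
    proof (subst sumJ, rule sum.cong[OF refl])
      fix \<alpha> assume \<alpha>: "\<alpha> \<in> F"
      have "(\<Sum>j<n \<beta>. smul (P (\<beta>, i, j) (\<beta>, l, m)) (u \<beta> $$ (i, j))) =
          (if i = l then \<Sum>j<n \<beta>. smul (lam \<beta> j m) (u \<beta> $$ (l, j)) else 0)" if "i < n \<beta>" for i
        using b that by (auto simp: Plam)
      then show "(\<Sum>i<n \<alpha>. \<Sum>j<n \<alpha>. smul (P (\<alpha>, i, j) (\<beta>, l, m)) (u (fst (\<alpha>, i, j)) $$ snd (\<alpha>, i, j))) =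
          (if \<alpha> = \<beta> then \<Sum>i<n \<beta>. if i = l then \<Sum>j<n \<beta>. smul (lam \<beta> j m) (u \<beta> $$ (l, j)) else 0 else 0)"
        using b \<alpha> by (auto simp: P0)
    qed
    also have "\<dots> = (\<Sum>j<n \<beta>. smul (lam \<beta> j m) (u \<beta> $$ (l, j)))" using b F by simp
    finally show ?thesis by simp
  qed
  \<comment> \<open>Multiplying the relation \<open>lam_rel\<close> by
    \<open>star (u \<beta> $$ (l, k))\<close> and summing over l isolates
    \<open>lam \<beta> k m\<close> by unitarity.\<close>
  have lam0: "lam \<beta> k m = 0" if b: "\<beta> \<in> F" "k < n \<beta>" "m < n \<beta>" for \<beta> k m
  proof -
    have "0 = (\<Sum>l<n \<beta>. star (u \<beta> $$ (l, k)) * (\<Sum>j<n \<beta>. smul (lam \<beta> j m) (u \<beta> $$ (l, j))))"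
      using b by (simp add: lam_rel)
    also have "\<dots> = (\<Sum>j<n \<beta>. smul (lam \<beta> j m) (\<Sum>l<n \<beta>. star (u \<beta> $$ (l, k)) * u \<beta> $$ (l, j)))"
      unfolding sum_distrib_left scale_mult_right scale_sum_right by (rule sum.swap)
    also have "\<dots> = (\<Sum>j<n \<beta>. if j = k then smul (lam \<beta> k m) 1 else 0)"
      by (rule sum.cong) (use b in \<open>auto simp: corep_star_mult[OF un]\<close>)
    also have "\<dots> = smul (lam \<beta> k m) 1" using b by simp
    finally show ?thesis by (intro smul_one_eq_0) (rule sym)
  qed
  have Pz: "P x y = 0" if "x \<in> J" "y \<in> J" for x y
  proof -
    obtain \<alpha> i j \<beta> l m where xy: "x = (\<alpha>, i, j)" "y = (\<beta>, l, m)" by (cases x; cases y) auto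
    show ?thesis using that unfolding xy memJ
      by (cases "\<alpha> = \<beta>") (auto simp: P0 Plam lam0)
  qed
  \<comment> \<open>P fixes every relation but vanishes on J, so the given relation, extended by
    zero, is trivial.\<close>
  define c' where "c' = (\<lambda>x. if x \<in> J then c (fst x) (fst (snd x)) (snd (snd x)) else 0)"
  have "c' \<in> N"
  proof -
    have "(\<Sum>x\<in>J. smul (c' x) (u (fst x) $$ snd x)) = 0"
      unfolding zero[symmetric] sumJ by (intro sum.cong refl) (auto simp: c'_def memJ)
    then show ?thesis by (simp add: N_def c'_def)
  qed
  have "c \<alpha> i j = c' (\<alpha>, i, j)" using mem by (simp add: c'_def memJ)
  also have "\<dots> = (\<Sum>y\<in>J. P (\<alpha>, i, j) y * c' y)" by (rule fixN[OF \<open>c' \<in> N\<close>, symmetric])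
  also have "\<dots> = 0" using mem by (intro sum.neutral) (auto simp: Pz memJ)
  finally show ?thesis .
qed

end

section \<open>Dual functionals of the coefficients\<close>

lemma sum_mult_lessThan:
  fixes g :: "nat \<Rightarrow> 'b::comm_monoid_add"
  shows "(\<Sum>t<a * b. g t) = (\<Sum>i<a. \<Sum>j<b. g (i * b + j))"
proof -
  have "(\<Sum>t<a * b. g t) = (\<Sum>i<a. sum g {i * b..<i * b + b})"
    by (rule sum.nat_group[symmetric])
  also have "\<dots> = (\<Sum>i<a. \<Sum>j<b. g (i * b + j))"
  proof (rule sum.cong[OF refl])
    fix i
    show "sum g {i * b..<i * b + b} = (\<Sum>j<b. g (i * b + j))"
      by (rule sum.reindex_bij_witness[of _ "\<lambda>j. i * b + j" "\<lambda>t. t - i * b"]) auto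
  qed
  finally show ?thesis .
qed

lemma mult_add_less: "k < a \<Longrightarrow> p < b \<Longrightarrow> k * b + p < a * (b :: nat)"
  by (metis add.commute add_less_mono1 less_le_trans mult.commute mult_Suc Suc_leI mult_le_mono1)

lemma kron_carrier: "A \<in> carrier_mat a b \<Longrightarrow> B \<in> carrier_mat c d \<Longrightarrow> kron A B \<in> carrier_mat (a * c) (b * d)"
  by (simp add: kron_def)

lemma kron_index:
  assumes "A \<in> carrier_mat a b" "B \<in> carrier_mat c d" "k < a" "p < c" "l < b" "q < d"
  shows "kron A B $$ (k * c + p, l * d + q) = A $$ (k, l) * B $$ (p, q)"
  using assms mult_add_less[of k a p c] mult_add_less[of l b q d] by (simp add: kron_def)

lemma kron_mult_index:
  fixes A :: "'b :: ring_1 mat"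
  assumes c: "A \<in> carrier_mat a a" "B \<in> carrier_mat b b" "A' \<in> carrier_mat a a" "B' \<in> carrier_mat b b"
    and i: "k < a" "p < b" "l < a" "q < b"
  shows "(kron A B * kron A' B') $$ (k * b + p, l * b + q) =
    (\<Sum>s<a. \<Sum>t<b. A $$ (k, s) * B $$ (p, t) * (A' $$ (s, l) * B' $$ (t, q)))"
  unfolding mult_mat_index[OF kron_carrier[OF c(1,2)] kron_carrier[OF c(3,4)] mult_add_less[OF i(1,2)] mult_add_less[OF i(3,4)]]
    sum_mult_lessThan
  by (intro sum.cong refl) (use assms in \<open>auto simp: kron_index[OF c(1,2)] kron_index[OF c(3,4)]\<close>)

lemma munit_carrier: "munit m i j \<in> carrier_mat m m" by (simp add: munit_def)

lemma munit_index: "k < m \<Longrightarrow> l < m \<Longrightarrow> munit m i j $$ (k, l) = (if k = i \<and> l = j then 1 else 0)"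
  by (simp add: munit_def)

lemma vnorm_L2: "vnorm v = L2_set (\<lambda>i. cmod (v $ i)) {..<dim_vec v}"
  by (simp add: vnorm_def L2_set_def)

lemma vnorm_mult_le:
  assumes A: "A \<in> carrier_mat m m" and v: "v \<in> carrier_vec m"
  shows "vnorm (A *\<^sub>v v) \<le> (\<Sum>i<m. \<Sum>j<m. cmod (A $$ (i, j))) * vnorm v"
proof -
  have vj: "cmod (v $ j) \<le> vnorm v" if "j < m" for j
    unfolding vnorm_L2 using v that by (intro member_le_L2_set) auto
  have "vnorm (A *\<^sub>v v) \<le> (\<Sum>i<m. cmod ((A *\<^sub>v v) $ i))"
    unfolding vnorm_L2 using A L2_set_le_sum_abs[of "\<lambda>i. cmod ((A *\<^sub>v v) $ i)" "{..<m}"] by simp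
  also have "\<dots> \<le> (\<Sum>i<m. \<Sum>j<m. cmod (A $$ (i, j)) * vnorm v)"
  proof (rule sum_mono)
    fix i assume i: "i \<in> {..<m}"
    have "cmod ((A *\<^sub>v v) $ i) = cmod (\<Sum>j<m. A $$ (i, j) * v $ j)"
      using mult_mat_vec_index_sum[OF A v] i by simp
    also have "\<dots> \<le> (\<Sum>j<m. cmod (A $$ (i, j) * v $ j))" by (rule norm_sum)
    also have "\<dots> \<le> (\<Sum>j<m. cmod (A $$ (i, j)) * vnorm v)"
      by (intro sum_mono) (auto simp: norm_mult intro!: mult_left_mono vj)
    finally show "cmod ((A *\<^sub>v v) $ i) \<le> (\<Sum>j<m. cmod (A $$ (i, j)) * vnorm v)" .
  qed
  finally show ?thesis by (simp add: sum_distrib_right)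
qed

lemma linfD: "x \<in> linf n \<Longrightarrow> x \<alpha> \<in> carrier_mat (n \<alpha>) (n \<alpha>)" by (simp add: linf_def)

lemma c00D: "x \<in> c00 n \<Longrightarrow> x \<alpha> \<in> carrier_mat (n \<alpha>) (n \<alpha>)" by (simp add: c00_def)

text \<open>Covers finitely supported families and also families that are the identity outside a
  finite set; the latter kind occurs as the competing projection in
  \<open>range_proj_sup_cover\<close>.\<close>

lemma linf_bounded:
  assumes c: "\<And>\<alpha>. x \<alpha> \<in> carrier_mat (n \<alpha>) (n \<alpha>)" and F: "finite F"
    and one: "\<And>\<alpha>. \<alpha> \<notin> F \<Longrightarrow> x \<alpha> = 0\<^sub>m (n \<alpha>) (n \<alpha>) \<or> x \<alpha> = 1\<^sub>m (n \<alpha>)"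
  shows "x \<in> linf n"
proof -
  define C where "C \<alpha> = (\<Sum>i<n \<alpha>. \<Sum>j<n \<alpha>. cmod (x \<alpha> $$ (i, j)))" for \<alpha>
  have C0: "C \<alpha> \<ge> 0" for \<alpha> unfolding C_def by (intro sum_nonneg) auto
  have "vnorm (x \<alpha> *\<^sub>v v) \<le> (1 + (\<Sum>\<alpha>\<in>F. C \<alpha>)) * vnorm v" if v: "v \<in> carrier_vec (n \<alpha>)" for \<alpha> v
  proof -
    have nv: "vnorm v \<ge> 0" by (simp add: vnorm_def sum_nonneg)
    have s0: "(\<Sum>\<alpha>\<in>F. C \<alpha>) \<ge> 0" by (intro sum_nonneg C0)
    consider "\<alpha> \<in> F" | "x \<alpha> = 0\<^sub>m (n \<alpha>) (n \<alpha>)" | "x \<alpha> = 1\<^sub>m (n \<alpha>)" using one by blast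
    then show ?thesis
    proof cases
      case 1
      have "vnorm (x \<alpha> *\<^sub>v v) \<le> C \<alpha> * vnorm v" unfolding C_def by (rule vnorm_mult_le[OF c v])
      also have "C \<alpha> \<le> 1 + (\<Sum>\<alpha>\<in>F. C \<alpha>)" using member_le_sum[OF 1, of C] C0 F by fastforce
      finally show ?thesis using nv by (meson mult_right_mono order_trans)
    next
      case 2
      have "vnorm (x \<alpha> *\<^sub>v v) = 0" using 2 v by (simp add: vnorm_def)
      then show ?thesis using nv s0 by simp
    next
      case 3
      have "1 * vnorm v \<le> (1 + (\<Sum>\<alpha>\<in>F. C \<alpha>)) * vnorm v" using nv s0 by (intro mult_right_mono) auto
      then show ?thesis using 3 v by simp
    qed
  qed
  then show ?thesis using c unfolding linf_def by blast
qed

lemma c00_linf: "x \<in> c00 n \<Longrightarrow> x \<in> linf n"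
  by (rule linf_bounded[of _ _ "{\<alpha>. x \<alpha> \<noteq> 0\<^sub>m (n \<alpha>) (n \<alpha>)}"]) (auto simp: c00_def)

lemma c00I:
  "(\<And>\<alpha>. x \<alpha> \<in> carrier_mat (n \<alpha>) (n \<alpha>)) \<Longrightarrow> finite F \<Longrightarrow> (\<And>\<alpha>. \<alpha> \<notin> F \<Longrightarrow> x \<alpha> = 0\<^sub>m (n \<alpha>) (n \<alpha>)) \<Longrightarrow> x \<in> c00 n"
  by (auto simp: c00_def intro: finite_subset[of _ F])

lemma single_c00: "a \<in> carrier_mat (n \<alpha>) (n \<alpha>) \<Longrightarrow> single n \<alpha> a \<in> c00 n"
  by (rule c00I[of _ _ "{\<alpha>}"]) (auto simp: single_def)

lemma single_same [simp]: "single n \<alpha> a \<alpha> = a" by (simp add: single_def)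

section \<open>Coordinates on the span of the irreducible coefficients\<close>

context discrete_quantum_group
begin

lemma u_corep: "unitary_corep (n \<alpha>) (u \<alpha>)" and n_pos: "n \<alpha> > 0"
  using irreducible_corepD[OF u_irreducible] by blast+

lemma rho_carrier: "\<rho> \<alpha> \<in> carrier_mat (n \<alpha>) (n \<alpha>)"
  using rho_pos_def[of \<alpha>] by (simp add: pos_def_def)

abbreviation dimq :: "'i \<Rightarrow> complex" where "dimq \<alpha> \<equiv> mtrace (\<rho> \<alpha>)"

abbreviation rinv :: "'i \<Rightarrow> complex mat" where "rinv \<alpha> \<equiv> mpow (\<rho> \<alpha>) (-1)"

lemma dimq_nonzero: "dimq \<alpha> \<noteq> 0"
  by (rule pos_def_mtrace_nonzero[OF rho_pos_def n_pos])

lemma rinv_carrier: "rinv \<alpha> \<in> carrier_mat (n \<alpha>) (n \<alpha>)" by (rule mpow_carrier[OF rho_pos_def])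

lemma coefficients_independent:
  assumes "finite F" "(\<Sum>\<alpha>\<in>F. \<Sum>i<n \<alpha>. \<Sum>j<n \<alpha>. smul (c \<alpha> i j) (u \<alpha> $$ (i, j))) = 0"
    "\<alpha> \<in> F" "i < n \<alpha>" "j < n \<alpha>"
  shows "c \<alpha> i j = 0"
  by (rule irreducible_coefficients_independent[where F = F and n = n and u = u])
    (use assms u_irreducible u_inequivalent in auto)

definition coeffs :: "'a set" where
  "coeffs = {u \<alpha> $$ (i, j) | \<alpha> i j. i < n \<alpha> \<and> j < n \<alpha>}"

definition triples :: "('i \<times> nat \<times> nat) set" where
  "triples = {(\<alpha>, i, j) | \<alpha> i j. i < n \<alpha> \<and> j < n \<alpha>}"

definition coeff :: "'i \<times> nat \<times> nat \<Rightarrow> 'a" where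
  "coeff = (\<lambda>(\<alpha>, i, j). u \<alpha> $$ (i, j))"

lemma triples_independent:
  assumes K: "finite K" "K \<subseteq> triples" and zero: "(\<Sum>x\<in>K. smul (c x) (coeff x)) = 0" and x: "x \<in> K"
  shows "c x = 0"
proof -
  define F where "F = fst ` K"
  define J where "J = (SIGMA \<alpha>:F. {..<n \<alpha>} \<times> {..<n \<alpha>})"
  have F: "finite F" using K by (simp add: F_def)
  have KJ: "K \<subseteq> J" using K by (force simp: J_def F_def triples_def)
  have J: "finite J" using F by (simp add: J_def)
  have "(\<Sum>\<alpha>\<in>F. \<Sum>i<n \<alpha>. \<Sum>j<n \<alpha>. smul (if (\<alpha>, i, j) \<in> K then c (\<alpha>, i, j) else 0) (u \<alpha> $$ (i, j))) =
      (\<Sum>x\<in>J. smul (if x \<in> K then c x else 0) (coeff x))"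
    unfolding J_def sum_triples[OF F] by (simp add: coeff_def)
  also have "\<dots> = (\<Sum>x\<in>K. smul (c x) (coeff x))"
    by (rule sum.mono_neutral_cong_right[OF J KJ]) auto
  finally have *: "(\<Sum>\<alpha>\<in>F. \<Sum>i<n \<alpha>. \<Sum>j<n \<alpha>. smul (if (\<alpha>, i, j) \<in> K then c (\<alpha>, i, j) else 0) (u \<alpha> $$ (i, j))) = 0"
    using zero by simp
  obtain \<alpha> i j where xe: "x = (\<alpha>, i, j)" by (cases x)
  have "\<alpha> \<in> F" "i < n \<alpha>" "j < n \<alpha>" using x KJ xe by (auto simp: J_def)
  from coefficients_independent[OF F * this] show ?thesis using x xe by simp
qed

text \<open>Independence of the set \<open>coeffs\<close> alone would not exclude that two triples
  name the same element; such a coincidence is itself a nontrivial relation.\<close>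

lemma coeff_inj: "inj_on coeff triples"
proof (rule inj_onI, rule ccontr)
  fix x y assume xy: "x \<in> triples" "y \<in> triples" "coeff x = coeff y" "x \<noteq> y"
  have "(\<Sum>z\<in>{x, y}. smul (if z = x then 1 else -1) (coeff z)) = 0" using xy by simp
  from triples_independent[OF _ _ this, of x] xy show False by simp
qed

lemma coeffs_eq: "coeffs = coeff ` triples"
  by (auto simp: coeffs_def coeff_def triples_def image_def)

lemma coeffs_independent: "independent coeffs"
  unfolding independent_explicit_module
proof (intro allI impI)
  fix t c v assume t: "finite t" "t \<subseteq> coeffs" and zero: "(\<Sum>v\<in>t. smul (c v) v) = 0" and v: "v \<in> t"
  obtain K where K: "K \<subseteq> triples" "t = coeff ` K" using t(2) unfolding coeffs_eq subset_image_iff by blast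
  have inj: "inj_on coeff K" using coeff_inj K(1) by (rule inj_on_subset)
  have "finite K" using t(1) K inj by (simp add: finite_image_iff)
  moreover have "(\<Sum>x\<in>K. smul (c (coeff x)) (coeff x)) = 0"
    using zero unfolding K(2) sum.reindex[OF inj] by simp
  moreover obtain x where "x \<in> K" "v = coeff x" using v K by blast
  ultimately show "c v = 0" using triples_independent[of K "\<lambda>x. c (coeff x)" x] K(1) by simp
qed

text \<open>Dual coordinates of the irreducible coefficients. They are extended to functionals on
  the whole algebra so that they can be composed with multiplication operators; the requirement
  determines them only on \<open>coeff_span\<close>.\<close>

definition chi :: "'i \<Rightarrow> nat \<Rightarrow> nat \<Rightarrow> 'a \<Rightarrow> complex" where
  "chi \<alpha> i j = (SOME f. functional f \<and> (\<forall>\<beta> k l. k < n \<beta> \<longrightarrow> l < n \<beta> \<longrightarrow>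
     f (u \<beta> $$ (k, l)) = (if \<beta> = \<alpha> \<and> k = i \<and> l = j then 1 else 0)))"

lemma chi_ex: "\<exists>f. functional f \<and> (\<forall>\<beta> k l. k < n \<beta> \<longrightarrow> l < n \<beta> \<longrightarrow>
     f (u \<beta> $$ (k, l)) = (if \<beta> = \<alpha> \<and> k = i \<and> l = j then 1 else 0))"
proof -
  define h where "h v = (if inv_into triples coeff v = (\<alpha>, i, j) then 1 else 0 :: complex)" for v
  from vector_space_pair.linear_independent_extend[OF functional_pair coeffs_independent, of h]
  obtain f where f: "functional f" "\<forall>x\<in>coeffs. f x = h x" by blast
  have "f (u \<beta> $$ (k, l)) = (if \<beta> = \<alpha> \<and> k = i \<and> l = j then 1 else 0)" if "k < n \<beta>" "l < n \<beta>" for \<beta> k l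
  proof -
    have t: "(\<beta>, k, l) \<in> triples" using that by (simp add: triples_def)
    have "u \<beta> $$ (k, l) = coeff (\<beta>, k, l)" by (simp add: coeff_def)
    moreover have "inv_into triples coeff (coeff (\<beta>, k, l)) = (\<beta>, k, l)" by (rule inv_into_f_f[OF coeff_inj t])
    ultimately show ?thesis using f(2) t by (auto simp: coeffs_eq h_def)
  qed
  then show ?thesis using f(1) by blast
qed

lemma chi_functional: "functional (chi \<alpha> i j)"
  and chi_u: "k < n \<beta> \<Longrightarrow> l < n \<beta> \<Longrightarrow> chi \<alpha> i j (u \<beta> $$ (k, l)) = (if \<beta> = \<alpha> \<and> k = i \<and> l = j then 1 else 0)"
  using someI_ex[OF chi_ex[of \<alpha> i j]] unfolding chi_def[symmetric] by blast+

definition coeff_span :: "'a set" where "coeff_span = span coeffs"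

lemma u_coeff_span: "i < n \<alpha> \<Longrightarrow> j < n \<alpha> \<Longrightarrow> u \<alpha> $$ (i, j) \<in> coeff_span"
  unfolding coeff_span_def by (rule span_base) (auto simp: coeffs_def)

lemma coeff_span_induct [consumes 1, case_names zero add scale coeff]:
  assumes "w \<in> coeff_span" "Q 0" "\<And>x y. Q x \<Longrightarrow> Q y \<Longrightarrow> Q (x + y)" "\<And>c x. Q x \<Longrightarrow> Q (smul c x)"
    "\<And>\<alpha> i j. i < n \<alpha> \<Longrightarrow> j < n \<alpha> \<Longrightarrow> Q (u \<alpha> $$ (i, j))"
  shows "Q w"
  using assms(1) unfolding coeff_span_def
proof (induction rule: span_induct_alt)
  case base then show ?case by (rule assms(2))
next
  case (step c x y)
  have "Q x" using step(1) assms(5) by (auto simp: coeffs_def)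
  then show ?case by (intro assms(3,4) step(2))
qed

lemma functional_eq_coeff_span:
  assumes f: "functional f" and g: "functional g" and w: "w \<in> coeff_span"
    and eq: "\<And>\<alpha> i j. i < n \<alpha> \<Longrightarrow> j < n \<alpha> \<Longrightarrow> f (u \<alpha> $$ (i, j)) = g (u \<alpha> $$ (i, j))"
  shows "f w = g w"
  using w
  by (induction rule: coeff_span_induct)
    (simp_all add: functional_0[OF f] functional_0[OF g] functional_add[OF f] functional_add[OF g]
      functional_scale[OF f] functional_scale[OF g] eq)

lemma coeff_span_add: "v \<in> coeff_span \<Longrightarrow> w \<in> coeff_span \<Longrightarrow> v + w \<in> coeff_span"
  and coeff_span_scale: "w \<in> coeff_span \<Longrightarrow> smul c w \<in> coeff_span"
  and coeff_span_0: "0 \<in> coeff_span"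
  unfolding coeff_span_def by (auto intro: span_add span_scale span_zero)

lemma coeff_span_sum: "(\<And>x. x \<in> K \<Longrightarrow> g x \<in> coeff_span) \<Longrightarrow> (\<Sum>x\<in>K. g x) \<in> coeff_span"
  unfolding coeff_span_def by (rule span_sum)

definition supp :: "'a \<Rightarrow> 'i set" where
  "supp w = {\<alpha>. \<exists>i<n \<alpha>. \<exists>j<n \<alpha>. chi \<alpha> i j w \<noteq> 0}"

lemma chi_outside_supp: "\<alpha> \<notin> supp w \<Longrightarrow> i < n \<alpha> \<Longrightarrow> j < n \<alpha> \<Longrightarrow> chi \<alpha> i j w = 0"
  by (auto simp: supp_def)

lemma finite_supp: "w \<in> coeff_span \<Longrightarrow> finite (supp w)"
proof (induction rule: coeff_span_induct)
  case zero
  show ?case by (simp add: supp_def functional_0[OF chi_functional])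
next
  case (add x y)
  have "supp (x + y) \<subseteq> supp x \<union> supp y"
    unfolding supp_def by (fastforce simp: functional_add[OF chi_functional])
  then show ?case using add by (meson finite_UnI finite_subset)
next
  case (scale c x)
  have "supp (smul c x) \<subseteq> supp x" by (auto simp: supp_def functional_scale[OF chi_functional])
  then show ?case using scale by (rule finite_subset)
next
  case (coeff \<alpha> i j)
  then have "supp (u \<alpha> $$ (i, j)) \<subseteq> {\<alpha>}" by (auto simp: supp_def chi_u split: if_splits)
  then show ?case by (rule finite_subset) simp
qed

text \<open>The set of irreducibles involved grows under addition, so the induction proves the
  formula for all finite supersets of some finite G. Coordinates outside \<open>supp w\<close>
  vanish, which allows any finite \<open>F\<close> containing the support.\<close>

lemma coeff_span_functional_expand:
  assumes w: "w \<in> coeff_span" and F: "finite F" "supp w \<subseteq> F" and f: "functional f"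
  shows "f w = (\<Sum>\<alpha>\<in>F. \<Sum>i<n \<alpha>. \<Sum>j<n \<alpha>. chi \<alpha> i j w * f (u \<alpha> $$ (i, j)))"
proof -
  have "\<exists>G. finite G \<and> (\<forall>F. finite F \<longrightarrow> G \<subseteq> F \<longrightarrow>
      f w = (\<Sum>\<alpha>\<in>F. \<Sum>i<n \<alpha>. \<Sum>j<n \<alpha>. chi \<alpha> i j w * f (u \<alpha> $$ (i, j))))"
    using w
  proof (induction rule: coeff_span_induct)
    case zero
    show ?case by (rule exI[of _ "{}"]) (simp add: functional_0[OF f] functional_0[OF chi_functional])
  next
    case (add x y)
    then obtain G H where "finite G" "finite H"
      and G: "\<And>F. finite F \<Longrightarrow> G \<subseteq> F \<Longrightarrow> f x = (\<Sum>\<alpha>\<in>F. \<Sum>i<n \<alpha>. \<Sum>j<n \<alpha>. chi \<alpha> i j x * f (u \<alpha> $$ (i, j)))"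
      and H: "\<And>F. finite F \<Longrightarrow> H \<subseteq> F \<Longrightarrow> f y = (\<Sum>\<alpha>\<in>F. \<Sum>i<n \<alpha>. \<Sum>j<n \<alpha>. chi \<alpha> i j y * f (u \<alpha> $$ (i, j)))"
      by blast
    have "f (x + y) = (\<Sum>\<alpha>\<in>F. \<Sum>i<n \<alpha>. \<Sum>j<n \<alpha>. chi \<alpha> i j (x + y) * f (u \<alpha> $$ (i, j)))"
      if "finite F" "G \<union> H \<subseteq> F" for F
      using G[of F] H[of F] that
      by (simp add: functional_add[OF f] functional_add[OF chi_functional] distrib_right sum.distrib)
    then show ?case using \<open>finite G\<close> \<open>finite H\<close> by (intro exI[of _ "G \<union> H"]) simp
  next
    case (scale c x)
    then obtain G where "finite G"
      and G: "\<And>F. finite F \<Longrightarrow> G \<subseteq> F \<Longrightarrow> f x = (\<Sum>\<alpha>\<in>F. \<Sum>i<n \<alpha>. \<Sum>j<n \<alpha>. chi \<alpha> i j x * f (u \<alpha> $$ (i, j)))"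
      by blast
    have "f (smul c x) = (\<Sum>\<alpha>\<in>F. \<Sum>i<n \<alpha>. \<Sum>j<n \<alpha>. chi \<alpha> i j (smul c x) * f (u \<alpha> $$ (i, j)))"
      if "finite F" "G \<subseteq> F" for F
      using G[OF that]
      by (simp add: functional_scale[OF f] functional_scale[OF chi_functional] sum_distrib_left mult.assoc)
    then show ?case using \<open>finite G\<close> by blast
  next
    case (coeff \<alpha> i j)
    have "f (u \<alpha> $$ (i, j)) = (\<Sum>\<beta>\<in>F. \<Sum>k<n \<beta>. \<Sum>l<n \<beta>. chi \<beta> k l (u \<alpha> $$ (i, j)) * f (u \<beta> $$ (k, l)))"
      if "finite F" "{\<alpha>} \<subseteq> F" for F
    proof -
      have "(\<Sum>x\<in>(SIGMA \<beta>:F. {..<n \<beta>} \<times> {..<n \<beta>}). chi (fst x) (fst (snd x)) (snd (snd x)) (u \<alpha> $$ (i, j)) *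
          f (u (fst x) $$ (fst (snd x), snd (snd x)))) = (\<Sum>k<n \<alpha>. if k = i then f (u \<alpha> $$ (i, j)) else 0)"
        by (rule sum_triples_slice[where j = j]) (use that coeff in \<open>auto simp: chi_u\<close>)
      then show ?thesis using that coeff by (simp add: sum_triples)
    qed
    then show ?case by (intro exI[of _ "{\<alpha>}"]) simp
  qed
  then obtain G where G: "finite G" "\<And>F. finite F \<Longrightarrow> G \<subseteq> F \<Longrightarrow>
      f w = (\<Sum>\<alpha>\<in>F. \<Sum>i<n \<alpha>. \<Sum>j<n \<alpha>. chi \<alpha> i j w * f (u \<alpha> $$ (i, j)))" by blast
  have chi0: "chi \<alpha> i j w = 0" if "\<alpha> \<notin> F" "i < n \<alpha>" "j < n \<alpha>" for \<alpha> i j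
    using chi_outside_supp F(2) that by blast
  have "f w = (\<Sum>\<alpha>\<in>F \<union> G. \<Sum>i<n \<alpha>. \<Sum>j<n \<alpha>. chi \<alpha> i j w * f (u \<alpha> $$ (i, j)))"
    by (rule G(2)) (use F G in auto)
  also have "\<dots> = (\<Sum>\<alpha>\<in>F. \<Sum>i<n \<alpha>. \<Sum>j<n \<alpha>. chi \<alpha> i j w * f (u \<alpha> $$ (i, j)))"
    proof (rule sum.mono_neutral_right)
    show "\<forall>\<alpha>\<in>F \<union> G - F. (\<Sum>i<n \<alpha>. \<Sum>j<n \<alpha>. chi \<alpha> i j w * f (u \<alpha> $$ (i, j))) = 0"
      by (auto simp: chi0 intro!: sum.neutral)
  qed (use F G in auto)
  finally show ?thesis .
qed

lemma coeff_span_eqI: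
  assumes "v \<in> coeff_span" "w \<in> coeff_span" "\<And>\<alpha> i j. i < n \<alpha> \<Longrightarrow> j < n \<alpha> \<Longrightarrow> chi \<alpha> i j v = chi \<alpha> i j w"
  shows "v = w"
proof (rule functionals_separate)
  fix f assume f: "functional f"
  let ?F = "supp v \<union> supp w"
  have F: "finite ?F" using finite_supp assms by simp
  show "f v = f w"
    unfolding coeff_span_functional_expand[OF assms(1) F _ f, simplified] coeff_span_functional_expand[OF assms(2) F _ f, simplified]
    by (intro sum.cong refl) (simp add: assms(3))
qed

text \<open>An entry of the block in \<open>D_W\<close> is a product of two coefficients in reversed
  order: the second leg \<gamma> stands on the left. \<open>first_leg\<close> then identifies the
  entries of \<open>D\<close> on matrix units with the structure constants of multiplication,
  finitely many of them nonzero for each product.\<close>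

lemma
  assumes i: "k < n \<beta>" "l < n \<beta>" "p < n \<gamma>" "q < n \<gamma>"
  shows u_mult_u_coeff_span: "u \<gamma> $$ (p, q) * u \<beta> $$ (k, l) \<in> coeff_span"
    and chi_u_mult_u: "i < n \<alpha> \<Longrightarrow> j < n \<alpha> \<Longrightarrow> chi \<alpha> i j (u \<gamma> $$ (p, q) * u \<beta> $$ (k, l)) =
      D (single n \<alpha> (munit (n \<alpha>) i j)) (\<beta>, \<gamma>) $$ (k * n \<gamma> + p, l * n \<gamma> + q)"
proof -
  note uc = corep_carrier[OF u_corep]
  define w where "w = kron (1\<^sub>m (n \<beta>)) (u \<gamma>) * kron (u \<beta>) (1\<^sub>m (n \<gamma>))"
  have wc: "w \<in> carrier_mat (n \<beta> * n \<gamma>) (n \<beta> * n \<gamma>)"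
    unfolding w_def
    by (rule mult_carrier_mat[OF kron_carrier[OF one_carrier_mat uc] kron_carrier[OF uc one_carrier_mat]])
  let ?r = "k * n \<gamma> + p" and ?s = "l * n \<gamma> + q"
  have "w $$ (?r, ?s) = (\<Sum>s<n \<beta>. \<Sum>t<n \<gamma>. 1\<^sub>m (n \<beta>) $$ (k, s) * u \<gamma> $$ (p, t) * (u \<beta> $$ (s, l) * 1\<^sub>m (n \<gamma>) $$ (t, q)))"
    unfolding w_def by (rule kron_mult_index[OF one_carrier_mat uc uc one_carrier_mat i(1,3,2,4)])
  also have "\<dots> = (\<Sum>s<n \<beta>. if s = k then u \<gamma> $$ (p, q) * u \<beta> $$ (k, l) else 0)"
  proof (rule sum.cong[OF refl])
    fix s assume s: "s \<in> {..<n \<beta>}"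
    have "1\<^sub>m (n \<beta>) $$ (k, s) * u \<gamma> $$ (p, t) * (u \<beta> $$ (s, l) * 1\<^sub>m (n \<gamma>) $$ (t, q)) =
        (if t = q then if s = k then u \<gamma> $$ (p, q) * u \<beta> $$ (k, l) else 0 else 0)" if "t < n \<gamma>" for t
      using i s that by auto
    then show "(\<Sum>t<n \<gamma>. 1\<^sub>m (n \<beta>) $$ (k, s) * u \<gamma> $$ (p, t) * (u \<beta> $$ (s, l) * 1\<^sub>m (n \<gamma>) $$ (t, q))) =
        (if s = k then u \<gamma> $$ (p, q) * u \<beta> $$ (k, l) else 0)"
      using i by simp
  qed
  also have "\<dots> = u \<gamma> $$ (p, q) * u \<beta> $$ (k, l)" using i by simp
  finally have we: "w $$ (?r, ?s) = u \<gamma> $$ (p, q) * u \<beta> $$ (k, l)" .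
  define c where "c = (\<lambda>(\<alpha>, i, j). D (single n \<alpha> (munit (n \<alpha>) i j)) (\<beta>, \<gamma>) $$ (?r, ?s))"
  define I where "I = {(\<alpha>, i, j). i < n \<alpha> \<and> j < n \<alpha> \<and> c (\<alpha>, i, j) \<noteq> 0}"
  have rs: "?r < dim_row w" "?s < dim_col w" using wc mult_add_less i by auto
  have fl: "first_leg smul n u (\<lambda>x. D x (\<beta>, \<gamma>)) w" unfolding w_def by (rule D_W)
  have "finite I \<and> w $$ (?r, ?s) = (\<Sum>(\<alpha>, i, j)\<in>I. smul (c (\<alpha>, i, j)) (u \<alpha> $$ (i, j)))"
    unfolding I_def c_def by (rule fl[unfolded first_leg_def Let_def, rule_format, OF rs])
  then have fin: "finite I" and we': "u \<gamma> $$ (p, q) * u \<beta> $$ (k, l) = (\<Sum>x\<in>I. smul (c x) (u (fst x) $$ snd x))"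
    unfolding we by (auto simp: split_def)
  show "u \<gamma> $$ (p, q) * u \<beta> $$ (k, l) \<in> coeff_span"
    unfolding we' by (rule coeff_span_sum) (auto simp: I_def intro!: coeff_span_scale u_coeff_span)
  assume ij: "i < n \<alpha>" "j < n \<alpha>"
  have "chi \<alpha> i j (u \<gamma> $$ (p, q) * u \<beta> $$ (k, l)) = (\<Sum>x\<in>I. if x = (\<alpha>, i, j) then c x else 0)"
    unfolding we' functional_sum[OF chi_functional] functional_scale[OF chi_functional]
    by (rule sum.cong[OF refl]) (auto simp: I_def chi_u split: if_splits)
  also have "\<dots> = c (\<alpha>, i, j)" using fin ij by (auto simp: I_def)
  finally show "chi \<alpha> i j (u \<gamma> $$ (p, q) * u \<beta> $$ (k, l)) =
      D (single n \<alpha> (munit (n \<alpha>) i j)) (\<beta>, \<gamma>) $$ (?r, ?s)" by (simp add: c_def)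
qed

lemma coeff_span_mult:
  assumes v: "v \<in> coeff_span" and w: "w \<in> coeff_span"
  shows "v * w \<in> coeff_span"
  using v
proof (induction rule: coeff_span_induct)
  case (coeff \<gamma> p q)
  show ?case using w
  proof (induction rule: coeff_span_induct)
    case (coeff \<beta> k l)
    then show ?case using u_mult_u_coeff_span \<open>p < n \<gamma>\<close> \<open>q < n \<gamma>\<close> by blast
  qed (simp_all add: distrib_left scale_mult_right coeff_span_add coeff_span_scale coeff_span_0)
qed (simp_all add: distrib_right scale_mult_left coeff_span_add coeff_span_scale coeff_span_0)

end

section \<open>The Fourier transform\<close>

lemma sum4_linear:
  fixes h :: "'t \<Rightarrow> 'b \<Rightarrow> 'c \<Rightarrow> 'd \<Rightarrow> 'e \<Rightarrow> complex"
  shows "finite K \<Longrightarrow> (\<Sum>k\<in>A. \<Sum>p\<in>B. \<Sum>l\<in>C. \<Sum>q\<in>E. (\<Sum>t\<in>K. a t * h t k p l q) * c k p l q) =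
    (\<Sum>t\<in>K. a t * (\<Sum>k\<in>A. \<Sum>p\<in>B. \<Sum>l\<in>C. \<Sum>q\<in>E. h t k p l q * c k p l q))"
  by (induction K rule: finite_induct)
    (simp_all add: distrib_right sum.distrib sum_distrib_left mult.assoc)

lemma sum_weighted_swap:
  fixes X :: "'b \<Rightarrow> 'c \<Rightarrow> 't \<Rightarrow> complex"
  shows "finite K \<Longrightarrow> (\<Sum>\<beta>\<in>G. \<Sum>\<gamma>\<in>H. d \<beta> \<gamma> * (\<Sum>t\<in>K. y t * X \<beta> \<gamma> t)) =
    (\<Sum>t\<in>K. y t * (\<Sum>\<beta>\<in>G. \<Sum>\<gamma>\<in>H. d \<beta> \<gamma> * X \<beta> \<gamma> t))"
proof (induction K rule: finite_induct)
  case (insert t K)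
  have "(\<Sum>\<beta>\<in>G. \<Sum>\<gamma>\<in>H. d \<beta> \<gamma> * (y t * X \<beta> \<gamma> t)) = y t * (\<Sum>\<beta>\<in>G. \<Sum>\<gamma>\<in>H. d \<beta> \<gamma> * X \<beta> \<gamma> t)"
    by (simp add: sum_distrib_left mult_ac)
  then show ?case using insert by (simp add: distrib_left sum.distrib)
qed simp

context discrete_quantum_group
begin

lemma D_linf: "x \<in> linf n \<Longrightarrow> D x \<in> linf (tdim n)"
  and D_add: "x \<in> linf n \<Longrightarrow> y \<in> linf n \<Longrightarrow> D (fadd x y) = fadd (D x) (D y)"
  and D_scale: "x \<in> linf n \<Longrightarrow> D (fscale c x) = fscale c (D x)"
  using D_hom unfolding normal_star_hom_def normal_star_map_def by blast+

lemma D_carrier: "x \<in> linf n \<Longrightarrow> D x (\<beta>, \<gamma>) \<in> carrier_mat (n \<beta> * n \<gamma>) (n \<beta> * n \<gamma>)"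
  using linfD[OF D_linf, of x "(\<beta>, \<gamma>)"] by (simp add: tdim_def)

definition fam_unit :: "'i \<times> nat \<times> nat \<Rightarrow> 'i fam" where
  "fam_unit = (\<lambda>(\<alpha>, i, j). single n \<alpha> (munit (n \<alpha>) i j))"

lemma fam_unit_c00: "fam_unit t \<in> c00 n"
  by (cases t) (simp add: fam_unit_def single_c00 munit_carrier)

definition supported :: "'i set \<Rightarrow> 'i fam \<Rightarrow> bool" where
  "supported F x \<longleftrightarrow> finite F \<and> (\<forall>\<alpha>. x \<alpha> \<in> carrier_mat (n \<alpha>) (n \<alpha>)) \<and> (\<forall>\<alpha>. \<alpha> \<notin> F \<longrightarrow> x \<alpha> = 0\<^sub>m (n \<alpha>) (n \<alpha>))"

lemma supported_c00: "supported F x \<Longrightarrow> x \<in> c00 n"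
  unfolding supported_def by (blast intro: c00I)

lemma c00_supported: "x \<in> c00 n \<Longrightarrow> supported {\<alpha>. x \<alpha> \<noteq> 0\<^sub>m (n \<alpha>) (n \<alpha>)} x"
  by (simp add: supported_def c00_def)

lemma D_expand:
  assumes y: "supported F y" and rs: "r < n \<beta> * n \<gamma>" "s < n \<beta> * n \<gamma>"
  shows "D y (\<beta>, \<gamma>) $$ (r, s) = (\<Sum>t\<in>(SIGMA \<alpha>:F. {..<n \<alpha>} \<times> {..<n \<alpha>}).
    y (fst t) $$ snd t * D (fam_unit t) (\<beta>, \<gamma>) $$ (r, s))"
proof -
  \<comment> \<open>The part of y supported on K. Adding one triple at a time reduces the claim to
    \<open>D_add\<close> and \<open>D_scale\<close>.\<close>
  define part where "part K = (\<lambda>\<alpha>. mat (n \<alpha>) (n \<alpha>) (\<lambda>(i, j). if (\<alpha>, i, j) \<in> K then y \<alpha> $$ (i, j) else 0))" for K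
  have F: "finite F" using y by (simp add: supported_def)
  have part_c00: "part K \<in> c00 n" for K
    by (rule c00I[OF _ F]) (use y in \<open>auto simp: part_def supported_def\<close>)
  have scale_c00: "fscale c (fam_unit t) \<in> c00 n" for c t
    using fam_unit_c00[of t] by (cases t) (auto simp: c00_def fscale_def elim!: finite_subset[rotated])
  have claim: "D (part K) (\<beta>, \<gamma>) $$ (r, s) = (\<Sum>t\<in>K. y (fst t) $$ snd t * D (fam_unit t) (\<beta>, \<gamma>) $$ (r, s))"
    if "finite K" "K \<subseteq> triples" for K
    using that
  proof (induction K rule: finite_induct)
    case empty
    have "part {} = fscale 0 (part {})"
      by (rule ext, rule eq_matI) (auto simp: part_def fscale_def)
    then have "D (part {}) = fscale 0 (D (part {}))"
      using D_scale[OF c00_linf[OF part_c00[of "{}"]], of 0] by simp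
    then have "D (part {}) (\<beta>, \<gamma>) $$ (r, s) = fscale 0 (D (part {})) (\<beta>, \<gamma>) $$ (r, s)" by simp
    also have "\<dots> = 0"
      using D_carrier[OF c00_linf[OF part_c00[of "{}"]], of \<beta> \<gamma>] rs by (simp add: fscale_def)
    finally show ?case by simp
  next
    case (insert t K)
    obtain \<alpha> i j where t: "t = (\<alpha>, i, j)" "i < n \<alpha>" "j < n \<alpha>" using insert.prems by (auto simp: triples_def)
    have "part (insert t K) = fadd (fscale (y (fst t) $$ snd t) (fam_unit t)) (part K)"
      by (rule ext, rule eq_matI)
        (use t insert.hyps(2) in \<open>auto simp: part_def fadd_def fscale_def fam_unit_def single_def munit_def split: if_splits\<close>)
    then have "D (part (insert t K)) = fadd (fscale (y (fst t) $$ snd t) (D (fam_unit t))) (D (part K))"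
      using D_add[OF c00_linf[OF scale_c00] c00_linf[OF part_c00]] D_scale[OF c00_linf[OF fam_unit_c00]] by simp
    then show ?case
      using insert rs D_carrier[OF c00_linf[OF part_c00], of K \<beta> \<gamma>] D_carrier[OF c00_linf[OF fam_unit_c00], of t \<beta> \<gamma>]
      by (simp add: fadd_def fscale_def)
  qed
  have "y = part (SIGMA \<alpha>:F. {..<n \<alpha>} \<times> {..<n \<alpha>})"
  proof (rule ext, rule eq_matI)
    fix \<alpha> i j assume "i < dim_row (part (SIGMA \<alpha>:F. {..<n \<alpha>} \<times> {..<n \<alpha>}) \<alpha>)" "j < dim_col (part (SIGMA \<alpha>:F. {..<n \<alpha>} \<times> {..<n \<alpha>}) \<alpha>)"
    then have ij: "i < n \<alpha>" "j < n \<alpha>" by (auto simp: part_def)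
    then show "y \<alpha> $$ (i, j) = part (SIGMA \<alpha>:F. {..<n \<alpha>} \<times> {..<n \<alpha>}) \<alpha> $$ (i, j)"
      using y by (cases "\<alpha> \<in> F") (auto simp: part_def supported_def)
  next
    fix \<alpha>
    have "y \<alpha> \<in> carrier_mat (n \<alpha>) (n \<alpha>)" using y by (simp add: supported_def)
    then show "dim_row (y \<alpha>) = dim_row (part (SIGMA \<alpha>:F. {..<n \<alpha>} \<times> {..<n \<alpha>}) \<alpha>)"
      "dim_col (y \<alpha>) = dim_col (part (SIGMA \<alpha>:F. {..<n \<alpha>} \<times> {..<n \<alpha>}) \<alpha>)" by (auto simp: part_def)
  qed
  moreover have "D (part (SIGMA \<alpha>:F. {..<n \<alpha>} \<times> {..<n \<alpha>})) (\<beta>, \<gamma>) $$ (r, s) =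
      (\<Sum>t\<in>(SIGMA \<alpha>:F. {..<n \<alpha>} \<times> {..<n \<alpha>}). y (fst t) $$ snd t * D (fam_unit t) (\<beta>, \<gamma>) $$ (r, s))"
    by (rule claim) (use F in \<open>auto simp: triples_def\<close>)
  ultimately show ?thesis by simp
qed

text \<open>The Fourier transform: \<open>y (ft x) = haar (y x)\<close>, where \<open>y \<in> c00\<close> acts on coefficients by
  \<open>u\<^sub>i\<^sub>j \<mapsto> y\<^sub>i\<^sub>j\<close>.\<close>

definition ft :: "'i fam \<Rightarrow> 'a" where
  "ft x = (\<Sum>\<alpha>\<in>{\<alpha>. x \<alpha> \<noteq> 0\<^sub>m (n \<alpha>) (n \<alpha>)}. \<Sum>i<n \<alpha>. \<Sum>j<n \<alpha>. smul (dimq \<alpha> * (x \<alpha> * \<rho> \<alpha>) $$ (j, i)) (u \<alpha> $$ (i, j)))"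

lemma ft_coeff_span: "ft x \<in> coeff_span"
  unfolding ft_def by (intro coeff_span_sum coeff_span_scale u_coeff_span) auto

lemma functional_ft:
  assumes x: "supported F x" and f: "functional f"
  shows "f (ft x) = (\<Sum>\<alpha>\<in>F. \<Sum>i<n \<alpha>. \<Sum>j<n \<alpha>. dimq \<alpha> * (x \<alpha> * \<rho> \<alpha>) $$ (j, i) * f (u \<alpha> $$ (i, j)))"
proof -
  have "f (ft x) = (\<Sum>\<alpha>\<in>{\<alpha>. x \<alpha> \<noteq> 0\<^sub>m (n \<alpha>) (n \<alpha>)}. \<Sum>i<n \<alpha>. \<Sum>j<n \<alpha>. dimq \<alpha> * (x \<alpha> * \<rho> \<alpha>) $$ (j, i) * f (u \<alpha> $$ (i, j)))"
    by (simp add: ft_def functional_sum[OF f] functional_scale[OF f])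
  also have "\<dots> = (\<Sum>\<alpha>\<in>F. \<Sum>i<n \<alpha>. \<Sum>j<n \<alpha>. dimq \<alpha> * (x \<alpha> * \<rho> \<alpha>) $$ (j, i) * f (u \<alpha> $$ (i, j)))"
  proof (rule sum.mono_neutral_left)
    show "\<forall>\<alpha>\<in>F - {\<alpha>. x \<alpha> \<noteq> 0\<^sub>m (n \<alpha>) (n \<alpha>)}. (\<Sum>i<n \<alpha>. \<Sum>j<n \<alpha>. dimq \<alpha> * (x \<alpha> * \<rho> \<alpha>) $$ (j, i) * f (u \<alpha> $$ (i, j))) = 0"
      using rho_carrier by (auto intro!: sum.neutral simp: left_mult_zero_mat[OF rho_carrier] simp del: index_mult_mat)
  qed (use x in \<open>auto simp: supported_def\<close>)
  finally show ?thesis .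
qed

lemma chi_ft:
  assumes x: "x \<in> c00 n" and ij: "i < n \<alpha>" "j < n \<alpha>"
  shows "chi \<alpha> i j (ft x) = dimq \<alpha> * (x \<alpha> * \<rho> \<alpha>) $$ (j, i)"
proof -
  define F where "F = insert \<alpha> {\<alpha>. x \<alpha> \<noteq> 0\<^sub>m (n \<alpha>) (n \<alpha>)}"
  have F: "supported F x" "finite F" "\<alpha> \<in> F" using c00_supported[OF x] by (auto simp: F_def supported_def)
  have "chi \<alpha> i j (ft x) = (\<Sum>t\<in>(SIGMA \<beta>:F. {..<n \<beta>} \<times> {..<n \<beta>}).
      if fst t = \<alpha> then if snd (snd t) = j then if fst (snd t) = i then dimq \<alpha> * (x \<alpha> * \<rho> \<alpha>) $$ (j, i) else 0 else 0 else 0)"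
    unfolding functional_ft[OF F(1) chi_functional] sum_triples[OF F(2)]
    by (intro sum.cong refl) (auto simp: chi_u)
  also have "\<dots> = (\<Sum>k<n \<alpha>. if k = i then dimq \<alpha> * (x \<alpha> * \<rho> \<alpha>) $$ (j, i) else 0)"
    by (rule sum_triples_slice[where j = j]) (use F ij in auto)
  finally show ?thesis using ij by simp
qed

text \<open>Solves \<open>chi_ft\<close> for x: transposing the coordinates, dividing by the quantum
  dimension and multiplying by the inverse of \<rho> undo the factors put in by
  \<open>ft\<close>.\<close>

definition ift :: "'a \<Rightarrow> 'i fam" where
  "ift w = (\<lambda>\<beta>. mat (n \<beta>) (n \<beta>) (\<lambda>(j, i). chi \<beta> i j w / dimq \<beta>) * rinv \<beta>)"

lemma ift_c00: "w \<in> coeff_span \<Longrightarrow> ift w \<in> c00 n"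
proof (rule c00I[of _ _ "supp w"])
  fix \<alpha> assume "\<alpha> \<notin> supp w"
  then have "mat (n \<alpha>) (n \<alpha>) (\<lambda>(j, i). chi \<alpha> i j w / dimq \<alpha>) = 0\<^sub>m (n \<alpha>) (n \<alpha>)"
    by (intro eq_matI) (auto simp: chi_outside_supp)
  then show "ift w \<alpha> = 0\<^sub>m (n \<alpha>) (n \<alpha>)"
    using rinv_carrier[of \<alpha>] by (simp add: ift_def)
qed (use rinv_carrier finite_supp in \<open>auto simp: ift_def intro!: mult_carrier_mat\<close>)

lemma rinv_rho: "rinv \<alpha> * \<rho> \<alpha> = 1\<^sub>m (n \<alpha>)" "\<rho> \<alpha> * rinv \<alpha> = 1\<^sub>m (n \<alpha>)"
  using pos_def_inverse[OF rho_pos_def[of \<alpha>]] by simp_all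

lemma ift_rho: "ift w \<alpha> * \<rho> \<alpha> = mat (n \<alpha>) (n \<alpha>) (\<lambda>(j, i). chi \<alpha> i j w / dimq \<alpha>)"
  unfolding ift_def
  by (subst assoc_mult_mat[OF _ rinv_carrier rho_carrier]) (auto simp: rinv_rho)

lemma ift_rho_index: "i < n \<alpha> \<Longrightarrow> j < n \<alpha> \<Longrightarrow> dimq \<alpha> * (ift w \<alpha> * \<rho> \<alpha>) $$ (j, i) = chi \<alpha> i j w"
  unfolding ift_rho using dimq_nonzero by simp

lemma ft_ift: "w \<in> coeff_span \<Longrightarrow> ft (ift w) = w"
  by (rule coeff_span_eqI[OF ft_coeff_span]) (simp_all add: chi_ft[OF ift_c00] ift_rho_index del: index_mult_mat)

section \<open>Haar weights and the convolution formula\<close>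

lemma haar_eq:
  assumes y: "supported F y" and z: "\<And>\<alpha>. z \<alpha> \<in> carrier_mat (n \<alpha>) (n \<alpha>)"
  shows "haar \<rho> (fmult y z) = (\<Sum>t\<in>(SIGMA \<alpha>:F. {..<n \<alpha>} \<times> {..<n \<alpha>}).
    y (fst t) $$ snd t * (dimq (fst t) * (z (fst t) * \<rho> (fst t)) $$ (snd (snd t), fst (snd t))))"
proof -
  have yc: "y \<alpha> \<in> carrier_mat (n \<alpha>) (n \<alpha>)" for \<alpha> using y by (simp add: supported_def)
  have F: "finite F" using y by (simp add: supported_def)
  have "haar \<rho> (fmult y z) = (\<Sum>\<^sub>\<infinity>\<alpha>\<in>F. dimq \<alpha> * mtrace (\<rho> \<alpha> * (y \<alpha> * z \<alpha>)))"
    unfolding haar_def fmult_def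
  proof (rule infsum_cong_neutral)
    fix \<alpha> assume "\<alpha> \<in> UNIV - F"
    then have "y \<alpha> = 0\<^sub>m (n \<alpha>) (n \<alpha>)" using y by (simp add: supported_def)
    then show "dimq \<alpha> * mtrace (\<rho> \<alpha> * (y \<alpha> * z \<alpha>)) = 0"
      using rho_carrier[of \<alpha>] z[of \<alpha>] by (simp add: mtrace_def)
  qed auto
  also have "\<dots> = (\<Sum>\<alpha>\<in>F. dimq \<alpha> * mtrace (\<rho> \<alpha> * (y \<alpha> * z \<alpha>)))" using F by simp
  also have "\<dots> = (\<Sum>\<alpha>\<in>F. \<Sum>i<n \<alpha>. \<Sum>j<n \<alpha>. y \<alpha> $$ (i, j) * (dimq \<alpha> * (z \<alpha> * \<rho> \<alpha>) $$ (j, i)))"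
  proof (rule sum.cong[OF refl])
    fix \<alpha>
    have "mtrace (\<rho> \<alpha> * (y \<alpha> * z \<alpha>)) = mtrace ((y \<alpha> * z \<alpha>) * \<rho> \<alpha>)"
      by (rule mtrace_mult_comm[OF rho_carrier mult_carrier_mat[OF yc z]])
    also have "(y \<alpha> * z \<alpha>) * \<rho> \<alpha> = y \<alpha> * (z \<alpha> * \<rho> \<alpha>)" by (rule assoc_mult_mat[OF yc z rho_carrier])
    also have "mtrace \<dots> = (\<Sum>i<n \<alpha>. \<Sum>j<n \<alpha>. y \<alpha> $$ (i, j) * (z \<alpha> * \<rho> \<alpha>) $$ (j, i))"
      unfolding mtrace_sum[OF mult_carrier_mat[OF yc mult_carrier_mat[OF z rho_carrier]]]
      by (rule sum.cong[OF refl], rule mult_mat_index[OF yc mult_carrier_mat[OF z rho_carrier]]) auto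
    finally show "dimq \<alpha> * mtrace (\<rho> \<alpha> * (y \<alpha> * z \<alpha>)) =
        (\<Sum>i<n \<alpha>. \<Sum>j<n \<alpha>. y \<alpha> $$ (i, j) * (dimq \<alpha> * (z \<alpha> * \<rho> \<alpha>) $$ (j, i)))"
      by (simp add: sum_distrib_left mult_ac del: index_mult_mat)
  qed
  finally show ?thesis by (simp add: sum_triples[OF F] del: index_mult_mat)
qed

text \<open>The sums are arranged in the index order of a Kronecker product, with P in the first leg
  and x in the second, for comparison with \<open>haar2\<close>.\<close>

lemma functional_ft_mult_ft:
  assumes x: "supported H x" and P: "supported G P" and f: "functional f"
  shows "f (ft x * ft P) = (\<Sum>\<beta>\<in>G. \<Sum>\<gamma>\<in>H. dimq \<beta> * dimq \<gamma> * (\<Sum>k<n \<beta>. \<Sum>p<n \<gamma>. \<Sum>l<n \<beta>. \<Sum>q<n \<gamma>.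
    f (u \<gamma> $$ (p, q) * u \<beta> $$ (k, l)) * ((P \<beta> * \<rho> \<beta>) $$ (l, k) * (x \<gamma> * \<rho> \<gamma>) $$ (q, p))))"
proof -
  define cP where "cP \<beta> l k = (P \<beta> * \<rho> \<beta>) $$ (l, k)" for \<beta> l k
  define cx where "cx \<gamma> q p = (x \<gamma> * \<rho> \<gamma>) $$ (q, p)" for \<gamma> q p
  define g where "g \<beta> \<gamma> k p l q = dimq \<beta> * dimq \<gamma> * (f (u \<gamma> $$ (p, q) * u \<beta> $$ (k, l)) * (cP \<beta> l k * cx \<gamma> q p))" for \<beta> \<gamma> k p l q
  have "f (ft x * ft P) = (\<Sum>\<beta>\<in>G. \<Sum>k<n \<beta>. \<Sum>l<n \<beta>. dimq \<beta> * cP \<beta> l k * f (ft x * u \<beta> $$ (k, l)))"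
    unfolding functional_ft[OF P functional_mult_left[OF f]] cP_def ..
  also have "\<dots> = (\<Sum>\<beta>\<in>G. \<Sum>k<n \<beta>. \<Sum>l<n \<beta>. \<Sum>\<gamma>\<in>H. \<Sum>p<n \<gamma>. \<Sum>q<n \<gamma>. g \<beta> \<gamma> k p l q)"
    unfolding functional_ft[OF x functional_mult_right[OF f]] cx_def[symmetric] sum_distrib_left g_def
    by (simp add: mult_ac)
  also have "\<dots> = (\<Sum>\<beta>\<in>G. \<Sum>\<gamma>\<in>H. \<Sum>k<n \<beta>. \<Sum>p<n \<gamma>. \<Sum>l<n \<beta>. \<Sum>q<n \<gamma>. g \<beta> \<gamma> k p l q)"
  proof (rule sum.cong[OF refl])
    fix \<beta>
    have "(\<Sum>k<n \<beta>. \<Sum>l<n \<beta>. \<Sum>\<gamma>\<in>H. \<Sum>p<n \<gamma>. \<Sum>q<n \<gamma>. g \<beta> \<gamma> k p l q) =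
        (\<Sum>k<n \<beta>. \<Sum>\<gamma>\<in>H. \<Sum>l<n \<beta>. \<Sum>p<n \<gamma>. \<Sum>q<n \<gamma>. g \<beta> \<gamma> k p l q)"
      by (rule sum.cong[OF refl]) (rule sum.swap)
    also have "\<dots> = (\<Sum>\<gamma>\<in>H. \<Sum>k<n \<beta>. \<Sum>l<n \<beta>. \<Sum>p<n \<gamma>. \<Sum>q<n \<gamma>. g \<beta> \<gamma> k p l q)" by (rule sum.swap)
    also have "\<dots> = (\<Sum>\<gamma>\<in>H. \<Sum>k<n \<beta>. \<Sum>p<n \<gamma>. \<Sum>l<n \<beta>. \<Sum>q<n \<gamma>. g \<beta> \<gamma> k p l q)"
      by (intro sum.cong[OF refl]) (rule sum.swap)
    finally show "(\<Sum>k<n \<beta>. \<Sum>l<n \<beta>. \<Sum>\<gamma>\<in>H. \<Sum>p<n \<gamma>. \<Sum>q<n \<gamma>. g \<beta> \<gamma> k p l q) =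
        (\<Sum>\<gamma>\<in>H. \<Sum>k<n \<beta>. \<Sum>p<n \<gamma>. \<Sum>l<n \<beta>. \<Sum>q<n \<gamma>. g \<beta> \<gamma> k p l q)" .
  qed
  finally show ?thesis unfolding g_def cP_def[symmetric] cx_def[symmetric] sum_distrib_left .
qed

text \<open>Convolution is dual to multiplication. The entries of \<open>D y\<close> are the
  structure constants of \<open>chi_u_mult_u\<close> weighted with the entries of y, and the factors
  \<rho> and \<open>dimq\<close> of the tensor square of the Haar weight are exactly those in
  \<open>ft P\<close> and \<open>ft x\<close>. The reversed order of the legs in \<open>D_W\<close>
  makes P the right factor.\<close>

lemma haar2_eq:
  assumes y: "supported F y" and x: "supported H x" and P: "supported G P"
  shows "haar2 \<rho> (fmult (D y) (ftensor P x)) = (\<Sum>t\<in>(SIGMA \<alpha>:F. {..<n \<alpha>} \<times> {..<n \<alpha>}).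
    y (fst t) $$ snd t * chi (fst t) (fst (snd t)) (snd (snd t)) (ft x * ft P))"
proof -
  let ?K = "SIGMA \<alpha>:F. {..<n \<alpha>} \<times> {..<n \<alpha>}"
  have xc: "x \<alpha> \<in> carrier_mat (n \<alpha>) (n \<alpha>)" and Pc: "P \<alpha> \<in> carrier_mat (n \<alpha>) (n \<alpha>)" for \<alpha>
    using x P by (auto simp: supported_def)
  have fin: "finite G" "finite H" "finite ?K" using x P y by (auto simp: supported_def)
  note Dc = D_carrier[OF c00_linf[OF supported_c00[OF y]]]
  define h where "h = (\<lambda>(\<beta>, \<gamma>). dimq \<beta> * dimq \<gamma> * mtrace (kron (\<rho> \<beta>) (\<rho> \<gamma>) * (D y (\<beta>, \<gamma>) * kron (P \<beta>) (x \<gamma>))))"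
  have "haar2 \<rho> (fmult (D y) (ftensor P x)) = (\<Sum>\<^sub>\<infinity>t\<in>UNIV. h t)"
    unfolding haar2_def h_def fmult_def ftensor_def by (simp add: split_def)
  also have "\<dots> = (\<Sum>\<^sub>\<infinity>t\<in>G \<times> H. h t)"
  proof (rule infsum_cong_neutral)
    fix t assume t: "t \<in> UNIV - G \<times> H"
    obtain \<beta> \<gamma> where tt: "t = (\<beta>, \<gamma>)" by (cases t)
    have "P \<beta> = 0\<^sub>m (n \<beta>) (n \<beta>) \<or> x \<gamma> = 0\<^sub>m (n \<gamma>) (n \<gamma>)"
      using t x P unfolding tt supported_def by blast
    then have "kron (P \<beta>) (x \<gamma>) = 0\<^sub>m (n \<beta> * n \<gamma>) (n \<beta> * n \<gamma>)"
    proof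
      assume "P \<beta> = 0\<^sub>m (n \<beta>) (n \<beta>)"
      then show ?thesis using xc[of \<gamma>] by (intro eq_matI) (auto simp: kron_def less_mult_imp_div_less)
    next
      assume "x \<gamma> = 0\<^sub>m (n \<gamma>) (n \<gamma>)"
      then show ?thesis using Pc[of \<beta>] n_pos[of \<gamma>] by (intro eq_matI) (auto simp: kron_def)
    qed
    then show "h t = 0"
      using Dc[of \<beta> \<gamma>] kron_carrier[OF rho_carrier rho_carrier, of \<beta> \<gamma>] by (simp add: h_def tt mtrace_def)
  qed auto
  also have "\<dots> = (\<Sum>\<beta>\<in>G. \<Sum>\<gamma>\<in>H. h (\<beta>, \<gamma>))" using fin by (simp add: sum.cartesian_product)
  also have "\<dots> = (\<Sum>\<beta>\<in>G. \<Sum>\<gamma>\<in>H. dimq \<beta> * dimq \<gamma> * (\<Sum>k<n \<beta>. \<Sum>p<n \<gamma>. \<Sum>l<n \<beta>. \<Sum>q<n \<gamma>.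
     D y (\<beta>, \<gamma>) $$ (k * n \<gamma> + p, l * n \<gamma> + q) * ((P \<beta> * \<rho> \<beta>) $$ (l, k) * (x \<gamma> * \<rho> \<gamma>) $$ (q, p))))"
  proof (intro sum.cong refl)
    fix \<beta> \<gamma>
    let ?N = "n \<beta> * n \<gamma>"
    note kr = kron_carrier[OF rho_carrier rho_carrier, of \<beta> \<gamma>] and kP = kron_carrier[OF Pc xc, of \<beta> \<gamma>]
    have "mtrace (kron (\<rho> \<beta>) (\<rho> \<gamma>) * (D y (\<beta>, \<gamma>) * kron (P \<beta>) (x \<gamma>))) =
        mtrace (D y (\<beta>, \<gamma>) * kron (P \<beta>) (x \<gamma>) * kron (\<rho> \<beta>) (\<rho> \<gamma>))"
      by (rule mtrace_mult_comm[OF kr mult_carrier_mat[OF Dc kP]])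
    also have "\<dots> = mtrace (D y (\<beta>, \<gamma>) * (kron (P \<beta>) (x \<gamma>) * kron (\<rho> \<beta>) (\<rho> \<gamma>)))"
      by (simp only: assoc_mult_mat[OF Dc kP kr])
    also have "\<dots> = (\<Sum>r<?N. \<Sum>s<?N. D y (\<beta>, \<gamma>) $$ (r, s) * (kron (P \<beta>) (x \<gamma>) * kron (\<rho> \<beta>) (\<rho> \<gamma>)) $$ (s, r))"
      unfolding mtrace_sum[OF mult_carrier_mat[OF Dc mult_carrier_mat[OF kP kr]]]
      by (rule sum.cong[OF refl], rule mult_mat_index[OF Dc mult_carrier_mat[OF kP kr]]) auto
    also have "\<dots> = (\<Sum>k<n \<beta>. \<Sum>p<n \<gamma>. \<Sum>l<n \<beta>. \<Sum>q<n \<gamma>. D y (\<beta>, \<gamma>) $$ (k * n \<gamma> + p, l * n \<gamma> + q) *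
        (kron (P \<beta>) (x \<gamma>) * kron (\<rho> \<beta>) (\<rho> \<gamma>)) $$ (l * n \<gamma> + q, k * n \<gamma> + p))"
      unfolding sum_mult_lessThan ..
    also have "\<dots> = (\<Sum>k<n \<beta>. \<Sum>p<n \<gamma>. \<Sum>l<n \<beta>. \<Sum>q<n \<gamma>. D y (\<beta>, \<gamma>) $$ (k * n \<gamma> + p, l * n \<gamma> + q) *
        ((P \<beta> * \<rho> \<beta>) $$ (l, k) * (x \<gamma> * \<rho> \<gamma>) $$ (q, p)))"
    proof (intro sum.cong refl arg_cong2[where f = "(*)"])
      fix k p l q assume "k \<in> {..<n \<beta>}" "p \<in> {..<n \<gamma>}" "l \<in> {..<n \<beta>}" "q \<in> {..<n \<gamma>}"
      then have i: "k < n \<beta>" "p < n \<gamma>" "l < n \<beta>" "q < n \<gamma>" by auto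
      show "(kron (P \<beta>) (x \<gamma>) * kron (\<rho> \<beta>) (\<rho> \<gamma>)) $$ (l * n \<gamma> + q, k * n \<gamma> + p) =
          (P \<beta> * \<rho> \<beta>) $$ (l, k) * (x \<gamma> * \<rho> \<gamma>) $$ (q, p)"
        unfolding kron_mult_index[OF Pc xc rho_carrier rho_carrier i(3,4,1,2)]
          mult_mat_index[OF Pc rho_carrier i(3,1)] mult_mat_index[OF xc rho_carrier i(4,2)] sum_product
        by (simp add: mult_ac)
    qed
    finally show "h (\<beta>, \<gamma>) = dimq \<beta> * dimq \<gamma> * (\<Sum>k<n \<beta>. \<Sum>p<n \<gamma>. \<Sum>l<n \<beta>. \<Sum>q<n \<gamma>.
        D y (\<beta>, \<gamma>) $$ (k * n \<gamma> + p, l * n \<gamma> + q) * ((P \<beta> * \<rho> \<beta>) $$ (l, k) * (x \<gamma> * \<rho> \<gamma>) $$ (q, p)))"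
      by (simp only: h_def split_conv)
  qed
  also have "\<dots> = (\<Sum>\<beta>\<in>G. \<Sum>\<gamma>\<in>H. dimq \<beta> * dimq \<gamma> * (\<Sum>t\<in>?K. y (fst t) $$ snd t *
     (\<Sum>k<n \<beta>. \<Sum>p<n \<gamma>. \<Sum>l<n \<beta>. \<Sum>q<n \<gamma>. chi (fst t) (fst (snd t)) (snd (snd t)) (u \<gamma> $$ (p, q) * u \<beta> $$ (k, l)) *
       ((P \<beta> * \<rho> \<beta>) $$ (l, k) * (x \<gamma> * \<rho> \<gamma>) $$ (q, p)))))"
  proof (intro sum.cong refl arg_cong2[where f = "(*)"], subst sum4_linear[OF fin(3), symmetric], intro sum.cong refl arg_cong2[where f = "(*)"])
    fix \<beta> \<gamma> k p l q assume "k \<in> {..<n \<beta>}" "p \<in> {..<n \<gamma>}" "l \<in> {..<n \<beta>}" "q \<in> {..<n \<gamma>}"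
    then have i: "k < n \<beta>" "p < n \<gamma>" "l < n \<beta>" "q < n \<gamma>" by auto
    show "D y (\<beta>, \<gamma>) $$ (k * n \<gamma> + p, l * n \<gamma> + q) =
        (\<Sum>t\<in>?K. y (fst t) $$ snd t * chi (fst t) (fst (snd t)) (snd (snd t)) (u \<gamma> $$ (p, q) * u \<beta> $$ (k, l)))"
      unfolding D_expand[OF y mult_add_less[OF i(1,2)] mult_add_less[OF i(3,4)]]
      by (rule sum.cong[OF refl]) (auto simp: chi_u_mult_u[OF i(1,3,2,4)] fam_unit_def)
  qed
  also have "\<dots> = (\<Sum>t\<in>?K. y (fst t) $$ snd t * (\<Sum>\<beta>\<in>G. \<Sum>\<gamma>\<in>H. dimq \<beta> * dimq \<gamma> *
     (\<Sum>k<n \<beta>. \<Sum>p<n \<gamma>. \<Sum>l<n \<beta>. \<Sum>q<n \<gamma>. chi (fst t) (fst (snd t)) (snd (snd t)) (u \<gamma> $$ (p, q) * u \<beta> $$ (k, l)) *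
       ((P \<beta> * \<rho> \<beta>) $$ (l, k) * (x \<gamma> * \<rho> \<gamma>) $$ (q, p)))))"
    by (rule sum_weighted_swap[OF fin(3)])
  also have "\<dots> = (\<Sum>t\<in>?K. y (fst t) $$ snd t * chi (fst t) (fst (snd t)) (snd (snd t)) (ft x * ft P))"
    by (simp only: functional_ft_mult_ft[OF x P chi_functional])
  finally show ?thesis .
qed

text \<open>By \<open>haar_eq\<close> and \<open>haar2_eq\<close> both sides of the equation
  defining \<open>conv\<close> are pairings with the entries of y. Uniqueness follows by testing on
  matrix units y, since \<open>dimq\<close> is nonzero and \<rho> is invertible.\<close>

lemma conv_eq:
  assumes P: "P \<in> c00 n" and x: "x \<in> c00 n"
  shows "conv n \<rho> D P x = ift (ft x * ft P)"
proof -
  note sP = c00_supported[OF P] and sx = c00_supported[OF x]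
  have w: "ft x * ft P \<in> coeff_span" by (intro coeff_span_mult ft_coeff_span)
  note z = ift_c00[OF w]
  show ?thesis
    unfolding conv_def
  proof (rule the_equality, intro conjI ballI)
    show "ift (ft x * ft P) \<in> linf n" by (rule c00_linf[OF z])
    fix y assume "y \<in> c00 n"
    note y = c00_supported[OF this]
    show "haar \<rho> (fmult y (ift (ft x * ft P))) = haar2 \<rho> (fmult (D y) (ftensor P x))"
      unfolding haar_eq[OF y c00D[OF z]] haar2_eq[OF y sx sP]
    proof (intro sum.cong refl arg_cong2[where f = "(*)"])
      fix t assume "t \<in> (SIGMA \<alpha>:{\<alpha>. y \<alpha> \<noteq> 0\<^sub>m (n \<alpha>) (n \<alpha>)}. {..<n \<alpha>} \<times> {..<n \<alpha>})"
      then have "fst (snd t) < n (fst t)" "snd (snd t) < n (fst t)" by auto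
      then show "dimq (fst t) * (ift (ft x * ft P) (fst t) * \<rho> (fst t)) $$ (snd (snd t), fst (snd t)) =
          chi (fst t) (fst (snd t)) (snd (snd t)) (ft x * ft P)" by (rule ift_rho_index)
    qed
  next
    fix z' assume z': "z' \<in> linf n \<and> (\<forall>y\<in>c00 n. haar \<rho> (fmult y z') = haar2 \<rho> (fmult (D y) (ftensor P x)))"
    note zc = linfD[OF conjunct1[OF z']]
    show "z' = ift (ft x * ft P)"
    proof
      fix \<alpha>
      have e: "(z' \<alpha> * \<rho> \<alpha>) $$ (j, i) = (ift (ft x * ft P) \<alpha> * \<rho> \<alpha>) $$ (j, i)" if ij: "i < n \<alpha>" "j < n \<alpha>" for i j
      proof -
        let ?y = "single n \<alpha> (munit (n \<alpha>) i j)"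
        have yc: "?y \<in> c00 n" by (intro single_c00 munit_carrier)
        have y: "supported {\<alpha>} ?y" by (auto simp: supported_def single_def munit_carrier)
        have pick: "(\<Sum>t\<in>(SIGMA \<alpha>:{\<alpha>}. {..<n \<alpha>} \<times> {..<n \<alpha>}). ?y (fst t) $$ snd t * g t) = g (\<alpha>, i, j)" for g
        proof -
          have "(\<Sum>t\<in>(SIGMA \<alpha>:{\<alpha>}. {..<n \<alpha>} \<times> {..<n \<alpha>}). ?y (fst t) $$ snd t * g t) =
              (\<Sum>t\<in>(SIGMA \<alpha>:{\<alpha>}. {..<n \<alpha>} \<times> {..<n \<alpha>}). if t = (\<alpha>, i, j) then g t else 0)"
            by (rule sum.cong[OF refl]) (auto simp: munit_index split: if_splits)
          also have "\<dots> = g (\<alpha>, i, j)" using ij by (subst sum.delta) auto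
          finally show ?thesis .
        qed
        have "haar \<rho> (fmult ?y z') = haar2 \<rho> (fmult (D ?y) (ftensor P x))" by (rule bspec[OF conjunct2[OF z'] yc])
        then have "dimq \<alpha> * (z' \<alpha> * \<rho> \<alpha>) $$ (j, i) = chi \<alpha> i j (ft x * ft P)"
          unfolding haar_eq[OF y zc] haar2_eq[OF y sx sP] pick by simp
        then have "dimq \<alpha> * (z' \<alpha> * \<rho> \<alpha>) $$ (j, i) = dimq \<alpha> * (ift (ft x * ft P) \<alpha> * \<rho> \<alpha>) $$ (j, i)"
          by (simp only: ift_rho_index[OF ij])
        then show ?thesis using dimq_nonzero[of \<alpha>] by (simp del: index_mult_mat)
      qed
      have "z' \<alpha> * \<rho> \<alpha> = ift (ft x * ft P) \<alpha> * \<rho> \<alpha>"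
        by (rule eq_matI) (use e zc[of \<alpha>] c00D[OF z, of \<alpha>] rho_carrier[of \<alpha>] in \<open>auto simp del: index_mult_mat(1)\<close>)
      then have "z' \<alpha> * \<rho> \<alpha> * rinv \<alpha> = ift (ft x * ft P) \<alpha> * \<rho> \<alpha> * rinv \<alpha>" by simp
      then show "z' \<alpha> = ift (ft x * ft P) \<alpha>"
        using zc[of \<alpha>] c00D[OF z, of \<alpha>]
        by (simp add: assoc_mult_mat[OF _ rho_carrier rinv_carrier] rinv_rho)
    qed
  qed
qed

lemma conv_c00: "P \<in> c00 n \<Longrightarrow> x \<in> c00 n \<Longrightarrow> conv n \<rho> D P x \<in> c00 n"
  by (simp add: conv_eq ift_c00 coeff_span_mult ft_coeff_span)

lemma ft_conv: "P \<in> c00 n \<Longrightarrow> x \<in> c00 n \<Longrightarrow> ft (conv n \<rho> D P x) = ft x * ft P"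
  by (simp add: conv_eq ft_ift coeff_span_mult ft_coeff_span)

text \<open>The index is shifted because \<open>conv_power\<close> is P both at 0 and at 1.\<close>

lemma conv_power_ft:
  assumes P: "P \<in> c00 n"
  shows "conv_power n \<rho> D P (Suc k) \<in> c00 n \<and> ft (conv_power n \<rho> D P (Suc k)) = ft P ^ Suc k"
proof (induction k)
  case 0
  then show ?case using P by simp
next
  case (Suc k)
  then show ?case using conv_c00[OF P] ft_conv[OF P] by (simp add: power_commutes mult.assoc)
qed

end

section \<open>Blocks of the graph bimodule\<close>

lemma triple_mult_index:
  assumes "A \<in> carrier_mat a b" "B \<in> carrier_mat b c" "C \<in> carrier_mat c d" "p < a" "q < d"
  shows "(A * B * C) $$ (p, q) = (\<Sum>s<b. \<Sum>t<c. A $$ (p, s) * B $$ (s, t) * (C $$ (t, q) :: complex))"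
proof -
  have "(A * B * C) $$ (p, q) = (\<Sum>t<c. (\<Sum>s<b. A $$ (p, s) * B $$ (s, t)) * C $$ (t, q))"
    unfolding mult_mat_index[OF mult_carrier_mat[OF assms(1,2)] assms(3-5)]
    by (intro sum.cong refl) (use assms in \<open>simp add: mult_mat_index[OF assms(1,2)] del: index_mult_mat\<close>)
  then show ?thesis unfolding sum_distrib_right by (subst sum.swap) simp
qed

lemma sandwich_munit_index:
  assumes "A \<in> carrier_mat m m" "B \<in> carrier_mat m m" "k < m" "l < m" "p < m" "q < m"
  shows "(A * munit m k l * B) $$ (p, q) = A $$ (p, k) * (B $$ (l, q) :: complex)"
proof -
  have "(A * munit m k l * B) $$ (p, q) =
      (\<Sum>s<m. \<Sum>t<m. if t = l then if s = k then A $$ (p, k) * B $$ (l, q) else 0 else 0)"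
    unfolding triple_mult_index[OF assms(1) munit_carrier assms(2,5,6)]
    by (intro sum.cong refl) (auto simp: munit_index)
  then show ?thesis using assms by simp
qed

lemma sandwich_inverse:
  fixes M :: "complex mat"
  assumes A: "A \<in> carrier_mat a a" "A' \<in> carrier_mat a a" "A * A' = 1\<^sub>m a"
    and B: "B \<in> carrier_mat b b" "B' \<in> carrier_mat b b" "B' * B = 1\<^sub>m b"
    and M: "M \<in> carrier_mat a b"
  shows "A * (A' * M * B') * B = M"
proof -
  have "A * (A' * M * B') * B = A * (A' * M * B' * B)"
    by (rule assoc_mult_mat[OF A(1) mult_carrier_mat[OF mult_carrier_mat[OF A(2) M] B(2)] B(1)])
  also have "A' * M * B' * B = A' * M"
    unfolding assoc_mult_mat[OF mult_carrier_mat[OF A(2) M] B(2,1)] B(3)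
    by (rule right_mult_one_mat[OF mult_carrier_mat[OF A(2) M]])
  also have "A * (A' * M) = M"
    unfolding assoc_mult_mat[OF A(1,2) M, symmetric] A(3) by (rule left_mult_one_mat[OF M])
  finally show ?thesis .
qed

lemma sum7_reorder:
  "(\<Sum>k\<in>A. \<Sum>l\<in>B. \<Sum>i\<in>C. \<Sum>j\<in>E. \<Sum>a\<in>F. \<Sum>m\<in>G. \<Sum>s\<in>H. f k l i j a m s) =
   (\<Sum>k\<in>A. \<Sum>s\<in>H. \<Sum>a\<in>F. \<Sum>m\<in>G. \<Sum>l\<in>B. \<Sum>i\<in>C. \<Sum>j\<in>E. (f k l i j a m s :: complex))"
  unfolding sum.cartesian_product
  by (rule sum.reindex_bij_witness[of _ "\<lambda>(k, s, a, m, l, i, j). (k, l, i, j, a, m, s)"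
      "\<lambda>(k, l, i, j, a, m, s). (k, s, a, m, l, i, j)"]) auto

text \<open>The format is fixed in advance, so that an empty sum is the zero matrix of the right
  size.\<close>

definition msum :: "nat \<Rightarrow> nat \<Rightarrow> 's set \<Rightarrow> ('s \<Rightarrow> complex mat) \<Rightarrow> complex mat" where
  "msum a b K f = mat a b (\<lambda>ij. \<Sum>s\<in>K. f s $$ ij)"

lemma msum_carrier [simp]: "msum a b K f \<in> carrier_mat a b"
  by (simp add: msum_def)

lemma msum_index [simp]: "i < a \<Longrightarrow> j < b \<Longrightarrow> msum a b K f $$ (i, j) = (\<Sum>s\<in>K. f s $$ (i, j))"
  by (simp add: msum_def)

lemma msum_sandwich:
  assumes A: "A \<in> carrier_mat a' a" and B: "B \<in> carrier_mat b b'" and f: "\<And>s. s \<in> K \<Longrightarrow> f s \<in> carrier_mat a b"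
  shows "A * msum a b K f * B = msum a' b' K (\<lambda>s. A * f s * B)"
proof (rule eq_matI)
  fix p q assume "p < dim_row (msum a' b' K (\<lambda>s. A * f s * B))" "q < dim_col (msum a' b' K (\<lambda>s. A * f s * B))"
  then have pq: "p < a'" "q < b'" by (auto simp: msum_def)
  have "(A * msum a b K f * B) $$ (p, q) = (\<Sum>s<a. \<Sum>t<b. \<Sum>x\<in>K. A $$ (p, s) * f x $$ (s, t) * B $$ (t, q))"
    unfolding triple_mult_index[OF A msum_carrier B pq]
    by (intro sum.cong refl) (simp add: sum_distrib_left sum_distrib_right)
  also have "\<dots> = (\<Sum>s<a. \<Sum>x\<in>K. \<Sum>t<b. A $$ (p, s) * f x $$ (s, t) * B $$ (t, q))"
    by (rule sum.cong[OF refl]) (rule sum.swap)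
  also have "\<dots> = (\<Sum>x\<in>K. \<Sum>s<a. \<Sum>t<b. A $$ (p, s) * f x $$ (s, t) * B $$ (t, q))"
    by (rule sum.swap)
  also have "\<dots> = (\<Sum>x\<in>K. (A * f x * B) $$ (p, q))"
    by (intro sum.cong refl) (simp add: triple_mult_index[OF A f B pq])
  finally show "(A * msum a b K f * B) $$ (p, q) = msum a' b' K (\<lambda>s. A * f s * B) $$ (p, q)"
    using pq by simp
qed (use A B in \<open>auto simp: msum_def\<close>)

context discrete_quantum_group
begin

definition rho_root :: "'i \<Rightarrow> complex mat" where "rho_root \<alpha> = mpow (\<rho> \<alpha>) (1/4)"

definition rho_inv_root :: "'i \<Rightarrow> complex mat" where "rho_inv_root \<alpha> = mpow (\<rho> \<alpha>) (-1/4)"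

lemma rho_root_carrier: "rho_root \<alpha> \<in> carrier_mat (n \<alpha>) (n \<alpha>)" and rho_inv_root_carrier: "rho_inv_root \<alpha> \<in> carrier_mat (n \<alpha>) (n \<alpha>)"
  unfolding rho_root_def rho_inv_root_def by (rule mpow_carrier[OF rho_pos_def])+

lemma rho_root_rho_inv_root: "rho_root \<alpha> * rho_inv_root \<alpha> = 1\<^sub>m (n \<alpha>)" "rho_inv_root \<alpha> * rho_root \<alpha> = 1\<^sub>m (n \<alpha>)"
  using mpow_minus_inverse[OF rho_pos_def[of \<alpha>], of "1/4"] by (simp_all add: rho_root_def rho_inv_root_def)

text \<open>The compressions of \<open>x \<mapsto> x w\<close> from \<open>\<alpha>\<close>-coefficients to \<open>\<beta>\<close>-coefficients, combined over their left
  indices \<open>(k, l)\<close> with weights \<open>X\<close>.\<close>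

definition coeff_block :: "'i \<Rightarrow> 'i \<Rightarrow> 'a \<Rightarrow> complex mat \<Rightarrow> complex mat" where
  "coeff_block \<alpha> \<beta> w X = mat (n \<beta>) (n \<alpha>) (\<lambda>(p, i). \<Sum>k<n \<beta>. \<Sum>l<n \<alpha>. X $$ (k, l) * chi \<beta> k p (u \<alpha> $$ (l, i) * w))"

lemma coeff_block_carrier [simp]: "coeff_block \<alpha> \<beta> w X \<in> carrier_mat (n \<beta>) (n \<alpha>)"
  by (simp add: coeff_block_def)

lemma coeff_block_index: "p < n \<beta> \<Longrightarrow> i < n \<alpha> \<Longrightarrow>
    coeff_block \<alpha> \<beta> w X $$ (p, i) = (\<Sum>k<n \<beta>. \<Sum>l<n \<alpha>. X $$ (k, l) * chi \<beta> k p (u \<alpha> $$ (l, i) * w))"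
  by (simp add: coeff_block_def)

text \<open>Letting X range over all weights makes these spaces insensitive to operations on left
  indices. The two fourth roots are what remains of the modular factors in \<open>graph_Q\<close>
  and \<open>bimod_act\<close>; at an intermediate irreducible they cancel when blocks are
  multiplied.\<close>

definition block_space :: "'i \<Rightarrow> 'i \<Rightarrow> 'a \<Rightarrow> complex mat set" where
  "block_space \<alpha> \<beta> w = (\<lambda>X. rho_root \<beta> * coeff_block \<alpha> \<beta> w X * rho_inv_root \<alpha>) ` carrier_mat (n \<beta>) (n \<alpha>)"

text \<open>Inserting \<open>conv_eq\<close> into \<open>graph_Q\<close> and expanding in entries
  leaves a sum over seven indices. Everything that involves x collects in the weight displayed in
  the conclusion; the rest is a \<open>coeff_block\<close> between two fourth roots.\<close>

lemma bimod_act_graph_Q: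
  assumes P: "P \<in> c00 n" and x: "x \<in> carrier_mat (n \<beta>) (n \<alpha>)"
  shows "bimod_act n \<rho> \<beta> \<alpha> (graph_Q n \<rho> (conv n \<rho> D P) \<beta> \<alpha>) x =
    rho_root \<beta> * coeff_block \<alpha> \<beta> (ft P) ((1 / dimq \<beta>) \<cdot>\<^sub>m (rinv \<beta> * (rho_inv_root \<beta> * x * rho_inv_root \<alpha>) * (rho_inv_root \<alpha> * (rho_inv_root \<alpha> * \<rho> \<alpha>)))) * rho_inv_root \<alpha>"
    (is "_ = rho_root \<beta> * coeff_block \<alpha> \<beta> (ft P) ?X * rho_inv_root \<alpha>")
proof -
  define Y where "Y = rho_inv_root \<beta> * x * rho_inv_root \<alpha>"
  have Yc: "Y \<in> carrier_mat (n \<beta>) (n \<alpha>)"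
    unfolding Y_def by (rule mult_carrier_mat[OF mult_carrier_mat[OF rho_inv_root_carrier x] rho_inv_root_carrier])
  define K where "K = rho_inv_root \<alpha> * \<rho> \<alpha>"
  have Kc: "K \<in> carrier_mat (n \<alpha>) (n \<alpha>)"
    unfolding K_def by (rule mult_carrier_mat[OF rho_inv_root_carrier rho_carrier])
  define c where "c l' k m i = chi \<beta> l' k (u \<alpha> $$ (m, i) * ft P)" for l' k m i
  define M where "M i j = rho_inv_root \<alpha> * munit (n \<alpha>) i j * rho_inv_root \<alpha>" for i j
  have Mc: "M i j \<in> carrier_mat (n \<alpha>) (n \<alpha>)" for i j
    unfolding M_def by (rule mult_carrier_mat[OF mult_carrier_mat[OF rho_inv_root_carrier munit_carrier] rho_inv_root_carrier])
  define z where "z i j = conv n \<rho> D P (single n \<alpha> (M i j)) \<beta>" for i j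
  have zc: "z i j \<in> carrier_mat (n \<beta>) (n \<beta>)" for i j
    unfolding z_def by (rule c00D[OF conv_c00[OF P single_c00[where n = n, OF Mc]]])
  have z_index: "z t j $$ (k, l) =
      (\<Sum>l'<n \<beta>. \<Sum>m<n \<alpha>. \<Sum>s<n \<alpha>. dimq \<alpha> * (1 / dimq \<beta>) * rinv \<beta> $$ (l', l) * rho_inv_root \<alpha> $$ (s, t) * K $$ (j, m) * c l' k m s)"
    if kl: "k < n \<beta>" "l < n \<beta>" and tj: "t < n \<alpha>" "j < n \<alpha>" for k l t j
  proof -
    have sup: "supported {\<alpha>} (single n \<alpha> (M t j))" using Mc[of t j] by (auto simp: supported_def single_def)
    have MK: "(M t j * \<rho> \<alpha>) $$ (s, m) = rho_inv_root \<alpha> $$ (s, t) * K $$ (j, m)" if "s < n \<alpha>" "m < n \<alpha>" for s m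
    proof -
      have "M t j * \<rho> \<alpha> = rho_inv_root \<alpha> * munit (n \<alpha>) t j * K"
        unfolding M_def K_def
        by (rule assoc_mult_mat[OF mult_carrier_mat[OF rho_inv_root_carrier munit_carrier] rho_inv_root_carrier rho_carrier])
      then show ?thesis
        using that tj by (simp add: sandwich_munit_index[OF rho_inv_root_carrier Kc] del: index_mult_mat)
    qed
    have chi_eq: "chi \<beta> l' k (ft (single n \<alpha> (M t j)) * ft P) =
        (\<Sum>m<n \<alpha>. \<Sum>s<n \<alpha>. dimq \<alpha> * (rho_inv_root \<alpha> $$ (s, t) * K $$ (j, m)) * c l' k m s)" for l'
      unfolding functional_ft[OF sup functional_mult_right[OF chi_functional]]
      by (simp add: MK c_def del: index_mult_mat)
    have "z t j $$ (k, l) = (\<Sum>l'<n \<beta>. mat (n \<beta>) (n \<beta>)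
        (\<lambda>(j', i). chi \<beta> i j' (ft (single n \<alpha> (M t j)) * ft P) / dimq \<beta>) $$ (k, l') * rinv \<beta> $$ (l', l))"
      unfolding z_def conv_eq[OF P single_c00[where n = n, OF Mc]] ift_def
      by (rule mult_mat_index[OF _ rinv_carrier kl]) simp
    also have "\<dots> = (\<Sum>l'<n \<beta>. chi \<beta> l' k (ft (single n \<alpha> (M t j)) * ft P) / dimq \<beta> * rinv \<beta> $$ (l', l))"
      by (rule sum.cong[OF refl]) (use kl in auto)
    finally show ?thesis
      unfolding chi_eq sum_distrib_right sum_divide_distrib by (simp add: mult_ac)
  qed
  define Q where "Q = graph_Q n \<rho> (conv n \<rho> D P) \<beta> \<alpha>"
  have Q_index: "Q $$ (k * n \<alpha> + i, l * n \<alpha> + j) =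
      1 / dimq \<alpha> * (\<Sum>i'<n \<alpha>. \<Sum>j'<n \<alpha>. z i' j' $$ (k, l) * (rho_inv_root \<alpha> $$ (i, j') * rho_inv_root \<alpha> $$ (i', j)))"
    if "k < n \<beta>" "l < n \<beta>" "i < n \<alpha>" "j < n \<alpha>" for k l i j
  proof -
    have "Q $$ (k * n \<alpha> + i, l * n \<alpha> + j) = 1 / dimq \<alpha> * (\<Sum>i'<n \<alpha>. \<Sum>j'<n \<alpha>.
        kron (z i' j') (M j' i') $$ (k * n \<alpha> + i, l * n \<alpha> + j))"
      unfolding Q_def graph_Q_def Let_def rho_inv_root_def[symmetric] using that mult_add_less[of k "n \<beta>" i "n \<alpha>"] mult_add_less[of l "n \<beta>" j "n \<alpha>"]
      by (simp add: z_def M_def)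
    also have "\<dots> = 1 / dimq \<alpha> * (\<Sum>i'<n \<alpha>. \<Sum>j'<n \<alpha>. z i' j' $$ (k, l) * M j' i' $$ (i, j))"
      using that by (simp add: kron_index[OF zc Mc])
    also have "\<dots> = 1 / dimq \<alpha> * (\<Sum>i'<n \<alpha>. \<Sum>j'<n \<alpha>. z i' j' $$ (k, l) * (rho_inv_root \<alpha> $$ (i, j') * rho_inv_root \<alpha> $$ (i', j)))"
      using that by (simp add: M_def sandwich_munit_index[OF rho_inv_root_carrier rho_inv_root_carrier] del: index_mult_mat)
    finally show ?thesis .
  qed
  have trip: "((rho_root \<beta> * munit (n \<beta>) k l * rho_inv_root \<beta>) * x * (rho_inv_root \<alpha> * munit (n \<alpha>) i j * rho_root \<alpha>)) $$ (p, t) =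
      rho_root \<beta> $$ (p, k) * Y $$ (l, i) * rho_root \<alpha> $$ (j, t)"
    if "k < n \<beta>" "l < n \<beta>" "i < n \<alpha>" "j < n \<alpha>" "p < n \<beta>" "t < n \<alpha>" for k l i j p t
  proof -
    note c1 = mult_carrier_mat[OF mult_carrier_mat[OF rho_root_carrier munit_carrier] rho_inv_root_carrier, of \<beta> k l]
    note c2 = mult_carrier_mat[OF mult_carrier_mat[OF rho_inv_root_carrier munit_carrier] rho_root_carrier, of \<alpha> i j]
    have "((rho_root \<beta> * munit (n \<beta>) k l * rho_inv_root \<beta>) * x * (rho_inv_root \<alpha> * munit (n \<alpha>) i j * rho_root \<alpha>)) $$ (p, t) =
        (\<Sum>a<n \<beta>. \<Sum>b<n \<alpha>. rho_root \<beta> $$ (p, k) * (rho_inv_root \<beta> $$ (l, a) * x $$ (a, b) * rho_inv_root \<alpha> $$ (b, i)) * rho_root \<alpha> $$ (j, t))"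
      unfolding triple_mult_index[OF c1 x c2 that(5,6)]
      by (intro sum.cong refl)
        (use that in \<open>simp add: sandwich_munit_index[OF rho_root_carrier rho_inv_root_carrier] sandwich_munit_index[OF rho_inv_root_carrier rho_root_carrier] del: index_mult_mat\<close>)
    also have "\<dots> = rho_root \<beta> $$ (p, k) * Y $$ (l, i) * rho_root \<alpha> $$ (j, t)"
      unfolding Y_def triple_mult_index[OF rho_inv_root_carrier x rho_inv_root_carrier that(2,3)] sum_distrib_left sum_distrib_right ..
    finally show ?thesis .
  qed
  \<comment> \<open>The second tensor leg of Q ends in \<open>rho_inv_root \<alpha>\<close>, which
    meets \<open>rho_root \<alpha>\<close> from \<open>bimod_act\<close>; their product removes the
    sum over i'. The \<open>rho_inv_root \<alpha>\<close> on the right of the final formula comes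
    from the sandwiched matrix unit inside \<open>z\<close>.\<close>
  have delta: "(\<Sum>j<n \<alpha>. rho_inv_root \<alpha> $$ (i', j) * rho_root \<alpha> $$ (j, t)) = (if i' = t then 1 else 0)"
    if "i' < n \<alpha>" "t < n \<alpha>" for i' t
    using mult_mat_index[OF rho_inv_root_carrier rho_root_carrier that] that by (simp add: rho_root_rho_inv_root)
  define X where "X = ?X"
  have X_index: "X $$ (l', m) = (\<Sum>l<n \<beta>. \<Sum>i<n \<alpha>. \<Sum>j<n \<alpha>. 1 / dimq \<beta> * (rinv \<beta> $$ (l', l) * Y $$ (l, i) * (rho_inv_root \<alpha> $$ (i, j) * K $$ (j, m))))"
    if "l' < n \<beta>" "m < n \<alpha>" for l' m
  proof -
    note cc = mult_carrier_mat[OF rho_inv_root_carrier Kc]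
    have "X $$ (l', m) = 1 / dimq \<beta> * (rinv \<beta> * Y * (rho_inv_root \<alpha> * K)) $$ (l', m)"
      unfolding X_def Y_def[symmetric] K_def[symmetric]
      by (rule index_smult_mat(1)) (use that carrier_matD[OF rinv_carrier[of \<beta>]] carrier_matD[OF Kc] in simp_all)
    also have "\<dots> = 1 / dimq \<beta> * (\<Sum>l<n \<beta>. \<Sum>i<n \<alpha>. rinv \<beta> $$ (l', l) * Y $$ (l, i) * (\<Sum>j<n \<alpha>. rho_inv_root \<alpha> $$ (i, j) * K $$ (j, m)))"
      unfolding triple_mult_index[OF rinv_carrier Yc cc that]
      by (simp add: mult_mat_index[OF rho_inv_root_carrier Kc] that del: index_mult_mat)
    finally show ?thesis unfolding sum_distrib_left .
  qed
  show ?thesis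
    unfolding Q_def[symmetric] X_def[symmetric]
  proof (rule eq_matI)
    fix p t assume "p < dim_row (rho_root \<beta> * coeff_block \<alpha> \<beta> (ft P) X * rho_inv_root \<alpha>)" "t < dim_col (rho_root \<beta> * coeff_block \<alpha> \<beta> (ft P) X * rho_inv_root \<alpha>)"
    then have pt: "p < n \<beta>" "t < n \<alpha>" using rho_root_carrier[of \<beta>] rho_inv_root_carrier[of \<alpha>] by auto
    have "bimod_act n \<rho> \<beta> \<alpha> Q x $$ (p, t) = (\<Sum>k<n \<beta>. \<Sum>l<n \<beta>. \<Sum>i<n \<alpha>. \<Sum>j<n \<alpha>.
        Q $$ (k * n \<alpha> + i, l * n \<alpha> + j) * (rho_root \<beta> $$ (p, k) * Y $$ (l, i) * rho_root \<alpha> $$ (j, t)))"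
      unfolding bimod_act_def rho_root_def[symmetric] rho_inv_root_def[symmetric] using pt by (simp add: trip del: index_mult_mat)
    also have "\<dots> = (\<Sum>k<n \<beta>. \<Sum>l<n \<beta>. \<Sum>i<n \<alpha>. \<Sum>j<n \<alpha>.
        1 / dimq \<alpha> * z t j $$ (k, l) * rho_inv_root \<alpha> $$ (i, j) * (rho_root \<beta> $$ (p, k) * Y $$ (l, i)))"
    proof (rule sum.cong[OF refl], rule sum.cong[OF refl], rule sum.cong[OF refl])
      fix k l i assume "k \<in> {..<n \<beta>}" "l \<in> {..<n \<beta>}" "i \<in> {..<n \<alpha>}"
      then have kli: "k < n \<beta>" "l < n \<beta>" "i < n \<alpha>" by auto
      let ?c = "1 / dimq \<alpha> * (rho_root \<beta> $$ (p, k) * Y $$ (l, i))"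
      have "(\<Sum>j<n \<alpha>. Q $$ (k * n \<alpha> + i, l * n \<alpha> + j) * (rho_root \<beta> $$ (p, k) * Y $$ (l, i) * rho_root \<alpha> $$ (j, t))) =
          (\<Sum>j<n \<alpha>. \<Sum>i'<n \<alpha>. \<Sum>j'<n \<alpha>. ?c * z i' j' $$ (k, l) * rho_inv_root \<alpha> $$ (i, j') * (rho_inv_root \<alpha> $$ (i', j) * rho_root \<alpha> $$ (j, t)))"
        by (rule sum.cong[OF refl]) (use kli in \<open>simp add: Q_index sum_distrib_left sum_distrib_right mult_ac\<close>)
      also have "\<dots> = (\<Sum>i'<n \<alpha>. \<Sum>j'<n \<alpha>. \<Sum>j<n \<alpha>. ?c * z i' j' $$ (k, l) * rho_inv_root \<alpha> $$ (i, j') * (rho_inv_root \<alpha> $$ (i', j) * rho_root \<alpha> $$ (j, t)))"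
        by (subst sum.swap, rule sum.cong[OF refl], rule sum.swap)
      also have "\<dots> = (\<Sum>i'<n \<alpha>. \<Sum>j'<n \<alpha>. ?c * z i' j' $$ (k, l) * rho_inv_root \<alpha> $$ (i, j') * (if i' = t then 1 else 0))"
        unfolding sum_distrib_left[symmetric] by (intro sum.cong refl) (use pt in \<open>simp add: delta\<close>)
      also have "\<dots> = (\<Sum>i'<n \<alpha>. if i' = t then \<Sum>j'<n \<alpha>. ?c * z t j' $$ (k, l) * rho_inv_root \<alpha> $$ (i, j') else 0)"
        by (intro sum.cong refl) auto
      also have "\<dots> = (\<Sum>j'<n \<alpha>. ?c * z t j' $$ (k, l) * rho_inv_root \<alpha> $$ (i, j'))" using pt by simp
      finally show "(\<Sum>j<n \<alpha>. Q $$ (k * n \<alpha> + i, l * n \<alpha> + j) * (rho_root \<beta> $$ (p, k) * Y $$ (l, i) * rho_root \<alpha> $$ (j, t))) =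
          (\<Sum>j<n \<alpha>. 1 / dimq \<alpha> * z t j $$ (k, l) * rho_inv_root \<alpha> $$ (i, j) * (rho_root \<beta> $$ (p, k) * Y $$ (l, i)))"
        by (simp add: mult_ac)
    qed
    also have "\<dots> = (\<Sum>k<n \<beta>. \<Sum>l<n \<beta>. \<Sum>i<n \<alpha>. \<Sum>j<n \<alpha>. \<Sum>l'<n \<beta>. \<Sum>m<n \<alpha>. \<Sum>s<n \<alpha>.
        rho_root \<beta> $$ (p, k) * (1 / dimq \<beta> * (rinv \<beta> $$ (l', l) * Y $$ (l, i) * (rho_inv_root \<alpha> $$ (i, j) * K $$ (j, m))) * c l' k m s) * rho_inv_root \<alpha> $$ (s, t))"
      by (intro sum.cong[OF refl])
        (use pt dimq_nonzero[of \<alpha>] in \<open>simp add: z_index sum_distrib_left sum_distrib_right, simp add: mult_ac\<close>)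
    \<comment> \<open>The sums over k and s become the two outer matrix products, those over l' and
      m form \<open>coeff_block\<close>, and the inner three form the weight X.\<close>
    also have "\<dots> = (\<Sum>k<n \<beta>. \<Sum>s<n \<alpha>. \<Sum>l'<n \<beta>. \<Sum>m<n \<alpha>. \<Sum>l<n \<beta>. \<Sum>i<n \<alpha>. \<Sum>j<n \<alpha>.
        rho_root \<beta> $$ (p, k) * (1 / dimq \<beta> * (rinv \<beta> $$ (l', l) * Y $$ (l, i) * (rho_inv_root \<alpha> $$ (i, j) * K $$ (j, m))) * c l' k m s) * rho_inv_root \<alpha> $$ (s, t))"
      by (rule sum7_reorder)
    also have "\<dots> = (\<Sum>k<n \<beta>. \<Sum>s<n \<alpha>. rho_root \<beta> $$ (p, k) * (\<Sum>l'<n \<beta>. \<Sum>m<n \<alpha>. X $$ (l', m) * c l' k m s) * rho_inv_root \<alpha> $$ (s, t))"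
      by (intro sum.cong[OF refl]) (simp add: X_index sum_distrib_left sum_distrib_right)
    also have "\<dots> = (rho_root \<beta> * coeff_block \<alpha> \<beta> (ft P) X * rho_inv_root \<alpha>) $$ (p, t)"
      unfolding triple_mult_index[OF rho_root_carrier coeff_block_carrier rho_inv_root_carrier pt]
      by (intro sum.cong[OF refl]) (simp add: coeff_block_index c_def)
    finally show "bimod_act n \<rho> \<beta> \<alpha> Q x $$ (p, t) = (rho_root \<beta> * coeff_block \<alpha> \<beta> (ft P) X * rho_inv_root \<alpha>) $$ (p, t)" .
  qed (use rho_root_carrier[of \<beta>] rho_inv_root_carrier[of \<alpha>] in \<open>auto simp: bimod_act_def\<close>)
qed

text \<open>In \<open>bimod_act_graph_Q\<close> the weight depends on x through invertible matrices
  and a nonzero scalar, so it runs through all matrices when x does.\<close>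

lemma graph_block_eq:
  assumes P: "P \<in> c00 n"
  shows "graph_block n \<rho> (conv n \<rho> D P) \<alpha> \<beta> = block_space \<alpha> \<beta> (ft P)"
proof
  show "graph_block n \<rho> (conv n \<rho> D P) \<alpha> \<beta> \<subseteq> block_space \<alpha> \<beta> (ft P)"
    unfolding graph_block_def block_space_def
  proof
    fix y assume "y \<in> bimod_act n \<rho> \<beta> \<alpha> (graph_Q n \<rho> (conv n \<rho> D P) \<beta> \<alpha>) ` carrier_mat (n \<beta>) (n \<alpha>)"
    then obtain x where x: "x \<in> carrier_mat (n \<beta>) (n \<alpha>)"
      and y: "y = bimod_act n \<rho> \<beta> \<alpha> (graph_Q n \<rho> (conv n \<rho> D P) \<beta> \<alpha>) x" by blast
    show "y \<in> (\<lambda>X. rho_root \<beta> * coeff_block \<alpha> \<beta> (ft P) X * rho_inv_root \<alpha>) ` carrier_mat (n \<beta>) (n \<alpha>)"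
      unfolding y bimod_act_graph_Q[OF P x]
      by (intro imageI smult_carrier_mat mult_carrier_mat[of _ "n \<beta>" "n \<alpha>" _ "n \<alpha>"]
          mult_carrier_mat[of _ "n \<beta>" "n \<beta>" _ "n \<alpha>"] mult_carrier_mat[of _ "n \<alpha>" "n \<alpha>" _ "n \<alpha>"]
          rinv_carrier rho_inv_root_carrier rho_carrier x)
  qed
  show "block_space \<alpha> \<beta> (ft P) \<subseteq> graph_block n \<rho> (conv n \<rho> D P) \<alpha> \<beta>"
    unfolding graph_block_def block_space_def
  proof
    fix y assume "y \<in> (\<lambda>X. rho_root \<beta> * coeff_block \<alpha> \<beta> (ft P) X * rho_inv_root \<alpha>) ` carrier_mat (n \<beta>) (n \<alpha>)"
    then obtain X where X: "X \<in> carrier_mat (n \<beta>) (n \<alpha>)" and y: "y = rho_root \<beta> * coeff_block \<alpha> \<beta> (ft P) X * rho_inv_root \<alpha>" by blast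
    define C where "C = rho_inv_root \<alpha> * (rho_inv_root \<alpha> * \<rho> \<alpha>)"
    \<comment> \<open>The inverse of C, needed to solve the equation for the weight for x.\<close>
    define C' where "C' = (rinv \<alpha> * rho_root \<alpha>) * rho_root \<alpha>"
    have Cc: "C \<in> carrier_mat (n \<alpha>) (n \<alpha>)" "C' \<in> carrier_mat (n \<alpha>) (n \<alpha>)"
      unfolding C_def C'_def
      by (intro mult_carrier_mat[of _ "n \<alpha>" "n \<alpha>" _ "n \<alpha>"] rho_inv_root_carrier rho_root_carrier rho_carrier rinv_carrier)+
    have CC: "C' * C = 1\<^sub>m (n \<alpha>)"
    proof -
      note c1 = mult_carrier_mat[OF rho_inv_root_carrier rho_carrier, of \<alpha>]
      have "C' * C = (rinv \<alpha> * rho_root \<alpha>) * (rho_root \<alpha> * (rho_inv_root \<alpha> * (rho_inv_root \<alpha> * \<rho> \<alpha>)))"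
        unfolding C_def C'_def
        by (rule assoc_mult_mat[OF mult_carrier_mat[OF rinv_carrier rho_root_carrier] rho_root_carrier mult_carrier_mat[OF rho_inv_root_carrier c1]])
      also have "rho_root \<alpha> * (rho_inv_root \<alpha> * (rho_inv_root \<alpha> * \<rho> \<alpha>)) = rho_inv_root \<alpha> * \<rho> \<alpha>"
        unfolding assoc_mult_mat[OF rho_root_carrier rho_inv_root_carrier c1, symmetric] rho_root_rho_inv_root by (rule left_mult_one_mat[OF c1])
      also have "(rinv \<alpha> * rho_root \<alpha>) * (rho_inv_root \<alpha> * \<rho> \<alpha>) = rinv \<alpha> * (rho_root \<alpha> * (rho_inv_root \<alpha> * \<rho> \<alpha>))"
        by (rule assoc_mult_mat[OF rinv_carrier rho_root_carrier c1])
      also have "rho_root \<alpha> * (rho_inv_root \<alpha> * \<rho> \<alpha>) = \<rho> \<alpha>"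
        unfolding assoc_mult_mat[OF rho_root_carrier rho_inv_root_carrier rho_carrier, symmetric] rho_root_rho_inv_root
        by (rule left_mult_one_mat[OF rho_carrier])
      finally show ?thesis by (simp add: rinv_rho)
    qed
    define Y where "Y = \<rho> \<beta> * (dimq \<beta> \<cdot>\<^sub>m X) * C'"
    have dX: "dimq \<beta> \<cdot>\<^sub>m X \<in> carrier_mat (n \<beta>) (n \<alpha>)" using X by simp
    have Yc: "Y \<in> carrier_mat (n \<beta>) (n \<alpha>)"
      unfolding Y_def by (rule mult_carrier_mat[OF mult_carrier_mat[OF rho_carrier dX] Cc(2)])
    define x where "x = rho_root \<beta> * Y * rho_root \<alpha>"
    have xc: "x \<in> carrier_mat (n \<beta>) (n \<alpha>)"
      unfolding x_def by (rule mult_carrier_mat[OF mult_carrier_mat[OF rho_root_carrier Yc] rho_root_carrier])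
    have e1: "rho_inv_root \<beta> * x * rho_inv_root \<alpha> = Y"
      unfolding x_def by (rule sandwich_inverse[OF rho_inv_root_carrier rho_root_carrier rho_root_rho_inv_root(2) rho_inv_root_carrier rho_root_carrier rho_root_rho_inv_root(1) Yc])
    have e2: "rinv \<beta> * Y * C = dimq \<beta> \<cdot>\<^sub>m X"
      unfolding Y_def by (rule sandwich_inverse[OF rinv_carrier rho_carrier rinv_rho(1) Cc CC dX])
    have e3: "(1 / dimq \<beta>) \<cdot>\<^sub>m (dimq \<beta> \<cdot>\<^sub>m X) = X"
      using dimq_nonzero[of \<beta>] by (intro eq_matI) auto
    have "y = bimod_act n \<rho> \<beta> \<alpha> (graph_Q n \<rho> (conv n \<rho> D P) \<beta> \<alpha>) x"
      unfolding bimod_act_graph_Q[OF P xc] y e1 C_def[symmetric] e2 e3 ..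
    then show "y \<in> bimod_act n \<rho> \<beta> \<alpha> (graph_Q n \<rho> (conv n \<rho> D P) \<beta> \<alpha>) ` carrier_mat (n \<beta>) (n \<alpha>)"
      by (rule image_eqI[OF _ xc])
  qed
qed

end

section \<open>Products of blocks and generating projections\<close>

lemma sum4_reorder:
  "(\<Sum>k\<in>A. \<Sum>l\<in>B. \<Sum>a\<in>C. \<Sum>m\<in>E. f k l a m) = (\<Sum>m\<in>E. \<Sum>a\<in>C. \<Sum>k\<in>A. \<Sum>l\<in>B. (f k l a m :: complex))"
  unfolding sum.cartesian_product
  by (rule sum.reindex_bij_witness[of _ "\<lambda>(m, a, k, l). (k, l, a, m)" "\<lambda>(k, l, a, m). (m, a, k, l)"]) auto

lemma sum_list_product:
  "(\<Sum>(x, y)\<leftarrow>[(a * c, b * d). (a, b) \<leftarrow> xs, (c, d) \<leftarrow> ys]. G x y) =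
    (\<Sum>(a, b)\<leftarrow>xs. \<Sum>(c, d)\<leftarrow>ys. (G (a * c) (b * d) :: complex))"
  by (induction xs) (auto simp: o_def split_def)

text \<open>The joint span of the columns of all \<open>Z k\<close>, encoded as functions vanishing
  from m on because \<open>orth_projection_exists\<close> asks for this form. The coefficients
  vanish from N on, so that N can be enlarged when two elements are added.\<close>

definition col_space :: "nat \<Rightarrow> (nat \<Rightarrow> complex mat) \<Rightarrow> (nat \<Rightarrow> complex) set" where
  "col_space m Z = {c. (\<forall>i\<ge>m. c i = 0) \<and>
     (\<exists>N a. (\<forall>k\<ge>N. \<forall>j. a k j = 0) \<and> (\<forall>i<m. c i = (\<Sum>k<N. \<Sum>j<m. Z k $$ (i, j) * a k j)))}"

lemma col_spaceE: "c \<in> col_space m Z \<Longrightarrow>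
    \<exists>N a. (\<forall>k\<ge>N. \<forall>j. a k j = 0) \<and> (\<forall>i<m. c i = (\<Sum>k<N. \<Sum>j<m. Z k $$ (i, j) * a k j))"
  by (simp add: col_space_def)

lemma col_space_extend:
  fixes a :: "nat \<Rightarrow> nat \<Rightarrow> complex"
  assumes "\<forall>k\<ge>N. \<forall>j. a k j = 0" "N \<le> N'"
  shows "(\<Sum>k<N. \<Sum>j<m. Z k $$ (i, j) * a k j) = (\<Sum>k<N'. \<Sum>j<m. Z k $$ (i, j) * a k j)"
  by (rule sum.mono_neutral_left) (use assms in auto)

lemma col_space_projection:
  "\<exists>P. (\<forall>i j. P i j = cnj (P j i)) \<and> (\<forall>j. (\<lambda>i. P i j) \<in> col_space m Z) \<and>
    (\<forall>c\<in>col_space m Z. \<forall>i. (\<Sum>j<m. P i j * c j) = c i)"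
proof (rule orth_projection_exists)
  show "finite {..<m}" by simp
  show "c i = 0" if "c \<in> col_space m Z" "i \<notin> {..<m}" for c i
    using that by (simp add: col_space_def)
  show "(\<lambda>_. 0) \<in> col_space m Z"
    unfolding col_space_def by (auto intro!: exI[of _ 0] exI[of _ "\<lambda>_ _. 0"])
  show "(\<lambda>i. c i + d i) \<in> col_space m Z" if cd: "c \<in> col_space m Z" "d \<in> col_space m Z" for c d
  proof -
    obtain N a where a: "\<forall>i\<ge>m. c i = 0" "\<forall>k\<ge>N. \<forall>j. a k j = 0" "\<forall>i<m. c i = (\<Sum>k<N. \<Sum>j<m. Z k $$ (i, j) * a k j)"
      using cd(1) unfolding col_space_def by blast
    obtain N' b where b: "\<forall>i\<ge>m. d i = 0" "\<forall>k\<ge>N'. \<forall>j. b k j = 0" "\<forall>i<m. d i = (\<Sum>k<N'. \<Sum>j<m. Z k $$ (i, j) * b k j)"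
      using cd(2) unfolding col_space_def by blast
    let ?N = "max N N'"
    have "c i + d i = (\<Sum>k<?N. \<Sum>j<m. Z k $$ (i, j) * (a k j + b k j))" if i: "i < m" for i
    proof -
      have "c i = (\<Sum>k<?N. \<Sum>j<m. Z k $$ (i, j) * a k j)"
        using a(3) i col_space_extend[where N' = ?N and m = m and Z = Z and i = i, OF a(2)] by simp
      moreover have "d i = (\<Sum>k<?N. \<Sum>j<m. Z k $$ (i, j) * b k j)"
        using b(3) i col_space_extend[where N' = ?N and m = m and Z = Z and i = i, OF b(2)] by simp
      ultimately show ?thesis by (simp add: distrib_left sum.distrib)
    qed
    then show ?thesis unfolding col_space_def using a(1,2) b(1,2)
      by (auto intro!: exI[of _ ?N] exI[of _ "\<lambda>k j. a k j + b k j"])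
  qed
  show "(\<lambda>i. e * c i) \<in> col_space m Z" if c: "c \<in> col_space m Z" for e c
  proof -
    obtain N a where a: "\<forall>i\<ge>m. c i = 0" "\<forall>k\<ge>N. \<forall>j. a k j = 0" "\<forall>i<m. c i = (\<Sum>k<N. \<Sum>j<m. Z k $$ (i, j) * a k j)"
      using c unfolding col_space_def by blast
    have "e * c i = (\<Sum>k<N. \<Sum>j<m. Z k $$ (i, j) * (e * a k j))" if "i < m" for i
      using a(3) that by (simp add: sum_distrib_left mult.left_commute)
    then show ?thesis unfolding col_space_def using a(1,2)
      by (auto intro!: exI[of _ N] exI[of _ "\<lambda>k j. e * a k j"])
  qed
qed

section \<open>Projection matrices and range projections\<close>

lemma projection_mat:
  assumes herm: "\<forall>i j. P i j = cnj (P j i)" and cols: "\<forall>j. (\<lambda>i. P i j) \<in> N"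
    and fixN: "\<forall>c\<in>N. \<forall>i. (\<Sum>j<m. P i j * c j) = c i"
  defines "p \<equiv> mat m m (\<lambda>(i, j). P i j)"
  shows "p * p = p" "mat_adjoint p = p"
proof -
  have pc: "p \<in> carrier_mat m m" by (simp add: p_def)
  show "p * p = p"
  proof (rule eq_matI)
    fix i j assume "i < dim_row p" "j < dim_col p"
    then have ij: "i < m" "j < m" by (auto simp: p_def)
    have "(p * p) $$ (i, j) = (\<Sum>k<m. P i k * P k j)"
      unfolding mult_mat_index[OF pc pc ij] by (rule sum.cong) (use ij in \<open>auto simp: p_def\<close>)
    also have "\<dots> = P i j" by (rule bspec[OF fixN cols[rule_format], rule_format])
    finally show "(p * p) $$ (i, j) = p $$ (i, j)" using ij by (simp add: p_def)
  qed (auto simp: p_def)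
  show "mat_adjoint p = p"
    by (rule eq_matI) (auto simp: p_def herm[rule_format, symmetric])
qed

lemma projection_mat_fixes:
  assumes x: "x \<in> carrier_vec m" and c: "\<And>i. (\<Sum>j<m. P i j * (if j < m then x $ j else 0)) = (if i < m then x $ i else 0)"
  shows "mat m m (\<lambda>(i, j). P i j) *\<^sub>v x = (x :: complex vec)"
proof (rule eq_vecI)
  fix i assume "i < dim_vec x"
  then have i: "i < m" using x by simp
  have "(mat m m (\<lambda>(i, j). P i j) *\<^sub>v x) $ i = (\<Sum>j<m. P i j * (if j < m then x $ j else 0))"
    by (subst mult_mat_vec_index_sum[OF _ x i]) (use i in \<open>auto intro!: sum.cong\<close>)
  then show "(mat m m (\<lambda>(i, j). P i j) *\<^sub>v x) $ i = x $ i" using c[of i] i by simp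
qed (use x in simp)

text \<open>The adjoint of q p = p is p q = p, whereas p q = q.\<close>

lemma projections_eq:
  assumes p: "p \<in> carrier_mat m m" "mat_adjoint p = (p :: complex mat)"
    and q: "q \<in> carrier_mat m m" "mat_adjoint q = q"
    and pq: "p * q = q" and qp: "q * p = p"
  shows "p = q"
proof (rule eq_matI)
  have adj: "x $$ (i, j) = cnj (x $$ (j, i))" if "x \<in> carrier_mat m m" "mat_adjoint x = x" "i < m" "j < m" for x :: "complex mat" and i j
    using that(1,3,4) arg_cong[OF that(2), of "\<lambda>x. x $$ (i, j)"] by simp
  fix i j assume "i < dim_row q" "j < dim_col q"
  then have ij: "i < m" "j < m" using q by auto
  have "p $$ (i, j) = cnj (p $$ (j, i))" by (rule adj[OF p ij])
  also have "p $$ (j, i) = (\<Sum>k<m. q $$ (j, k) * p $$ (k, i))"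
    using mult_mat_index[OF q(1) p(1) ij(2,1)] qp by simp
  also have "cnj \<dots> = (\<Sum>k<m. p $$ (i, k) * q $$ (k, j))"
    unfolding cnj_sum by (rule sum.cong[OF refl]) (use ij in \<open>simp add: adj[OF p, symmetric] adj[OF q, symmetric] mult.commute\<close>)
  also have "\<dots> = q $$ (i, j)" using mult_mat_index[OF p(1) q(1) ij] pq by simp
  finally show "p $$ (i, j) = q $$ (i, j)" .
qed (use p q in auto)

definition is_range_proj :: "nat \<Rightarrow> complex mat \<Rightarrow> complex mat \<Rightarrow> bool" where
  "is_range_proj m A p \<longleftrightarrow> p \<in> carrier_mat m m \<and> p * p = p \<and> mat_adjoint p = p \<and>
     (\<lambda>v. p *\<^sub>v v) ` carrier_vec m = (\<lambda>v. A *\<^sub>v v) ` carrier_vec m"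

lemma mult_unit_vec_index:
  assumes A: "(A :: complex mat) \<in> carrier_mat m m" and ij: "i < m" "j < m"
  shows "(A *\<^sub>v unit_vec m j) $ i = A $$ (i, j)"
proof -
  have "(A *\<^sub>v unit_vec m j) $ i = (\<Sum>k<m. if k = j then A $$ (i, j) else 0)"
    unfolding mult_mat_vec_index_sum[OF A unit_vec_carrier ij(1)] by (rule sum.cong) (use ij in auto)
  then show ?thesis using ij by simp
qed

lemma mult_fixes_range:
  assumes p: "p \<in> carrier_mat m m" "p * p = p" and q: "q \<in> carrier_mat m m"
    and sub: "(\<lambda>v. q *\<^sub>v v) ` carrier_vec m \<subseteq> (\<lambda>v. p *\<^sub>v v) ` carrier_vec m"
  shows "p * q = (q :: complex mat)"
proof (rule eq_matI)
  fix i j assume "i < dim_row q" "j < dim_col q"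
  then have ij: "i < m" "j < m" using q by auto
  have "q *\<^sub>v unit_vec m j \<in> (\<lambda>v. q *\<^sub>v v) ` carrier_vec m" by (rule imageI) simp
  then have "q *\<^sub>v unit_vec m j \<in> (\<lambda>v. p *\<^sub>v v) ` carrier_vec m" by (rule subsetD[OF sub])
  then obtain v where v: "v \<in> carrier_vec m" "q *\<^sub>v unit_vec m j = p *\<^sub>v v" by (elim imageE)
  have "(p * q) *\<^sub>v unit_vec m j = p *\<^sub>v (q *\<^sub>v unit_vec m j)"
    by (rule assoc_mult_mat_vec[OF p(1) q]) simp
  also have "\<dots> = (p * p) *\<^sub>v v" unfolding v(2) by (rule assoc_mult_mat_vec[OF p(1) p(1) v(1), symmetric])
  also have "\<dots> = q *\<^sub>v unit_vec m j" unfolding p(2) v(2) ..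
  finally have "((p * q) *\<^sub>v unit_vec m j) $ i = (q *\<^sub>v unit_vec m j) $ i" by simp
  then show "(p * q) $$ (i, j) = q $$ (i, j)"
    unfolding mult_unit_vec_index[OF mult_carrier_mat[OF p(1) q] ij] mult_unit_vec_index[OF q ij] .
qed (use p q in auto)

text \<open>\<open>range_proj\<close> is a definite description, so existence and uniqueness are
  both needed. Existence comes from the column space of the constant family A; two projections with
  the same range fix each other and are therefore equal.\<close>

lemma range_proj_mat:
  assumes A: "A \<in> carrier_mat m m"
  shows "is_range_proj m A (THE p. is_range_proj m A p)"
proof -
  obtain P where herm: "\<forall>i j. P i j = cnj (P j i)" and cols: "\<forall>j. (\<lambda>i. P i j) \<in> col_space m (\<lambda>_. A)"
    and fixN: "\<forall>c\<in>col_space m (\<lambda>_. A). \<forall>i. (\<Sum>j<m. P i j * c j) = c i"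
    using col_space_projection[of m "\<lambda>_. A"] by blast
  define p where "p = mat m m (\<lambda>(i, j). P i j)"
  have pc: "p \<in> carrier_mat m m" by (simp add: p_def)
  have pp: "p * p = p" "mat_adjoint p = p"
    unfolding p_def by (rule projection_mat[OF herm cols fixN])+
  have sub1: "(\<lambda>v. p *\<^sub>v v) ` carrier_vec m \<subseteq> (\<lambda>v. A *\<^sub>v v) ` carrier_vec m"
  proof
    fix x assume "x \<in> (\<lambda>v. p *\<^sub>v v) ` carrier_vec m"
    then obtain v where v: "v \<in> carrier_vec m" "x = p *\<^sub>v v" by blast
    \<comment> \<open>An element of the column space of the constant family may use several copies
      of A; adding their coefficients leaves one copy.\<close>
    have "\<forall>j. \<exists>a. \<forall>i<m. P i j = (\<Sum>l<m. A $$ (i, l) * a l)"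
    proof
      fix j
      obtain N :: nat and a where "\<forall>i<m. P i j = (\<Sum>k<N. \<Sum>l<m. A $$ (i, l) * a k l)"
        using col_spaceE[OF cols[rule_format, of j]] by blast
      then have "\<forall>i<m. P i j = (\<Sum>l<m. A $$ (i, l) * (\<Sum>k<N. a k l))"
        by (subst (asm) sum.swap) (simp add: sum_distrib_left)
      then show "\<exists>a. \<forall>i<m. P i j = (\<Sum>l<m. A $$ (i, l) * a l)"
        by (rule exI[of _ "\<lambda>l. \<Sum>k<N. a k l"])
    qed
    then obtain a where a: "\<forall>j. \<forall>i<m. P i j = (\<Sum>l<m. A $$ (i, l) * a j l)" by (rule choice[THEN exE])
    define w where "w = vec m (\<lambda>l. \<Sum>j<m. a j l * v $ j)"
    have "x = A *\<^sub>v w"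
    proof (rule eq_vecI)
      fix i assume "i < dim_vec (A *\<^sub>v w)"
      then have i: "i < m" using A by simp
      have "x $ i = (\<Sum>j<m. (\<Sum>l<m. A $$ (i, l) * a j l) * v $ j)"
        unfolding v(2) mult_mat_vec_index_sum[OF pc v(1) i] by (rule sum.cong) (use i a in \<open>auto simp: p_def\<close>)
      also have "\<dots> = (\<Sum>l<m. \<Sum>j<m. A $$ (i, l) * a j l * v $ j)"
        unfolding sum_distrib_right by (rule sum.swap)
      also have "\<dots> = (A *\<^sub>v w) $ i"
        by (subst mult_mat_vec_index_sum[OF A _ i]) (auto simp: w_def sum_distrib_left mult.assoc)
      finally show "x $ i = (A *\<^sub>v w) $ i" .
    qed (use A v pc in auto)
    moreover have "w \<in> carrier_vec m" by (simp add: w_def)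
    ultimately show "x \<in> (\<lambda>v. A *\<^sub>v v) ` carrier_vec m" by blast
  qed
  have sub2: "(\<lambda>v. A *\<^sub>v v) ` carrier_vec m \<subseteq> (\<lambda>v. p *\<^sub>v v) ` carrier_vec m"
  proof
    fix x assume "x \<in> (\<lambda>v. A *\<^sub>v v) ` carrier_vec m"
    then obtain v where v: "v \<in> carrier_vec m" "x = A *\<^sub>v v" by blast
    define c where "c i = (if i < m then x $ i else 0)" for i
    have xc: "x \<in> carrier_vec m" using v A by simp
    have "c \<in> col_space m (\<lambda>_. A)"
      unfolding col_space_def mem_Collect_eq
      by (intro conjI exI[of _ "Suc 0"] exI[of _ "\<lambda>k j. if k = 0 then v $ j else 0"])
        (auto simp: c_def v(2) mult_mat_vec_index_sum[OF A v(1)] simp del: index_mult_mat_vec)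
    then have "(\<Sum>j<m. P i j * c j) = c i" for i by (rule fixN[rule_format])
    then have "x = p *\<^sub>v x"
      by (intro projection_mat_fixes[OF xc, where P = P, folded p_def, symmetric]) (simp add: c_def)
    then show "x \<in> (\<lambda>v. p *\<^sub>v v) ` carrier_vec m" using xc by blast
  qed
  have p: "is_range_proj m A p"
    unfolding is_range_proj_def by (intro conjI pc pp subset_antisym sub1 sub2)
  show ?thesis
  proof (rule theI[of _ p], rule p)
    fix q assume q: "is_range_proj m A q"
    show "q = p"
    proof (rule projections_eq[of q m p])
      show "q * p = p" by (rule mult_fixes_range[of q m p]) (use p q in \<open>simp_all add: is_range_proj_def\<close>)
      show "p * q = q" by (rule mult_fixes_range[of p m q]) (use p q in \<open>simp_all add: is_range_proj_def\<close>)
    qed (use p q in \<open>simp_all add: is_range_proj_def\<close>)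
  qed
qed

lemma range_proj_spec: "x \<alpha> \<in> carrier_mat (n \<alpha>) (n \<alpha>) \<Longrightarrow> is_range_proj (n \<alpha>) (x \<alpha>) (range_proj n x \<alpha>)"
  unfolding range_proj_def is_range_proj_def[symmetric] by (rule range_proj_mat)

text \<open>If the ranges of the \<open>z k \<delta>\<close> did not span, the projection onto their span, extended by \<open>1\<close>
  in the other blocks, would be a smaller upper bound of the range projections.\<close>

lemma range_proj_sup_cover:
  assumes z: "\<And>k \<alpha>. z k \<alpha> \<in> carrier_mat (n \<alpha>) (n \<alpha>)"
    and sup: "is_proj_sup n (range (\<lambda>k. range_proj n (z k))) (fone n)"
  shows "\<exists>N y. (\<forall>k. y k \<in> carrier_mat (n \<delta>) (n \<delta>)) \<and> 1\<^sub>m (n \<delta>) = msum (n \<delta>) (n \<delta>) {..<N :: nat} (\<lambda>k. z k \<delta> * y k)"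
proof -
  let ?m = "n \<delta>"
  let ?N = "col_space ?m (\<lambda>k. z k \<delta>)"
  obtain P where herm: "\<forall>i j. P i j = cnj (P j i)" and cols: "\<forall>j. (\<lambda>i. P i j) \<in> ?N"
    and fixN: "\<forall>c\<in>?N. \<forall>i. (\<Sum>j<?m. P i j * c j) = c i"
    using col_space_projection[of ?m "\<lambda>k. z k \<delta>"] by blast
  define p where "p = mat ?m ?m (\<lambda>(i, j). P i j)"
  have pc: "p \<in> carrier_mat ?m ?m" by (simp add: p_def)
  have pp: "p * p = p" "mat_adjoint p = p"
    unfolding p_def by (rule projection_mat[OF herm cols fixN])+
  define q where "q = (\<lambda>\<alpha>. if \<alpha> = \<delta> then p else 1\<^sub>m (n \<alpha>))"
  have one_adj: "mat_adjoint (1\<^sub>m k) = (1\<^sub>m k :: complex mat)" for k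
    by (rule eq_matI) auto
  have "q \<in> linf n"
    by (rule linf_bounded[of _ _ "{\<delta>}"]) (auto simp: q_def pc)
  then have q: "is_proj n q"
    unfolding is_proj_def fmult_def fstar_def q_def using pp one_adj by (auto simp: fun_eq_iff)
  have le: "proj_le (range_proj n (z k)) q" for k
    unfolding proj_le_def fmult_def
  proof
    fix \<alpha>
    have rp: "is_range_proj (n \<alpha>) (z k \<alpha>) (range_proj n (z k) \<alpha>)" by (rule range_proj_spec) (rule z)
    then have rc: "range_proj n (z k) \<alpha> \<in> carrier_mat (n \<alpha>) (n \<alpha>)" by (simp add: is_range_proj_def)
    show "q \<alpha> * range_proj n (z k) \<alpha> = range_proj n (z k) \<alpha>"
    proof (cases "\<alpha> = \<delta>")
      case False
      then show ?thesis using rc by (simp add: q_def)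
    next
      case True
      have sub: "(\<lambda>v. z k \<delta> *\<^sub>v v) ` carrier_vec ?m \<subseteq> (\<lambda>v. p *\<^sub>v v) ` carrier_vec ?m"
      proof
        fix x assume "x \<in> (\<lambda>v. z k \<delta> *\<^sub>v v) ` carrier_vec ?m"
        then obtain v where v: "v \<in> carrier_vec ?m" "x = z k \<delta> *\<^sub>v v" by blast
        define c where "c i = (if i < ?m then x $ i else 0)" for i
        have xc: "x \<in> carrier_vec ?m" using v z[of k \<delta>] by simp
        have "(\<Sum>k'<Suc k. \<Sum>j<?m. z k' \<delta> $$ (i, j) * (if k' = k then v $ j else 0)) =
            (\<Sum>j<?m. z k \<delta> $$ (i, j) * v $ j)" for i
          by simp
        then have "c \<in> ?N"
          unfolding col_space_def mem_Collect_eq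
          by (intro conjI exI[of _ "Suc k"] exI[of _ "\<lambda>k' j. if k' = k then v $ j else 0"])
            (auto simp: c_def v(2) mult_mat_vec_index_sum[OF z v(1)] simp del: index_mult_mat_vec)
        then have "(\<Sum>j<?m. P i j * c j) = c i" for i by (rule fixN[rule_format])
        then have "x = p *\<^sub>v x"
          by (intro projection_mat_fixes[OF xc, where P = P, folded p_def, symmetric]) (simp add: c_def)
        then show "x \<in> (\<lambda>v. p *\<^sub>v v) ` carrier_vec ?m" using xc by blast
      qed
      show ?thesis
        using mult_fixes_range[OF pc pp(1) rc[unfolded True]] rp sub True
        by (simp add: q_def is_range_proj_def)
    qed
  qed
  \<comment> \<open>q dominates every range projection, hence also their supremum 1. Its component p
    at \<delta> is therefore the identity, so the columns of all \<open>z k \<delta>\<close>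
    span.\<close>
  have "proj_le (fone n) q" using sup q le unfolding is_proj_sup_def by blast
  then have "q \<delta> * 1\<^sub>m ?m = 1\<^sub>m ?m" unfolding proj_le_def fmult_def fone_def by (rule fun_cong)
  then have p1: "p = 1\<^sub>m ?m" using pc by (simp add: q_def)
  have "\<forall>j. \<exists>N a. (\<forall>k\<ge>N. \<forall>l. a k l = 0) \<and> (\<forall>i<?m. P i j = (\<Sum>k<N. \<Sum>l<?m. z k \<delta> $$ (i, l) * a k l))"
    using col_spaceE[OF cols[rule_format]] by (intro allI)
  then obtain N where "\<forall>j. \<exists>a. (\<forall>k\<ge>N j. \<forall>l. a k l = 0) \<and> (\<forall>i<?m. P i j = (\<Sum>k<N j. \<Sum>l<?m. z k \<delta> $$ (i, l) * a k l))"
    by (rule choice[THEN exE])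
  then obtain a where a: "\<forall>j. (\<forall>k\<ge>N j. \<forall>l. a j k l = 0) \<and> (\<forall>i<?m. P i j = (\<Sum>k<N j. \<Sum>l<?m. z k \<delta> $$ (i, l) * a j k l))"
    by (rule choice[THEN exE])
  \<comment> \<open>The number of matrices needed depends on the column j; the sum of these numbers
    bounds them all, and the additional coefficients are zero.\<close>
  define M where "M = (\<Sum>j<?m. N j)"
  have M: "N j \<le> M" if "j < ?m" for j unfolding M_def using that by (intro member_le_sum) auto
  define y where "y k = mat ?m ?m (\<lambda>(l, j). a j k l)" for k
  have yc: "y k \<in> carrier_mat ?m ?m" for k by (simp add: y_def)
  have "1\<^sub>m ?m = msum ?m ?m {..<M} (\<lambda>k. z k \<delta> * y k)"
  proof (rule eq_matI)
    fix i j assume "i < dim_row (msum ?m ?m {..<M} (\<lambda>k. z k \<delta> * y k))" "j < dim_col (msum ?m ?m {..<M} (\<lambda>k. z k \<delta> * y k))"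
    then have ij: "i < ?m" "j < ?m" by (auto simp: msum_def)
    have "(1\<^sub>m ?m :: complex mat) $$ (i, j) = P i j" unfolding p1[symmetric] using ij by (simp add: p_def)
    also have "\<dots> = (\<Sum>k<N j. \<Sum>l<?m. z k \<delta> $$ (i, l) * a j k l)"
      by (rule conjunct2[OF spec[OF a], rule_format, OF ij(1)])
    also have "\<dots> = (\<Sum>k<M. \<Sum>l<?m. z k \<delta> $$ (i, l) * a j k l)"
      by (rule col_space_extend[OF conjunct1[OF spec[OF a]] M[OF ij(2)]])
    also have "\<dots> = (\<Sum>k<M. (z k \<delta> * y k) $$ (i, j))"
      by (rule sum.cong[OF refl], subst mult_mat_index[OF z yc ij]) (use ij in \<open>simp add: y_def\<close>)
    finally show "(1\<^sub>m ?m :: complex mat) $$ (i, j) = msum ?m ?m {..<M} (\<lambda>k. z k \<delta> * y k) $$ (i, j)"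
      using ij by simp
  qed (auto simp: msum_def)
  then show ?thesis using yc by blast
qed

section \<open>Block spaces of sums, products and slices\<close>

context discrete_quantum_group
begin

lemma block_space_carrier: "M \<in> block_space \<alpha> \<beta> w \<Longrightarrow> M \<in> carrier_mat (n \<beta>) (n \<alpha>)"
  unfolding block_space_def using mult_carrier_mat[OF mult_carrier_mat[OF rho_root_carrier coeff_block_carrier] rho_inv_root_carrier] by blast

lemma coeff_block_msum: "coeff_block \<alpha> \<beta> w (msum (n \<beta>) (n \<alpha>) K X) = msum (n \<beta>) (n \<alpha>) K (\<lambda>s. coeff_block \<alpha> \<beta> w (X s))"
proof (rule eq_matI)
  fix p i assume "p < dim_row (msum (n \<beta>) (n \<alpha>) K (\<lambda>s. coeff_block \<alpha> \<beta> w (X s)))"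
    "i < dim_col (msum (n \<beta>) (n \<alpha>) K (\<lambda>s. coeff_block \<alpha> \<beta> w (X s)))"
  then have pi: "p < n \<beta>" "i < n \<alpha>" by (auto simp: msum_def)
  have "coeff_block \<alpha> \<beta> w (msum (n \<beta>) (n \<alpha>) K X) $$ (p, i) =
      (\<Sum>k<n \<beta>. \<Sum>l<n \<alpha>. \<Sum>s\<in>K. X s $$ (k, l) * chi \<beta> k p (u \<alpha> $$ (l, i) * w))"
    unfolding coeff_block_index[OF pi] by (intro sum.cong refl) (simp add: sum_distrib_right)
  also have "\<dots> = (\<Sum>k<n \<beta>. \<Sum>s\<in>K. \<Sum>l<n \<alpha>. X s $$ (k, l) * chi \<beta> k p (u \<alpha> $$ (l, i) * w))"
    by (rule sum.cong[OF refl]) (rule sum.swap)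
  also have "\<dots> = (\<Sum>s\<in>K. \<Sum>k<n \<beta>. \<Sum>l<n \<alpha>. X s $$ (k, l) * chi \<beta> k p (u \<alpha> $$ (l, i) * w))"
    by (rule sum.swap)
  finally show "coeff_block \<alpha> \<beta> w (msum (n \<beta>) (n \<alpha>) K X) $$ (p, i) = msum (n \<beta>) (n \<alpha>) K (\<lambda>s. coeff_block \<alpha> \<beta> w (X s)) $$ (p, i)"
    using pi by (simp add: coeff_block_index)
qed (auto simp: msum_def coeff_block_def)

lemma coeff_block_sum:
  "coeff_block \<alpha> \<beta> (\<Sum>s\<in>K. w s) X = msum (n \<beta>) (n \<alpha>) K (\<lambda>s. coeff_block \<alpha> \<beta> (w s) X)"
proof (rule eq_matI)
  fix p i assume "p < dim_row (msum (n \<beta>) (n \<alpha>) K (\<lambda>s. coeff_block \<alpha> \<beta> (w s) X))"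
    "i < dim_col (msum (n \<beta>) (n \<alpha>) K (\<lambda>s. coeff_block \<alpha> \<beta> (w s) X))"
  then have pi: "p < n \<beta>" "i < n \<alpha>" by (auto simp: msum_def)
  have "coeff_block \<alpha> \<beta> (\<Sum>s\<in>K. w s) X $$ (p, i) =
      (\<Sum>k<n \<beta>. \<Sum>l<n \<alpha>. \<Sum>s\<in>K. X $$ (k, l) * chi \<beta> k p (u \<alpha> $$ (l, i) * w s))"
    unfolding coeff_block_index[OF pi]
    by (intro sum.cong refl) (simp add: sum_distrib_left functional_sum[OF chi_functional])
  also have "\<dots> = (\<Sum>k<n \<beta>. \<Sum>s\<in>K. \<Sum>l<n \<alpha>. X $$ (k, l) * chi \<beta> k p (u \<alpha> $$ (l, i) * w s))"
    by (rule sum.cong[OF refl]) (rule sum.swap)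
  also have "\<dots> = (\<Sum>s\<in>K. \<Sum>k<n \<beta>. \<Sum>l<n \<alpha>. X $$ (k, l) * chi \<beta> k p (u \<alpha> $$ (l, i) * w s))"
    by (rule sum.swap)
  finally show "coeff_block \<alpha> \<beta> (\<Sum>s\<in>K. w s) X $$ (p, i) = msum (n \<beta>) (n \<alpha>) K (\<lambda>s. coeff_block \<alpha> \<beta> (w s) X) $$ (p, i)"
    using pi by (simp add: coeff_block_index)
qed (auto simp: msum_def coeff_block_def)

lemma block_space_msum:
  assumes "\<And>s. s \<in> K \<Longrightarrow> f s \<in> block_space \<alpha> \<beta> w"
  shows "msum (n \<beta>) (n \<alpha>) K f \<in> block_space \<alpha> \<beta> w"
proof -
  have "\<forall>s\<in>K. \<exists>X. X \<in> carrier_mat (n \<beta>) (n \<alpha>) \<and> f s = rho_root \<beta> * coeff_block \<alpha> \<beta> w X * rho_inv_root \<alpha>"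
    using assms unfolding block_space_def by blast
  then obtain X where X: "\<forall>s\<in>K. X s \<in> carrier_mat (n \<beta>) (n \<alpha>) \<and> f s = rho_root \<beta> * coeff_block \<alpha> \<beta> w (X s) * rho_inv_root \<alpha>"
    by (rule bchoice[THEN exE])
  have "msum (n \<beta>) (n \<alpha>) K f = msum (n \<beta>) (n \<alpha>) K (\<lambda>s. rho_root \<beta> * coeff_block \<alpha> \<beta> w (X s) * rho_inv_root \<alpha>)"
    unfolding msum_def by (intro cong_mat refl) (use X in \<open>auto intro!: sum.cong\<close>)
  also have "\<dots> = rho_root \<beta> * coeff_block \<alpha> \<beta> w (msum (n \<beta>) (n \<alpha>) K X) * rho_inv_root \<alpha>"
    unfolding coeff_block_msum by (rule msum_sandwich[OF rho_root_carrier rho_inv_root_carrier coeff_block_carrier, symmetric])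
  finally show ?thesis unfolding block_space_def by (rule image_eqI) (rule msum_carrier)
qed

text \<open>\<open>coeff_block\<close> is additive in the algebra element for a fixed weight, so the
  weight of M serves all summands.\<close>

lemma block_space_sum_decompose:
  assumes "M \<in> block_space \<alpha> \<beta> (\<Sum>s\<in>K. w s)"
  shows "\<exists>f. (\<forall>s. f s \<in> block_space \<alpha> \<beta> (w s)) \<and> M = msum (n \<beta>) (n \<alpha>) K f"
proof -
  obtain X where X: "X \<in> carrier_mat (n \<beta>) (n \<alpha>)" and M: "M = rho_root \<beta> * coeff_block \<alpha> \<beta> (\<Sum>s\<in>K. w s) X * rho_inv_root \<alpha>"
    using assms unfolding block_space_def by blast
  show ?thesis
  proof (intro exI conjI allI)
    show "rho_root \<beta> * coeff_block \<alpha> \<beta> (w s) X * rho_inv_root \<alpha> \<in> block_space \<alpha> \<beta> (w s)" for s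
      unfolding block_space_def using X by (rule imageI)
    show "M = msum (n \<beta>) (n \<alpha>) K (\<lambda>s. rho_root \<beta> * coeff_block \<alpha> \<beta> (w s) X * rho_inv_root \<alpha>)"
      unfolding M coeff_block_sum by (rule msum_sandwich[OF rho_root_carrier rho_inv_root_carrier coeff_block_carrier])
  qed
qed

text \<open>Inserting the expansion of \<open>u\<^sub>l\<^sub>i v\<close> in coefficients factors the block of \<open>v w\<close> through all
  intermediate irreducibles.\<close>

lemma coeff_block_mult:
  assumes v: "v \<in> coeff_span" and F: "finite F" "\<And>l i. l < n \<alpha> \<Longrightarrow> i < n \<alpha> \<Longrightarrow> supp (u \<alpha> $$ (l, i) * v) \<subseteq> F"
  shows "coeff_block \<alpha> \<gamma> (v * w) X = msum (n \<gamma>) (n \<alpha>) (SIGMA \<beta>:F. {..<n \<beta>} \<times> {..<n \<alpha>})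
    (\<lambda>(\<beta>, m, l). coeff_block \<beta> \<gamma> w (mat (n \<gamma>) (n \<beta>) (\<lambda>(k, m'). if m' = m then X $$ (k, l) else 0)) *
      coeff_block \<alpha> \<beta> v (mat (n \<beta>) (n \<alpha>) (\<lambda>(m', l'). if m' = m then if l' = l then 1 else 0 else 0)))"
    (is "_ = msum _ _ ?S (\<lambda>(\<beta>, m, l). ?Z \<beta> m l * ?Y \<beta> m l)")
proof (rule eq_matI)
  fix r i assume "r < dim_row (msum (n \<gamma>) (n \<alpha>) ?S (\<lambda>(\<beta>, m, l). ?Z \<beta> m l * ?Y \<beta> m l))"
    "i < dim_col (msum (n \<gamma>) (n \<alpha>) ?S (\<lambda>(\<beta>, m, l). ?Z \<beta> m l * ?Y \<beta> m l))"
  then have ri: "r < n \<gamma>" "i < n \<alpha>" by (auto simp: msum_def)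
  have Z: "?Z \<beta> m l $$ (r, j) = (\<Sum>k<n \<gamma>. X $$ (k, l) * chi \<gamma> k r (u \<beta> $$ (m, j) * w))"
    if "m < n \<beta>" "j < n \<beta>" for \<beta> m l j
  proof -
    have "?Z \<beta> m l $$ (r, j) = (\<Sum>k<n \<gamma>. \<Sum>m'<n \<beta>. if m' = m then X $$ (k, l) * chi \<gamma> k r (u \<beta> $$ (m, j) * w) else 0)"
      unfolding coeff_block_index[OF ri(1) that(2)] by (intro sum.cong refl) auto
    then show ?thesis using that by simp
  qed
  have Y: "?Y \<beta> m l $$ (j, i) = chi \<beta> m j (u \<alpha> $$ (l, i) * v)" if "m < n \<beta>" "j < n \<beta>" "l < n \<alpha>" for \<beta> m l j
  proof -
    have "?Y \<beta> m l $$ (j, i) = (\<Sum>m'<n \<beta>. if m' = m then \<Sum>l'<n \<alpha>. if l' = l then chi \<beta> m j (u \<alpha> $$ (l, i) * v) else 0 else 0)"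
      unfolding coeff_block_index[OF that(2) ri(2)] by (intro sum.cong refl) (use that in \<open>auto simp: mult_indicator\<close>)
    then show ?thesis using that by simp
  qed
  have chi_vw: "chi \<gamma> k r (u \<alpha> $$ (l, i) * (v * w)) =
      (\<Sum>\<beta>\<in>F. \<Sum>m<n \<beta>. \<Sum>j<n \<beta>. chi \<beta> m j (u \<alpha> $$ (l, i) * v) * chi \<gamma> k r (u \<beta> $$ (m, j) * w))"
    if l: "l < n \<alpha>" for k l
    using coeff_span_functional_expand[OF coeff_span_mult[OF u_coeff_span[OF l ri(2)] v] F(1) F(2)[OF l ri(2)] functional_mult_right[OF chi_functional]]
    by (simp add: mult.assoc)
  have "coeff_block \<alpha> \<gamma> (v * w) X $$ (r, i) = (\<Sum>l<n \<alpha>. \<Sum>k<n \<gamma>. X $$ (k, l) *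
      (\<Sum>\<beta>\<in>F. \<Sum>m<n \<beta>. \<Sum>j<n \<beta>. chi \<beta> m j (u \<alpha> $$ (l, i) * v) * chi \<gamma> k r (u \<beta> $$ (m, j) * w)))"
    unfolding coeff_block_index[OF ri] by (subst sum.swap) (simp add: chi_vw)
  also have "\<dots> = (\<Sum>l<n \<alpha>. \<Sum>k<n \<gamma>. \<Sum>x\<in>(SIGMA \<beta>:F. {..<n \<beta>} \<times> {..<n \<beta>}).
      X $$ (k, l) * (chi (fst x) (fst (snd x)) (snd (snd x)) (u \<alpha> $$ (l, i) * v) * chi \<gamma> k r (u (fst x) $$ snd x * w)))"
    unfolding sum_triples[OF F(1)] by (simp add: sum_distrib_left)
  also have "\<dots> = (\<Sum>l<n \<alpha>. \<Sum>x\<in>(SIGMA \<beta>:F. {..<n \<beta>} \<times> {..<n \<beta>}). \<Sum>k<n \<gamma>.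
      X $$ (k, l) * (chi (fst x) (fst (snd x)) (snd (snd x)) (u \<alpha> $$ (l, i) * v) * chi \<gamma> k r (u (fst x) $$ snd x * w)))"
    by (rule sum.cong[OF refl]) (rule sum.swap)
  also have "\<dots> = (\<Sum>l<n \<alpha>. \<Sum>\<beta>\<in>F. \<Sum>m<n \<beta>. \<Sum>j<n \<beta>. ?Z \<beta> m l $$ (r, j) * ?Y \<beta> m l $$ (j, i))"
    unfolding sum_triples[OF F(1)]
    by (intro sum.cong[OF refl]) (simp add: Z Y sum_distrib_right, simp add: mult_ac)
  also have "\<dots> = (\<Sum>\<beta>\<in>F. \<Sum>l<n \<alpha>. \<Sum>m<n \<beta>. (?Z \<beta> m l * ?Y \<beta> m l) $$ (r, i))"
    by (subst sum.swap) (simp add: mult_mat_index[OF coeff_block_carrier coeff_block_carrier ri] del: index_mult_mat)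
  also have "\<dots> = (\<Sum>\<beta>\<in>F. \<Sum>m<n \<beta>. \<Sum>l<n \<alpha>. (?Z \<beta> m l * ?Y \<beta> m l) $$ (r, i))"
    by (rule sum.cong[OF refl]) (rule sum.swap)
  also have "\<dots> = (\<Sum>(\<beta>, m, l)\<in>?S. (?Z \<beta> m l * ?Y \<beta> m l) $$ (r, i))"
    using F(1) by (simp add: sum.Sigma sum.cartesian_product split_def del: index_mult_mat)
  finally show "coeff_block \<alpha> \<gamma> (v * w) X $$ (r, i) = msum (n \<gamma>) (n \<alpha>) ?S (\<lambda>(\<beta>, m, l). ?Z \<beta> m l * ?Y \<beta> m l) $$ (r, i)"
    using ri by (simp add: split_def del: index_mult_mat)
qed (auto simp: msum_def coeff_block_def)

text \<open>The two fourth roots at the intermediate irreducible multiply to the identity and can be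
  inserted between the factors of each summand in \<open>coeff_block_mult\<close>. The index set is
  finite because only finitely many irreducibles occur in the products
  \<open>u \<alpha> $$ (l, i) * v\<close>. Right multiplication by v comes before that by w, so the
  block of v is the right factor.\<close>

lemma block_space_mult:
  assumes v: "v \<in> coeff_span" and M: "M \<in> block_space \<alpha> \<gamma> (v * w)"
  shows "\<exists>(S :: ('i \<times> nat \<times> nat) set) Z Y. finite S \<and> (\<forall>s. Z s \<in> block_space (fst s) \<gamma> w \<and> Y s \<in> block_space \<alpha> (fst s) v) \<and>
    M = msum (n \<gamma>) (n \<alpha>) S (\<lambda>s. Z s * Y s)"
proof -
  obtain X where X: "X \<in> carrier_mat (n \<gamma>) (n \<alpha>)" and MX: "M = rho_root \<gamma> * coeff_block \<alpha> \<gamma> (v * w) X * rho_inv_root \<alpha>"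
    using M unfolding block_space_def by blast
  define F where "F = (\<Union>l<n \<alpha>. \<Union>i<n \<alpha>. supp (u \<alpha> $$ (l, i) * v))"
  have F: "finite F" "\<And>l i. l < n \<alpha> \<Longrightarrow> i < n \<alpha> \<Longrightarrow> supp (u \<alpha> $$ (l, i) * v) \<subseteq> F"
    unfolding F_def by (auto intro!: finite_supp coeff_span_mult u_coeff_span v)
  define S where "S = (SIGMA \<beta>:F. {..<n \<beta>} \<times> {..<n \<alpha>})"
  define Z0 where "Z0 = (\<lambda>(\<beta>, m, l). coeff_block \<beta> \<gamma> w (mat (n \<gamma>) (n \<beta>) (\<lambda>(k, m'). if m' = m then X $$ (k, l) else 0)))"
  define Y0 where "Y0 = (\<lambda>(\<beta>, m, l). coeff_block \<alpha> \<beta> v (mat (n \<beta>) (n \<alpha>) (\<lambda>(m', l'). if m' = m then if l' = l then 1 else 0 else 0)))"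
  define Z where "Z s = rho_root \<gamma> * Z0 s * rho_inv_root (fst s)" for s
  define Y where "Y s = rho_root (fst s) * Y0 s * rho_inv_root \<alpha>" for s
  have Z0c: "Z0 s \<in> carrier_mat (n \<gamma>) (n (fst s))" and Y0c: "Y0 s \<in> carrier_mat (n (fst s)) (n \<alpha>)" for s
    by (auto simp: Z0_def Y0_def split_def)
  have ZY: "rho_root \<gamma> * (Z0 s * Y0 s) * rho_inv_root \<alpha> = Z s * Y s" for s
  proof -
    let ?b = "fst s"
    note c1 = mult_carrier_mat[OF rho_root_carrier Z0c, of s] and c2 = mult_carrier_mat[OF Y0c rho_inv_root_carrier, of s]
    have "Z s * Y s = rho_root \<gamma> * Z0 s * rho_inv_root ?b * (rho_root ?b * (Y0 s * rho_inv_root \<alpha>))"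
      unfolding Z_def Y_def assoc_mult_mat[OF rho_root_carrier Y0c rho_inv_root_carrier] ..
    also have "\<dots> = rho_root \<gamma> * Z0 s * (rho_inv_root ?b * (rho_root ?b * (Y0 s * rho_inv_root \<alpha>)))"
      by (rule assoc_mult_mat[OF c1 rho_inv_root_carrier mult_carrier_mat[OF rho_root_carrier c2]])
    also have "rho_inv_root ?b * (rho_root ?b * (Y0 s * rho_inv_root \<alpha>)) = Y0 s * rho_inv_root \<alpha>"
      unfolding assoc_mult_mat[OF rho_inv_root_carrier rho_root_carrier c2, symmetric] rho_root_rho_inv_root by (rule left_mult_one_mat[OF c2])
    also have "rho_root \<gamma> * Z0 s * (Y0 s * rho_inv_root \<alpha>) = rho_root \<gamma> * Z0 s * Y0 s * rho_inv_root \<alpha>"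
      by (rule assoc_mult_mat[OF c1 Y0c rho_inv_root_carrier, symmetric])
    also have "rho_root \<gamma> * Z0 s * Y0 s = rho_root \<gamma> * (Z0 s * Y0 s)"
      by (rule assoc_mult_mat[OF rho_root_carrier Z0c Y0c])
    finally show ?thesis by (rule sym)
  qed
  have e: "coeff_block \<alpha> \<gamma> (v * w) X = msum (n \<gamma>) (n \<alpha>) S (\<lambda>s. Z0 s * Y0 s)"
    using coeff_block_mult[where \<alpha> = \<alpha> and \<gamma> = \<gamma> and F = F and w = w and X = X, OF v F]
    by (simp add: S_def Z0_def Y0_def split_def)
  have "M = msum (n \<gamma>) (n \<alpha>) S (\<lambda>s. rho_root \<gamma> * (Z0 s * Y0 s) * rho_inv_root \<alpha>)"
    unfolding MX e by (rule msum_sandwich[OF rho_root_carrier rho_inv_root_carrier mult_carrier_mat[OF Z0c Y0c]])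
  then have "M = msum (n \<gamma>) (n \<alpha>) S (\<lambda>s. Z s * Y s)" unfolding ZY .
  moreover have "Z s \<in> block_space (fst s) \<gamma> w" for s
    unfolding Z_def Z0_def block_space_def split_def by (rule imageI) simp
  moreover have "Y s \<in> block_space \<alpha> (fst s) v" for s
    unfolding Y_def Y0_def block_space_def split_def by (rule imageI) simp
  moreover have "finite S" using F by (simp add: S_def)
  ultimately show ?thesis by blast
qed

text \<open>Slicing the first leg of the coproduct with g changes only the left index of the
  coordinates and leaves the right index p alone. This is the reason why slicing does not enlarge
  block spaces.\<close>

lemma cop_chi:
  assumes v: "v \<in> coeff_span" and g: "functional g" and kp: "k < n \<beta>" "p < n \<beta>"
  shows "(\<Sum>(c, d)\<leftarrow>cop v. g c * chi \<beta> k p d) = (\<Sum>m<n \<beta>. g (u \<beta> $$ (m, k)) * chi \<beta> m p v)"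
proof (rule functional_eq_coeff_span[OF functional_conv[OF bilinear_product[OF g chi_functional]] _ v])
  show "functional (\<lambda>v. \<Sum>m<n \<beta>. g (u \<beta> $$ (m, k)) * chi \<beta> m p v)"
    by (rule functionalI)
      (simp_all add: functional_add[OF chi_functional] functional_scale[OF chi_functional] distrib_left sum.distrib sum_distrib_left mult_ac)
next
  fix \<alpha> i j assume ij: "i < n \<alpha>" "j < n \<alpha>"
  have "(\<Sum>t<n \<alpha>. g (u \<alpha> $$ (i, t)) * chi \<beta> k p (u \<alpha> $$ (t, j))) = (\<Sum>t<n \<alpha>. if t = k then if \<alpha> = \<beta> \<and> j = p then g (u \<alpha> $$ (i, t)) else 0 else 0)"
    by (rule sum.cong[OF refl]) (use ij in \<open>auto simp: chi_u\<close>)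
  moreover have "(\<Sum>m<n \<beta>. g (u \<beta> $$ (m, k)) * chi \<beta> m p (u \<alpha> $$ (i, j))) = (\<Sum>m<n \<beta>. if m = i then if \<alpha> = \<beta> \<and> j = p then g (u \<beta> $$ (m, k)) else 0 else 0)"
    by (rule sum.cong[OF refl]) (use ij in \<open>auto simp: chi_u\<close>)
  ultimately show "(\<Sum>(c, d)\<leftarrow>cop (u \<alpha> $$ (i, j)). g c * chi \<beta> k p d) = (\<Sum>m<n \<beta>. g (u \<beta> $$ (m, k)) * chi \<beta> m p (u \<alpha> $$ (i, j)))"
    unfolding corep_cop[OF u_corep ij bilinear_product[OF g chi_functional]] using kp ij by auto
qed

text \<open>The pairing of the algebra with the element of \<open>c00\<close> whose only component
  is y, at \<delta>.\<close>

definition matfun :: "'i \<Rightarrow> complex mat \<Rightarrow> 'a \<Rightarrow> complex" where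
  "matfun \<delta> y a = (\<Sum>s<n \<delta>. \<Sum>t<n \<delta>. y $$ (s, t) * chi \<delta> s t a)"

lemma matfun_functional: "functional (matfun \<delta> y)"
  unfolding matfun_def
  by (rule functionalI)
    (simp_all add: functional_add[OF chi_functional] functional_scale[OF chi_functional] distrib_left sum.distrib sum_distrib_left mult_ac)

lemma matfun_u:
  assumes "k < n \<beta>" "l < n \<beta>"
  shows "matfun \<delta> y (u \<beta> $$ (k, l)) = (if \<beta> = \<delta> then y $$ (k, l) else 0)"
proof -
  have "matfun \<delta> y (u \<beta> $$ (k, l)) = (\<Sum>s<n \<delta>. if s = k then \<Sum>t<n \<delta>. if t = l then if \<beta> = \<delta> then y $$ (k, l) else 0 else 0 else 0)"
    unfolding matfun_def by (intro sum.cong refl) (use assms in \<open>auto simp: chi_u[OF assms] mult_indicator\<close>)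
  then show ?thesis using assms by auto
qed

text \<open>Right multiplication of \<open>z\<close> by \<open>y\<close> becomes slicing the first leg of the coproduct of \<open>ft z\<close>
  with the modular conjugate \<open>\<rho>\<^sup>-\<^sup>1 y \<rho>\<close>.\<close>

lemma ft_right_mult:
  assumes z: "z \<in> c00 n" and y: "y \<in> carrier_mat (n \<delta>) (n \<delta>)" and h: "functional h"
  shows "h (ft (single n \<delta> (z \<delta> * y))) = (\<Sum>(a, b)\<leftarrow>cop (ft z). matfun \<delta> (rinv \<delta> * (y * \<rho> \<delta>)) a * h b)"
proof -
  let ?y = "rinv \<delta> * (y * \<rho> \<delta>)"
  have yc: "?y \<in> carrier_mat (n \<delta>) (n \<delta>)"
    by (rule mult_carrier_mat[OF rinv_carrier mult_carrier_mat[OF y rho_carrier]])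
  note zc = c00D[OF z]
  define F where "F = insert \<delta> {\<alpha>. z \<alpha> \<noteq> 0\<^sub>m (n \<alpha>) (n \<alpha>)}"
  have F: "supported F z" "finite F" "\<delta> \<in> F" using c00_supported[OF z] by (auto simp: F_def supported_def)
  have sup: "supported {\<delta>} (single n \<delta> (z \<delta> * y))"
    using mult_carrier_mat[OF zc y] by (auto simp: supported_def single_def)
  note b = bilinear_product[OF matfun_functional[of \<delta> ?y] h]
  \<comment> \<open>The Fourier transform multiplies by \<rho> on the right of y; moving y past
    \<rho> conjugates it.\<close>
  have "z \<delta> * \<rho> \<delta> * ?y = z \<delta> * (\<rho> \<delta> * ?y)"
    by (rule assoc_mult_mat[OF zc rho_carrier yc])
  also have "\<rho> \<delta> * ?y = y * \<rho> \<delta>"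
    unfolding assoc_mult_mat[OF rho_carrier rinv_carrier mult_carrier_mat[OF y rho_carrier], symmetric] rinv_rho
    by (rule left_mult_one_mat[OF mult_carrier_mat[OF y rho_carrier]])
  also have "z \<delta> * (y * \<rho> \<delta>) = z \<delta> * y * \<rho> \<delta>"
    by (rule assoc_mult_mat[OF zc y rho_carrier, symmetric])
  finally have zy: "z \<delta> * y * \<rho> \<delta> = z \<delta> * \<rho> \<delta> * ?y" by (rule sym)
  have zy_index: "(z \<delta> * y * \<rho> \<delta>) $$ (j, k) = (\<Sum>i<n \<delta>. (z \<delta> * \<rho> \<delta>) $$ (j, i) * ?y $$ (i, k))"
    if "j < n \<delta>" "k < n \<delta>" for j k
    unfolding zy by (rule mult_mat_index[OF mult_carrier_mat[OF zc rho_carrier] yc that])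
  have "(\<Sum>(a, b)\<leftarrow>cop (ft z). matfun \<delta> ?y a * h b) =
      (\<Sum>\<alpha>\<in>F. \<Sum>i<n \<alpha>. \<Sum>j<n \<alpha>. dimq \<alpha> * (z \<alpha> * \<rho> \<alpha>) $$ (j, i) * (\<Sum>(a, b)\<leftarrow>cop (u \<alpha> $$ (i, j)). matfun \<delta> ?y a * h b))"
    by (rule functional_ft[OF F(1) functional_conv[OF b]])
  also have "\<dots> = (\<Sum>\<alpha>\<in>F. if \<alpha> = \<delta> then \<Sum>i<n \<delta>. \<Sum>j<n \<delta>. \<Sum>k<n \<delta>. dimq \<delta> * (z \<delta> * \<rho> \<delta>) $$ (j, i) * ?y $$ (i, k) * h (u \<delta> $$ (k, j)) else 0)"
  proof (rule sum.cong[OF refl])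
    fix \<alpha>
    have "(\<Sum>(a, b)\<leftarrow>cop (u \<alpha> $$ (i, j)). matfun \<delta> ?y a * h b) =
        (if \<alpha> = \<delta> then \<Sum>k<n \<delta>. ?y $$ (i, k) * h (u \<delta> $$ (k, j)) else 0)" if "i < n \<alpha>" "j < n \<alpha>" for i j
      unfolding corep_cop[OF u_corep that b] using that by (auto simp: matfun_u simp del: index_mult_mat)
    then show "(\<Sum>i<n \<alpha>. \<Sum>j<n \<alpha>. dimq \<alpha> * (z \<alpha> * \<rho> \<alpha>) $$ (j, i) * (\<Sum>(a, b)\<leftarrow>cop (u \<alpha> $$ (i, j)). matfun \<delta> ?y a * h b)) =
      (if \<alpha> = \<delta> then \<Sum>i<n \<delta>. \<Sum>j<n \<delta>. \<Sum>k<n \<delta>. dimq \<delta> * (z \<delta> * \<rho> \<delta>) $$ (j, i) * ?y $$ (i, k) * h (u \<delta> $$ (k, j)) else 0)"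
      by (auto simp: sum_distrib_left mult.assoc simp del: index_mult_mat)
  qed
  also have "\<dots> = (\<Sum>i<n \<delta>. \<Sum>j<n \<delta>. \<Sum>k<n \<delta>. dimq \<delta> * (z \<delta> * \<rho> \<delta>) $$ (j, i) * ?y $$ (i, k) * h (u \<delta> $$ (k, j)))"
    using F by (simp del: index_mult_mat)
  also have "\<dots> = (\<Sum>i<n \<delta>. \<Sum>k<n \<delta>. \<Sum>j<n \<delta>. dimq \<delta> * (z \<delta> * \<rho> \<delta>) $$ (j, i) * ?y $$ (i, k) * h (u \<delta> $$ (k, j)))"
    by (rule sum.cong[OF refl]) (rule sum.swap)
  also have "\<dots> = (\<Sum>k<n \<delta>. \<Sum>i<n \<delta>. \<Sum>j<n \<delta>. dimq \<delta> * (z \<delta> * \<rho> \<delta>) $$ (j, i) * ?y $$ (i, k) * h (u \<delta> $$ (k, j)))"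
    by (rule sum.swap)
  also have "\<dots> = (\<Sum>k<n \<delta>. \<Sum>j<n \<delta>. \<Sum>i<n \<delta>. dimq \<delta> * (z \<delta> * \<rho> \<delta>) $$ (j, i) * ?y $$ (i, k) * h (u \<delta> $$ (k, j)))"
    by (rule sum.cong[OF refl]) (rule sum.swap)
  also have "\<dots> = (\<Sum>k<n \<delta>. \<Sum>j<n \<delta>. dimq \<delta> * (z \<delta> * y * \<rho> \<delta>) $$ (j, k) * h (u \<delta> $$ (k, j)))"
    by (intro sum.cong[OF refl]) (simp add: zy_index sum_distrib_left sum_distrib_right mult.assoc del: index_mult_mat)
  also have "\<dots> = h (ft (single n \<delta> (z \<delta> * y)))"
    unfolding functional_ft[OF sup h] by (simp del: index_mult_mat)
  finally show ?thesis by (rule sym)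
qed

text \<open>Expanding the coproduct of \<open>u \<alpha> $$ (l', i) * w\<close> multiplicatively and
  summing over l' against the adjoint of \<open>u \<alpha>\<close> leaves the single index l by
  unitarity. A left factor outside the coproduct is thus moved inside, at the price of a modified
  slicing functional.\<close>

lemma slice_u_mult:
  assumes li: "l < n \<alpha>" "i < n \<alpha>" and y: "functional y" and f: "functional f"
  shows "(\<Sum>(a, b)\<leftarrow>cop w. y a * f (u \<alpha> $$ (l, i) * b)) =
    (\<Sum>l'<n \<alpha>. \<Sum>(c, d)\<leftarrow>cop (u \<alpha> $$ (l', i) * w). y (star (u \<alpha> $$ (l', l)) * c) * f d)"
proof -
  have term_eq: "(\<Sum>(c, d)\<leftarrow>cop (u \<alpha> $$ (l', i) * w). y (star (u \<alpha> $$ (l', l)) * c) * f d) =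
      (\<Sum>s<n \<alpha>. \<Sum>(c, d)\<leftarrow>cop w. y (star (u \<alpha> $$ (l', l)) * u \<alpha> $$ (l', s) * c) * f (u \<alpha> $$ (s, i) * d))"
    if l': "l' < n \<alpha>" for l'
  proof -
    define G where "G c d = y (star (u \<alpha> $$ (l', l)) * c) * f d" for c d
    have G: "bilinear_form smul G" unfolding G_def by (rule bilinear_product[OF functional_mult_left[OF y] f])
    have Gl: "functional (\<lambda>x. G x b)" and Gr: "functional (\<lambda>x. G b x)" for b
      using G unfolding bilinear_form_def by blast+
    have H: "bilinear_form smul (\<lambda>a b. \<Sum>(c, d)\<leftarrow>cop w. G (a * c) (b * d))"
    proof (rule bilinearI)
      show "functional (\<lambda>a. \<Sum>(c, d)\<leftarrow>cop w. G (a * c) (b * d))" for b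
        by (rule functionalI)
          (simp_all add: distrib_right scale_mult_left functional_add[OF Gl] functional_scale[OF Gl] split_def sum_list_addf sum_list_const_mult)
      show "functional (\<lambda>b. \<Sum>(c, d)\<leftarrow>cop w. G (a * c) (b * d))" for a
        by (rule functionalI)
          (simp_all add: distrib_right scale_mult_left functional_add[OF Gr] functional_scale[OF Gr] split_def sum_list_addf sum_list_const_mult)
    qed
    have "(\<Sum>(c, d)\<leftarrow>cop (u \<alpha> $$ (l', i) * w). G c d) =
        (\<Sum>(x, y)\<leftarrow>[(a * c, b * d). (a, b) \<leftarrow> cop (u \<alpha> $$ (l', i)), (c, d) \<leftarrow> cop w]. G x y)"
      using cop_mult[of "u \<alpha> $$ (l', i)" w] G unfolding tensor_eq_def by blast
    also have "\<dots> = (\<Sum>(a, b)\<leftarrow>cop (u \<alpha> $$ (l', i)). \<Sum>(c, d)\<leftarrow>cop w. G (a * c) (b * d))"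
      by (rule sum_list_product)
    also have "\<dots> = (\<Sum>s<n \<alpha>. \<Sum>(c, d)\<leftarrow>cop w. G (u \<alpha> $$ (l', s) * c) (u \<alpha> $$ (s, i) * d))"
      by (rule corep_cop[OF u_corep l' li(2) H])
    finally show ?thesis unfolding G_def by (simp add: mult.assoc)
  qed
  have "(\<Sum>l'<n \<alpha>. \<Sum>(c, d)\<leftarrow>cop (u \<alpha> $$ (l', i) * w). y (star (u \<alpha> $$ (l', l)) * c) * f d) =
      (\<Sum>l'<n \<alpha>. \<Sum>s<n \<alpha>. \<Sum>(c, d)\<leftarrow>cop w. y (star (u \<alpha> $$ (l', l)) * u \<alpha> $$ (l', s) * c) * f (u \<alpha> $$ (s, i) * d))"
    by (rule sum.cong[OF refl]) (simp add: term_eq)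
  also have "\<dots> = (\<Sum>s<n \<alpha>. \<Sum>l'<n \<alpha>. \<Sum>(c, d)\<leftarrow>cop w. y (star (u \<alpha> $$ (l', l)) * u \<alpha> $$ (l', s) * c) * f (u \<alpha> $$ (s, i) * d))"
    by (rule sum.swap)
  also have "\<dots> = (\<Sum>s<n \<alpha>. \<Sum>(c, d)\<leftarrow>cop w. y ((\<Sum>l'<n \<alpha>. star (u \<alpha> $$ (l', l)) * u \<alpha> $$ (l', s)) * c) * f (u \<alpha> $$ (s, i) * d))"
  proof (rule sum.cong[OF refl])
    fix s
    have "(\<Sum>l'\<in>L. \<Sum>(c, d)\<leftarrow>xs. y (star (u \<alpha> $$ (l', l)) * u \<alpha> $$ (l', s) * c) * f (u \<alpha> $$ (s, i) * d)) =
        (\<Sum>(c, d)\<leftarrow>xs. y ((\<Sum>l'\<in>L. star (u \<alpha> $$ (l', l)) * u \<alpha> $$ (l', s)) * c) * f (u \<alpha> $$ (s, i) * d))" for L xs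
      by (induction xs) (simp_all add: split_def sum.distrib sum_distrib_right functional_sum[OF y])
    then show "(\<Sum>l'<n \<alpha>. \<Sum>(c, d)\<leftarrow>cop w. y (star (u \<alpha> $$ (l', l)) * u \<alpha> $$ (l', s) * c) * f (u \<alpha> $$ (s, i) * d)) =
        (\<Sum>(c, d)\<leftarrow>cop w. y ((\<Sum>l'<n \<alpha>. star (u \<alpha> $$ (l', l)) * u \<alpha> $$ (l', s)) * c) * f (u \<alpha> $$ (s, i) * d))" .
  qed
  also have "\<dots> = (\<Sum>s<n \<alpha>. if s = l then \<Sum>(c, d)\<leftarrow>cop w. y c * f (u \<alpha> $$ (l, i) * d) else 0)"
  proof (rule sum.cong[OF refl])
    fix s assume "s \<in> {..<n \<alpha>}"
    then have "(\<Sum>l'<n \<alpha>. star (u \<alpha> $$ (l', l)) * u \<alpha> $$ (l', s)) = (if s = l then 1 else 0)"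
      using corep_star_mult[OF u_corep li(1), of s] by auto
    then show "(\<Sum>(c, d)\<leftarrow>cop w. y ((\<Sum>l'<n \<alpha>. star (u \<alpha> $$ (l', l)) * u \<alpha> $$ (l', s)) * c) * f (u \<alpha> $$ (s, i) * d)) =
        (if s = l then \<Sum>(c, d)\<leftarrow>cop w. y c * f (u \<alpha> $$ (l, i) * d) else 0)"
      by (simp add: functional_0[OF y] split_def)
  qed
  also have "\<dots> = (\<Sum>(c, d)\<leftarrow>cop w. y c * f (u \<alpha> $$ (l, i) * d))" using li by simp
  finally show ?thesis by (rule sym)
qed

text \<open>Right multiplication by y is a slice by \<open>ft_right_mult\<close>;
  \<open>slice_u_mult\<close> carries the left factor into the coproduct; and by
  \<open>cop_chi\<close> the slice acts on left indices only, where it is absorbed into a new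
  weight.\<close>

lemma block_space_right_mult:
  assumes z: "z \<in> c00 n" and y: "y \<in> carrier_mat (n \<delta>) (n \<delta>)"
  shows "block_space \<alpha> \<beta> (ft (single n \<delta> (z \<delta> * y))) \<subseteq> block_space \<alpha> \<beta> (ft z)"
proof
  fix M assume "M \<in> block_space \<alpha> \<beta> (ft (single n \<delta> (z \<delta> * y)))"
  then obtain X where X: "X \<in> carrier_mat (n \<beta>) (n \<alpha>)"
    and M: "M = rho_root \<beta> * coeff_block \<alpha> \<beta> (ft (single n \<delta> (z \<delta> * y))) X * rho_inv_root \<alpha>" unfolding block_space_def by blast
  define g where "g l l' a = matfun \<delta> (rinv \<delta> * (y * \<rho> \<delta>)) (star (u \<alpha> $$ (l', l)) * a)" for l l' a
  have g: "functional (g l l')" for l l'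
    unfolding g_def by (rule functional_mult_left[OF matfun_functional])
  have chi_eq: "chi \<beta> k p (u \<alpha> $$ (l, i) * ft (single n \<delta> (z \<delta> * y))) =
      (\<Sum>l'<n \<alpha>. \<Sum>m<n \<beta>. g l l' (u \<beta> $$ (m, k)) * chi \<beta> m p (u \<alpha> $$ (l', i) * ft z))"
    if "k < n \<beta>" "p < n \<beta>" "l < n \<alpha>" "i < n \<alpha>" for k p l i
  proof -
    have "chi \<beta> k p (u \<alpha> $$ (l, i) * ft (single n \<delta> (z \<delta> * y))) =
        (\<Sum>(a, b)\<leftarrow>cop (ft z). matfun \<delta> (rinv \<delta> * (y * \<rho> \<delta>)) a * chi \<beta> k p (u \<alpha> $$ (l, i) * b))"
      by (rule ft_right_mult[OF z y functional_mult_left[OF chi_functional]])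
    also have "\<dots> = (\<Sum>l'<n \<alpha>. \<Sum>(c, d)\<leftarrow>cop (u \<alpha> $$ (l', i) * ft z). g l l' c * chi \<beta> k p d)"
      unfolding g_def by (rule slice_u_mult[OF that(3,4) matfun_functional chi_functional])
    also have "\<dots> = (\<Sum>l'<n \<alpha>. \<Sum>m<n \<beta>. g l l' (u \<beta> $$ (m, k)) * chi \<beta> m p (u \<alpha> $$ (l', i) * ft z))"
      by (rule sum.cong[OF refl], rule cop_chi) (use that in \<open>auto intro!: coeff_span_mult u_coeff_span ft_coeff_span g\<close>)
    finally show ?thesis .
  qed
  define X' where "X' = mat (n \<beta>) (n \<alpha>) (\<lambda>(m, l'). \<Sum>k<n \<beta>. \<Sum>l<n \<alpha>. X $$ (k, l) * g l l' (u \<beta> $$ (m, k)))"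
  have e: "coeff_block \<alpha> \<beta> (ft (single n \<delta> (z \<delta> * y))) X = coeff_block \<alpha> \<beta> (ft z) X'"
  proof (rule eq_matI)
    fix p i assume "p < dim_row (coeff_block \<alpha> \<beta> (ft z) X')" "i < dim_col (coeff_block \<alpha> \<beta> (ft z) X')"
    then have pi: "p < n \<beta>" "i < n \<alpha>" by (auto simp: coeff_block_def)
    have "coeff_block \<alpha> \<beta> (ft (single n \<delta> (z \<delta> * y))) X $$ (p, i) = (\<Sum>k<n \<beta>. \<Sum>l<n \<alpha>. \<Sum>l'<n \<alpha>. \<Sum>m<n \<beta>.
        X $$ (k, l) * (g l l' (u \<beta> $$ (m, k)) * chi \<beta> m p (u \<alpha> $$ (l', i) * ft z)))"
      unfolding coeff_block_index[OF pi] by (intro sum.cong[OF refl]) (use pi in \<open>simp add: chi_eq sum_distrib_left\<close>)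
    also have "\<dots> = (\<Sum>m<n \<beta>. \<Sum>l'<n \<alpha>. \<Sum>k<n \<beta>. \<Sum>l<n \<alpha>.
        X $$ (k, l) * (g l l' (u \<beta> $$ (m, k)) * chi \<beta> m p (u \<alpha> $$ (l', i) * ft z)))"
      by (rule sum4_reorder)
    also have "\<dots> = coeff_block \<alpha> \<beta> (ft z) X' $$ (p, i)"
      unfolding coeff_block_index[OF pi] by (intro sum.cong[OF refl]) (simp add: X'_def sum_distrib_right mult.assoc)
    finally show "coeff_block \<alpha> \<beta> (ft (single n \<delta> (z \<delta> * y))) X $$ (p, i) = coeff_block \<alpha> \<beta> (ft z) X' $$ (p, i)" .
  qed (auto simp: coeff_block_def)
  show "M \<in> block_space \<alpha> \<beta> (ft z)" unfolding M block_space_def e by (rule imageI) (simp add: X'_def)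
qed

end

lemma msum_mult_right:
  assumes f: "\<And>s. s \<in> K \<Longrightarrow> f s \<in> carrier_mat a b" and B: "B \<in> carrier_mat b c"
  shows "msum a b K f * B = msum a c K (\<lambda>s. f s * B)"
proof (rule eq_matI)
  fix i j assume "i < dim_row (msum a c K (\<lambda>s. f s * B))" "j < dim_col (msum a c K (\<lambda>s. f s * B))"
  then have ij: "i < a" "j < c" by (auto simp: msum_def)
  have "(msum a b K f * B) $$ (i, j) = (\<Sum>k<b. \<Sum>s\<in>K. f s $$ (i, k) * B $$ (k, j))"
    unfolding mult_mat_index[OF msum_carrier B ij] by (rule sum.cong) (use ij in \<open>auto simp: sum_distrib_right\<close>)
  also have "\<dots> = (\<Sum>s\<in>K. \<Sum>k<b. f s $$ (i, k) * B $$ (k, j))" by (rule sum.swap)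
  also have "\<dots> = (\<Sum>s\<in>K. (f s * B) $$ (i, j))"
    by (rule sum.cong[OF refl]) (simp add: mult_mat_index[OF f B ij] del: index_mult_mat)
  finally show "(msum a b K f * B) $$ (i, j) = msum a c K (\<lambda>s. f s * B) $$ (i, j)" using ij by simp
qed (use B in \<open>auto simp: msum_def\<close>)

lemma msum_group:
  fixes f :: "'b \<times> nat \<Rightarrow> complex mat"
  assumes "finite S" "\<And>s. s \<in> S \<Longrightarrow> snd s < N"
  shows "msum a b S f = msum a b {..<N} (\<lambda>k. msum a b {s \<in> S. snd s = k} f)"
proof (rule eq_matI)
  fix i j assume "i < dim_row (msum a b {..<N} (\<lambda>k. msum a b {s \<in> S. snd s = k} f))"
    "j < dim_col (msum a b {..<N} (\<lambda>k. msum a b {s \<in> S. snd s = k} f))"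
  then have ij: "i < a" "j < b" by (auto simp: msum_def)
  have "(\<Sum>k<N. \<Sum>s | s \<in> S \<and> snd s = k. f s $$ (i, j)) = (\<Sum>s\<in>S. f s $$ (i, j))"
    by (rule sum.group) (use assms in auto)
  then show "msum a b S f $$ (i, j) = msum a b {..<N} (\<lambda>k. msum a b {s \<in> S. snd s = k} f) $$ (i, j)"
    using ij by simp
qed (auto simp: msum_def)

section \<open>Covering the blocks of one projection by powers of another\<close>

context discrete_quantum_group
begin

text \<open>Linearity of \<open>ft\<close> across components. Each component has its own index set
  because the number of convolution powers needed varies with \<delta>.\<close>

lemma ft_decompose:
  assumes x: "supported F x"
    and f: "\<And>\<delta> k. \<delta> \<in> F \<Longrightarrow> f \<delta> k \<in> carrier_mat (n \<delta>) (n \<delta>)"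
    and xf: "\<And>\<delta>. \<delta> \<in> F \<Longrightarrow> x \<delta> = msum (n \<delta>) (n \<delta>) (K \<delta>) (f \<delta>)"
    and K: "\<And>\<delta>. \<delta> \<in> F \<Longrightarrow> finite (K \<delta>)"
  shows "ft x = (\<Sum>s\<in>(SIGMA \<delta>:F. K \<delta>). ft (single n (fst s) (f (fst s) (snd s))))"
proof (rule functionals_separate)
  fix h assume h: "functional h"
  have F: "finite F" using x by (simp add: supported_def)
  have "h (ft x) = (\<Sum>\<delta>\<in>F. \<Sum>k\<in>K \<delta>. h (ft (single n \<delta> (f \<delta> k))))"
    unfolding functional_ft[OF x h]
  proof (rule sum.cong[OF refl])
    fix \<delta> assume \<delta>: "\<delta> \<in> F"
    have xr: "x \<delta> * \<rho> \<delta> = msum (n \<delta>) (n \<delta>) (K \<delta>) (\<lambda>k. f \<delta> k * \<rho> \<delta>)"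
      unfolding xf[OF \<delta>] by (rule msum_mult_right[OF f[OF \<delta>] rho_carrier])
    have "(\<Sum>i<n \<delta>. \<Sum>j<n \<delta>. dimq \<delta> * (x \<delta> * \<rho> \<delta>) $$ (j, i) * h (u \<delta> $$ (i, j))) =
        (\<Sum>i<n \<delta>. \<Sum>j<n \<delta>. \<Sum>k\<in>K \<delta>. dimq \<delta> * (f \<delta> k * \<rho> \<delta>) $$ (j, i) * h (u \<delta> $$ (i, j)))"
      unfolding xr by (intro sum.cong[OF refl]) (simp add: sum_distrib_left sum_distrib_right del: index_mult_mat)
    also have "\<dots> = (\<Sum>i<n \<delta>. \<Sum>k\<in>K \<delta>. \<Sum>j<n \<delta>. dimq \<delta> * (f \<delta> k * \<rho> \<delta>) $$ (j, i) * h (u \<delta> $$ (i, j)))"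
      by (rule sum.cong[OF refl]) (rule sum.swap)
    also have "\<dots> = (\<Sum>k\<in>K \<delta>. \<Sum>i<n \<delta>. \<Sum>j<n \<delta>. dimq \<delta> * (f \<delta> k * \<rho> \<delta>) $$ (j, i) * h (u \<delta> $$ (i, j)))"
      by (rule sum.swap)
    also have "\<dots> = (\<Sum>k\<in>K \<delta>. h (ft (single n \<delta> (f \<delta> k))))"
    proof (rule sum.cong[OF refl])
      fix k
      have "supported {\<delta>} (single n \<delta> (f \<delta> k))" using f[OF \<delta>] by (auto simp: supported_def single_def)
      from functional_ft[OF this h]
      show "(\<Sum>i<n \<delta>. \<Sum>j<n \<delta>. dimq \<delta> * (f \<delta> k * \<rho> \<delta>) $$ (j, i) * h (u \<delta> $$ (i, j))) = h (ft (single n \<delta> (f \<delta> k)))"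
        by (simp del: index_mult_mat)
    qed
    finally show "(\<Sum>i<n \<delta>. \<Sum>j<n \<delta>. dimq \<delta> * (x \<delta> * \<rho> \<delta>) $$ (j, i) * h (u \<delta> $$ (i, j))) =
        (\<Sum>k\<in>K \<delta>. h (ft (single n \<delta> (f \<delta> k))))" .
  qed
  then show "h (ft x) = h (\<Sum>s\<in>(SIGMA \<delta>:F. K \<delta>). ft (single n (fst s) (f (fst s) (snd s))))"
    unfolding functional_sum[OF h] using F K by (simp add: sum.Sigma split_def)
qed

lemma generating_c00: "generating_projection n u \<rho> D R P \<Longrightarrow> P \<in> c00 n"
  by (simp add: generating_projection_def)

text \<open>The decomposition of \<open>ft P1\<close> into slices of powers of \<open>ft P2\<close>
  is fixed before a block is chosen, so N does not depend on \<alpha> and \<beta>. This uniformity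
  is the source of the Lipschitz constant.\<close>

lemma block_space_cover:
  assumes P1: "P1 \<in> c00 n" and P2: "generating_projection n u \<rho> D R P2"
  shows "\<exists>N. \<forall>\<alpha> \<beta>. \<forall>M\<in>block_space \<alpha> \<beta> (ft P1). \<exists>f. (\<forall>k. f k \<in> block_space \<alpha> \<beta> (ft P2 ^ Suc k)) \<and> M = msum (n \<beta>) (n \<alpha>) {..<N} f"
proof -
  \<comment> \<open>The supremum runs over exponents at least 1, while z is counted from 0.\<close>
  define z where "z k = conv_power n \<rho> D P2 (Suc k)" for k
  have z: "z k \<in> c00 n" and ftz: "ft (z k) = ft P2 ^ Suc k" for k
    using conv_power_ft[OF generating_c00[OF P2], of k] unfolding z_def by blast+
  have "{range_proj n (conv_power n \<rho> D P2 k) | k. k \<ge> 1} = range (\<lambda>k. range_proj n (z k))"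
  proof
    show "{range_proj n (conv_power n \<rho> D P2 k) | k. k \<ge> 1} \<subseteq> range (\<lambda>k. range_proj n (z k))"
    proof
      fix x assume "x \<in> {range_proj n (conv_power n \<rho> D P2 k) | k. k \<ge> 1}"
      then obtain k where k: "k \<ge> 1" and x: "x = range_proj n (conv_power n \<rho> D P2 k)" by blast
      have "x = range_proj n (z (k - 1))" unfolding x z_def using k by simp
      then show "x \<in> range (\<lambda>k. range_proj n (z k))" by (rule range_eqI)
    qed
    show "range (\<lambda>k. range_proj n (z k)) \<subseteq> {range_proj n (conv_power n \<rho> D P2 k) | k. k \<ge> 1}"
    proof
      fix x assume "x \<in> range (\<lambda>k. range_proj n (z k))"
      then obtain k where x: "x = range_proj n (z k)" by (rule rangeE)
      show "x \<in> {range_proj n (conv_power n \<rho> D P2 k) | k. k \<ge> 1}"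
        unfolding x z_def mem_Collect_eq by (rule exI[of _ "Suc k"]) simp
    qed
  qed
  then have sup: "is_proj_sup n (range (\<lambda>k. range_proj n (z k))) (fone n)"
    using P2 by (simp add: generating_projection_def)
  have "\<forall>\<delta>. \<exists>N y. (\<forall>k. y k \<in> carrier_mat (n \<delta>) (n \<delta>)) \<and> 1\<^sub>m (n \<delta>) = msum (n \<delta>) (n \<delta>) {..<N :: nat} (\<lambda>k. z k \<delta> * y k)"
    by (intro allI range_proj_sup_cover[OF c00D[OF z] sup])
  then obtain N where "\<forall>\<delta>. \<exists>y. (\<forall>k. y k \<in> carrier_mat (n \<delta>) (n \<delta>)) \<and> 1\<^sub>m (n \<delta>) = msum (n \<delta>) (n \<delta>) {..<N \<delta> :: nat} (\<lambda>k. z k \<delta> * y k)"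
    by (rule choice[THEN exE])
  then obtain y where y: "\<forall>\<delta>. (\<forall>k. y \<delta> k \<in> carrier_mat (n \<delta>) (n \<delta>)) \<and> 1\<^sub>m (n \<delta>) = msum (n \<delta>) (n \<delta>) {..<N \<delta>} (\<lambda>k. z k \<delta> * y \<delta> k)"
    by (rule choice[THEN exE])
  have yc: "y \<delta> k \<in> carrier_mat (n \<delta>) (n \<delta>)" for \<delta> k
    by (rule conjunct1[OF spec[OF y], rule_format])
  have one: "1\<^sub>m (n \<delta>) = msum (n \<delta>) (n \<delta>) {..<N \<delta>} (\<lambda>k. z k \<delta> * y \<delta> k)" for \<delta>
    by (rule conjunct2[OF spec[OF y]])
  define F where "F = {\<delta>. P1 \<delta> \<noteq> 0\<^sub>m (n \<delta>) (n \<delta>)}"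
  have F: "supported F P1" "finite F" using c00_supported[OF P1] by (auto simp: F_def supported_def)
  \<comment> \<open>Multiplying the decomposition of the identity by \<open>P1 \<delta>\<close> on
    the right writes \<open>P1 \<delta>\<close> as a sum of right multiples of the
    \<open>z k \<delta>\<close>.\<close>
  define w where "w \<delta> k = y \<delta> k * P1 \<delta>" for \<delta> k
  have wc: "w \<delta> k \<in> carrier_mat (n \<delta>) (n \<delta>)" for \<delta> k
    unfolding w_def by (rule mult_carrier_mat[OF yc c00D[OF P1]])
  have "P1 \<delta> = msum (n \<delta>) (n \<delta>) {..<N \<delta>} (\<lambda>k. z k \<delta> * w \<delta> k)" for \<delta>
  proof -
    have "P1 \<delta> = 1\<^sub>m (n \<delta>) * P1 \<delta>" by (rule left_mult_one_mat[OF c00D[OF P1], symmetric])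
    also have "\<dots> = msum (n \<delta>) (n \<delta>) {..<N \<delta>} (\<lambda>k. z k \<delta> * y \<delta> k * P1 \<delta>)"
      unfolding one by (rule msum_mult_right[OF mult_carrier_mat[OF c00D[OF z] yc] c00D[OF P1]])
    finally show ?thesis unfolding w_def assoc_mult_mat[OF c00D[OF z] yc c00D[OF P1]] .
  qed
  then have ftP1: "ft P1 = (\<Sum>s\<in>(SIGMA \<delta>:F. {..<N \<delta>}). ft (single n (fst s) (z (snd s) (fst s) * w (fst s) (snd s))))"
    by (intro ft_decompose[OF F(1)] mult_carrier_mat[OF c00D[OF z] wc]) auto
  let ?S = "SIGMA \<delta>:F. {..<N \<delta>}"
  \<comment> \<open>Dominates \<open>N \<delta>\<close> for every \<delta> in the finite support of
    P1.\<close>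
  define M' where "M' = (\<Sum>\<delta>\<in>F. N \<delta>)"
  have S: "finite ?S" "\<And>s. s \<in> ?S \<Longrightarrow> snd s < M'"
  proof -
    show "finite ?S" using F by simp
    fix s assume s: "s \<in> ?S"
    then have "snd s < N (fst s)" "fst s \<in> F" by auto
    moreover have "N (fst s) \<le> M'" unfolding M'_def using F \<open>fst s \<in> F\<close> by (intro member_le_sum) auto
    ultimately show "snd s < M'" by simp
  qed
  show ?thesis
  proof (rule exI[of _ M'], intro allI ballI)
    fix \<alpha> \<beta> M assume "M \<in> block_space \<alpha> \<beta> (ft P1)"
    then obtain f where f: "\<forall>s. f s \<in> block_space \<alpha> \<beta> (ft (single n (fst s) (z (snd s) (fst s) * w (fst s) (snd s))))"
      and M: "M = msum (n \<beta>) (n \<alpha>) ?S f"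
      unfolding ftP1 using block_space_sum_decompose by blast
    have f': "f s \<in> block_space \<alpha> \<beta> (ft P2 ^ Suc (snd s))" for s
      using block_space_right_mult[OF z wc] f unfolding ftz[symmetric] by blast
    show "\<exists>f. (\<forall>k. f k \<in> block_space \<alpha> \<beta> (ft P2 ^ Suc k)) \<and> M = msum (n \<beta>) (n \<alpha>) {..<M'} f"
    proof (intro exI conjI allI)
      show "M = msum (n \<beta>) (n \<alpha>) {..<M'} (\<lambda>k. msum (n \<beta>) (n \<alpha>) {s \<in> ?S. snd s = k} f)"
        unfolding M by (rule msum_group[OF S])
      \<comment> \<open>For an exponent without summands this is the empty sum, the zero matrix,
        which lies in every block space.\<close>
      show "msum (n \<beta>) (n \<alpha>) {s \<in> ?S. snd s = k} f \<in> block_space \<alpha> \<beta> (ft P2 ^ Suc k)" for k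
        using f' by (intro block_space_msum) auto
    qed
  qed
qed

end

section \<open>Weak* closures of spaces of operators\<close>

lemma hspace_zero [simp]: "(\<lambda>_. 0) \<in> hspace n"
  by (simp add: hspace_def)

lemma hspace_summable: "\<xi> \<in> hspace n \<Longrightarrow> (\<lambda>p. (cmod (\<xi> p))\<^sup>2) summable_on UNIV"
  by (simp add: hspace_def)

lemma hspace_outside: "\<xi> \<in> hspace n \<Longrightarrow> n \<alpha> \<le> k \<Longrightarrow> \<xi> (\<alpha>, k) = 0"
  by (simp add: hspace_def)

lemma cmod_lincomb_square_le:
  "(cmod (c * x + d * y))\<^sup>2 \<le> 2 * (cmod c)\<^sup>2 * (cmod x)\<^sup>2 + 2 * (cmod d)\<^sup>2 * (cmod y)\<^sup>2"
proof -
  have "cmod (c * x + d * y) \<le> cmod c * cmod x + cmod d * cmod y"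
    by (metis norm_triangle_ineq norm_mult)
  then have "(cmod (c * x + d * y))\<^sup>2 \<le> (cmod c * cmod x + cmod d * cmod y)\<^sup>2"
    by (intro power_mono) auto
  also have "\<dots> \<le> 2 * (cmod c * cmod x)\<^sup>2 + 2 * (cmod d * cmod y)\<^sup>2"
    using sum_squares_bound[of "cmod c * cmod x" "cmod d * cmod y"] by (simp add: power2_sum)
  finally show ?thesis by (simp add: power_mult_distrib)
qed

lemma hspace_lincomb:
  assumes "\<xi> \<in> hspace n" "\<eta> \<in> hspace n"
  shows "(\<lambda>p. c * \<xi> p + d * \<eta> p) \<in> hspace n"
proof -
  have "(\<lambda>p. 2 * (cmod c)\<^sup>2 * (cmod (\<xi> p))\<^sup>2 + 2 * (cmod d)\<^sup>2 * (cmod (\<eta> p))\<^sup>2) summable_on UNIV"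
    by (intro summable_on_add summable_on_cmult_right hspace_summable[OF assms(1)] hspace_summable[OF assms(2)])
  then have "(\<lambda>p. (cmod (c * \<xi> p + d * \<eta> p))\<^sup>2) summable_on UNIV"
    by (rule summable_on_comparison_test) (rule cmod_lincomb_square_le, rule zero_le_power2)
  then show ?thesis using hspace_outside[OF assms(1)] hspace_outside[OF assms(2)]
    unfolding hspace_def mem_Collect_eq by simp
qed

lemma hnorm_nonneg: "hnorm \<xi> \<ge> 0"
  by (simp add: hnorm_def infsum_nonneg)

lemma hnorm_square: "(hnorm \<xi>)\<^sup>2 = (\<Sum>\<^sub>\<infinity>p. (cmod (\<xi> p))\<^sup>2)"
  by (simp add: hnorm_def infsum_nonneg)

lemma L2_le_hnorm:
  assumes "\<xi> \<in> hspace n" "finite F"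
  shows "L2_set (\<lambda>p. cmod (\<xi> p)) F \<le> hnorm \<xi>"
  unfolding L2_set_def hnorm_def
  by (intro real_sqrt_le_mono finite_sum_le_infsum hspace_summable[OF assms(1)] assms(2)) auto

lemma cmod_le_hnorm: "\<xi> \<in> hspace n \<Longrightarrow> cmod (\<xi> p) \<le> hnorm \<xi>"
  using L2_le_hnorm[of \<xi> n "{p}"] by simp

lemma hnorm_finite_le:
  assumes "finite F" "\<And>p. p \<notin> F \<Longrightarrow> \<xi> p = 0"
  shows "hnorm \<xi> \<le> (\<Sum>p\<in>F. cmod (\<xi> p))"
proof -
  have "(\<Sum>\<^sub>\<infinity>p. (cmod (\<xi> p))\<^sup>2) = (\<Sum>\<^sub>\<infinity>p\<in>F. (cmod (\<xi> p))\<^sup>2)"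
    by (rule infsum_cong_neutral) (use assms in auto)
  then have "hnorm \<xi> = L2_set (\<lambda>p. cmod (\<xi> p)) F"
    using assms(1) by (simp add: hnorm_def L2_set_def)
  also have "\<dots> \<le> (\<Sum>p\<in>F. \<bar>cmod (\<xi> p)\<bar>)" by (rule L2_set_le_sum_abs)
  finally show ?thesis by simp
qed

lemma finite_hspace:
  assumes "finite F" "\<And>p. p \<notin> F \<Longrightarrow> \<xi> p = 0" "\<And>\<alpha> k. n \<alpha> \<le> k \<Longrightarrow> \<xi> (\<alpha>, k) = 0"
  shows "\<xi> \<in> hspace n"
proof -
  have "(\<lambda>p. (cmod (\<xi> p))\<^sup>2) summable_on F" using assms(1) by (rule summable_on_finite)
  then have "(\<lambda>p. (cmod (\<xi> p))\<^sup>2) summable_on UNIV"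
    by (rule summable_on_cong_neutral[THEN iffD1, rotated -1]) (use assms(2) in auto)
  then show ?thesis using assms(3) by (simp add: hspace_def)
qed

lemma mult_le_squares:
  fixes a b :: real
  assumes "a \<ge> 0" "b \<ge> 0"
  shows "a * b \<le> a\<^sup>2 + b\<^sup>2"
proof -
  have "0 \<le> a * b" using assms by simp
  then show ?thesis using sum_squares_bound[of a b] by simp
qed

lemma hinner_abs_summable:
  assumes "\<xi> \<in> hspace n" "\<eta> \<in> hspace n"
  shows "(\<lambda>p. cnj (\<xi> p) * \<eta> p) abs_summable_on UNIV"
proof -
  have "(\<lambda>p. (cmod (\<xi> p))\<^sup>2 + (cmod (\<eta> p))\<^sup>2) summable_on UNIV"
    by (intro summable_on_add hspace_summable[OF assms(1)] hspace_summable[OF assms(2)])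
  then show ?thesis
  proof (rule summable_on_comparison_test)
    fix p
    show "norm (cnj (\<xi> p) * \<eta> p) \<le> (cmod (\<xi> p))\<^sup>2 + (cmod (\<eta> p))\<^sup>2"
      unfolding norm_mult complex_mod_cnj by (rule mult_le_squares) simp_all
  qed simp
qed

lemma hinner_cauchy_schwarz:
  assumes "\<xi> \<in> hspace n" "\<eta> \<in> hspace n"
  shows "cmod (hinner \<xi> \<eta>) \<le> hnorm \<xi> * hnorm \<eta>"
proof -
  note s = hinner_abs_summable[OF assms]
  have "cmod (hinner \<xi> \<eta>) \<le> (\<Sum>\<^sub>\<infinity>p. norm (cnj (\<xi> p) * \<eta> p))"
    unfolding hinner_def by (rule norm_infsum_bound[OF s])
  also have "\<dots> \<le> hnorm \<xi> * hnorm \<eta>"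
  proof (rule infsum_le_finite_sums[OF s])
    fix F :: "('a \<times> nat) set" assume F: "finite F"
    have "(\<Sum>p\<in>F. norm (cnj (\<xi> p) * \<eta> p)) = (\<Sum>p\<in>F. \<bar>cmod (\<xi> p)\<bar> * \<bar>cmod (\<eta> p)\<bar>)"
      by (simp add: norm_mult)
    also have "\<dots> \<le> L2_set (\<lambda>p. cmod (\<xi> p)) F * L2_set (\<lambda>p. cmod (\<eta> p)) F" by (rule L2_set_mult_ineq)
    also have "\<dots> \<le> hnorm \<xi> * hnorm \<eta>"
      by (intro mult_mono L2_le_hnorm[OF assms(1) F] L2_le_hnorm[OF assms(2) F] hnorm_nonneg L2_set_nonneg)
    finally show "(\<Sum>p\<in>F. norm (cnj (\<xi> p) * \<eta> p)) \<le> hnorm \<xi> * hnorm \<eta>" .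
  qed
  finally show ?thesis .
qed

lemma hinner_lincomb:
  assumes "\<xi> \<in> hspace n" "\<eta> \<in> hspace n" "\<zeta> \<in> hspace n"
  shows "hinner \<xi> (\<lambda>p. c * \<eta> p + d * \<zeta> p) = c * hinner \<xi> \<eta> + d * hinner \<xi> \<zeta>"
proof -
  note s = hinner_abs_summable[OF assms(1,2), THEN abs_summable_summable]
    hinner_abs_summable[OF assms(1,3), THEN abs_summable_summable]
  have "hinner \<xi> (\<lambda>p. c * \<eta> p + d * \<zeta> p) = (\<Sum>\<^sub>\<infinity>p. c * (cnj (\<xi> p) * \<eta> p) + d * (cnj (\<xi> p) * \<zeta> p))"
    unfolding hinner_def by (intro infsum_cong) (simp add: algebra_simps)
  also have "\<dots> = c * hinner \<xi> \<eta> + d * hinner \<xi> \<zeta>"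
    unfolding hinner_def
    by (simp add: infsum_add summable_on_cmult_right s infsum_cmult_right')
  finally show ?thesis .
qed

lemma bops_hspace: "T \<in> bops n \<Longrightarrow> T \<xi> \<in> hspace n"
  by (cases "\<xi> \<in> hspace n") (auto simp: bops_def)

lemma bops_outside: "T \<in> bops n \<Longrightarrow> \<xi> \<notin> hspace n \<Longrightarrow> T \<xi> = (\<lambda>_. 0)"
  by (simp add: bops_def)

lemma bops_linear: "T \<in> bops n \<Longrightarrow> \<xi> \<in> hspace n \<Longrightarrow> \<eta> \<in> hspace n \<Longrightarrow>
    T (\<lambda>p. c * \<xi> p + d * \<eta> p) = (\<lambda>p. c * T \<xi> p + d * T \<eta> p)"
  by (simp add: bops_def)

lemma bops_zero: "T \<in> bops n \<Longrightarrow> T (\<lambda>_. 0) = (\<lambda>_. 0)"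
  using bops_linear[of T n "\<lambda>_. 0" "\<lambda>_. 0" 0 0] by simp

lemma bops_bounded:
  assumes "T \<in> bops n"
  obtains C where "C \<ge> 0" "\<And>\<xi>. \<xi> \<in> hspace n \<Longrightarrow> hnorm (T \<xi>) \<le> C * hnorm \<xi>"
proof -
  obtain C where C: "\<forall>\<xi>\<in>hspace n. hnorm (T \<xi>) \<le> C * hnorm \<xi>" using assms by (auto simp: bops_def)
  have "hnorm (T \<xi>) \<le> max C 0 * hnorm \<xi>" if "\<xi> \<in> hspace n" for \<xi>
    using C that hnorm_nonneg[of \<xi>] by (meson max.cobounded1 mult_right_mono order_trans)
  then show ?thesis using that[of "max C 0"] by simp
qed

lemma bopsI:
  assumes "\<And>\<xi>. \<xi> \<in> hspace n \<Longrightarrow> T \<xi> \<in> hspace n" "\<And>\<xi>. \<xi> \<notin> hspace n \<Longrightarrow> T \<xi> = (\<lambda>_. 0)"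
    "\<And>\<xi> \<eta> c d. \<xi> \<in> hspace n \<Longrightarrow> \<eta> \<in> hspace n \<Longrightarrow> T (\<lambda>p. c * \<xi> p + d * \<eta> p) = (\<lambda>p. c * T \<xi> p + d * T \<eta> p)"
    "\<And>\<xi>. \<xi> \<in> hspace n \<Longrightarrow> hnorm (T \<xi>) \<le> C * hnorm \<xi>"
  shows "T \<in> bops n"
  using assms unfolding bops_def by blast

lemma bops_comp:
  assumes S: "S \<in> bops n" and T: "T \<in> bops n"
  shows "S \<circ> T \<in> bops n"
proof -
  obtain C where C: "C \<ge> 0" "\<And>\<xi>. \<xi> \<in> hspace n \<Longrightarrow> hnorm (S \<xi>) \<le> C * hnorm \<xi>" using bops_bounded[OF S] by blast
  obtain E where E: "E \<ge> 0" "\<And>\<xi>. \<xi> \<in> hspace n \<Longrightarrow> hnorm (T \<xi>) \<le> E * hnorm \<xi>" using bops_bounded[OF T] by blast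
  show ?thesis
  proof (rule bopsI)
    fix \<xi> assume "\<xi> \<in> hspace n"
    then have "hnorm (S (T \<xi>)) \<le> C * (E * hnorm \<xi>)"
      by (intro order_trans[OF C(2)[OF bops_hspace[OF T]]] mult_left_mono E C)
    then show "hnorm ((S \<circ> T) \<xi>) \<le> (C * E) * hnorm \<xi>" by (simp add: mult.assoc)
  qed (simp_all add: bops_hspace[OF S] bops_outside[OF T] bops_zero[OF S] bops_linear[OF T] bops_linear[OF S] bops_hspace[OF T])
qed

text \<open>A crude constant is enough: the bound only serves to show that linear combinations of
  bounded operators are bounded.\<close>

lemma hnorm_lincomb_le:
  assumes "\<xi> \<in> hspace n" "\<eta> \<in> hspace n"
  shows "hnorm (\<lambda>p. c * \<xi> p + d * \<eta> p) \<le> 2 * (cmod c * hnorm \<xi> + cmod d * hnorm \<eta>)"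
proof (rule power2_le_imp_le)
  have "(hnorm (\<lambda>p. c * \<xi> p + d * \<eta> p))\<^sup>2 \<le>
      (\<Sum>\<^sub>\<infinity>p. 2 * (cmod c)\<^sup>2 * (cmod (\<xi> p))\<^sup>2 + 2 * (cmod d)\<^sup>2 * (cmod (\<eta> p))\<^sup>2)"
    unfolding hnorm_square
    by (intro infsum_mono hspace_summable[OF hspace_lincomb[OF assms]] summable_on_add summable_on_cmult_right
        hspace_summable[OF assms(1)] hspace_summable[OF assms(2)] cmod_lincomb_square_le)
  also have "\<dots> = 2 * (cmod c)\<^sup>2 * (hnorm \<xi>)\<^sup>2 + 2 * (cmod d)\<^sup>2 * (hnorm \<eta>)\<^sup>2"
    unfolding hnorm_square
    by (simp add: infsum_add summable_on_cmult_right hspace_summable[OF assms(1)] hspace_summable[OF assms(2)]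
        infsum_cmult_right')
  also have "\<dots> \<le> (2 * (cmod c * hnorm \<xi> + cmod d * hnorm \<eta>))\<^sup>2"
    using hnorm_nonneg[of \<xi>] hnorm_nonneg[of \<eta>]
    by (simp add: power_mult_distrib power2_sum)
  finally show "(hnorm (\<lambda>p. c * \<xi> p + d * \<eta> p))\<^sup>2 \<le> (2 * (cmod c * hnorm \<xi> + cmod d * hnorm \<eta>))\<^sup>2" .
qed (simp add: hnorm_nonneg)

lemma bops_lincomb:
  assumes S: "S \<in> bops n" and T: "T \<in> bops n"
  shows "(\<lambda>\<xi> p. c * S \<xi> p + d * T \<xi> p) \<in> bops n"
proof -
  obtain C where C: "C \<ge> 0" "\<And>\<xi>. \<xi> \<in> hspace n \<Longrightarrow> hnorm (S \<xi>) \<le> C * hnorm \<xi>" using bops_bounded[OF S] by blast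
  obtain E where E: "E \<ge> 0" "\<And>\<xi>. \<xi> \<in> hspace n \<Longrightarrow> hnorm (T \<xi>) \<le> E * hnorm \<xi>" using bops_bounded[OF T] by blast
  show ?thesis
  proof (rule bopsI)
    fix \<xi> assume \<xi>: "\<xi> \<in> hspace n"
    have "hnorm (\<lambda>p. c * S \<xi> p + d * T \<xi> p) \<le> 2 * (cmod c * hnorm (S \<xi>) + cmod d * hnorm (T \<xi>))"
      by (rule hnorm_lincomb_le[OF bops_hspace[OF S] bops_hspace[OF T]])
    also have "\<dots> \<le> 2 * (cmod c * (C * hnorm \<xi>) + cmod d * (E * hnorm \<xi>))"
      by (intro mult_left_mono add_mono C E \<xi>) auto
    finally show "hnorm (\<lambda>p. c * S \<xi> p + d * T \<xi> p) \<le> (2 * (cmod c * C + cmod d * E)) * hnorm \<xi>"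
      by (simp add: algebra_simps)
  qed (auto simp: hspace_lincomb bops_hspace[OF S] bops_hspace[OF T] bops_outside[OF S] bops_outside[OF T]
      bops_linear[OF S] bops_linear[OF T] algebra_simps)
qed

lemma bops_0: "(\<lambda>_ _. 0) \<in> bops n"
  by (rule bopsI[where C = 0]) (simp_all add: hnorm_def)

lemma normal_functional_summable:
  assumes T: "T \<in> bops n" and h: "\<And>k. \<xi> k \<in> hspace n" "\<And>k. \<eta> k \<in> hspace n"
    and s: "summable (\<lambda>k. (hnorm (\<xi> k))\<^sup>2)" "summable (\<lambda>k. (hnorm (\<eta> k))\<^sup>2)"
  shows "summable (\<lambda>k. hinner (\<eta> k) (T (\<xi> k)))"
proof -
  obtain C where C: "C \<ge> 0" "\<And>\<xi>. \<xi> \<in> hspace n \<Longrightarrow> hnorm (T \<xi>) \<le> C * hnorm \<xi>" using bops_bounded[OF T] by blast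
  have "summable (\<lambda>k. C * ((hnorm (\<xi> k))\<^sup>2 + (hnorm (\<eta> k))\<^sup>2))"
    by (intro summable_mult summable_add s)
  then show ?thesis
  proof (rule summable_comparison_test')
    fix k
    have "norm (hinner (\<eta> k) (T (\<xi> k))) \<le> hnorm (\<eta> k) * hnorm (T (\<xi> k))"
      by (rule hinner_cauchy_schwarz[OF h(2) bops_hspace[OF T]])
    also have "\<dots> \<le> hnorm (\<eta> k) * (C * hnorm (\<xi> k))"
      by (intro mult_left_mono C h hnorm_nonneg)
    also have "\<dots> = C * (hnorm (\<eta> k) * hnorm (\<xi> k))" by simp
    also have "\<dots> \<le> C * ((hnorm (\<xi> k))\<^sup>2 + (hnorm (\<eta> k))\<^sup>2)"
      unfolding mult.commute[of "hnorm (\<eta> k)"]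
      by (intro mult_left_mono mult_le_squares hnorm_nonneg C(1))
    finally show "norm (hinner (\<eta> k) (T (\<xi> k))) \<le> C * ((hnorm (\<xi> k))\<^sup>2 + (hnorm (\<eta> k))\<^sup>2)" .
  qed
qed

lemma normal_functional_linear:
  assumes \<phi>: "\<phi> \<in> normal_functionals n" and S: "S \<in> bops n" and T: "T \<in> bops n"
  shows "\<phi> (\<lambda>\<xi> p. c * S \<xi> p + d * T \<xi> p) = c * \<phi> S + d * \<phi> T"
proof -
  obtain \<xi> \<eta> where e: "\<phi> = (\<lambda>T. \<Sum>k. hinner (\<eta> k) (T (\<xi> k)))"
    and h: "\<And>k. \<xi> k \<in> hspace n" "\<And>k. \<eta> k \<in> hspace n"
    and s: "summable (\<lambda>k. (hnorm (\<xi> k))\<^sup>2)" "summable (\<lambda>k. (hnorm (\<eta> k))\<^sup>2)"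
    using \<phi> unfolding normal_functionals_def by blast
  note sS = normal_functional_summable[OF S h s] and sT = normal_functional_summable[OF T h s]
  show ?thesis
    unfolding e hinner_lincomb[OF h(2) bops_hspace[OF S] bops_hspace[OF T]]
    by (simp add: suminf_add[symmetric] suminf_mult summable_mult sS sT)
qed

section \<open>Weak* neighbourhoods, linear spaces of operators and their closures\<close>

lemma weakstar_topspace: "topspace (weakstar n) = bops n"
proof -
  \<comment> \<open>The zero functional is normal, so \<open>bops n\<close> itself is one of the
    sets generating the topology.\<close>
  have "(\<lambda>T. \<Sum>k. hinner ((\<lambda>_ _. 0) k) (T ((\<lambda>_ _. 0) k))) \<in> normal_functionals n"
    unfolding normal_functionals_def mem_Collect_eq
    by (rule exI[of _ "\<lambda>_ _. 0"], rule exI[of _ "\<lambda>_ _. 0"]) (simp add: hnorm_def)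
  then show ?thesis
    unfolding weakstar_def topology_generated_by_topspace by blast
qed

text \<open>By induction over the generated topology, every open set around T contains a
  neighbourhood of T cut out by finitely many normal functionals and one tolerance.\<close>

lemma weakstar_closureI:
  assumes T: "T \<in> bops n"
    and ap: "\<And>\<Phi> e. finite \<Phi> \<Longrightarrow> \<Phi> \<subseteq> normal_functionals n \<Longrightarrow> e > 0 \<Longrightarrow>
      \<exists>S\<in>X \<inter> bops n. \<forall>\<phi>\<in>\<Phi>. cmod (\<phi> S - \<phi> T) < e"
  shows "T \<in> weakstar n closure_of X"
  unfolding in_closure_of weakstar_topspace
proof (intro conjI T allI impI)
  fix U assume "T \<in> U \<and> openin (weakstar n) U"
  then have TU: "T \<in> U" and U: "generate_topology_on {{T \<in> bops n. \<phi> T \<in> U} | \<phi> U. \<phi> \<in> normal_functionals n \<and> open U} U"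
    by (auto simp: weakstar_def openin_topology_generated_by_iff)
  from U TU have "\<exists>\<Phi> e. finite \<Phi> \<and> \<Phi> \<subseteq> normal_functionals n \<and> e > 0 \<and>
      (\<forall>S\<in>bops n. (\<forall>\<phi>\<in>\<Phi>. cmod (\<phi> S - \<phi> T) < e) \<longrightarrow> S \<in> U)"
  proof (induction rule: generate_topology_on.induct)
    case Empty
    then show ?case by simp
  next
    case (Int a b)
    obtain \<Phi> e where 1: "finite \<Phi>" "\<Phi> \<subseteq> normal_functionals n" "e > 0"
      "\<forall>S\<in>bops n. (\<forall>\<phi>\<in>\<Phi>. cmod (\<phi> S - \<phi> T) < e) \<longrightarrow> S \<in> a" using Int by blast
    obtain \<Psi> d where 2: "finite \<Psi>" "\<Psi> \<subseteq> normal_functionals n" "d > 0"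
      "\<forall>S\<in>bops n. (\<forall>\<phi>\<in>\<Psi>. cmod (\<phi> S - \<phi> T) < d) \<longrightarrow> S \<in> b" using Int by blast
    show ?case
      by (rule exI[of _ "\<Phi> \<union> \<Psi>"], rule exI[of _ "min e d"]) (use 1 2 in auto)
  next
    case (UN K)
    then obtain k where k: "k \<in> K" "T \<in> k" by blast
    from UN.IH[OF k] obtain \<Phi> e where "finite \<Phi>" "\<Phi> \<subseteq> normal_functionals n" "e > 0"
      "\<forall>S\<in>bops n. (\<forall>\<phi>\<in>\<Phi>. cmod (\<phi> S - \<phi> T) < e) \<longrightarrow> S \<in> k" by blast
    then show ?case using k(1) by (intro exI[of _ \<Phi>] exI[of _ e]) auto
  next
    case (Basis s)
    then obtain \<phi> V where s: "s = {T \<in> bops n. \<phi> T \<in> V}" and \<phi>: "\<phi> \<in> normal_functionals n" and V: "open V" by blast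
    have "\<phi> T \<in> V" using Basis s by blast
    then obtain e where e: "e > 0" "ball (\<phi> T) e \<subseteq> V" using V by (meson open_contains_ball)
    show ?case
      by (rule exI[of _ "{\<phi>}"], rule exI[of _ e])
        (use e \<phi> in \<open>auto simp: s dist_norm norm_minus_commute subset_iff\<close>)
  qed
  then obtain \<Phi> e where p: "finite \<Phi>" "\<Phi> \<subseteq> normal_functionals n" "e > 0"
    and q: "\<forall>S\<in>bops n. (\<forall>\<phi>\<in>\<Phi>. cmod (\<phi> S - \<phi> T) < e) \<longrightarrow> S \<in> U" by (elim exE conjE)
  show "\<exists>y. y \<in> X \<and> y \<in> U" using ap[OF p] q by blast
qed

lemma weakstar_closureD:
  assumes T: "T \<in> weakstar n closure_of X" and \<Phi>: "finite \<Phi>" "\<Phi> \<subseteq> normal_functionals n" and e: "e > 0"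
  shows "\<exists>S\<in>X \<inter> bops n. \<forall>\<phi>\<in>\<Phi>. cmod (\<phi> S - \<phi> T) < e"
proof -
  have Tb: "T \<in> bops n" using T by (simp add: in_closure_of weakstar_topspace)
  define U where "U = {S \<in> bops n. \<forall>\<phi>\<in>\<Phi>. \<phi> S \<in> ball (\<phi> T) e}"
  have "openin (weakstar n) U"
    using \<Phi> unfolding U_def
  proof (induction \<Phi> rule: finite_induct)
    case empty
    then show ?case using openin_topspace[of "weakstar n"] by (simp add: weakstar_topspace)
  next
    case (insert \<psi> \<Phi>)
    have "openin (weakstar n) {S \<in> bops n. \<psi> S \<in> ball (\<psi> T) e}"
      unfolding weakstar_def by (rule topology_generated_by_Basis) (use insert.prems in blast)
    moreover have "openin (weakstar n) {S \<in> bops n. \<forall>\<phi>\<in>\<Phi>. \<phi> S \<in> ball (\<phi> T) e}"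
      by (rule insert.IH) (use insert.prems in blast)
    ultimately have "openin (weakstar n) ({S \<in> bops n. \<psi> S \<in> ball (\<psi> T) e} \<inter> {S \<in> bops n. \<forall>\<phi>\<in>\<Phi>. \<phi> S \<in> ball (\<phi> T) e})"
      by (rule openin_Int)
    also have "{S \<in> bops n. \<psi> S \<in> ball (\<psi> T) e} \<inter> {S \<in> bops n. \<forall>\<phi>\<in>\<Phi>. \<phi> S \<in> ball (\<phi> T) e} =
        {S \<in> bops n. \<forall>\<phi>\<in>insert \<psi> \<Phi>. \<phi> S \<in> ball (\<phi> T) e}" by auto
    finally show ?case .
  qed
  moreover have "T \<in> U" using Tb e by (simp add: U_def)
  ultimately obtain S where "S \<in> X" "S \<in> U" using T unfolding in_closure_of by blast
  then show ?thesis by (auto simp: U_def dist_norm norm_minus_commute)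
qed

text \<open>Stated for plain functions, so that it applies before boundedness is known;
  \<open>op_span X\<close> is the smallest such set containing X.\<close>

definition lin_closed :: "'i hop set \<Rightarrow> bool" where
  "lin_closed C \<longleftrightarrow> (\<lambda>_ _. 0) \<in> C \<and>
     (\<forall>S\<in>C. \<forall>T\<in>C. \<forall>c d. (\<lambda>\<xi> p. c * S \<xi> p + d * T \<xi> p) \<in> C)"

lemma lin_closedD:
  "lin_closed C \<Longrightarrow> (\<lambda>_ _. 0) \<in> C"
  "lin_closed C \<Longrightarrow> S \<in> C \<Longrightarrow> T \<in> C \<Longrightarrow> (\<lambda>\<xi> p. c * S \<xi> p + d * T \<xi> p) \<in> C"
  unfolding lin_closed_def by blast+

lemma lin_closed_sum:
  assumes C: "lin_closed C" and T: "\<And>s. s \<in> K \<Longrightarrow> T s \<in> C"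
  shows "(\<lambda>\<xi> p. \<Sum>s\<in>K. c s * T s \<xi> p) \<in> C"
  using T
proof (induction K rule: infinite_finite_induct)
  case (insert s K)
  have "T s \<in> C" "(\<lambda>\<xi> p. \<Sum>s\<in>K. c s * T s \<xi> p) \<in> C" using insert by auto
  from lin_closedD(2)[OF C this, of "c s" 1] show ?case using insert.hyps by simp
qed (simp_all add: lin_closedD(1)[OF C])

lemma lin_closed_bops: "lin_closed (bops n)"
  by (simp add: lin_closed_def bops_0 bops_lincomb)

lemma op_span_base: "T \<in> X \<Longrightarrow> T \<in> op_span X"
  unfolding op_span_def mem_Collect_eq by (rule exI[of _ "{T}"], rule exI[of _ "\<lambda>_. 1"]) simp

lemma op_span_minimal: "lin_closed C \<Longrightarrow> X \<subseteq> C \<Longrightarrow> op_span X \<subseteq> C"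
  unfolding op_span_def using lin_closed_sum[of C _ "\<lambda>T. T"] by blast

lemma lin_closed_op_span: "lin_closed (op_span X)"
  unfolding lin_closed_def
proof (intro conjI ballI allI)
  show "(\<lambda>_ _. 0) \<in> op_span X"
    unfolding op_span_def mem_Collect_eq by (rule exI[of _ "{}"]) simp
  fix S T c d assume "S \<in> op_span X" "T \<in> op_span X"
  then obtain F a G b where F: "finite F" "F \<subseteq> X" "S = (\<lambda>\<xi> p. \<Sum>T\<in>F. a T * T \<xi> p)"
    and G: "finite G" "G \<subseteq> X" "T = (\<lambda>\<xi> p. \<Sum>T\<in>G. b T * T \<xi> p)"
    unfolding op_span_def by blast
  define e where "e = (\<lambda>T. c * (if T \<in> F then a T else 0) + d * (if T \<in> G then b T else 0))"
  have "c * (\<Sum>T\<in>F. a T * T \<xi> p) + d * (\<Sum>T\<in>G. b T * T \<xi> p) = (\<Sum>T\<in>F \<union> G. e T * T \<xi> p)" for \<xi> p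
  proof -
    have "(\<Sum>T\<in>F. a T * T \<xi> p) = (\<Sum>T\<in>F \<union> G. (if T \<in> F then a T else 0) * T \<xi> p)"
      by (rule sum.mono_neutral_cong_left) (use F(1) G(1) in auto)
    moreover have "(\<Sum>T\<in>G. b T * T \<xi> p) = (\<Sum>T\<in>F \<union> G. (if T \<in> G then b T else 0) * T \<xi> p)"
      by (rule sum.mono_neutral_cong_left) (use F(1) G(1) in auto)
    ultimately show ?thesis
      by (simp only: e_def sum_distrib_left sum.distrib distrib_right mult.assoc)
  qed
  then show "(\<lambda>\<xi> p. c * S \<xi> p + d * T \<xi> p) \<in> op_span X"
    unfolding op_span_def mem_Collect_eq F(3) G(3)
    by (intro exI[of _ "F \<union> G"] exI[of _ e]) (use F G in auto)
qed

lemma op_span_mono: "X \<subseteq> op_span Y \<Longrightarrow> op_span X \<subseteq> op_span Y"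
  by (rule op_span_minimal[OF lin_closed_op_span])

lemma lin_closed_closure:
  assumes X: "lin_closed X" "X \<subseteq> bops n"
  shows "lin_closed (weakstar n closure_of X)"
  unfolding lin_closed_def
proof (intro conjI ballI allI)
  have "X \<subseteq> weakstar n closure_of X" by (rule closure_of_subset) (simp add: weakstar_topspace X)
  then show "(\<lambda>_ _. 0) \<in> weakstar n closure_of X" using lin_closedD(1)[OF X(1)] by blast
  fix S T c d assume ST: "S \<in> weakstar n closure_of X" "T \<in> weakstar n closure_of X"
  then have b: "S \<in> bops n" "T \<in> bops n" by (auto simp: in_closure_of weakstar_topspace)
  show "(\<lambda>\<xi> p. c * S \<xi> p + d * T \<xi> p) \<in> weakstar n closure_of X"
  proof (rule weakstar_closureI[OF bops_lincomb[OF b]])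
    fix \<Phi> and e :: real assume \<Phi>: "finite \<Phi>" "\<Phi> \<subseteq> normal_functionals n" and e: "e > 0"
    \<comment> \<open>The tolerance for each of the two approximations; the summand 1 keeps the
      denominator positive and the final estimate strict.\<close>
    define \<delta> where "\<delta> = e / (cmod c + cmod d + 1)"
    have pos: "cmod c + cmod d + 1 > 0" by (smt (verit) norm_ge_zero)
    then have \<delta>: "\<delta> > 0" using e by (simp add: \<delta>_def)
    obtain S' where S': "S' \<in> X" "S' \<in> bops n" "\<forall>\<phi>\<in>\<Phi>. cmod (\<phi> S' - \<phi> S) < \<delta>"
      using weakstar_closureD[OF ST(1) \<Phi> \<delta>] by blast
    obtain T' where T': "T' \<in> X" "T' \<in> bops n" "\<forall>\<phi>\<in>\<Phi>. cmod (\<phi> T' - \<phi> T) < \<delta>"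
      using weakstar_closureD[OF ST(2) \<Phi> \<delta>] by blast
    show "\<exists>R\<in>X \<inter> bops n. \<forall>\<phi>\<in>\<Phi>. cmod (\<phi> R - \<phi> (\<lambda>\<xi> p. c * S \<xi> p + d * T \<xi> p)) < e"
    proof (rule bexI[of _ "\<lambda>\<xi> p. c * S' \<xi> p + d * T' \<xi> p"], rule ballI)
      fix \<phi> assume \<phi>: "\<phi> \<in> \<Phi>"
      then have \<phi>n: "\<phi> \<in> normal_functionals n" using \<Phi> by blast
      have "\<phi> (\<lambda>\<xi> p. c * S' \<xi> p + d * T' \<xi> p) - \<phi> (\<lambda>\<xi> p. c * S \<xi> p + d * T \<xi> p) = c * (\<phi> S' - \<phi> S) + d * (\<phi> T' - \<phi> T)"
        unfolding normal_functional_linear[OF \<phi>n S'(2) T'(2)] normal_functional_linear[OF \<phi>n b] by (simp add: algebra_simps)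
      also have "cmod \<dots> \<le> cmod c * cmod (\<phi> S' - \<phi> S) + cmod d * cmod (\<phi> T' - \<phi> T)"
        by (metis norm_mult norm_triangle_ineq)
      also have "\<dots> \<le> cmod c * \<delta> + cmod d * \<delta>"
        using S'(3) T'(3) \<phi> by (intro add_mono mult_left_mono) (auto intro: less_imp_le)
      also have "\<dots> < (cmod c + cmod d + 1) * \<delta>" using \<delta> by (simp add: algebra_simps)
      also have "\<dots> = e" using pos by (simp add: \<delta>_def)
      finally show "cmod (\<phi> (\<lambda>\<xi> p. c * S' \<xi> p + d * T' \<xi> p) - \<phi> (\<lambda>\<xi> p. c * S \<xi> p + d * T \<xi> p)) < e" .
    next
      show "(\<lambda>\<xi> p. c * S' \<xi> p + d * T' \<xi> p) \<in> X \<inter> bops n"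
        using lin_closedD(2)[OF X(1) S'(1) T'(1)] X(2) by blast
    qed
  qed
qed

section \<open>Truncation to finitely many blocks\<close>

definition block_proj :: "('i \<Rightarrow> nat) \<Rightarrow> 'i set \<Rightarrow> 'i hop" where
  "block_proj n F = (\<lambda>\<xi> p. if \<xi> \<in> hspace n \<and> fst p \<in> F then \<xi> p else 0)"

lemma block_proj_square_summable:
  assumes "\<xi> \<in> hspace n"
  shows "(\<lambda>p. (cmod (block_proj n F \<xi> p))\<^sup>2) summable_on UNIV"
  by (rule summable_on_comparison_test[OF hspace_summable[OF assms]]) (auto simp: block_proj_def)

lemma block_proj_hspace: "block_proj n F \<xi> \<in> hspace n"
proof (cases "\<xi> \<in> hspace n")
  case True
  then show ?thesis
    using block_proj_square_summable[OF True] hspace_outside[OF True] unfolding hspace_def mem_Collect_eq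
    by (simp add: block_proj_def)
qed (simp add: block_proj_def)

lemma hnorm_block_proj_le: "\<xi> \<in> hspace n \<Longrightarrow> hnorm (block_proj n F \<xi>) \<le> hnorm \<xi>"
  unfolding hnorm_def
  by (intro real_sqrt_le_mono infsum_mono block_proj_square_summable hspace_summable) (auto simp: block_proj_def)

lemma block_proj_bops: "block_proj n F \<in> bops n"
proof (rule bopsI[where C = 1])
  fix \<xi> \<eta> :: "'a hvec" and c d assume "\<xi> \<in> hspace n" "\<eta> \<in> hspace n"
  then show "block_proj n F (\<lambda>p. c * \<xi> p + d * \<eta> p) = (\<lambda>p. c * block_proj n F \<xi> p + d * block_proj n F \<eta> p)"
    by (simp add: block_proj_def hspace_lincomb fun_eq_iff)
qed (simp_all add: block_proj_hspace hnorm_block_proj_le, simp add: block_proj_def)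

text \<open>Operators have to vanish outside \<open>hspace n\<close>, so \<open>id\<close> is not in
  \<open>bops n\<close>; \<open>block_proj n UNIV\<close> takes its place as the identity
  operator.\<close>

lemma block_proj_UNIV: "\<xi> \<in> hspace n \<Longrightarrow> block_proj n UNIV \<xi> = \<xi>"
  by (simp add: block_proj_def)

lemma block_proj_UNIV_comp: "T \<in> bops n \<Longrightarrow> block_proj n UNIV \<circ> T = T"
  by (simp add: fun_eq_iff block_proj_UNIV bops_hspace)

lemma comp_block_proj_UNIV:
  assumes "T \<in> bops n"
  shows "T \<circ> block_proj n UNIV = T"
proof
  fix \<xi>
  show "(T \<circ> block_proj n UNIV) \<xi> = T \<xi>"
  proof (cases "\<xi> \<in> hspace n")
    case False
    then have "block_proj n UNIV \<xi> = (\<lambda>_. 0)" by (simp add: block_proj_def)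
    then show ?thesis using False by (simp add: bops_zero[OF assms] bops_outside[OF assms])
  qed (simp add: block_proj_UNIV)
qed

lemma block_proj_idem: "block_proj n F \<circ> block_proj n F = block_proj n F"
  using block_proj_hspace[of n F] by (fastforce simp: block_proj_def fun_eq_iff)

text \<open>By square summability a finite set H carries all but little of the norm; once F contains
  the first components of H, the complementary truncation is supported off H.\<close>

lemma hnorm_block_proj_compl_tendsto:
  fixes \<xi> :: "'i hvec"
  assumes \<xi>: "\<xi> \<in> hspace n"
  shows "((\<lambda>F. hnorm (block_proj n (- F) \<xi>)) \<longlongrightarrow> 0) (finite_subsets_at_top UNIV)"
proof (rule tendstoI)
  fix e :: real assume e: "e > 0"
  let ?g = "\<lambda>p. (cmod (\<xi> p))\<^sup>2"
  note sg = hspace_summable[OF \<xi>]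
  obtain H where H: "finite H" "dist (sum ?g H) (infsum ?g UNIV) \<le> e\<^sup>2 / 2"
    using infsum_finite_approximation[OF sg, of "e\<^sup>2 / 2"] e by auto
  have "hnorm (block_proj n (- F) \<xi>) < e" if F: "fst ` H \<subseteq> F" for F
  proof -
    \<comment> \<open>The mass on H. Its support is disjoint from that of the complementary
      truncation, so the two together stay below the total mass.\<close>
    define h where "h = (\<lambda>p. if p \<in> H then ?g p else 0)"
    have ih: "infsum h UNIV = sum ?g H"
    proof -
      have "infsum h UNIV = infsum ?g H"
        by (rule infsum_cong_neutral) (auto simp: h_def)
      then show ?thesis using H(1) by simp
    qed
    have sh: "h summable_on UNIV"
      by (rule summable_on_comparison_test[OF sg]) (auto simp: h_def)
    have "(hnorm (block_proj n (- F) \<xi>))\<^sup>2 + sum ?g H = (\<Sum>\<^sub>\<infinity>p. (cmod (block_proj n (- F) \<xi> p))\<^sup>2 + h p)"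
      by (simp add: hnorm_square infsum_add[OF block_proj_square_summable[OF \<xi>] sh] ih)
    also have "\<dots> \<le> infsum ?g UNIV"
      by (intro infsum_mono summable_on_add block_proj_square_summable[OF \<xi>] sh sg)
        (use F in \<open>force simp: block_proj_def h_def\<close>)
    finally have "(hnorm (block_proj n (- F) \<xi>))\<^sup>2 \<le> e\<^sup>2 / 2" using H(2) unfolding dist_real_def by linarith
    also have "\<dots> < e\<^sup>2" using e by simp
    finally show ?thesis using e by (simp add: power_less_imp_less_base)
  qed
  then show "\<forall>\<^sub>F F in finite_subsets_at_top UNIV. dist (hnorm (block_proj n (- F) \<xi>)) 0 < e"
    using H(1) unfolding eventually_finite_subsets_at_top
    by (intro exI[of _ "fst ` H"]) (simp add: dist_real_def abs_of_nonneg[OF hnorm_nonneg])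
qed

lemma hinner_block_proj_tendsto:
  assumes Y: "Y \<in> bops n" and \<xi>: "\<xi> \<in> hspace n" and \<eta>: "\<eta> \<in> hspace n"
  shows "((\<lambda>F. hinner \<eta> (Y (block_proj n F \<xi>))) \<longlongrightarrow> hinner \<eta> (Y \<xi>)) (finite_subsets_at_top UNIV)"
proof -
  obtain C where C: "C \<ge> 0" "\<And>\<xi>. \<xi> \<in> hspace n \<Longrightarrow> hnorm (Y \<xi>) \<le> C * hnorm \<xi>" using bops_bounded[OF Y] by blast
  have bound: "norm (hinner \<eta> (Y (block_proj n F \<xi>)) - hinner \<eta> (Y \<xi>)) \<le> hnorm \<eta> * C * hnorm (block_proj n (- F) \<xi>)" for F
  proof -
    have "\<xi> = (\<lambda>p. 1 * block_proj n F \<xi> p + 1 * block_proj n (- F) \<xi> p)" using \<xi> by (auto simp: block_proj_def)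
    then have "hinner \<eta> (Y \<xi>) = hinner \<eta> (Y (\<lambda>p. 1 * block_proj n F \<xi> p + 1 * block_proj n (- F) \<xi> p))"
      by (rule arg_cong)
    also have "\<dots> = 1 * hinner \<eta> (Y (block_proj n F \<xi>)) + 1 * hinner \<eta> (Y (block_proj n (- F) \<xi>))"
      unfolding bops_linear[OF Y block_proj_hspace block_proj_hspace]
      by (rule hinner_lincomb[OF \<eta> bops_hspace[OF Y] bops_hspace[OF Y]])
    finally have "hinner \<eta> (Y (block_proj n F \<xi>)) - hinner \<eta> (Y \<xi>) = - hinner \<eta> (Y (block_proj n (- F) \<xi>))"
      by simp
    then have "norm (hinner \<eta> (Y (block_proj n F \<xi>)) - hinner \<eta> (Y \<xi>)) = norm (hinner \<eta> (Y (block_proj n (- F) \<xi>)))"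
      by (simp only: norm_minus_cancel)
    also have "\<dots> \<le> hnorm \<eta> * hnorm (Y (block_proj n (- F) \<xi>))"
      by (rule hinner_cauchy_schwarz[OF \<eta> bops_hspace[OF Y]])
    also have "\<dots> \<le> hnorm \<eta> * (C * hnorm (block_proj n (- F) \<xi>))"
      by (intro mult_left_mono C(2) block_proj_hspace hnorm_nonneg)
    finally show ?thesis by (simp add: mult.assoc)
  qed
  have "((\<lambda>F. hnorm \<eta> * C * hnorm (block_proj n (- F) \<xi>)) \<longlongrightarrow> 0) (finite_subsets_at_top UNIV)"
    by (rule tendsto_mult_right_zero[OF hnorm_block_proj_compl_tendsto[OF \<xi>]])
  then have "((\<lambda>F. hinner \<eta> (Y (block_proj n F \<xi>)) - hinner \<eta> (Y \<xi>)) \<longlongrightarrow> 0) (finite_subsets_at_top UNIV)"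
    by (rule tendsto_0_le[where K = 1])
      (rule always_eventually, rule allI, rule order_trans[OF bound], simp only: real_norm_def mult_1_right abs_ge_self)
  then show ?thesis by (rule LIM_zero_cancel)
qed

text \<open>Dominated convergence for series along an arbitrary filter: the summable bound controls
  all tails at once and reduces the claim to finitely many terms.\<close>

lemma tendsto_suminf_dominated:
  fixes a :: "'f \<Rightarrow> nat \<Rightarrow> complex"
  assumes lim: "\<And>k. ((\<lambda>F. a F k) \<longlongrightarrow> b k) G" and bound: "\<And>F k. norm (a F k) \<le> M k"
    and M: "summable M" and G: "G \<noteq> bot"
  shows "((\<lambda>F. \<Sum>k. a F k) \<longlongrightarrow> (\<Sum>k. b k)) G"
proof (rule tendstoI)
  fix e :: real assume e: "e > 0"
  have bound_b: "norm (b k) \<le> M k" for k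
    by (rule tendsto_upperbound[OF tendsto_norm[OF lim]]) (simp_all add: bound G)
  obtain N where N: "\<And>m. N \<le> m \<Longrightarrow> norm (\<Sum>k. M (k + m)) < e / 3"
    using suminf_exist_split[of "e / 3" M] e M by auto
  have tail: "norm ((\<Sum>k. c k) - (\<Sum>k<N. c k)) < e / 3" if c: "\<And>k. norm (c k) \<le> M k" for c :: "nat \<Rightarrow> complex"
  proof -
    have sc: "summable c" by (rule summable_comparison_test'[OF M]) (rule c)
    have "norm (\<Sum>k. c (k + N)) \<le> (\<Sum>k. M (k + N))"
      by (rule norm_suminf_le) (simp_all add: c M)
    also have "\<dots> < e / 3" using N[of N] by simp
    finally show ?thesis by (simp add: suminf_split_initial_segment[OF sc, of N])
  qed
  have "((\<lambda>F. \<Sum>k<N. a F k) \<longlongrightarrow> (\<Sum>k<N. b k)) G" by (intro tendsto_sum lim)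
  then have "\<forall>\<^sub>F F in G. dist (\<Sum>k<N. a F k) (\<Sum>k<N. b k) < e / 3"
    by (rule tendstoD) (use e in simp)
  then show "\<forall>\<^sub>F F in G. dist (\<Sum>k. a F k) (\<Sum>k. b k) < e"
  proof (rule eventually_mono)
    fix F assume d: "dist (\<Sum>k<N. a F k) (\<Sum>k<N. b k) < e / 3"
    have 1: "dist (\<Sum>k. a F k) (\<Sum>k<N. a F k) < e / 3" unfolding dist_norm by (rule tail) (rule bound)
    have 2: "dist (\<Sum>k. b k) (\<Sum>k<N. b k) < e / 3" unfolding dist_norm by (rule tail) (rule bound_b)
    have "dist (\<Sum>k. a F k) (\<Sum>k. b k) \<le> dist (\<Sum>k. a F k) (\<Sum>k<N. a F k) +
        (dist (\<Sum>k<N. a F k) (\<Sum>k<N. b k) + dist (\<Sum>k. b k) (\<Sum>k<N. b k))"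
      using dist_triangle[of "\<Sum>k. a F k" "\<Sum>k. b k" "\<Sum>k<N. a F k"]
        dist_triangle2[of "\<Sum>k<N. a F k" "\<Sum>k. b k" "\<Sum>k<N. b k"] by linarith
    then show "dist (\<Sum>k. a F k) (\<Sum>k. b k) < e" using d 1 2 by linarith
  qed
qed

text \<open>Only the truncation in the middle varies while Y and X stay fixed, so the series is
  dominated by one summable series. This is the separate continuity on which the iterated limits
  rely.\<close>

lemma normal_functional_block_proj_tendsto:
  assumes \<phi>: "\<phi> \<in> normal_functionals n" and Y: "Y \<in> bops n" and X: "X \<in> bops n"
  shows "((\<lambda>F. \<phi> (Y \<circ> block_proj n F \<circ> X)) \<longlongrightarrow> \<phi> (Y \<circ> X)) (finite_subsets_at_top UNIV)"
proof -
  obtain \<xi> \<eta> where e: "\<phi> = (\<lambda>T. \<Sum>k. hinner (\<eta> k) (T (\<xi> k)))"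
    and h: "\<And>k. \<xi> k \<in> hspace n" "\<And>k. \<eta> k \<in> hspace n"
    and s: "summable (\<lambda>k. (hnorm (\<xi> k))\<^sup>2)" "summable (\<lambda>k. (hnorm (\<eta> k))\<^sup>2)"
    using \<phi> unfolding normal_functionals_def by blast
  obtain C where C: "C \<ge> 0" "\<And>\<xi>. \<xi> \<in> hspace n \<Longrightarrow> hnorm (Y \<xi>) \<le> C * hnorm \<xi>" using bops_bounded[OF Y] by blast
  obtain E where E: "E \<ge> 0" "\<And>\<xi>. \<xi> \<in> hspace n \<Longrightarrow> hnorm (X \<xi>) \<le> E * hnorm \<xi>" using bops_bounded[OF X] by blast
  have bound: "norm (hinner (\<eta> k) (Y (block_proj n F (X (\<xi> k))))) \<le> C * E * ((hnorm (\<eta> k))\<^sup>2 + (hnorm (\<xi> k))\<^sup>2)" for k F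
  proof -
    have "norm (hinner (\<eta> k) (Y (block_proj n F (X (\<xi> k))))) \<le> hnorm (\<eta> k) * hnorm (Y (block_proj n F (X (\<xi> k))))"
      by (rule hinner_cauchy_schwarz[OF h(2) bops_hspace[OF Y]])
    also have "\<dots> \<le> hnorm (\<eta> k) * (C * (E * hnorm (\<xi> k)))"
      by (intro mult_left_mono order_trans[OF C(2)[OF block_proj_hspace]] order_trans[OF hnorm_block_proj_le[OF bops_hspace[OF X]]]
          E h hnorm_nonneg C(1))
    also have "\<dots> = C * E * (hnorm (\<eta> k) * hnorm (\<xi> k))" by simp
    also have "\<dots> \<le> C * E * ((hnorm (\<eta> k))\<^sup>2 + (hnorm (\<xi> k))\<^sup>2)"
      by (intro mult_left_mono mult_le_squares hnorm_nonneg mult_nonneg_nonneg C(1) E(1))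
    finally show ?thesis .
  qed
  have "((\<lambda>F. \<Sum>k. hinner (\<eta> k) (Y (block_proj n F (X (\<xi> k))))) \<longlongrightarrow> (\<Sum>k. hinner (\<eta> k) (Y (X (\<xi> k))))) (finite_subsets_at_top UNIV)"
  proof (rule tendsto_suminf_dominated)
    show "((\<lambda>F. hinner (\<eta> k) (Y (block_proj n F (X (\<xi> k))))) \<longlongrightarrow> hinner (\<eta> k) (Y (X (\<xi> k)))) (finite_subsets_at_top UNIV)" for k
      by (rule hinner_block_proj_tendsto[OF Y bops_hspace[OF X] h(2)])
    show "summable (\<lambda>k. C * E * ((hnorm (\<eta> k))\<^sup>2 + (hnorm (\<xi> k))\<^sup>2))"
      by (intro summable_mult summable_add s)
  qed (rule bound, simp)
  then show ?thesis by (simp add: e)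
qed

text \<open>A closure is its own closure, so it suffices to approximate \<open>Y \<circ> X\<close>
  by members of the closure; the truncations inserted in the middle provide them.\<close>

lemma closure_block_proj_limit:
  assumes Y: "Y \<in> bops n" and X: "X \<in> bops n"
    and mem: "\<And>F. finite F \<Longrightarrow> Y \<circ> block_proj n F \<circ> X \<in> weakstar n closure_of Z"
  shows "Y \<circ> X \<in> weakstar n closure_of Z"
proof -
  have "Y \<circ> X \<in> weakstar n closure_of (weakstar n closure_of Z)"
  proof (rule weakstar_closureI[OF bops_comp[OF Y X]])
    fix \<Phi> and e :: real assume \<Phi>: "finite \<Phi>" "\<Phi> \<subseteq> normal_functionals n" and e: "e > 0"
    have d: "\<forall>\<^sub>F F in finite_subsets_at_top UNIV. \<forall>\<phi>\<in>\<Phi>. dist (\<phi> (Y \<circ> block_proj n F \<circ> X)) (\<phi> (Y \<circ> X)) < e"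
      using \<Phi> e by (intro eventually_ball_finite ballI tendstoD[OF normal_functional_block_proj_tendsto[OF _ Y X]]) auto
    have f: "\<forall>\<^sub>F F in finite_subsets_at_top (UNIV :: 'a set). finite F"
      by (auto simp: eventually_finite_subsets_at_top)
    from eventually_happens'[OF finite_subsets_at_top_neq_bot eventually_conj[OF d f]]
    obtain F where "finite F" "\<forall>\<phi>\<in>\<Phi>. dist (\<phi> (Y \<circ> block_proj n F \<circ> X)) (\<phi> (Y \<circ> X)) < e"
      by (elim exE conjE)
    then show "\<exists>S\<in>(weakstar n closure_of Z) \<inter> bops n. \<forall>\<phi>\<in>\<Phi>. cmod (\<phi> S - \<phi> (Y \<circ> X)) < e"
      using mem bops_comp[OF bops_comp[OF Y block_proj_bops] X]
      by (intro bexI[of _ "Y \<circ> block_proj n F \<circ> X"]) (auto simp: dist_norm)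
  qed
  then show ?thesis by simp
qed

section \<open>Operators consisting of a single block\<close>

definition block_op :: "('i \<Rightarrow> nat) \<Rightarrow> 'i \<Rightarrow> 'i \<Rightarrow> complex mat \<Rightarrow> 'i hop" where
  "block_op n \<alpha> \<beta> X = (\<lambda>\<xi> (\<gamma>, k). if \<xi> \<in> hspace n \<and> \<gamma> = \<beta> \<and> k < n \<beta>
     then \<Sum>j<n \<alpha>. X $$ (k, j) * \<xi> (\<alpha>, j) else 0)"

lemma block_op_bops: "block_op n \<alpha> \<beta> X \<in> bops n"
proof (rule bopsI[where C = "\<Sum>p\<in>{\<beta>} \<times> {..<n \<beta>}. \<Sum>j<n \<alpha>. cmod (X $$ (snd p, j))"])
  fix \<xi> assume \<xi>: "\<xi> \<in> hspace n"
  show "block_op n \<alpha> \<beta> X \<xi> \<in> hspace n"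
    by (rule finite_hspace[of "{\<beta>} \<times> {..<n \<beta>}"]) (auto simp: block_op_def split: if_splits)
  have "hnorm (block_op n \<alpha> \<beta> X \<xi>) \<le> (\<Sum>p\<in>{\<beta>} \<times> {..<n \<beta>}. cmod (block_op n \<alpha> \<beta> X \<xi> p))"
    by (rule hnorm_finite_le) (auto simp: block_op_def split: if_splits)
  also have "\<dots> \<le> (\<Sum>p\<in>{\<beta>} \<times> {..<n \<beta>}. \<Sum>j<n \<alpha>. cmod (X $$ (snd p, j)) * hnorm \<xi>)"
  proof (rule sum_mono)
    fix p assume "p \<in> {\<beta>} \<times> {..<n \<beta>}"
    then have "cmod (block_op n \<alpha> \<beta> X \<xi> p) = cmod (\<Sum>j<n \<alpha>. X $$ (snd p, j) * \<xi> (\<alpha>, j))"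
      using \<xi> by (auto simp: block_op_def)
    also have "\<dots> \<le> (\<Sum>j<n \<alpha>. cmod (X $$ (snd p, j)) * hnorm \<xi>)"
      by (rule order_trans[OF norm_sum]) (simp add: norm_mult sum_mono mult_left_mono cmod_le_hnorm[OF \<xi>])
    finally show "cmod (block_op n \<alpha> \<beta> X \<xi> p) \<le> (\<Sum>j<n \<alpha>. cmod (X $$ (snd p, j)) * hnorm \<xi>)" .
  qed
  finally show "hnorm (block_op n \<alpha> \<beta> X \<xi>) \<le> (\<Sum>p\<in>{\<beta>} \<times> {..<n \<beta>}. \<Sum>j<n \<alpha>. cmod (X $$ (snd p, j))) * hnorm \<xi>"
    by (simp only: sum_distrib_right)
next
  fix \<xi> \<eta> :: "'a hvec" and c d assume \<xi>: "\<xi> \<in> hspace n" and \<eta>: "\<eta> \<in> hspace n"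
  show "block_op n \<alpha> \<beta> X (\<lambda>p. c * \<xi> p + d * \<eta> p) = (\<lambda>p. c * block_op n \<alpha> \<beta> X \<xi> p + d * block_op n \<alpha> \<beta> X \<eta> p)"
    using hspace_lincomb[OF \<xi> \<eta>] \<xi> \<eta>
    by (simp add: block_op_def fun_eq_iff sum_distrib_left sum.distrib distrib_left mult.left_commute)
qed (auto simp: block_op_def)

lemma hbasis_hspace: "j < n \<alpha> \<Longrightarrow> hbasis \<alpha> j \<in> hspace n"
  by (rule finite_hspace[of "{(\<alpha>, j)}"]) (auto simp: hbasis_def)

lemma hbasis_eq: "hbasis \<alpha> j (\<beta>, k) = (if \<beta> = \<alpha> \<and> k = j then 1 else 0)"
  by (simp add: hbasis_def)

lemma block_block_op:
  "block n (block_op n \<alpha> \<beta> X) \<gamma> \<delta> = (if \<gamma> = \<alpha> \<and> \<delta> = \<beta> then mat (n \<beta>) (n \<alpha>) (\<lambda>p. X $$ p) else 0\<^sub>m (n \<delta>) (n \<gamma>))"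
  by (rule eq_matI)
    (auto simp: block_def block_op_def hbasis_hspace hbasis_eq if_distrib sum.delta cong: if_cong)

lemma block_op_comp:
  assumes "Y \<in> carrier_mat (n \<gamma>) (n \<beta>)" "X \<in> carrier_mat (n \<beta>) (n \<alpha>)"
  shows "block_op n \<beta> \<gamma> Y \<circ> block_op n \<alpha> \<beta> X = block_op n \<alpha> \<gamma> (Y * X)"
proof (intro ext)
  fix \<xi> :: "'a hvec" and p :: "'a \<times> nat"
  obtain \<delta> k where p: "p = (\<delta>, k)" by force
  show "(block_op n \<beta> \<gamma> Y \<circ> block_op n \<alpha> \<beta> X) \<xi> p = block_op n \<alpha> \<gamma> (Y * X) \<xi> p"
  proof (cases "\<xi> \<in> hspace n \<and> \<delta> = \<gamma> \<and> k < n \<gamma>")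
    case True
    have "(\<Sum>l<n \<beta>. Y $$ (k, l) * (\<Sum>j<n \<alpha>. X $$ (l, j) * \<xi> (\<alpha>, j))) =
        (\<Sum>j<n \<alpha>. (\<Sum>l<n \<beta>. Y $$ (k, l) * X $$ (l, j)) * \<xi> (\<alpha>, j))"
      unfolding sum_distrib_left sum_distrib_right by (subst sum.swap) (simp add: mult.assoc)
    then show ?thesis
      using True assms bops_hspace[OF block_op_bops, of n \<alpha> \<beta> X \<xi>]
      by (simp add: p block_op_def mult_mat_index[OF assms] del: index_mult_mat)
  qed (auto simp: p block_op_def)
qed

text \<open>The coefficients 1 are written out to match the linear combinations in
  \<open>lin_closed_sum\<close>.\<close>

lemma block_op_msum:
  "block_op n \<alpha> \<beta> (msum (n \<beta>) (n \<alpha>) K f) = (\<lambda>\<xi> p. \<Sum>s\<in>K. 1 * block_op n \<alpha> \<beta> (f s) \<xi> p)"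
proof (intro ext)
  fix \<xi> :: "'a hvec" and p :: "'a \<times> nat"
  obtain \<delta> k where p: "p = (\<delta>, k)" by force
  show "block_op n \<alpha> \<beta> (msum (n \<beta>) (n \<alpha>) K f) \<xi> p = (\<Sum>s\<in>K. 1 * block_op n \<alpha> \<beta> (f s) \<xi> p)"
    by (auto simp: p block_op_def sum_distrib_right intro: sum.swap)
qed

lemma bops_sum:
  assumes T: "T \<in> bops n" and f: "\<And>s. s \<in> K \<Longrightarrow> f s \<in> hspace n"
  shows "(\<lambda>p. \<Sum>s\<in>K. c s * f s p) \<in> hspace n \<and>
    T (\<lambda>p. \<Sum>s\<in>K. c s * f s p) = (\<lambda>p. \<Sum>s\<in>K. c s * T (f s) p)"
  using f
proof (induction K rule: infinite_finite_induct)
  case (insert s K)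
  have a: "f s \<in> hspace n" and b: "(\<lambda>p. \<Sum>s\<in>K. c s * f s p) \<in> hspace n"
    and e: "T (\<lambda>p. \<Sum>s\<in>K. c s * f s p) = (\<lambda>p. \<Sum>s\<in>K. c s * T (f s) p)" using insert by auto
  show ?case
    using hspace_lincomb[OF a b, of "c s" 1] bops_linear[OF T a b, of "c s" 1] insert.hyps by (simp add: e)
qed (simp_all add: bops_zero[OF T])

text \<open>G truncates the domain and F the range. A vector supported on the blocks in G is a
  finite combination of basis vectors, on which T is described by its blocks.\<close>

lemma block_proj_block_decomposition:
  assumes T: "T \<in> bops n" and F: "finite F" and G: "finite G"
  shows "block_proj n F \<circ> T \<circ> block_proj n G = (\<lambda>\<xi> p. \<Sum>s\<in>G \<times> F. 1 * block_op n (fst s) (snd s) (block n T (fst s) (snd s)) \<xi> p)"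
proof (intro ext)
  fix \<xi> :: "'a hvec" and p :: "'a \<times> nat"
  obtain \<beta> k where p: "p = (\<beta>, k)" by force
  show "(block_proj n F \<circ> T \<circ> block_proj n G) \<xi> p = (\<Sum>s\<in>G \<times> F. 1 * block_op n (fst s) (snd s) (block n T (fst s) (snd s)) \<xi> p)"
  proof (cases "\<xi> \<in> hspace n")
    case True
    let ?K = "SIGMA \<alpha>:G. {..<n \<alpha>}"
    have K: "finite ?K" using G by simp
    have "block_proj n G \<xi> = (\<lambda>p. \<Sum>s\<in>?K. \<xi> s * hbasis (fst s) (snd s) p)"
    proof
      fix q
      have "(\<Sum>s\<in>?K. \<xi> s * hbasis (fst s) (snd s) q) = (\<Sum>s\<in>?K. if q = s then \<xi> s else 0)"
        by (rule sum.cong) (auto simp: hbasis_def)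
      also have "\<dots> = block_proj n G \<xi> q"
        using True K hspace_outside[OF True, of "fst q" "snd q"] by (cases q) (auto simp: block_proj_def not_less)
      finally show "block_proj n G \<xi> q = (\<Sum>s\<in>?K. \<xi> s * hbasis (fst s) (snd s) q)" ..
    qed
    moreover have "T (\<lambda>p. \<Sum>s\<in>?K. \<xi> s * hbasis (fst s) (snd s) p) = (\<lambda>p. \<Sum>s\<in>?K. \<xi> s * T (hbasis (fst s) (snd s)) p)"
      by (rule bops_sum[OF T, THEN conjunct2]) (auto intro: hbasis_hspace)
    ultimately have e: "T (block_proj n G \<xi>) p = (\<Sum>\<alpha>\<in>G. \<Sum>j<n \<alpha>. \<xi> (\<alpha>, j) * T (hbasis \<alpha> j) p)"
      using G by (simp add: sum.Sigma split_def)
    have "(\<Sum>s\<in>G \<times> F. 1 * block_op n (fst s) (snd s) (block n T (fst s) (snd s)) \<xi> p) =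
        (\<Sum>\<alpha>\<in>G. \<Sum>\<gamma>\<in>F. if \<gamma> = \<beta> then (if k < n \<beta> then \<Sum>j<n \<alpha>. \<xi> (\<alpha>, j) * T (hbasis \<alpha> j) p else 0) else 0)"
      unfolding sum.cartesian_product
      by (rule sum.cong) (use True in \<open>auto simp: block_op_def block_def p mult.commute\<close>)
    also have "\<dots> = (\<Sum>\<alpha>\<in>G. if \<beta> \<in> F \<and> k < n \<beta> then \<Sum>j<n \<alpha>. \<xi> (\<alpha>, j) * T (hbasis \<alpha> j) p else 0)"
      using F by (intro sum.cong) auto
    also have "\<dots> = (if \<beta> \<in> F \<and> k < n \<beta> then T (block_proj n G \<xi>) p else 0)"
      by (cases "\<beta> \<in> F \<and> k < n \<beta>") (auto simp: e)
    also have "\<dots> = (block_proj n F \<circ> T \<circ> block_proj n G) \<xi> p"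
      using hspace_outside[OF bops_hspace[OF T], of \<beta> k "block_proj n G \<xi>"] bops_hspace[OF T, of "block_proj n G \<xi>"]
      by (auto simp: p block_proj_def[of n F] not_less)
    finally show ?thesis ..
  next
    case False
    then have "block_proj n G \<xi> = (\<lambda>_. 0)" by (simp add: block_proj_def)
    then show ?thesis using False by (simp add: bops_zero[OF T] bops_zero[OF block_proj_bops] block_op_def p)
  qed
qed

section \<open>Comparison of the quantum metrics\<close>

definition op_products :: "'i hop set \<Rightarrow> nat \<Rightarrow> 'i hop set" where
  "op_products W k = {foldr (\<circ>) Ts id | Ts. length Ts = k \<and> set Ts \<subseteq> W}"

text \<open>Noncommutative polynomials without constant term: the product of the empty list is
  \<open>id\<close>, which is not in \<open>bops n\<close>, and degree zero is represented by the
  commutant instead.\<close>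

definition op_polys :: "'i hop set \<Rightarrow> nat \<Rightarrow> 'i hop set" where
  "op_polys W K = op_span (\<Union>k\<in>{1..K}. op_products W k)"

lemma foldr_comp_id: "foldr (\<circ>) Ts id \<circ> g = foldr (\<circ>) Ts g"
proof
  fix x
  show "(foldr (\<circ>) Ts id \<circ> g) x = foldr (\<circ>) Ts g x" by (induction Ts) simp_all
qed

lemma op_products_comp:
  assumes "S \<in> op_products W k" "T \<in> op_products W l"
  shows "S \<circ> T \<in> op_products W (k + l)"
proof -
  obtain Ts Us where "length Ts = k" "set Ts \<subseteq> W" "S = foldr (\<circ>) Ts id"
    "length Us = l" "set Us \<subseteq> W" "T = foldr (\<circ>) Us id"
    using assms unfolding op_products_def by blast
  then show ?thesis
    unfolding op_products_def mem_Collect_eq by (intro exI[of _ "Ts @ Us"]) (simp add: foldr_comp_id)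
qed

lemma op_products_1: "T \<in> W \<Longrightarrow> T \<in> op_products W 1"
  unfolding op_products_def mem_Collect_eq by (rule exI[of _ "[T]"]) simp

lemma foldr_comp_bops:
  assumes "Ts \<noteq> []" "set Ts \<subseteq> bops n"
  shows "foldr (\<circ>) Ts id \<in> bops n"
  using assms by (induction Ts rule: list_nonempty_induct) (simp_all add: bops_comp)

lemma op_products_polys:
  assumes "1 \<le> k" "k \<le> K"
  shows "op_products W k \<subseteq> op_polys W K"
  unfolding op_polys_def by (rule subsetI, rule op_span_base) (use assms in auto)

lemma op_polys_bops:
  assumes "W \<subseteq> bops n"
  shows "op_polys W K \<subseteq> bops n"
proof -
  have "T \<in> bops n" if "k \<in> {1..K}" "T \<in> op_products W k" for k T
  proof -
    obtain Ts where "length Ts = k" "set Ts \<subseteq> W" "T = foldr (\<circ>) Ts id"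
      using \<open>T \<in> op_products W k\<close> unfolding op_products_def by blast
    then show ?thesis using that assms foldr_comp_bops[of Ts n] by fastforce
  qed
  then show ?thesis
    unfolding op_polys_def by (intro op_span_minimal lin_closed_bops) blast
qed

lemma op_span_comp_right:
  assumes S: "S \<in> op_span X" and T: "\<And>S. S \<in> X \<Longrightarrow> S \<circ> T \<in> op_span Z"
  shows "S \<circ> T \<in> op_span Z"
proof -
  have "lin_closed {S. S \<circ> T \<in> op_span Z}"
    unfolding lin_closed_def
    by (simp add: comp_def lin_closedD(1)[OF lin_closed_op_span] lin_closedD(2)[OF lin_closed_op_span])
  then have "op_span X \<subseteq> {S. S \<circ> T \<in> op_span Z}" by (rule op_span_minimal) (use T in blast)
  then show ?thesis using S by blast
qed

lemma op_polys_comp: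
  assumes W: "W \<subseteq> bops n" and S: "S \<in> op_polys W K" and T: "T \<in> op_polys W L"
  shows "S \<circ> T \<in> op_polys W (K + L)"
proof -
  let ?A = "op_polys W (K + L)"
  have lc: "lin_closed ?A" unfolding op_polys_def by (rule lin_closed_op_span)
  have 1: "S \<circ> T \<in> ?A" if S: "S \<in> op_polys W K" and T: "T \<in> op_products W l" "l \<in> {1..L}" for S T l
    using S unfolding op_polys_def
  proof (rule op_span_comp_right)
    fix S assume "S \<in> (\<Union>k\<in>{1..K}. op_products W k)"
    then obtain k where k: "k \<in> {1..K}" "S \<in> op_products W k" by blast
    have "S \<circ> T \<in> op_products W (k + l)" by (rule op_products_comp[OF k(2) T(1)])
    moreover have "k + l \<in> {1..K + L}" using k T by auto
    ultimately show "S \<circ> T \<in> op_span (\<Union>k\<in>{1..K + L}. op_products W k)" by (intro op_span_base) blast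
  qed
  have Sb: "S \<in> bops n" using S op_polys_bops[OF W] by blast
  \<comment> \<open>Composition is linear in its left factor for arbitrary functions, but in its
    right factor only through linearity of S on \<open>hspace n\<close>; hence the restriction to
    \<open>bops n\<close>.\<close>
  have "lin_closed {T \<in> bops n. S \<circ> T \<in> ?A}"
    unfolding lin_closed_def
  proof (intro conjI ballI allI)
    show "(\<lambda>_ _. 0) \<in> {T \<in> bops n. S \<circ> T \<in> ?A}"
      by (simp add: bops_0 comp_def bops_zero[OF Sb] lin_closedD(1)[OF lc])
    fix T U c d assume T: "T \<in> {T \<in> bops n. S \<circ> T \<in> ?A}" and U: "U \<in> {T \<in> bops n. S \<circ> T \<in> ?A}"
    then have "S \<circ> (\<lambda>\<xi> p. c * T \<xi> p + d * U \<xi> p) = (\<lambda>\<xi> p. c * (S \<circ> T) \<xi> p + d * (S \<circ> U) \<xi> p)"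
      by (simp add: fun_eq_iff bops_linear[OF Sb] bops_hspace)
    then show "(\<lambda>\<xi> p. c * T \<xi> p + d * U \<xi> p) \<in> {T \<in> bops n. S \<circ> T \<in> ?A}"
      using T U lin_closedD(2)[OF lc, of "S \<circ> T" "S \<circ> U" c d] by (simp add: bops_lincomb)
  qed
  moreover have "(\<Union>l\<in>{1..L}. op_products W l) \<subseteq> {T \<in> bops n. S \<circ> T \<in> ?A}"
  proof
    fix T assume T: "T \<in> (\<Union>l\<in>{1..L}. op_products W l)"
    then have "T \<in> op_polys W L" unfolding op_polys_def by (rule op_span_base)
    then have "T \<in> bops n" using op_polys_bops[OF W] by blast
    then show "T \<in> {T \<in> bops n. S \<circ> T \<in> ?A}" using T 1[OF S] by blast
  qed
  ultimately have "op_polys W L \<subseteq> {T \<in> bops n. S \<circ> T \<in> ?A}" unfolding op_polys_def[of W L] by (rule op_span_minimal)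
  then show ?thesis using T by blast
qed

text \<open>A product of operators in \<open>V\<close> is an iterated weak* limit of products of finite truncations,
  which are finite sums of single blocks. The limits have to be taken one at a time, since
  multiplication is only separately continuous.\<close>

lemma products_in_closure:
  fixes n :: "'i \<Rightarrow> nat"
  assumes V: "V \<subseteq> bops n" and W: "W \<subseteq> bops n"
    and blocks: "\<And>T \<alpha> \<beta>. T \<in> V \<Longrightarrow> block_op n \<alpha> \<beta> (block n T \<alpha> \<beta>) \<in> op_polys W N"
    and k: "k > 0"
  shows "op_products V k \<subseteq> weakstar n closure_of op_polys W (N * k)"
proof
  have lc: "lin_closed (op_polys W K)" for K unfolding op_polys_def by (rule lin_closed_op_span)
  have sub: "op_polys W K \<subseteq> weakstar n closure_of op_polys W K" for K
    by (rule closure_of_subset) (simp add: weakstar_topspace op_polys_bops[OF W])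
  have block_proj_mem: "block_proj n F \<circ> T \<circ> block_proj n G \<in> op_polys W N" if "finite F" "finite G" "T \<in> V" for F G T
  proof -
    have "T \<in> bops n" using that V by blast
    then show ?thesis
      unfolding block_proj_block_decomposition[OF \<open>T \<in> bops n\<close> that(1,2)]
      by (intro lin_closed_sum lc blocks that)
  qed
  \<comment> \<open>L collects the factors on the left that are already truncated, and K is the
    degree spent on them. The last hypothesis says that truncating behind the next factor yields a
    polynomial; the conclusion leaves the remaining factors untruncated.\<close>
  have chain: "L \<circ> foldr (\<circ>) Ts id \<in> weakstar n closure_of op_polys W (K + N * length Ts)"
    if "Ts \<noteq> []" "set Ts \<subseteq> V" "L \<in> bops n"
      "\<And>T G. T \<in> V \<Longrightarrow> finite G \<Longrightarrow> L \<circ> T \<circ> block_proj n G \<in> op_polys W (K + N)" for Ts L K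
    using that
  proof (induction Ts arbitrary: L K rule: list_nonempty_induct)
    case (single T)
    then have TV: "T \<in> V" and T: "T \<in> bops n" using V by auto
    have LT: "L \<circ> T \<in> bops n" by (rule bops_comp[OF single.prems(2) T])
    have "(L \<circ> T) \<circ> block_proj n UNIV \<in> weakstar n closure_of op_polys W (K + N)"
    proof (rule closure_block_proj_limit[OF LT block_proj_bops])
      fix G :: "'i set" assume "finite G"
      then show "(L \<circ> T) \<circ> block_proj n G \<circ> block_proj n UNIV \<in> weakstar n closure_of op_polys W (K + N)"
        using single.prems(3)[OF TV] sub unfolding comp_block_proj_UNIV[OF bops_comp[OF LT block_proj_bops]] by blast
    qed
    moreover have "L \<circ> foldr (\<circ>) [T] id = (L \<circ> T) \<circ> block_proj n UNIV"
      unfolding comp_block_proj_UNIV[OF LT] by (simp add: fun_eq_iff)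
    moreover have "K + N * length [T] = K + N" by simp
    ultimately show ?case by (simp only:)
  next
    case (cons T Ts)
    then have TV: "T \<in> V" and T: "T \<in> bops n" and Ts: "set Ts \<subseteq> V" using V by auto
    have LT: "L \<circ> T \<in> bops n" by (rule bops_comp[OF cons.prems(2) T])
    have Tsb: "foldr (\<circ>) Ts id \<in> bops n" by (rule foldr_comp_bops) (use cons.hyps Ts V in auto)
    have "(L \<circ> T) \<circ> foldr (\<circ>) Ts id \<in> weakstar n closure_of op_polys W (K + N + N * length Ts)"
    proof (rule closure_block_proj_limit[OF LT Tsb])
      fix G :: "'i set" assume G: "finite G"
      show "(L \<circ> T) \<circ> block_proj n G \<circ> foldr (\<circ>) Ts id \<in> weakstar n closure_of op_polys W (K + N + N * length Ts)"
      proof (rule cons.IH[OF Ts bops_comp[OF LT block_proj_bops]])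
        fix T' and G' :: "'i set" assume T': "T' \<in> V" and G': "finite G'"
        \<comment> \<open>The truncation is idempotent: one copy stays with the left part, and the
          other cuts \<open>T'\<close> down to finitely many blocks.\<close>
        have "(L \<circ> T \<circ> block_proj n G) \<circ> (block_proj n G \<circ> T' \<circ> block_proj n G') \<in> op_polys W (K + N + N)"
          by (rule op_polys_comp[OF W cons.prems(3)[OF TV G] block_proj_mem[OF G G' T']])
        moreover have "(L \<circ> T \<circ> block_proj n G) \<circ> (block_proj n G \<circ> T' \<circ> block_proj n G') = L \<circ> T \<circ> (block_proj n G \<circ> block_proj n G) \<circ> T' \<circ> block_proj n G'"
          by (simp only: comp_assoc)
        ultimately show "L \<circ> T \<circ> block_proj n G \<circ> T' \<circ> block_proj n G' \<in> op_polys W (K + N + N)"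
          by (simp only: block_proj_idem)
      qed
    qed
    moreover have "L \<circ> foldr (\<circ>) (T # Ts) id = (L \<circ> T) \<circ> foldr (\<circ>) Ts id"
      by (simp add: fun_eq_iff)
    moreover have "K + N * length (T # Ts) = K + N + N * length Ts" by simp
    ultimately show ?case by (simp only:)
  qed
  fix X assume "X \<in> op_products V k"
  then obtain Ts where Ts: "length Ts = k" "set Ts \<subseteq> V" "X = foldr (\<circ>) Ts id"
    unfolding op_products_def by blast
  have ne: "Ts \<noteq> []" using Ts(1) k by auto
  have Xb: "X \<in> bops n" unfolding Ts(3) by (rule foldr_comp_bops[OF ne]) (use Ts V in auto)
  \<comment> \<open>It remains to remove the leftmost truncation, with which the chain starts at
    degree 0.\<close>
  have "block_proj n UNIV \<circ> X \<in> weakstar n closure_of op_polys W (N * k)"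
  proof (rule closure_block_proj_limit[OF block_proj_bops Xb])
    fix F :: "'i set" assume F: "finite F"
    have "block_proj n F \<circ> X \<in> weakstar n closure_of op_polys W (0 + N * length Ts)"
      unfolding Ts(3) by (rule chain[OF ne Ts(2) block_proj_bops]) (simp add: block_proj_mem[OF F])
    then show "block_proj n UNIV \<circ> block_proj n F \<circ> X \<in> weakstar n closure_of op_polys W (N * k)"
      by (simp add: block_proj_UNIV_comp[OF block_proj_bops] Ts(1))
  qed
  then show "X \<in> weakstar n closure_of op_polys W (N * k)" by (simp add: block_proj_UNIV_comp[OF Xb])
qed

section \<open>Generators of the quantum metrics\<close>

definition metric_generators :: "('i \<Rightarrow> nat) \<Rightarrow> 'i hop set \<Rightarrow> nat \<Rightarrow> 'i hop set" where
  "metric_generators n V m = op_span {\<lambda>\<xi> p. \<Sum>k\<le>m. T k \<xi> p | T. \<forall>k\<le>m. T k \<in> bimod_power n V k}"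

lemma quantum_metric_eq:
  "quantum_metric n \<rho> A t = weakstar n closure_of metric_generators n (graph_bimodule n \<rho> A) (nat \<lfloor>t\<rfloor>)"
  by (simp add: quantum_metric_def metric_generators_def)

lemma bimod_power_eq: "bimod_power n V k = (if k = 0 then commutant n else op_span (op_products V k))"
  by (simp add: bimod_power_def op_products_def)

lemma bimod_power_0: "(\<lambda>_ _. 0) \<in> bimod_power n V k"
proof (cases "k = 0")
  case True
  have "(\<lambda>_ _. 0) \<circ> rep n x = rep n x \<circ> (\<lambda>_ _. 0)" for x
    by (auto simp: fun_eq_iff rep_def)
  then show ?thesis using True by (simp add: bimod_power_eq commutant_def bops_0)
qed (simp add: bimod_power_eq lin_closedD(1)[OF lin_closed_op_span])

lemma bimod_power_bops:
  assumes "V \<subseteq> bops n"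
  shows "bimod_power n V k \<subseteq> bops n"
proof (cases "k = 0")
  case False
  then have "op_products V k \<subseteq> op_polys V k" by (intro op_products_polys) simp_all
  then have "op_span (op_products V k) \<subseteq> bops n"
    using op_polys_bops[OF assms] by (intro op_span_minimal lin_closed_bops) blast
  then show ?thesis using False by (simp add: bimod_power_eq)
qed (auto simp: bimod_power_eq commutant_def)

text \<open>The other degrees are filled with zero, which belongs to every power.\<close>

lemma bimod_power_generators:
  assumes "k \<le> m" "X \<in> bimod_power n V k"
  shows "X \<in> metric_generators n V m"
proof -
  define T where "T = (\<lambda>j. if j = k then X else (\<lambda>_ _. 0))"
  have "X = (\<lambda>\<xi> p. \<Sum>j\<le>m. T j \<xi> p)"
    using assms(1) by (simp add: T_def fun_eq_iff if_distribR sum.delta cong: if_cong)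
  moreover have "\<forall>j\<le>m. T j \<in> bimod_power n V j" using assms(2) by (simp add: T_def bimod_power_0)
  ultimately show ?thesis unfolding metric_generators_def by (intro op_span_base) blast
qed

lemma metric_generators_bops:
  assumes "V \<subseteq> bops n"
  shows "metric_generators n V m \<subseteq> bops n"
proof -
  have "(\<lambda>\<xi> p. \<Sum>k\<le>m. T k \<xi> p) \<in> bops n" if "\<forall>k\<le>m. T k \<in> bimod_power n V k" for T
    using lin_closed_sum[OF lin_closed_bops, of "{..m}" T n "\<lambda>_. 1"] that bimod_power_bops[OF assms] by auto
  then show ?thesis
    unfolding metric_generators_def by (intro op_span_minimal lin_closed_bops) blast
qed

text \<open>Degree 0 contributes the same commutant on both sides. For 0 < k \<le> m the k-fold
  products are limits of polynomials of degree at most \<open>N * k\<close>, which is at most M. The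
  target is a closed linear space, so passing to spans and closures preserves the inclusion.\<close>

lemma metric_generators_closure_subset:
  assumes V: "V \<subseteq> bops n" and W: "W \<subseteq> bops n"
    and blocks: "\<And>T \<alpha> \<beta>. T \<in> V \<Longrightarrow> block_op n \<alpha> \<beta> (block n T \<alpha> \<beta>) \<in> op_polys W N"
    and M: "N * m \<le> M"
  shows "weakstar n closure_of metric_generators n V m \<subseteq> weakstar n closure_of metric_generators n W M"
proof -
  let ?C = "weakstar n closure_of metric_generators n W M"
  have sub: "metric_generators n W M \<subseteq> ?C"
    by (rule closure_of_subset) (simp add: weakstar_topspace metric_generators_bops[OF W])
  have lcW: "lin_closed (metric_generators n W M)"
    unfolding metric_generators_def by (rule lin_closed_op_span)
  have lc: "lin_closed ?C" by (rule lin_closed_closure[OF lcW metric_generators_bops[OF W]])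
  have polys: "op_polys W (N * k) \<subseteq> metric_generators n W M" if k: "k \<le> m" for k
    unfolding op_polys_def
  proof (rule op_span_minimal[OF lcW])
    have "N * k \<le> M" using M k by (meson le_trans mult_le_mono2)
    then have "op_products W j \<subseteq> metric_generators n W M" if "j \<in> {1..N * k}" for j
      using that by (auto intro!: bimod_power_generators[of j] op_span_base simp: bimod_power_eq)
    then show "(\<Union>j\<in>{1..N * k}. op_products W j) \<subseteq> metric_generators n W M" by blast
  qed
  have "bimod_power n V k \<subseteq> ?C" if k: "k \<le> m" for k
  proof (cases "k = 0")
    case True
    then have "bimod_power n V k = bimod_power n W 0" by (simp add: bimod_power_eq)
    then show ?thesis using sub bimod_power_generators[of 0 M] by blast
  next
    case False
    have "op_products V k \<subseteq> weakstar n closure_of op_polys W (N * k)"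
      by (rule products_in_closure[OF V W blocks]) (use False in auto)
    also have "\<dots> \<subseteq> ?C" by (rule closure_of_mono[OF polys[OF k]])
    finally show ?thesis using False by (simp add: bimod_power_eq op_span_minimal[OF lc])
  qed
  then have "(\<lambda>\<xi> p. \<Sum>k\<le>m. T k \<xi> p) \<in> ?C" if "\<forall>k\<le>m. T k \<in> bimod_power n V k" for T
    using lin_closed_sum[OF lc, of "{..m}" T "\<lambda>_. 1"] that by auto
  then have "metric_generators n V m \<subseteq> ?C"
    unfolding metric_generators_def[of n V m] by (intro op_span_minimal lc) blast
  then show ?thesis by (rule closure_of_minimal) simp
qed

section \<open>Transfer to the metrics of a discrete quantum group\<close>

context discrete_quantum_group
begin

lemma graph_bimodule_bops: "graph_bimodule n \<rho> A \<subseteq> bops n"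
  by (auto simp: graph_bimodule_def)

text \<open>All blocks except one vanish, and zero lies in every block space, here as an empty
  sum.\<close>

lemma block_op_graph_bimodule:
  assumes P: "P \<in> c00 n" and M: "M \<in> block_space \<alpha> \<beta> (ft P)"
  shows "block_op n \<alpha> \<beta> M \<in> graph_bimodule n \<rho> (conv n \<rho> D P)"
proof -
  have zero: "0\<^sub>m (n \<delta>) (n \<gamma>) \<in> block_space \<gamma> \<delta> (ft P)" for \<gamma> \<delta>
  proof -
    have "msum (n \<delta>) (n \<gamma>) ({} :: nat set) (\<lambda>_. M) \<in> block_space \<gamma> \<delta> (ft P)" by (rule block_space_msum) simp
    moreover have "msum (n \<delta>) (n \<gamma>) ({} :: nat set) (\<lambda>_. M) = 0\<^sub>m (n \<delta>) (n \<gamma>)" by (rule eq_matI) (simp_all add: msum_def)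
    ultimately show ?thesis by simp
  qed
  have "mat (n \<beta>) (n \<alpha>) (\<lambda>p. M $$ p) = M" using block_space_carrier[OF M] by (intro eq_matI) auto
  then show ?thesis
    using M zero by (simp add: graph_bimodule_def block_op_bops graph_block_eq[OF P] block_block_op)
qed

text \<open>Splitting off one factor of the power with \<open>block_space_mult\<close> passes
  through intermediate irreducibles, so the remaining block starts elsewhere and the induction has
  to run over all blocks simultaneously.\<close>

lemma block_op_power:
  assumes P: "P \<in> c00 n" and M: "M \<in> block_space \<alpha> \<beta> (ft P ^ Suc k)"
  shows "block_op n \<alpha> \<beta> M \<in> op_span (op_products (graph_bimodule n \<rho> (conv n \<rho> D P)) (Suc k))"
  using M
proof (induction k arbitrary: \<alpha> \<beta> M)
  case 0
  then have "block_op n \<alpha> \<beta> M \<in> graph_bimodule n \<rho> (conv n \<rho> D P)"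
    by (intro block_op_graph_bimodule[OF P]) simp
  then show ?case using op_products_1 by (intro op_span_base) simp
next
  case (Suc k)
  let ?W = "graph_bimodule n \<rho> (conv n \<rho> D P)"
  have "M \<in> block_space \<alpha> \<beta> (ft P * ft P ^ Suc k)" using Suc.prems by simp
  from block_space_mult[OF ft_coeff_span this] obtain K :: "('i \<times> nat \<times> nat) set" and Z Y where
    Z: "\<And>s. Z s \<in> block_space (fst s) \<beta> (ft P ^ Suc k)" and Y: "\<And>s. Y s \<in> block_space \<alpha> (fst s) (ft P)"
    and M: "M = msum (n \<beta>) (n \<alpha>) K (\<lambda>s. Z s * Y s)" by (elim exE conjE) blast
  have "block_op n (fst s) \<beta> (Z s) \<circ> block_op n \<alpha> (fst s) (Y s) \<in> op_span (op_products ?W (Suc (Suc k)))" for s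
    using Suc.IH[OF Z]
  proof (rule op_span_comp_right)
    fix S assume S: "S \<in> op_products ?W (Suc k)"
    have "S \<circ> block_op n \<alpha> (fst s) (Y s) \<in> op_products ?W (Suc k + 1)"
      by (intro op_products_comp S op_products_1 block_op_graph_bimodule P Y)
    then show "S \<circ> block_op n \<alpha> (fst s) (Y s) \<in> op_span (op_products ?W (Suc (Suc k)))"
      by (intro op_span_base) simp
  qed
  then have "(\<lambda>\<xi> p. \<Sum>s\<in>K. 1 * (block_op n (fst s) \<beta> (Z s) \<circ> block_op n \<alpha> (fst s) (Y s)) \<xi> p)
      \<in> op_span (op_products ?W (Suc (Suc k)))"
    by (intro lin_closed_sum lin_closed_op_span)
  moreover have "block_op n (fst s) \<beta> (Z s) \<circ> block_op n \<alpha> (fst s) (Y s) = block_op n \<alpha> \<beta> (Z s * Y s)" for s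
    by (rule block_op_comp[where \<beta> = "fst s"]) (rule block_space_carrier[OF Z], rule block_space_carrier[OF Y])
  ultimately show ?case
    unfolding M block_op_msum by (simp only:)
qed

text \<open>Stated for every M above N, so that a common constant can be chosen for the two
  inclusions.\<close>

lemma quantum_metric_comparison:
  assumes P1: "P1 \<in> c00 n" and P2: "generating_projection n u \<rho> D R P2"
  shows "\<exists>N. \<forall>M t. real N \<le> M \<longrightarrow> 0 \<le> t \<longrightarrow>
    quantum_metric n \<rho> (conv n \<rho> D P1) t \<subseteq> quantum_metric n \<rho> (conv n \<rho> D P2) (M * t)"
proof -
  note P2c = generating_c00[OF P2]
  let ?V = "graph_bimodule n \<rho> (conv n \<rho> D P1)" and ?W = "graph_bimodule n \<rho> (conv n \<rho> D P2)"
  obtain N where N: "\<forall>\<alpha> \<beta>. \<forall>M\<in>block_space \<alpha> \<beta> (ft P1). \<exists>f. (\<forall>k. f k \<in> block_space \<alpha> \<beta> (ft P2 ^ Suc k)) \<and>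
      M = msum (n \<beta>) (n \<alpha>) {..<N} f"
    using block_space_cover[OF P1 P2] by (elim exE)
  have blocks: "block_op n \<alpha> \<beta> (block n T \<alpha> \<beta>) \<in> op_polys ?W N" if T: "T \<in> ?V" for T \<alpha> \<beta>
  proof -
    have "block n T \<alpha> \<beta> \<in> block_space \<alpha> \<beta> (ft P1)"
      using T by (simp add: graph_bimodule_def graph_block_eq[OF P1])
    then obtain f where f: "\<And>k. f k \<in> block_space \<alpha> \<beta> (ft P2 ^ Suc k)"
      and e: "block n T \<alpha> \<beta> = msum (n \<beta>) (n \<alpha>) {..<N} f"
      using N by blast
    have "op_span (op_products ?W (Suc k)) \<subseteq> op_polys ?W N" if "k < N" for k
    proof -
      have "op_products ?W (Suc k) \<subseteq> op_polys ?W N" by (rule op_products_polys) (use that in simp_all)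
      then show ?thesis unfolding op_polys_def by (rule op_span_mono)
    qed
    then show ?thesis
      unfolding e block_op_msum using block_op_power[OF P2c f] op_polys_def
      by (intro lin_closed_sum) (auto simp: op_polys_def lin_closed_op_span)
  qed
  have "quantum_metric n \<rho> (conv n \<rho> D P1) t \<subseteq> quantum_metric n \<rho> (conv n \<rho> D P2) (M * t)"
    if M: "real N \<le> M" and t: "0 \<le> t" for M t :: real
    unfolding quantum_metric_eq
  proof (rule metric_generators_closure_subset[OF graph_bimodule_bops graph_bimodule_bops blocks])
    \<comment> \<open>\<open>N * nat \<lfloor>t\<rfloor>\<close> is an integer not exceeding M t,
      hence not exceeding the integer part of M t.\<close>
    have "real (nat \<lfloor>t\<rfloor>) \<le> t" using t by simp
    then have "real N * real (nat \<lfloor>t\<rfloor>) \<le> M * t" using M by (intro mult_mono) auto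
    then have "real (N * nat \<lfloor>t\<rfloor>) \<le> M * t" by simp
    then show "N * nat \<lfloor>t\<rfloor> \<le> nat \<lfloor>M * t\<rfloor>" by (simp only: le_nat_floor)
  qed
  then show ?thesis by blast
qed

end

theorem theorem5:
  fixes smul :: "complex \<Rightarrow> 'a::ring_1 \<Rightarrow> 'a"
    and star :: "'a \<Rightarrow> 'a"
    and cop :: "'a \<Rightarrow> ('a \<times> 'a) list"
    and eps :: "'a \<Rightarrow> complex"
    and S :: "'a \<Rightarrow> 'a"
    and n :: "'i \<Rightarrow> nat"
    and u :: "'i \<Rightarrow> 'a mat"
    and \<rho> :: "'i fam"
    and D :: "'i fam \<Rightarrow> ('i \<times> 'i) fam"
    and R :: "'i fam \<Rightarrow> 'i fam"
    and P1 P2 :: "'i fam"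
  assumes "discrete_quantum_group smul star cop eps S n u \<rho> D R"
    and "generating_projection n u \<rho> D R P1"
    and "generating_projection n u \<rho> D R P2"
  shows "\<exists>M::real. M > 0 \<and> (\<forall>t\<ge>0.
     quantum_metric n \<rho> (conv n \<rho> D P1) t \<subseteq> quantum_metric n \<rho> (conv n \<rho> D P2) (M * t) \<and>
     quantum_metric n \<rho> (conv n \<rho> D P2) t \<subseteq> quantum_metric n \<rho> (conv n \<rho> D P1) (M * t))"
proof -
  interpret discrete_quantum_group smul star cop eps S n u \<rho> D R by (rule assms(1))
  obtain N1 where N1: "\<forall>M t. real N1 \<le> M \<longrightarrow> 0 \<le> t \<longrightarrow>
      quantum_metric n \<rho> (conv n \<rho> D P1) t \<subseteq> quantum_metric n \<rho> (conv n \<rho> D P2) (M * t)"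
    using quantum_metric_comparison[OF generating_c00[OF assms(2)] assms(3)] by blast
  obtain N2 where N2: "\<forall>M t. real N2 \<le> M \<longrightarrow> 0 \<le> t \<longrightarrow>
      quantum_metric n \<rho> (conv n \<rho> D P2) t \<subseteq> quantum_metric n \<rho> (conv n \<rho> D P1) (M * t)"
    using quantum_metric_comparison[OF generating_c00[OF assms(3)] assms(2)] by blast
  \<comment> \<open>The sum dominates both constants, and the summand 1 keeps it positive even if
    both are zero.\<close>
  show ?thesis
    by (rule exI[of _ "real (N1 + N2 + 1)"]) (use N1 N2 in simp)
qed

end
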